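(* Let $T>0$, $\delta\in[0,T]$. Let $b$ and $\sigma$ be coefficients defined on $[-\delta,T]\times\mathbb{R}^m\times\mathbb{R}^m\times\mathcal P_2(\mathbb{R}^m)\times\mathcal P_2(\mathbb{R}^m)$ such that for fixed $(x,x_\delta,\mu,\mu_\delta)$ the processes $b(\cdot,x,x_\delta,\mu,\mu_\delta)$ and $\sigma(\cdot,x,x_\delta,\mu,\mu_\delta)$ belong to $H^2_{\mathcal F}(-\delta,T;\mathbb{R}^m)$ and $H^2_{\mathcal F}(-\delta,T;\mathbb{R}^{m\times d})$ respectively, and such that: (C5) there is a constant $C\ge0$ such that for all $t\in[-\delta,T]$, $x,x',x_\delta,x'_\delta\in\mathbb{R}^m$, $\mu,\mu',\mu_\delta,\mu'_\delta\in\mathcal P_2(\mathbb{R}^m)$, $$|b(t,x,x_\delta,\mu,\mu_\delta)-b(t,x',x'_\delta,\mu',\mu'_\delta)|\le C\big(|x-x'|+|x_\delta-x'_\delta|+W_2(\mu,\mu')+W_2(\mu_\delta,\mu'_\delta)\big),$$ and $\sigma$ satisfies the same condition; (C6) $\sup_{t\ge-\delta}\big(|b(t,0,0,0,0)|+|\sigma(t,0,0,0,0)|\big)<\infty$, where $0$ in a measure argument means the Dirac mass at $0$. Then for any given delay condition $\xi_\cdot\in H^2_{\mathcal F}(-\delta,0;\mathbb{R}^m)$, the generalized mean-field delay stochastic differential equation $$\begin{cases} dX_t=b(t,X_t,X_{t-\delta},P_{X_t},P_{X_{t-\delta}})\,dt+\sigma(t,X_t,X_{t-\delta},P_{X_t},P_{X_{t-\delta}})\,dB_t,&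 t\in[0,T],\\ X_t=\xi_t,& t\in[-\delta,0], \end{cases}$$ has a unique strong solution.
   Context: $(\Omega,\mathcal F,P)$ is a complete probability space carrying a $d$-dimensional Brownian motion $B$; $\mathcal F_0\subset\mathcal F$ is a sub-$\sigma$-field independent of $B$, and $(\mathcal F_t)_{t\ge0}$ is the filtration generated by $B$, completed and augmented by $\mathcal F_0$; set $\mathcal F_t=\mathcal F_0$ for $t<0$. $P_X$ denotes the law of $X$. $\mathcal P_2(\mathbb{R}^m)$ is the set of probability measures on $\mathbb{R}^m$ with finite second moment, with the 2-Wasserstein metric $W_2$. $H^2_{\mathcal F}(s,r;\mathbb{R}^n)$: $\mathcal F_t$-adapted $\mathbb{R}^n$-valued processes $\phi$ on $[s,r]$ with $\mathbb{E}\int_s^r|\phi_t|^2dt<\infty$. A strong solution is a process $X\in H^2_{\mathcal F}(-\delta,T;\mathbb{R}^m)$, adapted to the given filtration on the given probability space, satisfying the initial condition and $X_t=\xi_0+\int_0^tb(s,X_s,X_{s-\delta},P_{X_s},P_{X_{s-\delta}})ds+\int_0^t\sigma(s,X_s,X_{s-\delta},P_{X_s},P_{X_{s-\delta}})dB_s$ for $t\in[0,T]$.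
   Formalization: The formal theorem also assumes that ξ_0 is square integrable, which membership of ξ in H²(-δ,0) does not give; without it the claim fails, e.g. for b = σ = 0, where X_t = ξ_0 on [0,T] is not in H². *)

theory Defs
  imports "HOL-Probability.Probability"
begin

section \<open>Wasserstein space\<close>

definition P2 :: "'a::euclidean_space measure set" where
  "P2 = {\<mu>. prob_space \<mu> \<and> sets \<mu> = sets borel \<and> (\<integral>\<^sup>+x. ennreal ((norm x)\<^sup>2) \<partial>\<mu>) < \<infinity>}"

definition couplings ::
  "'a::euclidean_space measure \<Rightarrow> 'a measure \<Rightarrow> ('a \<times> 'a) measure set" where
  "couplings \<mu> \<nu> = {\<pi>. prob_space \<pi> \<and> sets \<pi> = sets (borel \<Otimes>\<^sub>M borel) \<and>
      distr \<pi> borel fst = \<mu> \<and> distr \<pi> borel snd = \<nu>}"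

text \<open>On \<open>P2\<close> the infimum is finite, so the truncation to \<open>real\<close> is harmless there.\<close>

definition W2 :: "'a::euclidean_space measure \<Rightarrow> 'a measure \<Rightarrow> real" where
  "W2 \<mu> \<nu> = sqrt (enn2real
     (INF \<pi>\<in>couplings \<mu> \<nu>. \<integral>\<^sup>+p. ennreal ((dist (fst p) (snd p))\<^sup>2) \<partial>\<pi>))"


section \<open>Brownian motion and its filtration\<close>

definition generated_by ::
  "'w measure \<Rightarrow> (real \<Rightarrow> 'w \<Rightarrow> 'a::topological_space) \<Rightarrow> real set \<Rightarrow> 'w set set" where
  "generated_by M B J = (\<Union>s\<in>J. {B s -` A \<inter> space M | A. A \<in> sets borel})"

text \<open>The density in the third clause is that of the normal law with mean zero and covariance
  \<open>(t - s)\<close> times the identity.\<close>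

definition brownian_motion :: "'w measure \<Rightarrow> (real \<Rightarrow> 'w \<Rightarrow> real^'d) \<Rightarrow> bool" where
  "brownian_motion M B \<longleftrightarrow>
     (\<forall>t\<ge>0. B t \<in> borel_measurable M) \<and>
     (AE \<omega> in M. B 0 \<omega> = 0) \<and>
     (\<forall>s t. 0 \<le> s \<longrightarrow> s < t \<longrightarrow>
        distributed M lborel (\<lambda>\<omega>. B t \<omega> - B s \<omega>)
          (\<lambda>x. ennreal (\<Prod>i\<in>UNIV. normal_density 0 (sqrt (t - s)) (x $ i)))) \<and>
     (\<forall>n (\<tau> :: nat \<Rightarrow> real). 0 \<le> \<tau> 0 \<longrightarrow> mono \<tau> \<longrightarrow>
        prob_space.indep_vars M (\<lambda>_. borel)
          (\<lambda>i \<omega>. B (\<tau> (Suc i)) \<omega> - B (\<tau> i) \<omega>) {..<n}) \<and>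
     (AE \<omega> in M. continuous_on {0..} (\<lambda>t. B t \<omega>))"

locale brownian_basis = prob_space M + complete_measure M
  for M :: "'w measure" and B :: "real \<Rightarrow> 'w \<Rightarrow> real^'d" and F0 :: "'w measure" +
  assumes brownian: "brownian_motion M B"
    and subalgebra_F0: "subalgebra M F0"
    and indep_F0: "indep_set (sets F0) (sigma_sets (space M) (generated_by M B {0..}))"

text \<open>The \<open>max\<close> makes the filtration constant, equal to its value at \<open>0\<close>, on negative times.
  As \<open>B 0 = 0\<close> almost surely, that value is the completion of \<open>F0\<close> by the null sets of \<open>M\<close>.\<close>

definition brownian_filtration ::
  "'w measure \<Rightarrow> (real \<Rightarrow> 'w \<Rightarrow> real^'d) \<Rightarrow> 'w measure \<Rightarrow> real \<Rightarrow> 'w measure" where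
  "brownian_filtration M B F0 t =
     sigma (space M) (sets F0 \<union> null_sets M \<union> generated_by M B {0..max 0 t})"


section \<open>Square-integrable adapted processes\<close>

text \<open>Joint measurability is the usual tacit requirement that gives the expected time integral
  a meaning. For matrices (\<open>real^'d^'m\<close>) the norm is the Frobenius norm.\<close>

definition H2 ::
  "'w measure \<Rightarrow> (real \<Rightarrow> 'w measure) \<Rightarrow> real \<Rightarrow> real \<Rightarrow> (real \<Rightarrow> 'w \<Rightarrow> 'a::euclidean_space) set" where
  "H2 M F s r = {\<phi>.
     (\<forall>t\<in>{s..r}. \<phi> t \<in> borel_measurable (F t)) \<and>
     (\<lambda>(t, \<omega>). \<phi> t \<omega>) \<in> borel_measurable (restrict_space lborel {s..r} \<Otimes>\<^sub>M M) \<and>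
     (\<integral>\<^sup>+\<omega>. (\<integral>\<^sup>+t\<in>{s..r}. ennreal ((norm (\<phi> t \<omega>))\<^sup>2) \<partial>lborel) \<partial>M) < \<infinity>}"


section \<open>The Ito integral\<close>

definition simple_integrand ::
  "'w measure \<Rightarrow> (real \<Rightarrow> 'w measure) \<Rightarrow> nat \<Rightarrow> (nat \<Rightarrow> real) \<Rightarrow> (nat \<Rightarrow> 'w \<Rightarrow> real^'d^'m) \<Rightarrow> bool" where
  "simple_integrand M F n \<tau> \<zeta> \<longleftrightarrow>
     0 \<le> \<tau> 0 \<and> (\<forall>i<n. \<tau> i \<le> \<tau> (Suc i)) \<and>
     (\<forall>i<n. \<zeta> i \<in> borel_measurable (F (\<tau> i))) \<and>
     (\<exists>K. \<forall>i<n. \<forall>\<omega>\<in>space M. norm (\<zeta> i \<omega>) \<le> K)"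

definition simple_process ::
  "nat \<Rightarrow> (nat \<Rightarrow> real) \<Rightarrow> (nat \<Rightarrow> 'w \<Rightarrow> real^'d^'m) \<Rightarrow> real \<Rightarrow> 'w \<Rightarrow> real^'d^'m" where
  "simple_process n \<tau> \<zeta> s \<omega> = (\<Sum>i<n. indicator {\<tau> i<..\<tau> (Suc i)} s *\<^sub>R \<zeta> i \<omega>)"

definition simple_ito ::
  "(real \<Rightarrow> 'w \<Rightarrow> real^'d) \<Rightarrow> nat \<Rightarrow> (nat \<Rightarrow> real) \<Rightarrow> (nat \<Rightarrow> 'w \<Rightarrow> real^'d^'m) \<Rightarrow> real \<Rightarrow> 'w \<Rightarrow> real^'m" where
  "simple_ito B n \<tau> \<zeta> u \<omega> =
     (\<Sum>i<n. \<zeta> i \<omega> *v (B (min (\<tau> (Suc i)) u) \<omega> - B (min (\<tau> i) u) \<omega>))"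

text \<open>\<open>has_ito_integral M B F T \<phi> I\<close>: the process \<open>I\<close> is a continuous version of the indefinite
  Ito integral of \<open>\<phi>\<close> on \<open>[0, T]\<close>, that is, an \<open>L2\<close> limit of integrals of simple processes.
  Measurability of \<open>\<phi>\<close> is required only with respect to the completed product measure, so that
  the notion depends on \<open>\<phi>\<close> only up to null sets. This matters for integrands that contain the
  law of \<open>X s\<close>: for \<open>X\<close> in \<open>H2\<close> that law lies in \<open>P2\<close> for almost every \<open>s\<close> only, and the
  coefficients are unconstrained outside \<open>P2\<close>.\<close>

definition has_ito_integral ::
  "'w measure \<Rightarrow> (real \<Rightarrow> 'w \<Rightarrow> real^'d) \<Rightarrow> (real \<Rightarrow> 'w measure) \<Rightarrow> real \<Rightarrow>
   (real \<Rightarrow> 'w \<Rightarrow> real^'d^'m) \<Rightarrow> (real \<Rightarrow> 'w \<Rightarrow> real^'m) \<Rightarrow> bool" where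
  "has_ito_integral M B F T \<phi> I \<longleftrightarrow>
     (let Q = completion (restrict_space lborel {0..T} \<Otimes>\<^sub>M M) in
      (\<lambda>(s, \<omega>). \<phi> s \<omega>) \<in> borel_measurable Q \<and>
      (\<forall>t\<in>{0..T}. I t \<in> borel_measurable (F t)) \<and>
      (AE \<omega> in M. continuous_on {0..T} (\<lambda>t. I t \<omega>)) \<and>
      (\<exists>n \<tau> \<zeta>.
         (\<forall>k. simple_integrand M F (n k) (\<tau> k) (\<zeta> k)) \<and>
         (\<lambda>k. \<integral>\<^sup>+(s, \<omega>). ennreal ((norm (\<phi> s \<omega> - simple_process (n k) (\<tau> k) (\<zeta> k) s \<omega>))\<^sup>2) \<partial>Q)
           \<longlonglongrightarrow> 0 \<and>
         (\<forall>t\<in>{0..T}.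
           (\<lambda>k. \<integral>\<^sup>+\<omega>. ennreal ((norm (I t \<omega> - simple_ito B (n k) (\<tau> k) (\<zeta> k) t \<omega>))\<^sup>2) \<partial>M)
             \<longlonglongrightarrow> 0)))"


section \<open>Mean-field delay equations\<close>

text \<open>Coefficients are random: they take time, the sample point, the present and delayed states,
  and the present and delayed laws.\<close>

type_synonym ('w, 'x, 'y) coefficient =
  "real \<Rightarrow> 'w \<Rightarrow> 'x \<Rightarrow> 'x \<Rightarrow> 'x measure \<Rightarrow> 'x measure \<Rightarrow> 'y"

definition coefficient_in_H2 ::
  "'w measure \<Rightarrow> (real \<Rightarrow> 'w measure) \<Rightarrow> real \<Rightarrow> real \<Rightarrow>
   ('w, 'x::euclidean_space, 'y::euclidean_space) coefficient \<Rightarrow> bool" where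
  "coefficient_in_H2 M F s r f \<longleftrightarrow>
     (\<forall>x x\<^sub>\<delta>. \<forall>\<mu>\<in>P2. \<forall>\<mu>\<^sub>\<delta>\<in>P2. (\<lambda>t \<omega>. f t \<omega> x x\<^sub>\<delta> \<mu> \<mu>\<^sub>\<delta>) \<in> H2 M F s r)"

definition coefficient_lipschitz ::
  "'w measure \<Rightarrow> real \<Rightarrow> real \<Rightarrow>
   ('w, 'x::euclidean_space, 'y::euclidean_space) coefficient \<Rightarrow> bool" where
  "coefficient_lipschitz M s r f \<longleftrightarrow>
     (\<exists>C\<ge>0. AE \<omega> in M. \<forall>t\<in>{s..r}. \<forall>x x' x\<^sub>\<delta> x\<^sub>\<delta>'.
        \<forall>\<mu>\<in>P2. \<forall>\<mu>'\<in>P2. \<forall>\<mu>\<^sub>\<delta>\<in>P2. \<forall>\<mu>\<^sub>\<delta>'\<in>P2.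
          norm (f t \<omega> x x\<^sub>\<delta> \<mu> \<mu>\<^sub>\<delta> - f t \<omega> x' x\<^sub>\<delta>' \<mu>' \<mu>\<^sub>\<delta>')
            \<le> C * (norm (x - x') + norm (x\<^sub>\<delta> - x\<^sub>\<delta>') + W2 \<mu> \<mu>' + W2 \<mu>\<^sub>\<delta> \<mu>\<^sub>\<delta>'))"

definition along ::
  "'w measure \<Rightarrow> real \<Rightarrow> ('w, 'x::euclidean_space, 'y) coefficient \<Rightarrow> (real \<Rightarrow> 'w \<Rightarrow> 'x) \<Rightarrow>
   real \<Rightarrow> 'w \<Rightarrow> 'y" where
  "along M \<delta> f X s \<omega> =
     f s \<omega> (X s \<omega>) (X (s - \<delta>) \<omega>) (distr M borel (X s)) (distr M borel (X (s - \<delta>)))"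

text \<open>The time integral is taken with respect to \<open>lebesgue\<close> rather than \<open>lborel\<close>, again because
  its integrand is determined for almost every time only.\<close>

definition strong_solution ::
  "'w measure \<Rightarrow> (real \<Rightarrow> 'w \<Rightarrow> real^'d) \<Rightarrow> (real \<Rightarrow> 'w measure) \<Rightarrow> real \<Rightarrow> real \<Rightarrow>
   ('w, real^'m, real^'m) coefficient \<Rightarrow> ('w, real^'m, real^'d^'m) coefficient \<Rightarrow>
   (real \<Rightarrow> 'w \<Rightarrow> real^'m) \<Rightarrow> (real \<Rightarrow> 'w \<Rightarrow> real^'m) \<Rightarrow> bool" where
  "strong_solution M B F T \<delta> b \<sigma> \<xi> X \<longleftrightarrow>
     X \<in> H2 M F (- \<delta>) T \<and>
     (AE \<omega> in M. \<forall>t\<in>{-\<delta>..0}. X t \<omega> = \<xi> t \<omega>) \<and>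
     (AE \<omega> in M. set_integrable lebesgue {0..T} (\<lambda>s. along M \<delta> b X s \<omega>)) \<and>
     (\<exists>I. has_ito_integral M B F T (along M \<delta> \<sigma> X) I \<and>
        (AE \<omega> in M. \<forall>t\<in>{0..T}.
           X t \<omega> = \<xi> 0 \<omega> + (LINT s:{0..t}|lebesgue. along M \<delta> b X s \<omega>) + I t \<omega>))"

end

(* Freeze the coefficients along a process X and solve the resulting equation Z = xi_0 + int b dt +
   int sigma dB. By the Ito isometry, Doob's maximal inequality, the Lipschitz condition and
   W2(P_X, P_Y)^2 <= E |X - Y|^2, the map X |-> Z satisfies
     E |Z_t - Z'_t|^2 <= K int_0^t (E |X_s - X'_s|^2 + E |X_(s-delta) - X'_(s-delta)|^2) ds,
   hence is a contraction for the norm sup_t exp(-kappa t) E |X_t|^2 with kappa large. Picard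
   iterates therefore converge and fixed points are unique up to modification, and continuity of the
   paths turns modifications into indistinguishable processes.

   The Ito integral has to be constructed: adapted square integrable integrands are approximated by
   adapted step functions, for which the isometry is a computation with independent increments, and a
   maximal inequality makes the integrals converge uniformly in time. The law t |-> P_(X_t) is handled
   by approximation with laws that are piecewise constant in time. *)

theory Submission
  imports Defs
begin

section \<open>Mean square norms\<close>

text \<open>Mean squares are kept as extended nonnegative reals, so the estimates carry few
  integrability side conditions. \<open>norm_add_sq_le\<close> stands in for Minkowski's inequality;
  this is why constants are powers of two and why the geometric rates are \<open>1/4\<close>: each
  triangle inequality doubles, and telescoping survives this only for ratios below
  \<open>1/2\<close>. The obstacle is measurability. Processes in \<open>H2\<close> are jointly
  measurable and adapted, not progressively measurable, so neither approximating step functions nor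
  time integrals are adapted for free; projecting step functions by conditional expectations settles
  both. The law of \<open>X t\<close> lies in \<open>P2\<close> for almost every \<open>t\<close>
  only, so a coefficient along \<open>X\<close> is determined up to null sets, and all estimates run
  on a measurable version of it. The limit of the Picard iterates is taken at each time separately
  and has no evident continuity.\<close>

definition msq :: "'a measure \<Rightarrow> ('a \<Rightarrow> 'b::real_normed_vector) \<Rightarrow> ennreal" where
  "msq M f = (\<integral>\<^sup>+x. ennreal ((norm (f x))\<^sup>2) \<partial>M)"

lemma norm_add_sq_le: "(norm (x + y))\<^sup>2 \<le> 2 * (norm x)\<^sup>2 + 2 * (norm y)\<^sup>2"
  for x y :: "'a::real_normed_vector"
proof -
  have "(norm (x + y))\<^sup>2 \<le> (norm x + norm y)\<^sup>2"
    by (intro power_mono norm_triangle_ineq) auto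
  also have "\<dots> \<le> 2 * (norm x)\<^sup>2 + 2 * (norm y)\<^sup>2"
    using zero_le_power2[of "norm x - norm y"] by (simp add: power2_sum power2_diff)
  finally show ?thesis .
qed

lemma numeral_mult_ennreal: "0 \<le> x \<Longrightarrow> numeral k * ennreal x = ennreal (numeral k * x)"
  by (simp add: ennreal_mult)

lemma msq_mono: "(AE x in M. norm (f x) \<le> norm (g x)) \<Longrightarrow> msq M f \<le> msq M g"
  unfolding msq_def by (intro nn_integral_mono_AE) (auto intro!: ennreal_leI power_mono)

lemma msq_cong: "(AE x in M. f x = g x) \<Longrightarrow> msq M f = msq M g"
  unfolding msq_def by (intro nn_integral_cong_AE) auto

lemma msq_minus_commute: "msq M (\<lambda>x. f x - g x) = msq M (\<lambda>x. g x - f x)"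
  unfolding msq_def by (simp add: norm_minus_commute)

lemma msq_zero [simp]: "msq M (\<lambda>x. 0) = 0"
  by (simp add: msq_def)

text \<open>The factor \<open>2\<close> avoids square roots of extended reals, and nothing has to be
  finite. It accumulates: the \<open>16\<close> in the estimate for the Ito integral is four uses of
  it.\<close>

lemma msq_add:
  fixes f g :: "'a \<Rightarrow> 'b::euclidean_space"
  assumes [measurable]: "f \<in> borel_measurable M" "g \<in> borel_measurable M"
  shows "msq M (\<lambda>x. f x + g x) \<le> 2 * msq M f + 2 * msq M g"
proof -
  have "msq M (\<lambda>x. f x + g x) \<le> (\<integral>\<^sup>+x. 2 * ennreal ((norm (f x))\<^sup>2) + 2 * ennreal ((norm (g x))\<^sup>2) \<partial>M)"
    unfolding msq_def
  proof (intro nn_integral_mono)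
    fix x
    have "ennreal ((norm (f x + g x))\<^sup>2) \<le> ennreal (2 * (norm (f x))\<^sup>2 + 2 * (norm (g x))\<^sup>2)"
      by (intro ennreal_leI norm_add_sq_le)
    then show "ennreal ((norm (f x + g x))\<^sup>2) \<le> 2 * ennreal ((norm (f x))\<^sup>2) + 2 * ennreal ((norm (g x))\<^sup>2)"
      by (simp add: ennreal_plus ennreal_mult)
  qed
  also have "\<dots> = 2 * msq M f + 2 * msq M g"
    unfolding msq_def by (simp add: nn_integral_add nn_integral_cmult)
  finally show ?thesis .
qed

lemma msq_triangle:
  fixes f g h :: "'a \<Rightarrow> 'b::euclidean_space"
  assumes [measurable]: "f \<in> borel_measurable M" "g \<in> borel_measurable M" "h \<in> borel_measurable M"
  shows "msq M (\<lambda>x. f x - h x) \<le> 2 * msq M (\<lambda>x. f x - g x) + 2 * msq M (\<lambda>x. g x - h x)"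
  using msq_add[of "\<lambda>x. f x - g x" M "\<lambda>x. g x - h x"] by simp

text \<open>Fatou's lemma for the squared norms. An eventual bound suffices because the lower limit
  is estimated through the upper limit.\<close>

lemma msq_lim_le:
  fixes f :: "nat \<Rightarrow> 'a \<Rightarrow> 'b::euclidean_space"
  assumes [measurable]: "\<And>n. f n \<in> borel_measurable M" "g \<in> borel_measurable M"
    and lim: "AE x in M. (\<lambda>n. f n x) \<longlonglongrightarrow> g x"
    and le: "eventually (\<lambda>n. msq M (f n) \<le> c) sequentially"
  shows "msq M g \<le> c"
proof -
  have "msq M g = (\<integral>\<^sup>+x. liminf (\<lambda>n. ennreal ((norm (f n x))\<^sup>2)) \<partial>M)"
    unfolding msq_def
  proof (intro nn_integral_cong_AE, use lim in eventually_elim)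
    case (elim x)
    then have "(\<lambda>n. ennreal ((norm (f n x))\<^sup>2)) \<longlonglongrightarrow> ennreal ((norm (g x))\<^sup>2)"
      by (intro tendsto_intros)
    then show ?case by (intro lim_imp_Liminf[symmetric]) auto
  qed
  also have "\<dots> \<le> liminf (\<lambda>n. msq M (f n))"
    unfolding msq_def by (intro nn_integral_liminf) auto
  also have "\<dots> \<le> limsup (\<lambda>n. msq M (f n))"
    by (intro Liminf_le_Limsup) auto
  also have "\<dots> \<le> c" using le by (intro Limsup_bounded) auto
  finally show ?thesis .
qed

text \<open>The total mass is finite, so \<open>1 + (norm (f x))\<^sup>2\<close> is an integrable
  bound for the norm.\<close>

lemma (in finite_measure) msq_integrable:
  fixes f :: "'a \<Rightarrow> 'b::euclidean_space"
  assumes [measurable]: "f \<in> borel_measurable M" and fin: "msq M f < \<infinity>"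
  shows "integrable M f" and "integrable M (\<lambda>x. (norm (f x))\<^sup>2)"
proof -
  show I: "integrable M (\<lambda>x. (norm (f x))\<^sup>2)"
    using fin unfolding msq_def by (intro integrableI_bounded) auto
  show "integrable M f"
  proof (rule Bochner_Integration.integrable_bound[of _ "\<lambda>x. 1 + (norm (f x))\<^sup>2"])
    show "AE x in M. norm (f x) \<le> norm (1 + (norm (f x))\<^sup>2)"
    proof (intro AE_I2)
      fix x
      have "0 \<le> (norm (f x) - 1)\<^sup>2" by simp
      then have "2 * norm (f x) \<le> 1 + (norm (f x))\<^sup>2" unfolding power2_diff by simp
      then have "norm (f x) \<le> 1 + (norm (f x))\<^sup>2" using norm_ge_zero[of "f x"] by linarith
      then show "norm (f x) \<le> norm (1 + (norm (f x))\<^sup>2)" by simp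
    qed
  qed (use I in auto)
qed

lemma msq_eq_integral:
  fixes f :: "'a \<Rightarrow> 'b::euclidean_space"
  assumes "integrable M (\<lambda>x. (norm (f x))\<^sup>2)"
  shows "msq M f = ennreal (\<integral>x. (norm (f x))\<^sup>2 \<partial>M)"
  unfolding msq_def by (intro nn_integral_eq_integral assms) auto

text \<open>Cauchy-Schwarz against the constant \<open>1\<close>, by the discriminant argument: the
  integral of \<open>(s - norm (f x))\<^sup>2\<close> is nonnegative for every \<open>s\<close>, and
  the best \<open>s\<close> is the mean of the norm.\<close>

lemma (in finite_measure) integral_sq_le:
  fixes f :: "'a \<Rightarrow> 'b::euclidean_space"
  assumes [measurable]: "f \<in> borel_measurable M"
  shows "ennreal ((norm (integral\<^sup>L M f))\<^sup>2) \<le> emeasure M (space M) * msq M f"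
proof (cases "msq M f < \<infinity>")
  case False
  then have top: "msq M f = \<infinity>" by (simp add: less_top[symmetric])
  show ?thesis
  \<comment> \<open>As \<open>0 * \<infinity> = 0\<close> in \<open>ennreal\<close>, a null space
    makes the right-hand side vanish even here, so the integral has to be seen to be
    \<open>0\<close>.\<close>
  proof (cases "emeasure M (space M) = 0")
    case True
    then have "AE x in M. f x = 0"
      by (intro AE_I[of _ _ "space M"]) auto
    then have "integral\<^sup>L M f = 0" by (simp add: integral_eq_zero_AE)
    then show ?thesis by simp
  qed (simp add: top ennreal_mult_top)
next
  case True
  let ?m = "measure M (space M)" and ?a = "\<integral>x. norm (f x) \<partial>M"
  note I = msq_integrable[OF assms True]
  have J: "integrable M (\<lambda>x. norm (f x))" using I(1) by auto
  have *: "0 \<le> s\<^sup>2 * ?m - 2 * s * ?a + (\<integral>x. (norm (f x))\<^sup>2 \<partial>M)" for s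
  proof -
    have "0 \<le> (\<integral>x. (s - norm (f x))\<^sup>2 \<partial>M)" by simp
    also have "\<dots> = (\<integral>x. s\<^sup>2 - 2 * s * norm (f x) + (norm (f x))\<^sup>2 \<partial>M)"
      by (intro Bochner_Integration.integral_cong) (auto simp: power2_diff)
    also have "\<dots> = s\<^sup>2 * ?m - 2 * s * ?a + (\<integral>x. (norm (f x))\<^sup>2 \<partial>M)"
      using I J by (simp add: Bochner_Integration.integral_add Bochner_Integration.integral_diff mult.commute)
    finally show ?thesis .
  qed
  have a0: "0 \<le> ?a" by simp
  have "?a\<^sup>2 \<le> ?m * (\<integral>x. (norm (f x))\<^sup>2 \<partial>M)"
  proof (cases "?m = 0")
    case True
    then have "space M \<in> null_sets M" by (auto simp: emeasure_eq_measure)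
    then have "AE x in M. f x = 0"
      by (intro AE_I[of _ _ "space M"]) auto
    then have "?a = 0" by (intro integral_eq_zero_AE) auto
    then show ?thesis by simp
  next
    case False
    then have m: "0 < ?m" by (simp add: zero_less_measure_iff)
    from *[of "?a / ?m"] m show ?thesis
      by (simp add: field_simps power2_eq_square)
  qed
  moreover have "(norm (integral\<^sup>L M f))\<^sup>2 \<le> ?a\<^sup>2"
    by (rule power_mono[OF integral_norm_bound]) auto
  ultimately have "ennreal ((norm (integral\<^sup>L M f))\<^sup>2) \<le> ennreal (?m * (\<integral>x. (norm (f x))\<^sup>2 \<partial>M))"
    by (intro ennreal_leI) linarith
  also have "\<dots> = emeasure M (space M) * msq M f"
    by (simp add: msq_eq_integral[OF I(2)] ennreal_mult emeasure_eq_measure)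
  finally show ?thesis .
qed

text \<open>Peeling off the first increment doubles the bound for the rest, so the constant
  \<open>c\<close> has to satisfy \<open>2 * c / 4 + 2 * C = c\<close>, that is
  \<open>c = 4 * C\<close>.\<close>

lemma msq_telescope:
  fixes f :: "nat \<Rightarrow> 'a \<Rightarrow> 'b::euclidean_space"
  assumes [measurable]: "\<And>n. f n \<in> borel_measurable M"
    and le: "\<And>n. msq M (\<lambda>x. f (Suc n) x - f n x) \<le> ennreal (C * (1/4)^n)" and C: "0 \<le> C"
  shows "msq M (\<lambda>x. f (n + m) x - f n x) \<le> ennreal (4 * C * (1/4)^n)"
proof (induction m arbitrary: n)
  case 0
  then show ?case by simp
next
  case (Suc m)
  have "msq M (\<lambda>x. f (n + Suc m) x - f n x)
      \<le> 2 * msq M (\<lambda>x. f (Suc n + m) x - f (Suc n) x) + 2 * msq M (\<lambda>x. f (Suc n) x - f n x)"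
    using msq_triangle[of "f (Suc n + m)" M "f (Suc n)" "f n"] by simp
  also have "\<dots> \<le> 2 * ennreal (4 * C * (1/4)^Suc n) + 2 * ennreal (C * (1/4)^n)"
    by (intro add_mono mult_left_mono Suc.IH le) auto
  also have "\<dots> = ennreal (2 * (4 * C * (1/4)^Suc n) + 2 * (C * (1/4)^n))"
    using C by (simp only: numeral_mult_ennreal ennreal_plus mult_nonneg_nonneg zero_le_power zero_le_numeral
        zero_le_divide_1_iff)
  also have "2 * (4 * C * (1/4)^Suc n) + 2 * (C * (1/4)^n) = 4 * C * (1/4)^n"
    by simp
  finally show ?case .
qed

text \<open>By the inequality between arithmetic and geometric mean, the first moment of the \<open>n\<close>-th
  increment is at most a multiple of \<open>(1/2)^n\<close>.\<close>

lemma (in finite_measure) msq_fast_AE_convergent: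
  fixes f :: "nat \<Rightarrow> 'a \<Rightarrow> 'b::euclidean_space"
  assumes [measurable]: "\<And>n. f n \<in> borel_measurable M"
    and le: "\<And>n. msq M (\<lambda>x. f (Suc n) x - f n x) \<le> ennreal (C * (1/4)^n)" and C: "0 \<le> C"
  shows "AE x in M. convergent (\<lambda>n. f n x)"
proof -
  define d where "d n x = norm (f (Suc n) x - f n x)" for n x
  have [measurable]: "d n \<in> borel_measurable M" for n unfolding d_def by simp
  have 1: "(\<integral>\<^sup>+x. ennreal (d n x) \<partial>M) \<le> ennreal ((measure M (space M) + C) * (1/2)^n)" for n
  proof -
    have "(\<integral>\<^sup>+x. ennreal (d n x) \<partial>M) \<le> (\<integral>\<^sup>+x. ennreal ((1/2)^n) + ennreal (2^n) * ennreal ((d n x)\<^sup>2) \<partial>M)"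
    proof (intro nn_integral_mono)
      fix x
      have "0 \<le> ((1/2)^n - d n x)\<^sup>2" by simp
      then have "2 * (1/2)^n * d n x \<le> (1/2)^n * (1/2)^n + (d n x)\<^sup>2"
        by (simp only: power2_diff) (simp add: power2_eq_square)
      then have "2^n * (2 * (1/2)^n * d n x) \<le> 2^n * ((1/2)^n * (1/2)^n + (d n x)\<^sup>2)"
        by (intro mult_left_mono) auto
      moreover have "2^n * (2 * (1/2)^n * d n x) = 2 * d n x"
        by (simp add: power_one_over)
      moreover have "2^n * ((1/2)^n * (1/2)^n + (d n x)\<^sup>2) = (1/2)^n + 2^n * (d n x)\<^sup>2"
        by (simp add: power_one_over field_simps)
      moreover have "0 \<le> d n x" by (simp add: d_def)
      ultimately have "d n x \<le> (1/2)^n + 2^n * (d n x)\<^sup>2" by linarith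
      then have "ennreal (d n x) \<le> ennreal ((1/2)^n + 2^n * (d n x)\<^sup>2)" by (rule ennreal_leI)
      then show "ennreal (d n x) \<le> ennreal ((1/2)^n) + ennreal (2^n) * ennreal ((d n x)\<^sup>2)"
        by (subst (asm) ennreal_plus) (auto simp: ennreal_mult)
    qed
    also have "\<dots> = ennreal ((1/2)^n) * emeasure M (space M) + ennreal (2^n) * msq M (\<lambda>x. f (Suc n) x - f n x)"
      by (simp add: nn_integral_add nn_integral_cmult msq_def d_def)
    also have "\<dots> \<le> ennreal ((1/2)^n) * emeasure M (space M) + ennreal (2^n) * ennreal (C * (1/4)^n)"
      by (intro add_mono mult_left_mono le) auto
    also have "\<dots> = ennreal ((1/2)^n * measure M (space M) + 2^n * (C * (1/4)^n))"
      using C by (simp add: emeasure_eq_measure ennreal_mult[symmetric] ennreal_plus[symmetric] del: ennreal_plus)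
    also have "(1/2)^n * measure M (space M) + 2^n * (C * (1/4)^n) = (measure M (space M) + C) * (1/2)^n"
    proof -
      have "(2::real)^n * (1/4)^n = (1/2)^n" by (simp add: power_mult_distrib[symmetric])
      then show ?thesis by (simp add: algebra_simps)
    qed
    finally show ?thesis .
  qed
  have sm: "summable (\<lambda>n. (measure M (space M) + C) * (1/2)^n)"
    by (intro summable_mult summable_geometric) auto
  have "(\<integral>\<^sup>+x. (\<Sum>n. ennreal (d n x)) \<partial>M) = (\<Sum>n. \<integral>\<^sup>+x. ennreal (d n x) \<partial>M)"
    by (intro nn_integral_suminf) auto
  also have "\<dots> \<le> (\<Sum>n. ennreal ((measure M (space M) + C) * (1/2)^n))"
    by (intro suminf_le 1) auto
  also have "\<dots> = ennreal (\<Sum>n. (measure M (space M) + C) * (1/2)^n)"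
    using C by (intro suminf_ennreal2 sm) auto
  also have "\<dots> < \<infinity>" by simp
  finally have "AE x in M. (\<Sum>n. ennreal (d n x)) \<noteq> \<infinity>"
    by (intro nn_integral_PInf_AE) auto
  then show ?thesis
  proof eventually_elim
    case (elim x)
    then have "summable (\<lambda>n. d n x)"
      by (intro summable_suminf_not_top) (auto simp: d_def)
    then have "summable (\<lambda>n. f (Suc n) x - f n x)"
      unfolding d_def by (rule summable_norm_cancel)
    then have "convergent (\<lambda>n. \<Sum>i<n. f (Suc i) x - f i x)"
      by (simp add: summable_iff_convergent)
    then have "convergent (\<lambda>n. f n x - f 0 x)"
      using sum_lessThan_telescope[of "\<lambda>i. f i x"] by simp
    then have "convergent (\<lambda>n. (f n x - f 0 x) + f 0 x)"
      by (intro convergent_add convergent_const)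
    then show ?case by simp
  qed
qed

text \<open>The telescoped bound does not depend on the later index, so it passes to the limit.
  Where the sequence diverges, \<open>lim\<close> is an arbitrary value, but only on a null
  set.\<close>

lemma (in finite_measure) msq_fast_lim:
  fixes f :: "nat \<Rightarrow> 'a \<Rightarrow> 'b::euclidean_space"
  assumes [measurable]: "\<And>n. f n \<in> borel_measurable M"
    and le: "\<And>n. msq M (\<lambda>x. f (Suc n) x - f n x) \<le> ennreal (C * (1/4)^n)" and C: "0 \<le> C"
  shows "msq M (\<lambda>x. lim (\<lambda>k. f k x) - f n x) \<le> ennreal (4 * C * (1/4)^n)"
proof (rule msq_lim_le[of "\<lambda>k x. f k x - f n x"])
  show "AE x in M. (\<lambda>k. f k x - f n x) \<longlonglongrightarrow> lim (\<lambda>k. f k x) - f n x"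
    using msq_fast_AE_convergent[OF assms]
    by eventually_elim (auto intro!: tendsto_intros simp: convergent_LIMSEQ_iff)
  show "\<forall>\<^sub>F k in sequentially. msq M (\<lambda>x. f k x - f n x) \<le> ennreal (4 * C * (1/4)^n)"
    using eventually_ge_at_top[of n]
  proof eventually_elim
    case (elim k)
    then show ?case using msq_telescope[OF assms, of n "k - n"] by simp
  qed
qed auto

text \<open>The classical statement for convergence in mean is applied to the squared distances. The
  shift by \<open>N\<close> discards the indices at which the mean square may be infinite.\<close>

lemma (in finite_measure) msq_tendsto_AE_subseq:
  fixes f :: "nat \<Rightarrow> 'a \<Rightarrow> 'b::euclidean_space"
  assumes [measurable]: "\<And>n. f n \<in> borel_measurable M" "g \<in> borel_measurable M"
    and lim: "(\<lambda>n. msq M (\<lambda>x. f n x - g x)) \<longlonglongrightarrow> 0"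
  shows "\<exists>r. strict_mono r \<and> (AE x in M. (\<lambda>n. f (r n) x) \<longlonglongrightarrow> g x)"
proof -
  from order_tendstoD(2)[OF lim, of 1] obtain N where
    N: "\<And>n. n \<ge> N \<Longrightarrow> msq M (\<lambda>x. f n x - g x) < 1"
    by (auto simp: eventually_sequentially)
  define u where "u n x = (norm (f (n + N) x - g x))\<^sup>2" for n x
  have I: "integrable M (u n)" for n
    unfolding u_def using N[of "n + N"]
    by (intro msq_integrable(2)) (auto intro: less_trans)
  have "(\<lambda>n. ennreal (\<integral>x. norm (u n x) \<partial>M)) \<longlonglongrightarrow> ennreal 0"
  proof -
    have "ennreal (\<integral>x. norm (u n x) \<partial>M) = msq M (\<lambda>x. f (n + N) x - g x)" for n
      using msq_eq_integral[of M "\<lambda>x. f (n + N) x - g x"] I[of n] unfolding u_def by simp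
    then show ?thesis using LIMSEQ_ignore_initial_segment[OF lim, of N] by simp
  qed
  then have "(\<lambda>n. \<integral>x. norm (u n x) \<partial>M) \<longlonglongrightarrow> 0"
    by (subst (asm) tendsto_ennreal_iff) auto
  from tendsto_L1_AE_subseq[OF I this] obtain r where r: "strict_mono r"
    "AE x in M. (\<lambda>n. u (r n) x) \<longlonglongrightarrow> 0" by auto
  show ?thesis
  proof (intro exI[of _ "\<lambda>n. r n + N"] conjI)
    show "strict_mono (\<lambda>n. r n + N)" using r(1) by (auto simp: strict_mono_def)
    show "AE x in M. (\<lambda>n. f (r n + N) x) \<longlonglongrightarrow> g x"
      using r(2)
    proof eventually_elim
      case (elim x)
      then have "(\<lambda>n. sqrt (u (r n) x)) \<longlonglongrightarrow> sqrt 0" by (intro tendsto_intros)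
      then show ?case
        unfolding u_def by (subst tendsto_dist_iff) (simp add: dist_norm)
    qed
  qed
qed

lemma (in finite_measure) msq_eq_0_AE:
  fixes f :: "'a \<Rightarrow> 'b::euclidean_space"
  assumes [measurable]: "f \<in> borel_measurable M" and "msq M f = 0"
  shows "AE x in M. f x = 0"
  using assms(2) unfolding msq_def by (subst (asm) nn_integral_0_iff_AE) auto

section \<open>Approximation by step functions in time\<close>

text \<open>Cells are open on the left and closed on the right, like the intervals of
  \<open>simple_process\<close>: a coefficient attached to a cell may then be measurable at the left
  end point. \<open>nat\<close> sends the negative value at \<open>t = a\<close> to
  \<open>0\<close>, which puts \<open>a\<close> itself into cell \<open>0\<close>.\<close>

definition cell :: "real \<Rightarrow> real \<Rightarrow> nat \<Rightarrow> real \<Rightarrow> nat" where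
  "cell a c n t = nat (\<lceil>real n * (t - a) / (c - a)\<rceil> - 1)"

definition node :: "real \<Rightarrow> real \<Rightarrow> nat \<Rightarrow> nat \<Rightarrow> real" where
  "node a c n i = a + real i * (c - a) / real n"

abbreviation strip :: "real \<Rightarrow> real \<Rightarrow> 'w measure \<Rightarrow> (real \<times> 'w) measure" where
  "strip a c M \<equiv> restrict_space lborel {a..c} \<Otimes>\<^sub>M M"

lemma node_mono: "a \<le> c \<Longrightarrow> i \<le> j \<Longrightarrow> node a c n i \<le> node a c n j"
  unfolding node_def by (intro add_left_mono divide_right_mono mult_right_mono) auto

lemma node_ge: "a \<le> c \<Longrightarrow> a \<le> node a c n i"
  by (simp add: node_def)

lemma node_0 [simp]: "node a c n 0 = a" by (simp add: node_def)

lemma node_last [simp]: "0 < n \<Longrightarrow> node a c n n = c" by (simp add: node_def)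

lemma node_Suc: "node a c n (Suc i) = node a c n i + (c - a) / real n"
  by (simp add: node_def add_divide_distrib[symmetric] algebra_simps)

lemma cell_less:
  assumes "a < c" "0 < n" "t \<le> c"
  shows "cell a c n t < n"
proof -
  have "real n * (t - a) / (c - a) \<le> real n"
    using assms by (simp add: divide_le_eq)
  then have "\<lceil>real n * (t - a) / (c - a)\<rceil> \<le> int n" by (simp add: ceiling_le_iff)
  then show ?thesis using assms by (simp add: cell_def nat_less_iff)
qed

lemma le_node_Suc_cell:
  assumes "a < c" "0 < n"
  shows "t \<le> node a c n (Suc (cell a c n t))"
proof -
  let ?x = "real n * (t - a) / (c - a)"
  have "?x \<le> real_of_int \<lceil>?x\<rceil>" by simp
  also have "\<dots> \<le> real (Suc (cell a c n t))" by (simp add: cell_def)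
  finally have "t - a \<le> real (Suc (cell a c n t)) * (c - a) / real n"
    using assms by (simp add: field_simps)
  then show ?thesis by (simp add: node_def)
qed

lemma node_cell_less:
  assumes "a < c" "0 < n" "a < t"
  shows "node a c n (cell a c n t) < t"
proof -
  let ?x = "real n * (t - a) / (c - a)"
  have "0 < ?x" using assms by simp
  then have "0 < \<lceil>?x\<rceil>" by simp
  then have "real (cell a c n t) = real_of_int \<lceil>?x\<rceil> - 1" by (simp add: cell_def)
  also have "\<dots> < ?x" by linarith
  finally have "real (cell a c n t) * (c - a) / real n < t - a"
    using assms by (simp add: field_simps)
  then show ?thesis by (simp add: node_def)
qed

lemma node_cell_le:
  assumes "a < c" "0 < n" "a \<le> t"
  shows "node a c n (cell a c n t) \<le> t"
proof (cases "a = t")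
  case True
  then show ?thesis by (simp add: cell_def)
next
  case False
  then show ?thesis using node_cell_less[of a c n t] assms by simp
qed

lemma cell_eqI:
  assumes "a < c" "0 < n" "node a c n i < t" "t \<le> node a c n (Suc i)"
  shows "cell a c n t = i"
proof -
  have "real i < real n * (t - a) / (c - a)" "real n * (t - a) / (c - a) \<le> real (Suc i)"
    using assms by (simp_all add: node_def field_simps)
  then have "\<lceil>real n * (t - a) / (c - a)\<rceil> = int i + 1"
    by (intro ceiling_unique) auto
  then show ?thesis by (simp add: cell_def)
qed

lemma cell_eq_iff:
  assumes "a < c" "0 < n" "a < t"
  shows "cell a c n t = i \<longleftrightarrow> node a c n i < t \<and> t \<le> node a c n (Suc i)"
  using cell_eqI[of a c n i t] node_cell_less[of a c n t] le_node_Suc_cell[of a c n t] assms by auto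

text \<open>Coarse node \<open>k\<close> is fine node \<open>k * m\<close>, so integer division by
  \<open>m\<close> finds the coarse cell that contains a given fine cell. This compares a step
  function with one on a refined partition.\<close>

lemma cell_refine:
  assumes "a < c" "0 < n" "0 < m" "a < t"
  shows "cell a c n t = cell a c (n * m) t div m"
proof (intro cell_eqI)
  let ?j = "cell a c (n * m) t"
  have pos: "0 < n * m" using assms by simp
  have *: "node a c (n * m) (k * m) = node a c n k" for k
    using assms by (simp add: node_def field_simps)
  have "node a c n (?j div m) \<le> node a c (n * m) ?j"
    unfolding *[symmetric] using assms by (intro node_mono) auto
  then show "node a c n (?j div m) < t"
    using node_cell_less[OF assms(1) pos assms(4)] by simp
  have "Suc ?j \<le> Suc (?j div m) * m"
    using assms(3) by (metis Suc_leI dividend_less_div_times mult.commute mult_Suc_right add.commute)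
  then have "node a c (n * m) (Suc ?j) \<le> node a c n (Suc (?j div m))"
    unfolding *[symmetric] using assms by (intro node_mono) auto
  then show "t \<le> node a c n (Suc (?j div m))"
    using le_node_Suc_cell[OF assms(1) pos, of t] by simp
qed (use assms in auto)

text \<open>The left end point of the dyadic cell lies below \<open>t\<close> by at most the mesh
  \<open>T / 2^n\<close>. With continuous paths, statements at the countably many dyadic nodes thus
  extend to all times.\<close>

lemma node_cell_tendsto:
  assumes T: "0 < T" and t: "t \<in> {0..T}"
  shows "(\<lambda>n. node 0 T (2^n) (cell 0 T (2^n) t)) \<longlonglongrightarrow> t"
proof (rule tendsto_sandwich[of "\<lambda>n. t - T * (1/2)^n" _ _ "\<lambda>n. t"])
  have s: "node 0 T (2^n) (cell 0 T (2^n) t) \<le> t" "t \<le> node 0 T (2^n) (cell 0 T (2^n) t) + T / 2^n" for n :: nat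
    using node_cell_le[of 0 T "2^n" t] le_node_Suc_cell[of 0 T "2^n" t] T t by (auto simp: node_Suc)
  show "\<forall>\<^sub>F n in sequentially. t - T * (1/2)^n \<le> node 0 T (2^n) (cell 0 T (2^n) t)"
    using s(2) by (intro always_eventually) (auto simp: power_one_over field_simps)
  show "\<forall>\<^sub>F n in sequentially. node 0 T (2^n) (cell 0 T (2^n) t) \<le> t"
    using s(1) by (intro always_eventually) auto
  have "(\<lambda>n. t - T * (1/2)^n) \<longlonglongrightarrow> t - T * 0"
    by (intro tendsto_intros LIMSEQ_power_zero) auto
  then show "(\<lambda>n. t - T * (1/2)^n) \<longlonglongrightarrow> t" by simp
qed simp

lemma measurable_cell [measurable]: "cell a c n \<in> measurable borel (count_space UNIV)"
  unfolding cell_def by measurable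

lemma space_strip: "space (strip a c M) = {a..c} \<times> space M"
  by (simp add: space_pair_measure space_restrict_space)

lemma finite_measure_time: "finite_measure (restrict_space lborel {a..c::real})"
  by (intro finite_measureI) (simp add: emeasure_restrict_space space_restrict_space emeasure_lborel_Icc_eq)

lemma emeasure_time_le: "emeasure (restrict_space lborel {a..c::real}) A \<le> emeasure lborel A"
proof (cases "A \<in> sets (restrict_space lborel {a..c})")
  case True
  then have "A \<subseteq> {a..c}" using sets.sets_into_space by (fastforce simp: space_restrict_space)
  then show ?thesis by (simp add: emeasure_restrict_space)
qed (simp add: emeasure_notin_sets)

section \<open>Mean square approximation on a strip by step functions, without adaptedness\<close>

context prob_space
begin

lemma pair_sigma_finite_strip: "pair_sigma_finite (restrict_space lborel {a..c::real}) M"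
proof -
  interpret T: finite_measure "restrict_space lborel {a..c::real}" by (rule finite_measure_time)
  show ?thesis ..
qed

lemma finite_measure_strip: "finite_measure (strip a c M)"
  by (intro finite_measure_pair_measure finite_measure_time finite_measure_axioms)

lemma nn_integral_strip:
  assumes "f \<in> borel_measurable (strip a c M)"
  shows "(\<integral>\<^sup>+p. f p \<partial>strip a c M) = (\<integral>\<^sup>+t\<in>{a..c}. (\<integral>\<^sup>+w. f (t, w) \<partial>M) \<partial>lborel)"
  using nn_integral_fst[OF assms] by (simp add: nn_integral_restrict_space)

lemma msq_strip:
  fixes f :: "real \<times> 'a \<Rightarrow> 'b::euclidean_space"
  assumes [measurable]: "f \<in> borel_measurable (strip a c M)"
  shows "msq (strip a c M) f = (\<integral>\<^sup>+t\<in>{a..c}. msq M (\<lambda>w. f (t, w)) \<partial>lborel)"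
  unfolding msq_def by (subst nn_integral_strip) auto

lemma measurable_strip_section:
  assumes "f \<in> borel_measurable (strip a c M)" "t \<in> {a..c}"
  shows "(\<lambda>w. f (t, w)) \<in> borel_measurable M"
  using assms by (intro measurable_compose[OF measurable_Pair1']) (auto simp: space_restrict_space)

lemma measurable_cell_fst [measurable]:
  "(\<lambda>p. cell a c n (fst p)) \<in> measurable (strip a' c' M) (count_space UNIV)"
  by (rule measurable_compose[OF measurable_fst]) (simp add: measurable_restrict_space1)

text \<open>Gluing along a countably valued measurable index: each \<open>\<eta> i\<close> is a
  function of the sample point alone.\<close>

lemma step_measurable:
  fixes \<eta> :: "nat \<Rightarrow> 'a \<Rightarrow> 'b::euclidean_space"
  assumes "\<And>i. \<eta> i \<in> borel_measurable M"
  shows "(\<lambda>p. \<eta> (cell a c n (fst p)) (snd p)) \<in> borel_measurable (strip a' c' M)"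
proof (rule measurable_compose_countable[where f="\<lambda>i p. \<eta> i (snd p)"])
  fix i show "(\<lambda>p. \<eta> i (snd p)) \<in> borel_measurable (strip a' c' M)"
    using assms[of i] by measurable
qed measurable

text \<open>The approximation is demanded on all sufficiently fine partitions, not on some one.
  Approximants of two functions can then be chosen on the same partition and added.\<close>

definition step_approx :: "real \<Rightarrow> real \<Rightarrow> (real \<times> 'a \<Rightarrow> 'b::euclidean_space) \<Rightarrow> bool" where
  "step_approx a c g \<longleftrightarrow> (\<forall>e>0. \<forall>\<^sub>F n in sequentially. \<exists>\<eta>. (\<forall>i. \<eta> i \<in> borel_measurable M) \<and>
     (\<exists>K. \<forall>i. \<forall>w\<in>space M. norm (\<eta> i w) \<le> K) \<and>
     msq (strip a c M) (\<lambda>p. g p - \<eta> (cell a c n (fst p)) (snd p)) \<le> ennreal e)"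

text \<open>Closedness in mean square. Two errors \<open>e / 4\<close>, each doubled by
  \<open>msq_triangle\<close>, add up to \<open>e\<close>.\<close>

lemma step_approx_lim:
  fixes g :: "real \<times> 'a \<Rightarrow> 'b::euclidean_space"
  assumes [measurable]: "g \<in> borel_measurable (strip a c M)"
    and h: "\<And>e. 0 < e \<Longrightarrow> \<exists>h. h \<in> borel_measurable (strip a c M) \<and> step_approx a c h \<and>
      msq (strip a c M) (\<lambda>p. g p - h p) \<le> ennreal e"
  shows "step_approx a c g"
  unfolding step_approx_def
proof safe
  fix e :: real assume "0 < e"
  then have e: "0 < e / 4" by simp
  from h[OF this] obtain h where [measurable]: "h \<in> borel_measurable (strip a c M)"
    and h: "step_approx a c h" "msq (strip a c M) (\<lambda>p. g p - h p) \<le> ennreal (e / 4)" by auto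
  from h(1) e show "\<forall>\<^sub>F n in sequentially. \<exists>\<eta>. (\<forall>i. \<eta> i \<in> borel_measurable M) \<and>
     (\<exists>K. \<forall>i. \<forall>w\<in>space M. norm (\<eta> i w) \<le> K) \<and>
     msq (strip a c M) (\<lambda>p. g p - \<eta> (cell a c n (fst p)) (snd p)) \<le> ennreal e"
    unfolding step_approx_def
  proof (elim allE[of _ "e / 4"] impE, simp, elim eventually_mono exE conjE)
    fix n \<eta> K
    assume \<eta>m: "\<forall>i. \<eta> i \<in> borel_measurable M"
      and \<eta>: "\<forall>i. \<forall>w\<in>space M. norm (\<eta> i w) \<le> K"
      "msq (strip a c M) (\<lambda>p. h p - \<eta> (cell a c n (fst p)) (snd p)) \<le> ennreal (e / 4)"
    have [measurable]: "(\<lambda>p. \<eta> (cell a c n (fst p)) (snd p)) \<in> borel_measurable (strip a c M)"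
      using \<eta>m by (intro step_measurable) auto
    have "msq (strip a c M) (\<lambda>p. g p - \<eta> (cell a c n (fst p)) (snd p))
        \<le> 2 * msq (strip a c M) (\<lambda>p. g p - h p)
          + 2 * msq (strip a c M) (\<lambda>p. h p - \<eta> (cell a c n (fst p)) (snd p))"
      by (intro msq_triangle) auto
    also have "\<dots> \<le> 2 * ennreal (e / 4) + 2 * ennreal (e / 4)"
      using h \<eta> by (intro add_mono mult_left_mono) auto
    also have "\<dots> = ennreal e"
      using e by (simp add: numeral_mult_ennreal ennreal_plus[symmetric] del: ennreal_plus)
    finally show "\<exists>\<eta>. (\<forall>i. \<eta> i \<in> borel_measurable M) \<and>
     (\<exists>K. \<forall>i. \<forall>w\<in>space M. norm (\<eta> i w) \<le> K) \<and>
     msq (strip a c M) (\<lambda>p. g p - \<eta> (cell a c n (fst p)) (snd p)) \<le> ennreal e"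
      using \<eta> \<eta>m by (intro exI[of _ \<eta>]) auto
  qed
qed

lemma step_approx_add:
  fixes g h :: "real \<times> 'a \<Rightarrow> 'b::euclidean_space"
  assumes [measurable]: "g \<in> borel_measurable (strip a c M)" "h \<in> borel_measurable (strip a c M)"
    and gh: "step_approx a c g" "step_approx a c h"
  shows "step_approx a c (\<lambda>p. g p + h p)"
  unfolding step_approx_def
proof safe
  fix e :: real assume "0 < e"
  then have e: "0 < e / 4" by simp
  have A: "step_approx a c g \<Longrightarrow> \<forall>\<^sub>F n in sequentially. \<exists>\<eta>. (\<forall>i. \<eta> i \<in> borel_measurable M) \<and>
     (\<exists>K. \<forall>i. \<forall>w\<in>space M. norm (\<eta> i w) \<le> K) \<and>
     msq (strip a c M) (\<lambda>p. g p - \<eta> (cell a c n (fst p)) (snd p)) \<le> ennreal (e / 4)"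
    for g :: "real \<times> 'a \<Rightarrow> 'b"
    using e unfolding step_approx_def by blast
  from A[OF gh(1)] A[OF gh(2)]
  show "\<forall>\<^sub>F n in sequentially. \<exists>\<eta>. (\<forall>i. \<eta> i \<in> borel_measurable M) \<and>
     (\<exists>K. \<forall>i. \<forall>w\<in>space M. norm (\<eta> i w) \<le> K) \<and>
     msq (strip a c M) (\<lambda>p. g p + h p - \<eta> (cell a c n (fst p)) (snd p)) \<le> ennreal e"
  proof eventually_elim
    case (elim n)
    then obtain \<eta> K \<zeta> L where m [measurable]: "\<forall>i. \<eta> i \<in> borel_measurable M" "\<forall>i. \<zeta> i \<in> borel_measurable M"
      and \<eta>: "\<forall>i. \<forall>w\<in>space M. norm (\<eta> i w) \<le> K"
      "msq (strip a c M) (\<lambda>p. g p - \<eta> (cell a c n (fst p)) (snd p)) \<le> ennreal (e / 4)"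
      and \<zeta>: "\<forall>i. \<forall>w\<in>space M. norm (\<zeta> i w) \<le> L"
      "msq (strip a c M) (\<lambda>p. h p - \<zeta> (cell a c n (fst p)) (snd p)) \<le> ennreal (e / 4)"
      by blast
    have [measurable]: "(\<lambda>p. \<eta> (cell a c n (fst p)) (snd p)) \<in> borel_measurable (strip a c M)"
      "(\<lambda>p. \<zeta> (cell a c n (fst p)) (snd p)) \<in> borel_measurable (strip a c M)"
      using m by (auto intro: step_measurable)
    have "msq (strip a c M) (\<lambda>p. g p + h p - (\<eta> (cell a c n (fst p)) (snd p) + \<zeta> (cell a c n (fst p)) (snd p)))
        = msq (strip a c M) (\<lambda>p. (g p - \<eta> (cell a c n (fst p)) (snd p)) + (h p - \<zeta> (cell a c n (fst p)) (snd p)))"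
      by (intro msq_cong) (auto simp: algebra_simps)
    also have "\<dots> \<le> 2 * msq (strip a c M) (\<lambda>p. g p - \<eta> (cell a c n (fst p)) (snd p))
          + 2 * msq (strip a c M) (\<lambda>p. h p - \<zeta> (cell a c n (fst p)) (snd p))"
      by (intro msq_add) auto
    also have "\<dots> \<le> 2 * ennreal (e / 4) + 2 * ennreal (e / 4)"
      using \<zeta> \<eta> by (intro add_mono mult_left_mono) auto
    also have "\<dots> = ennreal e"
      using e by (simp add: numeral_mult_ennreal ennreal_plus[symmetric] del: ennreal_plus)
    finally show "\<exists>\<eta>. (\<forall>i. \<eta> i \<in> borel_measurable M) \<and>
     (\<exists>K. \<forall>i. \<forall>w\<in>space M. norm (\<eta> i w) \<le> K) \<and>
     msq (strip a c M) (\<lambda>p. g p + h p - \<eta> (cell a c n (fst p)) (snd p)) \<le> ennreal e"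
      using m \<eta>(1) \<zeta>(1) by (intro exI[of _ "\<lambda>i w. \<eta> i w + \<zeta> i w"])
        (auto intro!: exI[of _ "K + L"] borel_measurable_add order_trans[OF norm_triangle_ineq] add_mono)
  qed
qed

lemma step_approx_const_time:
  fixes h :: "'a \<Rightarrow> 'b::euclidean_space"
  assumes "h \<in> borel_measurable M" "\<And>w. w \<in> space M \<Longrightarrow> norm (h w) \<le> K"
  shows "step_approx a c (\<lambda>p. h (snd p))"
  unfolding step_approx_def using assms by (auto intro!: exI[of _ "\<lambda>i. h"] always_eventually)

lemma step_approx_uminus:
  fixes g :: "real \<times> 'a \<Rightarrow> 'b::euclidean_space"
  assumes "step_approx a c g"
  shows "step_approx a c (\<lambda>p. - g p)"
  unfolding step_approx_def
proof safe
  fix e :: real assume "0 < e"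
  with assms show "\<forall>\<^sub>F n in sequentially. \<exists>\<eta>. (\<forall>i. \<eta> i \<in> borel_measurable M) \<and>
     (\<exists>K. \<forall>i. \<forall>w\<in>space M. norm (\<eta> i w) \<le> K) \<and>
     msq (strip a c M) (\<lambda>p. - g p - \<eta> (cell a c n (fst p)) (snd p)) \<le> ennreal e"
    unfolding step_approx_def
  proof (elim allE[of _ "e"] impE, simp, elim eventually_mono exE conjE)
    fix n \<eta> K
    assume \<eta>: "\<forall>i. \<eta> i \<in> borel_measurable M" "\<forall>i. \<forall>w\<in>space M. norm (\<eta> i w) \<le> K"
      "msq (strip a c M) (\<lambda>p. g p - \<eta> (cell a c n (fst p)) (snd p)) \<le> ennreal e"
    moreover have "msq (strip a c M) (\<lambda>p. - g p - - \<eta> (cell a c n (fst p)) (snd p))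
      = msq (strip a c M) (\<lambda>p. g p - \<eta> (cell a c n (fst p)) (snd p))"
      unfolding msq_def by (simp add: norm_minus_commute)
    ultimately show "\<exists>\<eta>. (\<forall>i. \<eta> i \<in> borel_measurable M) \<and>
     (\<exists>K. \<forall>i. \<forall>w\<in>space M. norm (\<eta> i w) \<le> K) \<and>
     msq (strip a c M) (\<lambda>p. - g p - \<eta> (cell a c n (fst p)) (snd p)) \<le> ennreal e"
      by (intro exI[of _ "\<lambda>i w. - \<eta> i w"]) auto
  qed
qed

text \<open>A cell is kept only if it lies entirely below \<open>x\<close>. The step function then
  errs only at times within one mesh width \<open>h\<close> of \<open>x\<close>, at a cost of at
  most \<open>2 * h * (norm v)\<^sup>2\<close>, which is the \<open>C / n\<close> that determines
  \<open>N\<close>.\<close>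

lemma step_approx_halfspace:
  fixes v :: "'b::euclidean_space"
  assumes "a < c" and E: "E \<in> sets M"
  shows "step_approx a c (\<lambda>p. indicator ({..x} \<times> E) p *\<^sub>R v)"
  unfolding step_approx_def
proof safe
  fix e :: real assume e: "0 < e"
  define C where "C = 2 * (c - a) * (norm v)\<^sup>2"
  have C: "0 \<le> C" using assms by (simp add: C_def)
  obtain N :: nat where N: "0 < N" "C / e < real N"
    using reals_Archimedean2[of "max 1 (C / e)"] by (metis max_less_iff_conj of_nat_0_less_iff less_trans zero_less_one)
  show "\<forall>\<^sub>F n in sequentially. \<exists>\<eta>. (\<forall>i. \<eta> i \<in> borel_measurable M) \<and>
     (\<exists>K. \<forall>i. \<forall>w\<in>space M. norm (\<eta> i w) \<le> K) \<and>
     msq (strip a c M) (\<lambda>p. indicator ({..x} \<times> E) p *\<^sub>R v - \<eta> (cell a c n (fst p)) (snd p)) \<le> ennreal e"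
    using eventually_ge_at_top[of N]
  proof eventually_elim
    case (elim n)
    then have n: "0 < n" "C \<le> e * real n"
    proof -
      show "0 < n" using elim N by simp
      have "C < e * real N" using N e by (simp add: divide_less_eq mult.commute)
      also have "\<dots> \<le> e * real n" using elim e by simp
      finally show "C \<le> e * real n" by simp
    qed
    define \<eta> where "\<eta> i w = (if node a c n (Suc i) \<le> x then indicator E w *\<^sub>R v else 0)" for i w
    have [measurable]: "\<eta> i \<in> borel_measurable M" for i
      using E unfolding \<eta>_def by measurable
    define h where "h = (c - a) / real n"
    have h: "0 < h" using assms n by (simp add: h_def)
    have "msq (strip a c M) (\<lambda>p. indicator ({..x} \<times> E) p *\<^sub>R v - \<eta> (cell a c n (fst p)) (snd p))
       \<le> (\<integral>\<^sup>+p. ennreal ((norm v)\<^sup>2) * indicator ({x - h..x + h} \<times> space M) p \<partial>strip a c M)"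
      unfolding msq_def
    proof (intro nn_integral_mono)
      fix p assume "p \<in> space (strip a c M)"
      then obtain t w where p: "p = (t, w)" "a \<le> t" "t \<le> c" "w \<in> space M"
        by (auto simp: space_strip)
      let ?i = "cell a c n t"
      have 1: "t \<le> node a c n (Suc ?i)" using assms n by (intro le_node_Suc_cell) auto
      have 2: "node a c n ?i \<le> t" using assms n p by (intro node_cell_le) auto
      have 3: "node a c n (Suc ?i) = node a c n ?i + h" by (simp add: node_Suc h_def)
      show "ennreal ((norm (indicator ({..x} \<times> E) p *\<^sub>R v - \<eta> (cell a c n (fst p)) (snd p)))\<^sup>2)
         \<le> ennreal ((norm v)\<^sup>2) * indicator ({x - h..x + h} \<times> space M) p"
        using 1 2 3 p h by (auto simp: \<eta>_def indicator_def)
    qed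
    also have "\<dots> = ennreal ((norm v)\<^sup>2) * emeasure (strip a c M) (({x - h..x + h} \<inter> {a..c}) \<times> space M)"
    proof -
      have "({x - h..x + h} \<inter> {a..c}) \<times> space M \<in> sets (strip a c M)"
        by (intro pair_measureI) (auto simp: sets_restrict_space)
      moreover have "(\<integral>\<^sup>+p. ennreal ((norm v)\<^sup>2) * indicator ({x - h..x + h} \<times> space M) p \<partial>strip a c M)
        = (\<integral>\<^sup>+p. ennreal ((norm v)\<^sup>2) * indicator (({x - h..x + h} \<inter> {a..c}) \<times> space M) p \<partial>strip a c M)"
        by (intro nn_integral_cong) (auto simp: space_strip indicator_def)
      ultimately show ?thesis by (simp add: nn_integral_cmult_indicator)
    qed
    also have "emeasure (strip a c M) (({x - h..x + h} \<inter> {a..c}) \<times> space M)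
        = emeasure (restrict_space lborel {a..c}) ({x - h..x + h} \<inter> {a..c})"
      by (subst emeasure_pair_measure_Times) (auto simp: sets_restrict_space emeasure_space_1)
    also have "ennreal ((norm v)\<^sup>2) * \<dots> \<le> ennreal ((norm v)\<^sup>2) * emeasure lborel {x - h..x + h}"
      by (intro mult_left_mono order_trans[OF emeasure_time_le] emeasure_mono) auto
    also have "\<dots> = ennreal ((norm v)\<^sup>2 * (2 * h))"
      using h by (simp add: ennreal_mult)
    also have "(norm v)\<^sup>2 * (2 * h) = C / real n"
      by (simp add: C_def h_def)
    also have "\<dots> \<le> ennreal e"
      using n by (intro ennreal_leI) (simp add: divide_le_eq)
    finally show ?case
      by (intro exI[of _ \<eta>]) (auto simp: \<eta>_def indicator_def intro!: exI[of _ "norm v"])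
  qed
qed

text \<open>Finite disjoint unions follow by adding, and the remaining tail is small in measure
  because the strip has finite measure. This is the union step of the two Dynkin arguments that
  follow.\<close>

lemma step_approx_UN:
  fixes v :: "'b::euclidean_space" and S :: "nat \<Rightarrow> (real \<times> 'a) set"
  assumes S: "disjoint_family S" "\<And>i. S i \<in> sets (strip a c M)"
    and approx: "\<And>i. step_approx a c (\<lambda>p. indicator (S i) p *\<^sub>R v)"
  shows "step_approx a c (\<lambda>p. indicator (\<Union>i. S i) p *\<^sub>R v)"
proof (rule step_approx_lim)
  interpret R: finite_measure "strip a c M" by (rule finite_measure_strip)
  note S(2)[measurable]
  have [measurable]: "(\<Union>i. S i) \<in> sets (strip a c M)" by (intro sets.countable_UN) (use S(2) in blast)
  show "(\<lambda>p. indicator (\<Union>i. S i) p *\<^sub>R v) \<in> borel_measurable (strip a c M)" by measurable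
  fix e :: real assume e: "0 < e"
  define U where "U n = (\<Union>i<n. S i)" for n
  have [measurable]: "U n \<in> sets (strip a c M)" for n unfolding U_def by measurable
  have U: "step_approx a c (\<lambda>p. indicator (U n) p *\<^sub>R v)" for n
  proof (induction n)
    case 0
    have "step_approx a c (\<lambda>p. 0::'b)" by (rule step_approx_const_time[of "\<lambda>w. 0" 0]) auto
    then show ?case by (simp add: U_def)
  next
    case (Suc n)
    have "U n \<inter> S n = {}"
    proof -
      have "S i \<inter> S n = {}" if "i < n" for i
        using S(1) that by (auto simp: disjoint_family_on_def)
      then show ?thesis by (auto simp: U_def)
    qed
    then have "(\<lambda>p. indicator (U (Suc n)) p *\<^sub>R v) = (\<lambda>p. indicator (U n) p *\<^sub>R v + indicator (S n) p *\<^sub>R v)"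
      by (auto simp: U_def lessThan_Suc indicator_def fun_eq_iff)
    then show ?case using Suc approx[of n] by (auto intro!: step_approx_add)
  qed
  have Uinc: "incseq U" unfolding U_def by (force simp: incseq_def)
  have UN: "(\<Union>n. U n) = (\<Union>i. S i)" unfolding U_def by auto
  have "(\<lambda>n. measure (strip a c M) (U n)) \<longlonglongrightarrow> measure (strip a c M) (\<Union>i. S i)"
    unfolding UN[symmetric] by (intro R.finite_Lim_measure_incseq Uinc) auto
  then have "(\<lambda>n. (measure (strip a c M) (\<Union>i. S i) - measure (strip a c M) (U n)) * (norm v)\<^sup>2) \<longlonglongrightarrow>
     (measure (strip a c M) (\<Union>i. S i) - measure (strip a c M) (\<Union>i. S i)) * (norm v)\<^sup>2"
    by (intro tendsto_intros)
  then have "\<forall>\<^sub>F n in sequentially. (measure (strip a c M) (\<Union>i. S i) - measure (strip a c M) (U n)) * (norm v)\<^sup>2 < e"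
    using e by (intro order_tendstoD(2)[of _ 0]) auto
  then obtain n where n: "(measure (strip a c M) (\<Union>i. S i) - measure (strip a c M) (U n)) * (norm v)\<^sup>2 < e"
    by (auto simp: eventually_sequentially)
  have sub: "U n \<subseteq> (\<Union>i. S i)" by (auto simp: U_def)
  have "msq (strip a c M) (\<lambda>p. indicator (\<Union>i. S i) p *\<^sub>R v - indicator (U n) p *\<^sub>R v)
     = (\<integral>\<^sup>+p. ennreal ((norm v)\<^sup>2) * indicator ((\<Union>i. S i) - U n) p \<partial>strip a c M)"
    unfolding msq_def using sub by (intro nn_integral_cong) (auto simp: indicator_def)
  also have "\<dots> = ennreal ((norm v)\<^sup>2) * emeasure (strip a c M) ((\<Union>i. S i) - U n)"
    by (intro nn_integral_cmult_indicator) measurable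
  also have "\<dots> = ennreal ((norm v)\<^sup>2 * (measure (strip a c M) (\<Union>i. S i) - measure (strip a c M) (U n)))"
    using sub by (simp add: R.emeasure_eq_measure ennreal_mult' R.finite_measure_Diff)
  also have "\<dots> \<le> ennreal e" using n by (intro ennreal_leI) (simp add: mult.commute)
  finally show "\<exists>h. h \<in> borel_measurable (strip a c M) \<and> step_approx a c h \<and>
      msq (strip a c M) (\<lambda>p. indicator (\<Union>i. S i) p *\<^sub>R v - h p) \<le> ennreal e"
    using U by (intro exI[of _ "\<lambda>p. indicator (U n) p *\<^sub>R v"]) auto
qed

lemma step_approx_Diff:
  fixes v :: "'b::euclidean_space"
  assumes [measurable]: "S \<in> sets (strip a c M)" "S' \<in> sets (strip a c M)" and "S \<subseteq> S'"
    and "step_approx a c (\<lambda>p. indicator S p *\<^sub>R v)" "step_approx a c (\<lambda>p. indicator S' p *\<^sub>R v)"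
  shows "step_approx a c (\<lambda>p. indicator (S' - S) p *\<^sub>R v)"
proof -
  have "(\<lambda>p. indicator (S' - S) p *\<^sub>R v) = (\<lambda>p. indicator S' p *\<^sub>R v + - (indicator S p *\<^sub>R v))"
    using assms(3) by (auto simp: indicator_def fun_eq_iff)
  moreover have "step_approx a c (\<lambda>p. indicator S' p *\<^sub>R v + - (indicator S p *\<^sub>R v))"
    using assms(4,5) by (intro step_approx_add step_approx_uminus) auto
  ultimately show ?thesis by simp
qed

lemma step_approx_cong:
  fixes g h :: "real \<times> 'a \<Rightarrow> 'b::euclidean_space"
  assumes "\<And>p. p \<in> space (strip a c M) \<Longrightarrow> g p = h p"
  shows "step_approx a c g \<longleftrightarrow> step_approx a c h"
proof -
  have "msq (strip a c M) (\<lambda>p. g p - \<eta> (cell a c n (fst p)) (snd p))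
    = msq (strip a c M) (\<lambda>p. h p - \<eta> (cell a c n (fst p)) (snd p))" for \<eta> n
    by (intro msq_cong AE_I2) (simp add: assms)
  then show ?thesis unfolding step_approx_def by simp
qed

text \<open>A Dynkin argument in the time set, starting from half-lines, which are stable under
  intersection and generate the Borel sets. Complements are differences from the full strip over
  \<open>E\<close>.\<close>

lemma step_approx_rect:
  fixes v :: "'b::euclidean_space"
  assumes ac: "a < c" and A: "A \<in> sets borel" and E: "E \<in> sets M"
  shows "step_approx a c (\<lambda>p. indicator ((A \<inter> {a..c}) \<times> E) p *\<^sub>R v)"
proof -
  have meas: "(A \<inter> {a..c}) \<times> E \<in> sets (strip a c M)" if "A \<in> sets borel" for A
    using that E by (intro pair_measureI) (auto simp: sets_restrict_space)
  have full: "step_approx a c (\<lambda>p. indicator ((UNIV \<inter> {a..c}) \<times> E) p *\<^sub>R v)"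
  proof -
    have "step_approx a c (\<lambda>p. indicator E (snd p) *\<^sub>R v)"
      using E by (intro step_approx_const_time[where K="norm v"]) (auto simp: indicator_def)
    then show ?thesis
      by (subst step_approx_cong) (auto simp: space_strip indicator_def)
  qed
  have borel_eq: "sets borel = sigma_sets UNIV (range (\<lambda>x::real. {..x}))"
    by (simp add: borel_eq_atMost)
  have "Int_stable (range (\<lambda>x::real. {..x}))" by (auto simp: Int_stable_def)
  moreover have "range (\<lambda>x::real. {..x}) \<subseteq> Pow UNIV" by simp
  moreover have "A \<in> sigma_sets UNIV (range (\<lambda>x::real. {..x}))" using A borel_eq by simp
  ultimately show ?thesis
  proof (induction rule: sigma_sets_induct_disjoint)
    case (basic A)
    then obtain x where x: "A = {..x}" by auto
    show ?case unfolding x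
      by (subst step_approx_cong[where h="\<lambda>p. indicator ({..x} \<times> E) p *\<^sub>R v"])
        (auto simp: space_strip indicator_def simp del: of_bool_eq intro: step_approx_halfspace[OF ac E, unfolded indicator_def])
  next
    case empty
    have "step_approx a c (\<lambda>p. 0::'b)" by (rule step_approx_const_time[of "\<lambda>w. 0" 0]) auto
    then show ?case by simp
  next
    case (compl A)
    have "((UNIV - A) \<inter> {a..c}) \<times> E = (UNIV \<inter> {a..c}) \<times> E - (A \<inter> {a..c}) \<times> E" by auto
    then show ?case
      using compl full meas[of A] meas[OF space_in_borel] borel_eq by (auto intro!: step_approx_Diff)
  next
    case (union A)
    have "((\<Union>i. A i) \<inter> {a..c}) \<times> E = (\<Union>i. (A i \<inter> {a..c}) \<times> E)" by auto
    moreover have "step_approx a c (\<lambda>p. indicator (\<Union>i. (A i \<inter> {a..c}) \<times> E) p *\<^sub>R v)"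
    proof (intro step_approx_UN)
      show "disjoint_family (\<lambda>i. (A i \<inter> {a..c}) \<times> E)"
        using union(1) by (fastforce simp: disjoint_family_on_def)
      show "(A i \<inter> {a..c}) \<times> E \<in> sets (strip a c M)" for i
        using union(2) borel_eq by (intro meas) auto
    qed (use union in auto)
    ultimately show ?case by simp
  qed
qed

text \<open>A second Dynkin argument, from measurable rectangles to the whole product
  sigma-field.\<close>

lemma step_approx_indicator:
  fixes v :: "'b::euclidean_space"
  assumes ac: "a < c" and S: "S \<in> sets (strip a c M)"
  shows "step_approx a c (\<lambda>p. indicator S p *\<^sub>R v)"
proof -
  let ?G = "{A \<times> E | A E. A \<in> sets (restrict_space lborel {a..c}) \<and> E \<in> sets M}"
  let ?\<Omega> = "space (restrict_space lborel {a..c}) \<times> space M"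
  have eq: "sets (strip a c M) = sigma_sets ?\<Omega> ?G" by (rule sets_pair_measure)
  have rect: "step_approx a c (\<lambda>p. indicator S p *\<^sub>R v)" if "S \<in> ?G" for S
  proof -
    from that obtain A E where S: "S = A \<times> E" "A \<in> sets (restrict_space lborel {a..c})" "E \<in> sets M" by auto
    then obtain A' where "A' \<in> sets borel" "A = A' \<inter> {a..c}"
      by (auto simp: sets_restrict_space)
    then show ?thesis using S ac by (auto intro!: step_approx_rect)
  qed
  have "S \<in> sigma_sets ?\<Omega> ?G" using S eq by simp
  from Int_stable_pair_measure_generator pair_measure_closed this show ?thesis
  proof (induction rule: sigma_sets_induct_disjoint)
    case (basic A)
    then show ?case by (rule rect)
  next
    case empty
    have "step_approx a c (\<lambda>p. 0::'b)" by (rule step_approx_const_time[of "\<lambda>w. 0" 0]) auto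
    then show ?case by simp
  next
    case (compl A)
    have "step_approx a c (\<lambda>p. indicator ?\<Omega> p *\<^sub>R v)"
      by (intro rect) (auto intro!: exI[of _ "space M"] exI[of _ "space (restrict_space lborel {a..c})"])
    then show ?case
      using compl eq sets.top[of "strip a c M"] sets.sets_into_space[of A "strip a c M"]
      by (auto intro!: step_approx_Diff simp: space_pair_measure)
  next
    case (union A)
    then show ?case using eq by (intro step_approx_UN) auto
  qed
qed

text \<open>Simple functions with \<open>norm (s i p) \<le> 2 * norm (g p)\<close> converge to
  \<open>g\<close> pointwise. The error has norm at most three times that of \<open>g\<close>, which
  gives the dominating function with factor \<open>9\<close>.\<close>

theorem step_approx_L2:
  fixes g :: "real \<times> 'a \<Rightarrow> 'b::euclidean_space"
  assumes ac: "a < c" and [measurable]: "g \<in> borel_measurable (strip a c M)"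
    and fin: "msq (strip a c M) g < \<infinity>"
  shows "step_approx a c g"
proof (rule step_approx_lim)
  interpret R: finite_measure "strip a c M" by (rule finite_measure_strip)
  fix e :: real assume e: "0 < e"
  obtain s where s: "\<And>i. simple_function (strip a c M) (s i)"
    "\<And>p. p \<in> space (strip a c M) \<Longrightarrow> (\<lambda>i. s i p) \<longlonglongrightarrow> g p"
    "\<And>i p. p \<in> space (strip a c M) \<Longrightarrow> norm (s i p) \<le> 2 * norm (g p)"
    using borel_measurable_implies_sequence_metric[OF assms(2), of 0] unfolding norm_conv_dist by metis
  have sm [measurable]: "s i \<in> borel_measurable (strip a c M)" for i
    using s(1) by (rule borel_measurable_simple_function)
  have sap: "step_approx a c (s i)" for i
  proof -
    have fin: "finite (s i ` space (strip a c M))" using s(1) by (rule simple_functionD)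
    have "step_approx a c (\<lambda>p. \<Sum>y\<in>F. indicator (s i -` {y} \<inter> space (strip a c M)) p *\<^sub>R y)"
      if "F \<subseteq> s i ` space (strip a c M)" for F
      using finite_subset[OF that fin]
    proof (induction F rule: finite_induct)
      case empty
      have "step_approx a c (\<lambda>p. 0::'b)" by (rule step_approx_const_time[of "\<lambda>w. 0" 0]) auto
      then show ?case by simp
    next
      case (insert x F)
      have "step_approx a c (\<lambda>p. indicator (s i -` {x} \<inter> space (strip a c M)) p *\<^sub>R x +
          (\<Sum>y\<in>F. indicator (s i -` {y} \<inter> space (strip a c M)) p *\<^sub>R y))"
        by (intro step_approx_add step_approx_indicator ac insert.IH) auto
      then show ?case unfolding sum.insert[OF insert.hyps(1,2)] .
    qed
    note A = this[OF order_refl]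
    have B: "(\<Sum>y\<in>s i ` space (strip a c M). indicator (s i -` {y} \<inter> space (strip a c M)) p *\<^sub>R y) = s i p"
      if "p \<in> space (strip a c M)" for p
    proof -
      have "(\<Sum>y\<in>s i ` space (strip a c M). indicator (s i -` {y} \<inter> space (strip a c M)) p *\<^sub>R y)
        = (\<Sum>y\<in>s i ` space (strip a c M). if y = s i p then y else 0)"
        using that by (intro sum.cong) (auto simp: indicator_def)
      also have "\<dots> = s i p"
        using that simple_functionD(1)[OF s(1), of i] by (subst sum.delta) auto
      finally show ?thesis .
    qed
    from A show ?thesis by (subst step_approx_cong[OF B, symmetric])
  qed
  have "(\<lambda>i. \<integral>\<^sup>+p. ennreal ((norm (g p - s i p))\<^sup>2) \<partial>strip a c M) \<longlonglongrightarrow> (\<integral>\<^sup>+p. 0 \<partial>strip a c M)"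
  proof (rule nn_integral_dominated_convergence[where w="\<lambda>p. 9 * ennreal ((norm (g p))\<^sup>2)"])
    show "(\<integral>\<^sup>+p. 9 * ennreal ((norm (g p))\<^sup>2) \<partial>strip a c M) < \<infinity>"
      using fin by (simp add: nn_integral_cmult msq_def ennreal_mult_less_top)
    show "AE p in strip a c M. ennreal ((norm (g p - s i p))\<^sup>2) \<le> 9 * ennreal ((norm (g p))\<^sup>2)" for i
    proof (intro AE_I2)
      fix p assume "p \<in> space (strip a c M)"
      from s(3)[OF this, of i] have "norm (g p - s i p) \<le> 3 * norm (g p)"
        using norm_triangle_ineq4[of "g p" "s i p"] by simp
      then have "(norm (g p - s i p))\<^sup>2 \<le> (3 * norm (g p))\<^sup>2" by (intro power_mono) auto
      then show "ennreal ((norm (g p - s i p))\<^sup>2) \<le> 9 * ennreal ((norm (g p))\<^sup>2)"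
        by (simp add: numeral_mult_ennreal power_mult_distrib)
    qed
    show "AE p in strip a c M. (\<lambda>i. ennreal ((norm (g p - s i p))\<^sup>2)) \<longlonglongrightarrow> 0"
    proof (intro AE_I2)
      fix p assume "p \<in> space (strip a c M)"
      from s(2)[OF this] have "(\<lambda>i. ennreal ((norm (g p - s i p))\<^sup>2)) \<longlonglongrightarrow> ennreal ((norm (g p - g p))\<^sup>2)"
        by (intro tendsto_intros)
      then show "(\<lambda>i. ennreal ((norm (g p - s i p))\<^sup>2)) \<longlonglongrightarrow> 0" by simp
    qed
  qed auto
  then have "(\<lambda>i. msq (strip a c M) (\<lambda>p. g p - s i p)) \<longlonglongrightarrow> 0" by (simp add: msq_def)
  from order_tendstoD(2)[OF this, of "ennreal e"] e obtain i where
    "msq (strip a c M) (\<lambda>p. g p - s i p) < ennreal e"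
    by (auto simp: eventually_sequentially)
  then show "\<exists>h. h \<in> borel_measurable (strip a c M) \<and> step_approx a c h \<and>
      msq (strip a c M) (\<lambda>p. g p - h p) \<le> ennreal e"
    using sap sm by (intro exI[of _ "s i"]) auto
qed fact

section \<open>Clamped conditional expectations\<close>

text \<open>A conditional expectation of a function bounded by \<open>K\<close> is bounded almost
  everywhere only. Clamping each coordinate to \<open>[-K, K]\<close> changes it on a null set and
  makes it bounded at every sample point, as the integrands of simple processes must be.\<close>

definition cexp :: "'a measure \<Rightarrow> real \<Rightarrow> ('a \<Rightarrow> 'b::euclidean_space) \<Rightarrow> 'a \<Rightarrow> 'b" where
  "cexp F K f w = (\<Sum>b\<in>Basis. max (- K) (min K (real_cond_exp M F (\<lambda>w. f w \<bullet> b) w)) *\<^sub>R b)"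

lemma cexp_inner: "b \<in> Basis \<Longrightarrow> cexp F K f w \<bullet> b = max (- K) (min K (real_cond_exp M F (\<lambda>w. f w \<bullet> b) w))"
  by (simp add: cexp_def inner_sum_left inner_Basis if_distrib cong: if_cong)

lemma cexp_measurable: "cexp F K f \<in> borel_measurable F"
  unfolding cexp_def[abs_def] by measurable

lemma norm_cexp_le:
  fixes f :: "'a \<Rightarrow> 'b::euclidean_space"
  assumes "0 \<le> K"
  shows "norm (cexp F K f w) \<le> real DIM('b) * K"
proof -
  have "norm (cexp F K f w) \<le> (\<Sum>b\<in>(Basis::'b set). norm (max (- K) (min K (real_cond_exp M F (\<lambda>w. f w \<bullet> b) w)) *\<^sub>R b))"
    unfolding cexp_def by (rule norm_sum)
  also have "\<dots> \<le> (\<Sum>b\<in>(Basis::'b set). K)"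
    using assms by (intro sum_mono) auto
  finally show ?thesis by simp
qed

lemma norm_sq_Basis: "(norm (x::'b::euclidean_space))\<^sup>2 = (\<Sum>b\<in>Basis. (x \<bullet> b)\<^sup>2)"
  by (simp only: power2_norm_eq_inner) (simp add: euclidean_inner[of x x] power2_eq_square)

lemma msq_Basis:
  fixes f :: "'a \<Rightarrow> 'b::euclidean_space"
  assumes [measurable]: "f \<in> borel_measurable M"
  shows "msq M f = (\<Sum>b\<in>Basis. msq M (\<lambda>x. f x \<bullet> b))"
  unfolding msq_def
  by (subst nn_integral_sum[symmetric]) (auto simp: norm_sq_Basis[of "f _"] sum_ennreal)

lemma integrable_bounded_sq:
  fixes f :: "'a \<Rightarrow> real"
  assumes [measurable]: "f \<in> borel_measurable M" and K: "\<And>w. w \<in> space M \<Longrightarrow> \<bar>f w\<bar> \<le> K"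
  shows "integrable M f" and "integrable M (\<lambda>w. (f w)\<^sup>2)"
proof -
  show "integrable M f" using K by (intro integrable_const_bound[of _ K]) auto
  have "(f w)\<^sup>2 \<le> K\<^sup>2" if "w \<in> space M" for w
    using power_mono[OF K[OF that], of 2] by simp
  then show "integrable M (\<lambda>w. (f w)\<^sup>2)" by (intro integrable_const_bound[of _ "K\<^sup>2"]) auto
qed

text \<open>The clamping acts on a null set, so the defining property of the conditional expectation
  is kept. As \<open>f\<close> is bounded, the test function \<open>u\<close> need only be
  integrable.\<close>

lemma cexp_integral:
  fixes f :: "'a \<Rightarrow> 'b::euclidean_space"
  assumes F: "subalgebra M F" and f [measurable]: "f \<in> borel_measurable M"
    and K: "\<And>w. w \<in> space M \<Longrightarrow> norm (f w) \<le> K"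
    and b: "b \<in> Basis" and u: "u \<in> borel_measurable F" "integrable M u"
  shows "integrable M (\<lambda>w. u w * (cexp F K f w \<bullet> b))"
    and "(\<integral>w. u w * (cexp F K f w \<bullet> b) \<partial>M) = (\<integral>w. u w * (f w \<bullet> b) \<partial>M)"
proof -
  interpret F: finite_measure_subalgebra M F by unfold_locales fact
  have um [measurable]: "u \<in> borel_measurable M" by (rule measurable_from_subalg[OF F u(1)])
  have K': "\<bar>f w \<bullet> b\<bar> \<le> K" if "w \<in> space M" for w
    using Basis_le_norm[OF b, of "f w"] K[OF that] by simp
  have I: "integrable M (\<lambda>w. f w \<bullet> b)"
    using K' by (intro integrable_const_bound[of _ K]) auto
  have "AE w in M. real_cond_exp M F (\<lambda>w. f w \<bullet> b) w \<le> K"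
    using K' by (intro F.real_cond_exp_le_c I) (auto simp: abs_le_iff)
  moreover have "AE w in M. - K \<le> real_cond_exp M F (\<lambda>w. f w \<bullet> b) w"
    using K' by (intro F.real_cond_exp_ge_c I AE_I2) (force simp: abs_le_iff)
  ultimately have AE: "AE w in M. cexp F K f w \<bullet> b = real_cond_exp M F (\<lambda>w. f w \<bullet> b) w"
    by eventually_elim (simp add: cexp_inner[OF b])
  have ufI: "integrable M (\<lambda>w. u w * (f w \<bullet> b))"
  proof (rule Bochner_Integration.integrable_bound[of _ "\<lambda>w. K * u w"])
    show "AE w in M. norm (u w * (f w \<bullet> b)) \<le> norm (K * u w)"
    proof (intro AE_I2)
      fix w assume w: "w \<in> space M"
      have "\<bar>u w\<bar> * \<bar>f w \<bullet> b\<bar> \<le> \<bar>u w\<bar> * K" using K'[OF w] by (intro mult_left_mono) auto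
      also have "\<dots> \<le> \<bar>u w\<bar> * \<bar>K\<bar>" by (intro mult_left_mono) auto
      finally show "norm (u w * (f w \<bullet> b)) \<le> norm (K * u w)" by (simp add: abs_mult mult.commute)
    qed
  qed (use u in auto)
  have cm [measurable]: "(\<lambda>w. cexp F K f w \<bullet> b) \<in> borel_measurable M"
    using measurable_from_subalg[OF F cexp_measurable[of F K f]] by measurable
  note * = F.real_cond_exp_intg[OF ufI u(1)]
  show "integrable M (\<lambda>w. u w * (cexp F K f w \<bullet> b))"
    using *(1) by (rule integrable_cong_AE_imp) (use AE in auto)
  have "(\<integral>w. u w * (cexp F K f w \<bullet> b) \<partial>M) = (\<integral>w. u w * real_cond_exp M F (\<lambda>w. f w \<bullet> b) w \<partial>M)"
    using AE by (intro integral_cong_AE) auto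
  then show "(\<integral>w. u w * (cexp F K f w \<bullet> b) \<partial>M) = (\<integral>w. u w * (f w \<bullet> b) \<partial>M)"
    using *(2) by simp
qed

lemma msq_diff_real:
  fixes f g :: "'a \<Rightarrow> real"
  assumes "integrable M (\<lambda>w. (f w)\<^sup>2)" "integrable M (\<lambda>w. (g w)\<^sup>2)" "integrable M (\<lambda>w. f w * g w)"
  shows "msq M (\<lambda>w. f w - g w)
    = ennreal ((\<integral>w. (f w)\<^sup>2 \<partial>M) - 2 * (\<integral>w. f w * g w \<partial>M) + (\<integral>w. (g w)\<^sup>2 \<partial>M))"
proof -
  have eq: "(\<lambda>w. (f w - g w)\<^sup>2) = (\<lambda>w. (f w)\<^sup>2 - 2 * (f w * g w) + (g w)\<^sup>2)"
    by (auto simp: power2_diff fun_eq_iff)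
  have "integrable M (\<lambda>w. (f w - g w)\<^sup>2)" unfolding eq using assms by auto
  then have "msq M (\<lambda>w. f w - g w) = ennreal (\<integral>w. (f w - g w)\<^sup>2 \<partial>M)"
    using msq_eq_integral[of M "\<lambda>w. f w - g w"] by simp
  also have "(\<integral>w. (f w - g w)\<^sup>2 \<partial>M) = (\<integral>w. (f w)\<^sup>2 \<partial>M) - 2 * (\<integral>w. f w * g w \<partial>M) + (\<integral>w. (g w)\<^sup>2 \<partial>M)"
    unfolding eq using assms by simp
  finally show ?thesis .
qed

text \<open>The conditional expectation is an orthogonal projection in each coordinate. As
  \<open>g\<close> is measurable for \<open>F\<close>, its cross terms with \<open>f\<close> and
  with the projection of \<open>f\<close> coincide, so only the second moments of these two have to
  be compared.\<close>

lemma cexp_contraction: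
  fixes f g :: "'a \<Rightarrow> 'b::euclidean_space"
  assumes F: "subalgebra M F" and f [measurable]: "f \<in> borel_measurable M"
    and K: "\<And>w. w \<in> space M \<Longrightarrow> norm (f w) \<le> K"
    and g: "g \<in> borel_measurable F" "msq M g < \<infinity>"
  shows "msq M (\<lambda>w. g w - cexp F K f w) \<le> msq M (\<lambda>w. g w - f w)"
proof -
  have [measurable]: "g \<in> borel_measurable M" "cexp F K f \<in> borel_measurable M"
    by (rule measurable_from_subalg[OF F], fact, rule measurable_from_subalg[OF F cexp_measurable])
  have K0: "0 \<le> K" using K not_empty by (meson all_not_in_conv norm_ge_zero order_trans)
  have "msq M (\<lambda>w. (g w - cexp F K f w) \<bullet> b) \<le> msq M (\<lambda>w. (g w - f w) \<bullet> b)" if b: "b \<in> Basis" for b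
  proof -
    let ?g = "\<lambda>w. g w \<bullet> b" and ?f = "\<lambda>w. f w \<bullet> b" and ?e = "\<lambda>w. cexp F K f w \<bullet> b"
    have "msq M ?g \<le> msq M g" by (intro msq_mono AE_I2) (simp add: Basis_le_norm[OF b])
    then have "msq M ?g < \<infinity>" using g(2) by (rule le_less_trans)
    then have Ig: "integrable M ?g" "integrable M (\<lambda>w. (?g w)\<^sup>2)"
      using msq_integrable[of ?g] by auto
    have fK: "\<bar>?f w\<bar> \<le> K" if "w \<in> space M" for w
      using Basis_le_norm[OF b, of "f w"] K[OF that] by simp
    have eK: "\<bar>?e w\<bar> \<le> K" for w using K0 by (simp add: cexp_inner[OF b])
    have If: "integrable M ?f" "integrable M (\<lambda>w. (?f w)\<^sup>2)"
      using fK by (auto intro: integrable_bounded_sq[of _ K])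
    have Ie: "integrable M ?e" "integrable M (\<lambda>w. (?e w)\<^sup>2)"
      using eK by (auto intro: integrable_bounded_sq[of _ K])
    have Igf: "integrable M (\<lambda>w. ?g w * ?f w)"
    proof (rule Bochner_Integration.integrable_bound[of _ "\<lambda>w. K * ?g w"])
      show "AE w in M. norm (?g w * ?f w) \<le> norm (K * ?g w)"
        using fK K0 by (intro AE_I2) (auto simp: abs_mult mult.commute intro!: mult_mono)
    qed (use Ig in auto)
    have em: "?e \<in> borel_measurable F" using cexp_measurable[of F K f] by measurable
    have gm: "?g \<in> borel_measurable F" using g(1) by measurable
    note 1 = cexp_integral[OF F f K b em Ie(1)] and 2 = cexp_integral[OF F f K b gm Ig(1)]
    let ?G = "\<integral>w. (?g w)\<^sup>2 \<partial>M" and ?X = "\<integral>w. ?g w * ?f w \<partial>M" and ?E = "\<integral>w. (?e w)\<^sup>2 \<partial>M" and ?F = "\<integral>w. (?f w)\<^sup>2 \<partial>M"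
    have ef: "(\<integral>w. ?e w * ?f w \<partial>M) = ?E" using 1 by (simp add: power2_eq_square)
    have efI: "integrable M (\<lambda>w. ?e w * ?f w)"
      using eK fK K0 by (intro integrable_const_bound[of _ "K * K"]) (auto simp: abs_mult intro!: mult_mono)
    have "msq M (\<lambda>w. ?e w - ?f w) = ennreal (?E - 2 * ?E + ?F)"
      using msq_diff_real[OF Ie(2) If(2) efI] ef by simp
    have "0 \<le> (\<integral>w. (?e w - ?f w)\<^sup>2 \<partial>M)" by simp
    also have "(\<integral>w. (?e w - ?f w)\<^sup>2 \<partial>M) = ?E - 2 * (\<integral>w. ?e w * ?f w \<partial>M) + ?F"
    proof -
      have "(\<integral>w. (?e w - ?f w)\<^sup>2 \<partial>M) = (\<integral>w. (?e w)\<^sup>2 - 2 * (?e w * ?f w) + (?f w)\<^sup>2 \<partial>M)"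
        by (intro Bochner_Integration.integral_cong) (auto simp: power2_diff)
      also have "\<dots> = ?E - 2 * (\<integral>w. ?e w * ?f w \<partial>M) + ?F" using Ie If efI by simp
      finally show ?thesis .
    qed
    finally have EF: "?E \<le> ?F" unfolding ef by simp
    have "msq M (\<lambda>w. ?g w - ?e w) = ennreal (?G - 2 * ?X + ?E)"
      using msq_diff_real[OF Ig(2) Ie(2) 2(1)] 2(2) by simp
    also have "\<dots> \<le> ennreal (?G - 2 * ?X + ?F)" using EF by (intro ennreal_leI) simp
    also have "\<dots> = msq M (\<lambda>w. ?g w - ?f w)"
      using msq_diff_real[OF Ig(2) If(2) Igf] by simp
    finally show ?thesis by (simp add: inner_diff_left)
  qed
  then show ?thesis by (simp add: msq_Basis[of "\<lambda>w. g w - cexp F K f w"] msq_Basis[of "\<lambda>w. g w - f w"] sum_mono)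
qed

text \<open>Pythagoras for nested projections: by the tower property the cross term equals the
  second moment of the coarser projection. The right-hand side is a difference of second moments, so
  it telescopes along a filtration.\<close>

lemma cexp_increment:
  fixes f :: "'a \<Rightarrow> 'b::euclidean_space"
  assumes F: "subalgebra M F" and G: "subalgebra M G" and FG: "sets F \<subseteq> sets G"
    and f [measurable]: "f \<in> borel_measurable M"
    and K: "\<And>w. w \<in> space M \<Longrightarrow> norm (f w) \<le> K"
  shows "msq M (\<lambda>w. cexp G K f w - cexp F K f w)
    = ennreal ((\<integral>w. (norm (cexp G K f w))\<^sup>2 \<partial>M) - (\<integral>w. (norm (cexp F K f w))\<^sup>2 \<partial>M))" (is ?A)
    and "(\<integral>w. (norm (cexp F K f w))\<^sup>2 \<partial>M) \<le> (\<integral>w. (norm (cexp G K f w))\<^sup>2 \<partial>M)" (is ?B)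
proof -
  have [measurable]: "cexp G K f \<in> borel_measurable M" "cexp F K f \<in> borel_measurable M"
    by (rule measurable_from_subalg[OF G cexp_measurable], rule measurable_from_subalg[OF F cexp_measurable])
  have K0: "0 \<le> K" using K not_empty by (meson all_not_in_conv norm_ge_zero order_trans)
  have sub: "subalgebra G F" using F G FG by (auto simp: subalgebra_def)
  let ?g = "\<lambda>b w. cexp G K f w \<bullet> b" and ?e = "\<lambda>b w. cexp F K f w \<bullet> b"
  have I: "integrable M (\<lambda>w. (?g b w)\<^sup>2)" "integrable M (\<lambda>w. (?e b w)\<^sup>2)" "integrable M (?e b)"
      if b: "b \<in> Basis" for b
  proof -
    have eK: "\<bar>?e b w\<bar> \<le> K" "\<bar>?g b w\<bar> \<le> K" for w using K0 by (simp_all add: cexp_inner[OF b])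
    show "integrable M (\<lambda>w. (?g b w)\<^sup>2)" "integrable M (\<lambda>w. (?e b w)\<^sup>2)" "integrable M (?e b)"
      using eK by (auto intro: integrable_bounded_sq[of _ K])
  qed
  have main: "msq M (\<lambda>w. (cexp G K f w - cexp F K f w) \<bullet> b) = ennreal ((\<integral>w. (?g b w)\<^sup>2 \<partial>M) - (\<integral>w. (?e b w)\<^sup>2 \<partial>M))
      \<and> 0 \<le> (\<integral>w. (?g b w)\<^sup>2 \<partial>M) - (\<integral>w. (?e b w)\<^sup>2 \<partial>M)"
      if b: "b \<in> Basis" for b
  proof -
    have em: "?e b \<in> borel_measurable F" using cexp_measurable[of F K f] by measurable
    have emG: "?e b \<in> borel_measurable G" by (rule measurable_from_subalg[OF sub em])
    note 1 = cexp_integral[OF F f K b em I(3)[OF b]] and 2 = cexp_integral[OF G f K b emG I(3)[OF b]]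
    have eq: "(\<integral>w. ?g b w * ?e b w \<partial>M) = (\<integral>w. (?e b w)\<^sup>2 \<partial>M)"
      using 1(2) 2(2) by (simp add: power2_eq_square mult.commute)
    have intg: "integrable M (\<lambda>w. ?g b w * ?e b w)" using 2(1) by (simp add: mult.commute)
    have "0 \<le> (\<integral>w. (?g b w - ?e b w)\<^sup>2 \<partial>M)" by simp
    also have "(\<integral>w. (?g b w - ?e b w)\<^sup>2 \<partial>M) = (\<integral>w. (?g b w)\<^sup>2 - 2 * (?g b w * ?e b w) + (?e b w)\<^sup>2 \<partial>M)"
      by (intro Bochner_Integration.integral_cong) (auto simp: power2_diff)
    also have "\<dots> = (\<integral>w. (?g b w)\<^sup>2 \<partial>M) - (\<integral>w. (?e b w)\<^sup>2 \<partial>M)" using I[OF b] intg eq by simp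
    finally show ?thesis
      using msq_diff_real[OF I(1,2)[OF b] intg] eq by (simp add: inner_diff_left)
  qed
  have "msq M (\<lambda>w. cexp G K f w - cexp F K f w)
     = (\<Sum>b\<in>Basis. ennreal ((\<integral>w. (?g b w)\<^sup>2 \<partial>M) - (\<integral>w. (?e b w)\<^sup>2 \<partial>M)))"
    by (subst msq_Basis) (auto intro!: sum.cong simp: main)
  also have "\<dots> = ennreal (\<Sum>b\<in>Basis. ((\<integral>w. (?g b w)\<^sup>2 \<partial>M) - (\<integral>w. (?e b w)\<^sup>2 \<partial>M)))"
    using main by (intro sum_ennreal) auto
  also have *: "(\<Sum>b\<in>Basis. ((\<integral>w. (?g b w)\<^sup>2 \<partial>M) - (\<integral>w. (?e b w)\<^sup>2 \<partial>M)))
     = (\<integral>w. (norm (cexp G K f w))\<^sup>2 \<partial>M) - (\<integral>w. (norm (cexp F K f w))\<^sup>2 \<partial>M)"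
    using I by (simp add: norm_sq_Basis sum_subtractf)
  finally show ?A .
  have "0 \<le> (\<Sum>b\<in>Basis. ((\<integral>w. (?g b w)\<^sup>2 \<partial>M) - (\<integral>w. (?e b w)\<^sup>2 \<partial>M)))"
    using main by (intro sum_nonneg) auto
  then show ?B unfolding * by simp
qed

section \<open>Approximation by adapted step functions\<close>

lemma msq_strip_time:
  fixes f :: "real \<times> 'a \<Rightarrow> 'b::euclidean_space"
  assumes [measurable]: "f \<in> borel_measurable (strip a c M)"
  shows "msq (strip a c M) f = (\<integral>\<^sup>+t. msq M (\<lambda>w. f (t, w)) \<partial>restrict_space lborel {a..c})"
    and "(\<lambda>t. msq M (\<lambda>w. f (t, w))) \<in> borel_measurable (restrict_space lborel {a..c})"
proof -
  have m: "(\<lambda>p. ennreal ((norm (f p))\<^sup>2)) \<in> borel_measurable (strip a c M)" by measurable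
  show "msq (strip a c M) f = (\<integral>\<^sup>+t. msq M (\<lambda>w. f (t, w)) \<partial>restrict_space lborel {a..c})"
    unfolding msq_def using nn_integral_fst[OF m] by simp
  show "(\<lambda>t. msq M (\<lambda>w. f (t, w))) \<in> borel_measurable (restrict_space lborel {a..c})"
    unfolding msq_def using borel_measurable_nn_integral_fst[OF m] by simp
qed

text \<open>A coarse step function \<open>\<zeta>\<close> approximating \<open>g\<close> is replaced by \<open>E[\<zeta> | F s]\<close>, where \<open>s\<close> is
  the left end point of the current cell of a refined partition. As \<open>g t = E[g t | F t]\<close>, passing to
  \<open>E[\<zeta> | F t]\<close> does not increase the error, and the remaining error is controlled by the increments of
  the bounded increasing functions \<open>t \<mapsto> E |E[\<zeta> | F t]|\<^sup>2\<close>, whose sum over the cells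
  telescopes.\<close>

theorem adapted_step_approx:
  fixes g :: "real \<times> 'a \<Rightarrow> 'b::euclidean_space" and F :: "real \<Rightarrow> 'a measure"
  assumes T: "0 < T" and sub: "\<And>t. 0 \<le> t \<Longrightarrow> subalgebra M (F t)"
    and mono: "\<And>s t. 0 \<le> s \<Longrightarrow> s \<le> t \<Longrightarrow> sets (F s) \<subseteq> sets (F t)"
    and g [measurable]: "g \<in> borel_measurable (strip 0 T M)" and fin: "msq (strip 0 T M) g < \<infinity>"
    and adapted: "AE t in restrict_space lborel {0..T}. (\<lambda>w. g (t, w)) \<in> borel_measurable (F t)"
    and e: "0 < e"
  shows "\<exists>n>0. \<exists>\<eta>. (\<forall>i. \<eta> i \<in> borel_measurable (F (node 0 T n i))) \<and> (\<exists>K. \<forall>i w. norm (\<eta> i w) \<le> K) \<and>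
    msq (strip 0 T M) (\<lambda>p. g p - \<eta> (cell 0 T n (fst p)) (snd p)) \<le> ennreal e"
proof -
  let ?L = "restrict_space lborel {0..T}"
  interpret L: finite_measure ?L by (rule finite_measure_time)
  from step_approx_L2[OF T g fin] e have
    "\<forall>\<^sub>F n in sequentially. \<exists>\<zeta>. (\<forall>i. \<zeta> i \<in> borel_measurable M) \<and>
     (\<exists>K. \<forall>i. \<forall>w\<in>space M. norm (\<zeta> i w) \<le> K) \<and>
     msq (strip 0 T M) (\<lambda>p. g p - \<zeta> (cell 0 T n (fst p)) (snd p)) \<le> ennreal (e / 4)"
    unfolding step_approx_def by simp
  from eventually_happens'[OF sequentially_bot eventually_conj[OF this eventually_gt_at_top[of 0]]]
  obtain n0 \<zeta> K where n0: "0 < n0" and 1: "\<forall>i. \<zeta> i \<in> borel_measurable M"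
     and 2: "\<forall>i. \<forall>w\<in>space M. norm (\<zeta> i w) \<le> K"
     and \<zeta>: "msq (strip 0 T M) (\<lambda>p. g p - \<zeta> (cell 0 T n0 (fst p)) (snd p)) \<le> ennreal (e / 4)"
    by (elim exE conjE) (rule that)
  have \<zeta>m: "\<zeta> i \<in> borel_measurable M" for i using 1 by simp
  have K: "norm (\<zeta> i w) \<le> K" if "w \<in> space M" for i w using 2 that by simp
  have K0: "0 \<le> K" using K[of _ 0] not_empty by (meson all_not_in_conv norm_ge_zero order_trans)
  define C where "C = (real DIM('b) * K)\<^sup>2"
  \<comment> \<open>Each coarse cell is cut into \<open>m\<close> subcells. The increments of the
    projections will cost at most \<open>T * C / m\<close>, which this choice brings below
    \<open>e / 4\<close>.\<close>
  obtain m :: nat where m: "4 * T * C / e < real m" using reals_Archimedean2 by blast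
  have m0: "0 < m"
  proof -
    have "0 \<le> 4 * T * C / e" using T e by (simp add: C_def)
    then have "0 < real m" using m by linarith
    then show ?thesis by simp
  qed
  define n where "n = n0 * m"
  have n: "0 < n" using n0 m0 by (simp add: n_def)
  let ?c = "cell 0 T n" and ?N = "node 0 T n"
  define \<eta> where "\<eta> i = cexp (F (?N i)) K (\<zeta> (i div m))" for i
  define H where "H j t = (\<integral>w. (norm (cexp (F t) K (\<zeta> j) w))\<^sup>2 \<partial>M)" for j t
  define D where "D i = H (i div m) (?N (Suc i)) - H (i div m) (?N i)" for i
  have N0: "0 \<le> ?N i" for i using T by (simp add: node_ge)
  have NN: "?N i \<le> ?N (Suc i)" for i using T by (intro node_mono) auto
  have Hmono: "H j s \<le> H j t" if "0 \<le> s" "s \<le> t" for j s t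
    unfolding H_def using that by (intro cexp_increment(2) sub mono \<zeta>m K) auto
  have H0: "0 \<le> H j t" for j t unfolding H_def by simp
  have HC: "H j t \<le> C" if "0 \<le> t" for j t
  proof -
    have "(norm (cexp (F t) K (\<zeta> j) w))\<^sup>2 \<le> C" for w
      unfolding C_def by (intro power_mono norm_cexp_le K0) auto
    then have "H j t \<le> (\<integral>w. C \<partial>M)"
      unfolding H_def by (intro integral_mono') (auto simp: C_def)
    then show ?thesis by (simp add: prob_space)
  qed
  have D0: "0 \<le> D i" for i
    unfolding D_def using Hmono[OF N0 NN] by simp
  have \<eta>F: "\<eta> i \<in> borel_measurable (F (?N i))" for i
    unfolding \<eta>_def by (rule cexp_measurable)
  have \<eta>m: "\<eta> i \<in> borel_measurable M" for i
    by (rule measurable_from_subalg[OF sub[OF N0] \<eta>F])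
  have [measurable]: "(\<lambda>p. \<eta> (?c (fst p)) (snd p)) \<in> borel_measurable (strip 0 T M)"
    "(\<lambda>p. \<zeta> (cell 0 T n0 (fst p)) (snd p)) \<in> borel_measurable (strip 0 T M)"
    using \<eta>m \<zeta>m by (auto intro: step_measurable)
  have fin_t: "AE t in ?L. msq M (\<lambda>w. g (t, w)) \<noteq> \<infinity>"
    using fin msq_strip_time[OF g] by (intro nn_integral_PInf_AE) auto
  \<comment> \<open>Time \<open>0\<close> lies in cell \<open>0\<close> but not strictly to the
    right of its left end point; as a null set it is discarded.\<close>
  have t0: "AE t in ?L. t \<noteq> 0"
    by (subst AE_restrict_space_iff) (auto intro: AE_mp[OF AE_lborel_singleton[of 0]])
  let ?R = "\<lambda>t. 2 * msq M (\<lambda>w. g (t, w) - \<zeta> (cell 0 T n0 t) w) + 2 * ennreal (D (?c t))"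
  have AE: "AE t in ?L. msq M (\<lambda>w. g (t, w) - \<eta> (?c t) w) \<le> ?R t"
    using fin_t t0 adapted AE_space
  proof eventually_elim
    case (elim t)
    then have t: "0 < t" "t \<le> T" by (auto simp: space_restrict_space)
    have gm: "(\<lambda>w. g (t, w)) \<in> borel_measurable M"
      using t by (intro measurable_strip_section[OF g]) auto
    define i where "i = ?c t"
    have i: "?N i < t" "t \<le> ?N (Suc i)"
      using cell_eq_iff[of 0 T n t i] T n t by (auto simp: i_def)
    have j: "cell 0 T n0 t = i div m"
      unfolding i_def n_def using T n0 m0 t by (intro cell_refine) auto
    let ?z = "\<zeta> (i div m)"
    have cm: "cexp (F s) K ?z \<in> borel_measurable M" if "0 \<le> s" for s
      by (rule measurable_from_subalg[OF sub[OF that] cexp_measurable])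
    have "msq M (\<lambda>w. g (t, w) - \<eta> i w) \<le> 2 * msq M (\<lambda>w. g (t, w) - cexp (F t) K ?z w)
        + 2 * msq M (\<lambda>w. cexp (F t) K ?z w - \<eta> i w)"
      using t by (intro msq_triangle gm \<eta>m cm) auto
    also have "msq M (\<lambda>w. g (t, w) - cexp (F t) K ?z w) \<le> msq M (\<lambda>w. g (t, w) - ?z w)"
      using t elim by (intro cexp_contraction sub \<zeta>m K) (auto simp: less_top)
    also have "msq M (\<lambda>w. cexp (F t) K ?z w - \<eta> i w) = ennreal (H (i div m) t - H (i div m) (?N i))"
      unfolding \<eta>_def H_def using i t N0 by (intro cexp_increment sub \<zeta>m K mono) auto
    also have "\<dots> \<le> ennreal (D i)"
      unfolding D_def using Hmono[of t "?N (Suc i)"] i t by (intro ennreal_leI) auto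
    finally show ?case by (simp add: i_def[symmetric] j add_mono mult_left_mono)
  qed
  have [measurable]: "(\<lambda>t. ennreal (D (?c t))) \<in> borel_measurable ?L"
    by (rule measurable_compose[where g="\<lambda>i. ennreal (D i)" and N="count_space UNIV"])
      (simp_all add: measurable_restrict_space1)
  have "msq (strip 0 T M) (\<lambda>p. g p - \<eta> (?c (fst p)) (snd p)) = (\<integral>\<^sup>+t. msq M (\<lambda>w. g (t, w) - \<eta> (?c t) w) \<partial>?L)"
    by (subst msq_strip_time) auto
  also have "\<dots> \<le> (\<integral>\<^sup>+t. ?R t \<partial>?L)"
    using AE by (rule nn_integral_mono_AE)
  also have "\<dots> = 2 * (\<integral>\<^sup>+t. msq M (\<lambda>w. g (t, w) - \<zeta> (cell 0 T n0 t) w) \<partial>?L) + 2 * (\<integral>\<^sup>+t. ennreal (D (?c t)) \<partial>?L)"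
    using msq_strip_time(2)[of "\<lambda>p. g p - \<zeta> (cell 0 T n0 (fst p)) (snd p)" 0 T]
    by (simp add: nn_integral_add nn_integral_cmult)
  also have "(\<integral>\<^sup>+t. msq M (\<lambda>w. g (t, w) - \<zeta> (cell 0 T n0 t) w) \<partial>?L) \<le> ennreal (e / 4)"
    using \<zeta> by (subst (asm) msq_strip_time) auto
  also have "(\<integral>\<^sup>+t. ennreal (D (?c t)) \<partial>?L) \<le> ennreal (T * C / real m)"
  proof -
    have "(\<integral>\<^sup>+t. ennreal (D (?c t)) \<partial>?L) \<le> (\<integral>\<^sup>+t. (\<Sum>i<n. ennreal (D i) * indicator {?N i<..?N (Suc i)} t) \<partial>lborel)"
    proof -
      have "(\<integral>\<^sup>+t. ennreal (D (?c t)) \<partial>?L) = (\<integral>\<^sup>+t. ennreal (D (?c t)) * indicator {0..T} t \<partial>lborel)"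
        by (simp add: nn_integral_restrict_space)
      also have "\<dots> \<le> (\<integral>\<^sup>+t. (\<Sum>i<n. ennreal (D i) * indicator {?N i<..?N (Suc i)} t) \<partial>lborel)"
      proof (intro nn_integral_mono_AE, use AE_lborel_singleton[of "0::real"] in eventually_elim)
        case (elim t)
        show ?case
        proof (cases "t \<in> {0..T}")
          case True
          then have t: "0 < t" "t \<le> T" using elim by auto
          have "ennreal (D (?c t)) = ennreal (D (?c t)) * indicator {?N (?c t)<..?N (Suc (?c t))} t"
            using cell_eq_iff[of 0 T n t "?c t"] T n t by auto
          also have "\<dots> \<le> (\<Sum>i<n. ennreal (D i) * indicator {?N i<..?N (Suc i)} t)"
            using cell_less[OF T n t(2)] by (intro member_le_sum) auto
          finally show ?thesis using True by simp
        qed simp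
      qed
      finally show ?thesis .
    qed
    also have "\<dots> = (\<Sum>i<n. ennreal (D i) * emeasure lborel {?N i<..?N (Suc i)})"
      by (subst nn_integral_sum) (auto simp: nn_integral_cmult_indicator)
    also have "\<dots> = (\<Sum>i<n. ennreal (D i * (T / real n)))"
      using NN D0 T by (intro sum.cong) (auto simp: node_Suc ennreal_mult'[symmetric])
    also have "\<dots> = ennreal ((\<Sum>i<n. D i) * (T / real n))"
      unfolding sum_distrib_right using D0 T by (intro sum_ennreal) simp
    also have "\<dots> \<le> ennreal (T * C / real m)"
    proof (intro ennreal_leI)
      \<comment> \<open>The \<open>m\<close> increments inside one coarse cell belong to the same
        \<open>\<zeta> j\<close>, so they telescope to at most \<open>C\<close>. There are
        \<open>n0\<close> coarse cells, and each fine cell has length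
        \<open>T / (n0 * m)\<close>.\<close>
      have "(\<Sum>i<n. D i) = (\<Sum>j<n0. sum D {j * m..<j * m + m})"
        unfolding n_def by (rule sum.nat_group[symmetric])
      also have "\<dots> \<le> (\<Sum>j<n0. C)"
      proof (intro sum_mono)
        fix j
        have "sum D {j * m..<j * m + m} = (\<Sum>k<m. D (k + j * m))"
          by (simp add: sum.shift_bounds_nat_ivl[of D 0 "j * m" m, simplified] atLeast0LessThan add.commute)
        also have "\<dots> = (\<Sum>k<m. H j (?N (Suc k + j * m)) - H j (?N (k + j * m)))"
          by (intro sum.cong) (auto simp: D_def)
        also have "\<dots> = H j (?N (m + j * m)) - H j (?N (0 + j * m))"
          by (rule sum_lessThan_telescope)
        also have "\<dots> \<le> C" using HC[OF N0, of j "m + j * m"] H0[of j "?N (0 + j * m)"] by simp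
        finally show "sum D {j * m..<j * m + m} \<le> C" .
      qed
      finally have "(\<Sum>i<n. D i) \<le> real n0 * C" by simp
      then have "(\<Sum>i<n. D i) * (T / real n) \<le> real n0 * C * (T / real n)"
        using T by (intro mult_right_mono) auto
      also have "\<dots> = T * C / real m" using n0 by (simp add: n_def)
      finally show "(\<Sum>i<n. D i) * (T / real n) \<le> T * C / real m" .
    qed
    finally show ?thesis .
  qed
  also have "\<dots> \<le> ennreal (e / 4)"
    using m m0 e by (intro ennreal_leI) (simp add: field_simps)
  also have "2 * ennreal (e / 4) + 2 * ennreal (e / 4) = ennreal e"
    using e by (simp add: numeral_mult_ennreal ennreal_plus[symmetric] del: ennreal_plus)
  finally have *: "msq (strip 0 T M) (\<lambda>p. g p - \<eta> (?c (fst p)) (snd p)) \<le> ennreal e"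
    by (simp add: add_mono mult_left_mono)
  have "\<forall>i w. norm (\<eta> i w) \<le> real DIM('b) * K"
    unfolding \<eta>_def by (auto intro: norm_cexp_le K0)
  then show ?thesis using n \<eta>F * by blast
qed

end

section \<open>Brownian increments\<close>

text \<open>Lebesgue measure on vectors is the image of the product measure over the standard basis
  vectors, so this is Fubini's theorem after the index is moved from coordinates to basis vectors by
  \<open>axis_index\<close>. It reduces Gaussian moments to one dimension.\<close>

lemma has_bochner_integral_prod_vec:
  fixes g :: "'d::finite \<Rightarrow> real \<Rightarrow> real"
  assumes g: "\<And>i. has_bochner_integral lborel (g i) (c i)"
  shows "has_bochner_integral lborel (\<lambda>x::real^'d. \<Prod>i\<in>UNIV. g i (x $ i)) (\<Prod>i\<in>UNIV. c i)"
proof -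
  interpret product_sigma_finite "\<lambda>b::real^'d. lborel :: real measure" by standard
  have gI: "integrable lborel (g i)" and gc: "integral\<^sup>L lborel (g i) = c i" for i
    using g[of i] by (auto simp: has_bochner_integral_iff)
  have gm [measurable]: "g i \<in> borel_measurable borel" for i
    using borel_measurable_integrable[OF gI] by simp
  define h where "h b = g (axis_index b)" for b :: "real^'d"
  have re: "(\<Prod>i\<in>UNIV. f i) = (\<Prod>b\<in>(Basis::(real^'d) set). f (axis_index b))" for f :: "'d \<Rightarrow> real"
  proof -
    have "inj (\<lambda>i. axis i (1::real) :: real^'d)" by (auto simp: inj_on_def axis_eq_axis)
    moreover have "(Basis::(real^'d) set) = range (\<lambda>i. axis i 1)" by (auto simp: Basis_vec_def)
    moreover have "inj (\<lambda>i. axis i (1::real) :: real^'d) \<Longrightarrow>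
        (\<Prod>b\<in>range (\<lambda>i. axis i (1::real) :: real^'d). f (axis_index b)) = (\<Prod>i\<in>UNIV. f i)"
      by (subst prod.reindex) auto
    ultimately show ?thesis by simp
  qed
  have nth: "x $ axis_index b = x \<bullet> b" if "b \<in> Basis" for x b :: "real^'d"
    using that by (auto simp: Basis_vec_def inner_axis axis_index_axis)
  have eq: "(\<Prod>i\<in>UNIV. g i (x $ i)) = (\<Prod>b\<in>Basis. h b (x \<bullet> b))" for x :: "real^'d"
    unfolding re by (intro prod.cong) (auto simp: h_def nth)
  have inn: "(\<Sum>b\<in>Basis. f b *\<^sub>R b) \<bullet> b' = f b'" if "b' \<in> Basis" for b' :: "real^'d" and f
    using that by (simp add: inner_sum_left inner_Basis if_distrib cong: if_cong)
  have eq2: "(\<Prod>i\<in>UNIV. g i ((\<Sum>b\<in>Basis. f b *\<^sub>R b) $ i)) = (\<Prod>b\<in>Basis. h b (f b))" for f :: "real^'d \<Rightarrow> real"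
    unfolding eq by (intro prod.cong) (auto simp: inn)
  have I: "integrable (\<Pi>\<^sub>M b\<in>(Basis::(real^'d) set). lborel) (\<lambda>f. \<Prod>b\<in>Basis. h b (f b))"
    by (intro product_integrable_prod) (auto simp: h_def gI)
  have [measurable]: "(\<lambda>x::real^'d. \<Prod>i\<in>UNIV. g i (x $ i)) \<in> borel_measurable borel" by measurable
  have [measurable]: "(\<lambda>f. \<Sum>b\<in>Basis. f b *\<^sub>R b) \<in> (\<Pi>\<^sub>M b\<in>(Basis::(real^'d) set). lborel) \<rightarrow>\<^sub>M borel" by measurable
  have "integrable lborel (\<lambda>x::real^'d. \<Prod>i\<in>UNIV. g i (x $ i))"
    unfolding lborel_eq[where 'a="real^'d"] by (subst integrable_distr_eq) (simp_all only: eq2 I, measurable)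
  moreover have "(\<integral>x. (\<Prod>i\<in>UNIV. g i (x $ i)) \<partial>(lborel :: (real^'d) measure)) = (\<Prod>b\<in>(Basis::(real^'d) set). integral\<^sup>L lborel (h b))"
    unfolding lborel_eq[where 'a="real^'d"]
    by (subst integral_distr, measurable) (simp only: eq2, subst product_integral_prod, auto simp: h_def gI)
  moreover have "(\<Prod>b\<in>(Basis::(real^'d) set). integral\<^sup>L lborel (h b)) = (\<Prod>i\<in>UNIV. c i)"
    unfolding re by (simp add: h_def gc)
  ultimately show ?thesis by (simp add: has_bochner_integral_iff)
qed

lemma sets_Collect_in:
  assumes "g \<in> M \<rightarrow>\<^sub>M N" "A \<in> sets N"
  shows "{x \<in> space M. g x \<in> A} \<in> sets M"
proof -
  have "{x \<in> space M. g x \<in> A} = g -` A \<inter> space M" by auto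
  then show ?thesis using measurable_sets[OF assms] by simp
qed

context brownian_basis
begin

section \<open>The completed filtration and the independence of increments from the past\<close>

abbreviation F :: "real \<Rightarrow> 'w measure" where "F \<equiv> brownian_filtration M B F0"

lemma B_measurable: "0 \<le> t \<Longrightarrow> B t \<in> borel_measurable M"
  using brownian by (simp add: brownian_motion_def)

lemma generated_by_subset: "J \<subseteq> {0..} \<Longrightarrow> generated_by M B J \<subseteq> sets M"
  unfolding generated_by_def by (auto intro!: measurable_sets[OF B_measurable])

lemma filtration_gen_subset: "sets F0 \<union> null_sets M \<union> generated_by M B {0..max 0 t} \<subseteq> sets M"
  using subalgebra_F0 generated_by_subset[of "{0..max 0 t}"] by (auto simp: subalgebra_def)

lemma space_F [simp]: "space (F t) = space M"
  by (simp add: brownian_filtration_def space_measure_of_conv)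

lemma sets_F: "sets (F t) = sigma_sets (space M) (sets F0 \<union> null_sets M \<union> generated_by M B {0..max 0 t})"
  unfolding brownian_filtration_def
  by (intro sets_measure_of order_trans[OF filtration_gen_subset sets.space_closed])

lemma subalgebra_F: "subalgebra M (F t)"
  unfolding subalgebra_def using sets.sigma_sets_subset[OF filtration_gen_subset[of t]]
  by (simp add: sets_F)

lemma sets_F_mono: "s \<le> t \<Longrightarrow> sets (F s) \<subseteq> sets (F t)"
  unfolding sets_F generated_by_def by (intro sigma_sets_mono' Un_mono UN_mono order_refl) auto

lemma F_measurable_mono: "f \<in> borel_measurable (F s) \<Longrightarrow> s \<le> t \<Longrightarrow> f \<in> borel_measurable (F t)"
  by (rule measurable_from_subalg[of "F t" "F s"]) (simp_all add: subalgebra_def sets_F_mono)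

lemma F_measurable_M: "f \<in> borel_measurable (F t) \<Longrightarrow> f \<in> borel_measurable M"
  by (rule measurable_from_subalg[OF subalgebra_F])

lemma B_F_measurable:
  assumes "0 \<le> s" "s \<le> t"
  shows "B s \<in> borel_measurable (F t)"
proof (rule measurableI)
  fix A :: "(real^'d) set" assume "A \<in> sets borel"
  then have "B s -` A \<inter> space M \<in> generated_by M B {0..max 0 t}"
    unfolding generated_by_def using assms by (intro UN_I[of s]) auto
  then show "B s -` A \<inter> space (F t) \<in> sets (F t)" unfolding sets_F by auto
qed simp

lemma null_sets_F: "N \<in> null_sets M \<Longrightarrow> N \<in> sets (F t)"
  unfolding sets_F by auto

text \<open>\<open>M\<close> is complete and every \<open>F t\<close> contains all null sets, so the
  set on which \<open>g\<close> differs from \<open>f\<close> contributes only null events.\<close>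

lemma F_measurable_cong_AE:
  fixes f g :: "'w \<Rightarrow> 'b::topological_space"
  assumes f: "f \<in> borel_measurable (F t)" and AE: "AE w in M. f w = g w"
  shows "g \<in> borel_measurable (F t)"
proof (rule measurableI)
  fix A :: "'b set" assume A: "A \<in> sets borel"
  obtain N where N: "N \<in> null_sets M" "{w \<in> space M. f w \<noteq> g w} \<subseteq> N"
    using AE by (auto simp: eventually_ae_filter)
  have "g -` A \<inter> N \<inter> space M \<in> null_sets M"
    using complete2[of "g -` A \<inter> N \<inter> space M" N] N(1) by auto
  then have "g -` A \<inter> N \<inter> space M \<in> sets (F t)" by (rule null_sets_F)
  moreover have "f -` A \<inter> space (F t) - N \<in> sets (F t)"
    using measurable_sets[OF f A] null_sets_F[OF N(1)] by auto
  moreover have "g -` A \<inter> space (F t) = (f -` A \<inter> space (F t) - N) \<union> (g -` A \<inter> N \<inter> space M)"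
    using N(2) by auto
  ultimately show "g -` A \<inter> space (F t) \<in> sets (F t)" by auto
qed simp

text \<open>A subsequence converges almost everywhere; its pointwise limit is measurable for
  \<open>F t\<close> and is then changed on a null set.\<close>

lemma F_measurable_limit:
  fixes f :: "nat \<Rightarrow> 'w \<Rightarrow> 'b::euclidean_space"
  assumes f: "\<And>n. f n \<in> borel_measurable (F t)" and g: "g \<in> borel_measurable M"
    and lim: "(\<lambda>n. msq M (\<lambda>w. f n w - g w)) \<longlonglongrightarrow> 0"
  shows "g \<in> borel_measurable (F t)"
proof -
  obtain r where r: "AE w in M. (\<lambda>n. f (r n) w) \<longlonglongrightarrow> g w"
    using msq_tendsto_AE_subseq[OF F_measurable_M[OF f] g lim] by auto
  have "(\<lambda>w. lim (\<lambda>n. f (r n) w)) \<in> borel_measurable (F t)"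
    using f by (intro borel_measurable_lim_metric) auto
  then show ?thesis
    by (rule F_measurable_cong_AE) (use r in \<open>auto elim!: eventually_mono intro: limI\<close>)
qed

text \<open>Finite-dimensional events of the past: an intersection-stable family that contains the
  generators of the past of \<open>B\<close>, and for which independence only involves finitely many
  increments.\<close>

definition cylinders :: "real \<Rightarrow> 'w set set" where
  "cylinders s = {{w\<in>space M. \<forall>r\<in>J. B r w \<in> A r} | J A. finite J \<and> J \<subseteq> {0..s} \<and> (\<forall>r. A r \<in> sets borel)}"

text \<open>The values of \<open>B\<close> at the times in \<open>J\<close> are partial sums of
  increments along a grid that continues to \<open>s\<close> and then to \<open>t\<close>. The
  cylinder therefore depends on the first \<open>n\<close> increments, and these are independent of
  the last one.\<close>

lemma cylinder_indep:
  assumes st: "0 \<le> s" "s < t" and G: "G \<in> cylinders s" and D: "D \<in> sets borel"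
  shows "G \<in> events"
    and "prob (G \<inter> ((\<lambda>w. B t w - B s w) -` D \<inter> space M)) = prob G * prob ((\<lambda>w. B t w - B s w) -` D \<inter> space M)"
proof -
  obtain J A where J: "finite J" "J \<subseteq> {0..s}" and A: "\<And>r. A r \<in> sets borel"
    and G: "G = {w\<in>space M. \<forall>r\<in>J. B r w \<in> A r}"
    using G by (auto simp: cylinders_def)
  have [measurable]: "B r \<in> borel_measurable M" if "r \<in> J" for r
    using J(2) that by (intro B_measurable) auto
  show Ge: "G \<in> events"
    unfolding G using J A by (intro sets.sets_Collect_finite_All sets_Collect_in[where N=borel]) auto
  define l where "l = sorted_list_of_set J"
  define n where "n = length l"
  have l: "set l = J" "sorted l" using J by (auto simp: l_def)
  define \<tau> where "\<tau> i = (if i = 0 then 0 else if i \<le> n then l ! (i - 1) else if i = Suc n then s else t)" for i :: nat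
  have lJ: "l ! i \<in> J" if "i < n" for i using that l unfolding n_def by (metis nth_mem)
  have "mono \<tau>"
  proof (rule monoI)
    fix i j :: nat assume "i \<le> j"
    show "\<tau> i \<le> \<tau> j"
    proof (cases "i = 0")
      case True
      have "0 \<le> \<tau> j" using lJ[of "j - 1"] J st by (fastforce simp: \<tau>_def)
      then show ?thesis using True by (simp add: \<tau>_def)
    next
      case False
      show ?thesis
      proof (cases "j \<le> n")
        case True
        then have "l ! (i - 1) \<le> l ! (j - 1)"
          using False \<open>i \<le> j\<close> l(2) by (intro sorted_nth_mono) (auto simp: n_def)
        then show ?thesis using True False \<open>i \<le> j\<close> by (simp add: \<tau>_def)
      next
        case False
        then have "\<tau> j = s \<or> \<tau> j = t" "j = Suc n \<longrightarrow> \<tau> j = s" "j > Suc n \<longrightarrow> \<tau> j = t" by (auto simp: \<tau>_def)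
        moreover have "l ! (i - 1) \<le> s" if "i \<le> n" using lJ[of "i - 1"] J that \<open>i \<noteq> 0\<close> by fastforce
        ultimately show ?thesis using False \<open>i \<le> j\<close> \<open>i \<noteq> 0\<close> st
          by (cases "i \<le> n"; cases "i = Suc n"; cases "j = Suc n") (auto simp: \<tau>_def)
      qed
    qed
  qed
  moreover have "\<tau> 0 = 0" by (simp add: \<tau>_def)
  ultimately have ind: "indep_vars (\<lambda>_. borel) (\<lambda>i w. B (\<tau> (Suc i)) w - B (\<tau> i) w) {..<n + 2}"
    using brownian unfolding brownian_motion_def by auto
  define X where "X i w = B (\<tau> (Suc i)) w - B (\<tau> i) w" for i w
  have iv: "indep_var (PiM {..<n} (\<lambda>_. borel)) (\<lambda>w. restrict (\<lambda>i. X i w) {..<n})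
     (PiM {Suc n} (\<lambda>_. borel)) (\<lambda>w. restrict (\<lambda>i. X i w) {Suc n})"
    using ind unfolding X_def by (intro indep_var_restrict) auto
  define S where "S = {f \<in> space (PiM {..<n} (\<lambda>_. borel :: (real^'d) measure)). \<forall>i<n. (\<Sum>k\<le>i. f k) \<in> A (l ! i)}"
  have S: "S \<in> sets (PiM {..<n} (\<lambda>_. borel))"
  proof -
    have "(\<lambda>f. \<Sum>k\<le>i. f k) \<in> borel_measurable (PiM {..<n} (\<lambda>_. borel :: (real^'d) measure))" if "i < n" for i
      using that by (intro borel_measurable_sum measurable_component_singleton) auto
    then have "{f \<in> space (PiM {..<n} (\<lambda>_. borel :: (real^'d) measure)). \<forall>i\<in>{..<n}. (\<Sum>k\<le>i. f k) \<in> A (l ! i)} \<in> sets (PiM {..<n} (\<lambda>_. borel))"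
      using A by (intro sets.sets_Collect_finite_All sets_Collect_in[where N=borel]) auto
    then show ?thesis unfolding S_def by (simp only: Ball_def lessThan_iff)
  qed
  have Xm: "(\<lambda>w. restrict (\<lambda>i. X i w) {..<n}) \<in> M \<rightarrow>\<^sub>M PiM {..<n} (\<lambda>_. borel)"
    using iv by (rule indep_var_rv1)
  define G' where "G' = (\<lambda>w. restrict (\<lambda>i. X i w) {..<n}) -` S \<inter> space M"
  have G': "G' \<in> events" unfolding G'_def by (rule measurable_sets[OF Xm S])
  have "AE w in M. B 0 w = 0" using brownian by (simp add: brownian_motion_def)
  \<comment> \<open>The partial sums start at \<open>B 0\<close>, which vanishes only almost surely,
    so \<open>G\<close> and \<open>G'\<close> agree up to a null set.\<close>
  then have AE: "AE w in M. w \<in> G \<longleftrightarrow> w \<in> G'"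
    using AE_space
  proof eventually_elim
    case (elim w)
    have sum: "(\<Sum>k\<le>i. X k w) = B (l ! i) w" if "i < n" for i
    proof -
      have "(\<Sum>k\<le>i. X k w) = B (\<tau> (Suc i)) w - B (\<tau> 0) w"
        unfolding X_def lessThan_Suc_atMost[symmetric] by (rule sum_lessThan_telescope)
      then show ?thesis using elim that by (simp add: \<tau>_def)
    qed
    have "w \<in> G' \<longleftrightarrow> (\<forall>i<n. (\<Sum>k\<le>i. restrict (\<lambda>i. X i w) {..<n} k) \<in> A (l ! i))"
      using elim measurable_space[OF Xm] by (auto simp: G'_def S_def)
    also have "\<dots> \<longleftrightarrow> (\<forall>i<n. (\<Sum>k\<le>i. X k w) \<in> A (l ! i))"
      by (intro all_cong) (simp add: restrict_def)
    also have "\<dots> \<longleftrightarrow> (\<forall>i<n. B (l ! i) w \<in> A (l ! i))" using sum by auto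
    also have "\<dots> \<longleftrightarrow> (\<forall>r\<in>J. B r w \<in> A r)"
      unfolding l(1)[symmetric] by (auto simp: all_set_conv_all_nth n_def)
    finally show ?case using elim by (simp add: G)
  qed
  let ?H = "(\<lambda>w. B t w - B s w) -` D \<inter> space M"
  define S2 where "S2 = {f \<in> space (PiM {Suc n} (\<lambda>_. borel :: (real^'d) measure)). f (Suc n) \<in> D}"
  have S2: "S2 \<in> sets (PiM {Suc n} (\<lambda>_. borel))"
    unfolding S2_def using D by (intro sets_Collect_in[where N=borel] measurable_component_singleton) auto
  have H_eq: "?H = (\<lambda>w. restrict (\<lambda>i. X i w) {Suc n}) -` S2 \<inter> space M"
    using measurable_space[OF indep_var_rv2[OF iv]] by (auto simp: S2_def X_def \<tau>_def)
  have H: "?H \<in> events" unfolding H_eq by (rule measurable_sets[OF indep_var_rv2[OF iv] S2])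
  have "prob (G \<inter> ?H) = prob (G' \<inter> ?H)"
    using AE Ge G' H by (intro measure_eq_AE) auto
  also have "\<dots> = prob G' * prob ?H"
  proof -
    have "G' \<inter> ?H = (\<lambda>w. (restrict (\<lambda>i. X i w) {..<n}, restrict (\<lambda>i. X i w) {Suc n})) -` (S \<times> S2) \<inter> space M"
      unfolding H_eq by (auto simp: G'_def)
    then show ?thesis using indep_varD[OF iv S S2] by (simp add: G'_def H_eq)
  qed
  also have "prob G' = prob G" using AE Ge G' by (intro measure_eq_AE) auto
  finally show "prob (G \<inter> ?H) = prob G * prob ?H" .
qed

definition increment_algebra :: "real \<Rightarrow> real \<Rightarrow> 'w set set" where
  "increment_algebra s t = {(\<lambda>w. B t w - B s w) -` D \<inter> space M | D. D \<in> sets borel}"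

lemma Int_stable_increment: "Int_stable (increment_algebra s t)"
proof (rule Int_stableI)
  fix a b assume "a \<in> increment_algebra s t" "b \<in> increment_algebra s t"
  then obtain D D' where *: "D \<in> sets borel" "D' \<in> sets borel"
    "a = (\<lambda>w. B t w - B s w) -` D \<inter> space M" "b = (\<lambda>w. B t w - B s w) -` D' \<inter> space M"
    by (auto simp: increment_algebra_def)
  then show "a \<inter> b \<in> increment_algebra s t"
    unfolding increment_algebra_def by (intro CollectI exI[of _ "D \<inter> D'"]) auto
qed

lemma Int_stable_cylinders: "Int_stable (cylinders s)"
proof (rule Int_stableI)
  fix a b assume "a \<in> cylinders s" "b \<in> cylinders s"
  then obtain J A J' A' where *: "finite J" "J \<subseteq> {0..s}" "\<And>r. A r \<in> sets borel"
    "finite J'" "J' \<subseteq> {0..s}" "\<And>r. A' r \<in> sets borel"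
    "a = {w\<in>space M. \<forall>r\<in>J. B r w \<in> A r}" "b = {w\<in>space M. \<forall>r\<in>J'. B r w \<in> A' r}"
    by (auto simp: cylinders_def)
  let ?A = "\<lambda>r. (if r \<in> J then A r else UNIV) \<inter> (if r \<in> J' then A' r else UNIV)"
  have "a \<inter> b = {w\<in>space M. \<forall>r\<in>J \<union> J'. B r w \<in> ?A r}" using * by auto
  then show "a \<inter> b \<in> cylinders s"
    unfolding cylinders_def using * by (intro CollectI exI[of _ "J \<union> J'"] exI[of _ ?A]) auto
qed

lemma indep_generated_increment:
  assumes st: "0 \<le> s" "s < t"
  shows "indep_set (sigma_sets (space M) (generated_by M B {0..s})) (sigma_sets (space M) (increment_algebra s t))"
proof -
  have [measurable]: "(\<lambda>w. B t w - B s w) \<in> borel_measurable M"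
    using st by (intro borel_measurable_diff B_measurable) auto
  have "indep_set (cylinders s) (increment_algebra s t)"
    using cylinder_indep[OF st] by (intro indep_setI) (auto simp: increment_algebra_def)
  then have "indep_set (sigma_sets (space M) (cylinders s)) (sigma_sets (space M) (increment_algebra s t))"
    by (intro indep_set_sigma_sets Int_stable_cylinders Int_stable_increment)
  moreover have "sigma_sets (space M) (generated_by M B {0..s}) \<subseteq> sigma_sets (space M) (cylinders s)"
  proof (intro sigma_sets_mono')
    show "generated_by M B {0..s} \<subseteq> cylinders s"
    proof
      fix x assume "x \<in> generated_by M B {0..s}"
      then obtain r A where "r \<in> {0..s}" "A \<in> sets borel" "x = B r -` A \<inter> space M"
        by (auto simp: generated_by_def)
      then show "x \<in> cylinders s"
        unfolding cylinders_def by (intro CollectI exI[of _ "{r}"] exI[of _ "\<lambda>_. A"]) auto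
    qed
  qed
  ultimately show ?thesis unfolding indep_sets2_eq by blast
qed

text \<open>The events \<open>E \<inter> G\<close> with \<open>E\<close> in \<open>F0\<close> and
  \<open>G\<close> in the past of \<open>B\<close> are an intersection-stable generator. For them
  the probability factorises by applying the independence of \<open>F0\<close> from the whole of
  \<open>B\<close> twice, once to \<open>G\<close> together with the increment and once to
  \<open>G\<close> alone.\<close>

lemma indep_F_increment_aux:
  assumes st: "0 \<le> s" "s < t"
  shows "indep_set (sigma_sets (space M) (sets F0 \<union> generated_by M B {0..s})) (sigma_sets (space M) (increment_algebra s t))"
proof -
  let ?G = "sigma_sets (space M) (generated_by M B {0..s})" and ?H = "sigma_sets (space M) (increment_algebra s t)"
  let ?P = "{E \<inter> G | E G. E \<in> sets F0 \<and> G \<in> ?G}"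
  have F0: "space F0 = space M" "sets F0 \<subseteq> events" using subalgebra_F0 unfolding subalgebra_def by blast+
  have Gev: "?G \<subseteq> events" "?H \<subseteq> events"
    using indep_setD_ev1[OF indep_generated_increment[OF st]] indep_setD_ev2[OF indep_generated_increment[OF st]]
    by simp_all
  have Gpow: "generated_by M B {0..s} \<subseteq> Pow (space M)" "generated_by M B {0..} \<subseteq> Pow (space M)"
    unfolding generated_by_def by blast+
  interpret G: sigma_algebra "space M" ?G by (rule sigma_algebra_sigma_sets) (rule Gpow)
  interpret A: sigma_algebra "space M" "sigma_sets (space M) (generated_by M B {0..})" by (rule sigma_algebra_sigma_sets) (rule Gpow)
  have GA: "?G \<subseteq> sigma_sets (space M) (generated_by M B {0..})"
    unfolding generated_by_def by (intro sigma_sets_mono' UN_mono order_refl) auto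
  have HA: "?H \<subseteq> sigma_sets (space M) (generated_by M B {0..})"
  proof -
    let ?A = "sigma (space M) (generated_by M B {0..})"
    have sA: "sets ?A = sigma_sets (space M) (generated_by M B {0..})" by (intro sets_measure_of Gpow)
    have spA: "space ?A = space M" by (rule space_measure_of_conv)
    have [measurable]: "B r \<in> borel_measurable ?A" if "0 \<le> r" for r
    proof (rule measurableI)
      fix D :: "(real^'d) set" assume "D \<in> sets borel"
      then have "B r -` D \<inter> space M \<in> generated_by M B {0..}"
        unfolding generated_by_def using that by (intro UN_I[of r]) auto
      then show "B r -` D \<inter> space ?A \<in> sets ?A" unfolding sA spA by (rule sigma_sets.Basic)
    qed (rule UNIV_I[of "_ :: real^'d", folded space_borel])
    have m: "(\<lambda>w. B t w - B s w) \<in> borel_measurable ?A" using st by (intro borel_measurable_diff) auto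
    have "increment_algebra s t \<subseteq> sets ?A"
      using measurable_sets[OF m] unfolding increment_algebra_def spA by blast
    then have "sigma_sets (space ?A) (increment_algebra s t) \<subseteq> sets ?A" by (rule sets.sigma_sets_subset)
    then show ?thesis unfolding sA spA .
  qed
  have "indep_set ?P ?H"
  proof (rule indep_setI)
    show "?P \<subseteq> events"
    proof
      fix x assume "x \<in> ?P"
      then obtain E G where "x = E \<inter> G" "E \<in> sets F0" "G \<in> ?G" by blast
      moreover have "E \<in> events" "G \<in> events"
        using \<open>E \<in> sets F0\<close> \<open>G \<in> ?G\<close> F0(2) Gev(1) by blast+
      ultimately show "x \<in> events" by simp
    qed
    fix a b assume "a \<in> ?P" and b: "b \<in> ?H"
    then obtain E G where a: "a = E \<inter> G" "E \<in> sets F0" "G \<in> ?G" by blast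
    have GA': "G \<in> sigma_sets (space M) (generated_by M B {0..})" using a(3) GA by blast
    have "b \<in> sigma_sets (space M) (generated_by M B {0..})" using b HA by blast
    then have Gb: "G \<inter> b \<in> sigma_sets (space M) (generated_by M B {0..})" by (rule A.Int[OF GA'])
    have "prob (a \<inter> b) = prob (E \<inter> (G \<inter> b))" by (simp add: a Int_assoc)
    also have "\<dots> = prob E * prob (G \<inter> b)"
      by (rule indep_setD[OF indep_F0 a(2) Gb])
    also have "prob (G \<inter> b) = prob G * prob b"
      by (intro indep_setD[OF indep_generated_increment[OF st]] a b)
    also have "prob E * (prob G * prob b) = prob (E \<inter> G) * prob b"
      by (simp add: indep_setD[OF indep_F0 a(2) GA'])
    finally show "prob (a \<inter> b) = prob a * prob b" by (simp add: a)
  qed (rule Gev)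
  moreover have "Int_stable ?P"
  proof (rule Int_stableI)
    fix a b assume "a \<in> ?P" "b \<in> ?P"
    then obtain E G E' G' where "a = E \<inter> G" "E \<in> sets F0" "G \<in> ?G" "b = E' \<inter> G'" "E' \<in> sets F0" "G' \<in> ?G" by blast
    then show "a \<inter> b \<in> ?P"
      by (intro CollectI exI[of _ "E \<inter> E'"] exI[of _ "G \<inter> G'"] conjI sets.Int G.Int) blast+
  qed
  moreover have "Int_stable ?H"
  proof (rule Int_stableI)
    interpret H: sigma_algebra "space M" ?H
      by (rule sigma_algebra_sigma_sets) (auto simp: increment_algebra_def)
    show "a \<inter> b \<in> ?H" if "a \<in> ?H" "b \<in> ?H" for a b using that by (rule H.Int)
  qed
  ultimately have "indep_set (sigma_sets (space M) ?P) (sigma_sets (space M) ?H)"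
    by (rule indep_set_sigma_sets)
  moreover have "sigma_sets (space M) (sets F0 \<union> generated_by M B {0..s}) \<subseteq> sigma_sets (space M) ?P"
  proof (intro sigma_sets_mono' Un_least subsetI)
    fix x assume "x \<in> sets F0"
    then show "x \<in> ?P" using F0(1) sets.sets_into_space[of x F0]
      by (intro CollectI exI[of _ x] exI[of _ "space M"] conjI G.top) auto
  next
    fix x assume "x \<in> generated_by M B {0..s}"
    then show "x \<in> ?P" using F0(1) sets.top[of F0] Gpow(1)
      by (intro CollectI exI[of _ "space M"] exI[of _ x] conjI sigma_sets.Basic) auto
  qed
  moreover have "?H \<subseteq> sigma_sets (space M) ?H" by auto
  ultimately show ?thesis unfolding indep_sets2_eq by blast
qed

text \<open>Null sets may be dropped from the generators: agreement almost everywhere with an event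
  of the smaller sigma-field is preserved by complements and countable unions. Probabilities are
  unaffected, so independence carries over to \<open>F s\<close>.\<close>

lemma F_approx_modulo_null:
  assumes "0 \<le> s" "A \<in> sets (F s)"
  shows "\<exists>A'\<in>sigma_sets (space M) (sets F0 \<union> generated_by M B {0..s}). AE w in M. w \<in> A \<longleftrightarrow> w \<in> A'"
proof -
  have "A \<in> sigma_sets (space M) (sets F0 \<union> null_sets M \<union> generated_by M B {0..s})"
    using assms by (simp add: sets_F max_def)
  then show ?thesis
  proof induction
    case (Basic a)
    then consider "a \<in> sets F0 \<union> generated_by M B {0..s}" | "a \<in> null_sets M" by auto
    then show ?case
    proof cases
      case 2
      then have "AE w in M. w \<notin> a" by (rule AE_not_in)
      then show ?thesis by (intro bexI[of _ "{}"]) (auto intro: sigma_sets.Empty)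
    qed (auto intro!: bexI[of _ a])
  next
    case Empty
    then show ?case by (intro bexI[of _ "{}"]) (auto intro: sigma_sets.Empty)
  next
    case (Compl a)
    then obtain A' where A': "A' \<in> sigma_sets (space M) (sets F0 \<union> generated_by M B {0..s})"
      "AE w in M. w \<in> a \<longleftrightarrow> w \<in> A'" by auto
    show ?case
      using A'(2) by (intro bexI[of _ "space M - A'"] sigma_sets.Compl A') auto
  next
    case (Union a)
    then have "\<forall>i. \<exists>A'. A' \<in> sigma_sets (space M) (sets F0 \<union> generated_by M B {0..s}) \<and>
      (AE w in M. w \<in> a i \<longleftrightarrow> w \<in> A')" by blast
    from choice[OF this] obtain A' where A': "\<And>i. A' i \<in> sigma_sets (space M) (sets F0 \<union> generated_by M B {0..s})"
      "\<And>i. AE w in M. w \<in> a i \<longleftrightarrow> w \<in> A' i" by blast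
    have "AE w in M. \<forall>i. w \<in> a i \<longleftrightarrow> w \<in> A' i" using A'(2) by (simp add: AE_all_countable)
    then have "AE w in M. w \<in> (\<Union>i. a i) \<longleftrightarrow> w \<in> (\<Union>i. A' i)" by eventually_elim auto
    then show ?case by (intro bexI[of _ "\<Union>i. A' i"] sigma_sets.Union A')
  qed
qed

lemma indep_F_increment:
  assumes st: "0 \<le> s" "s < t"
  shows "indep_set (sets (F s)) (sigma_sets (space M) (increment_algebra s t))"
proof (rule indep_setI)
  note ind = indep_F_increment_aux[OF st]
  show "sets (F s) \<subseteq> events" using subalgebra_F by (simp add: subalgebra_def)
  show "sigma_sets (space M) (increment_algebra s t) \<subseteq> events" by (rule indep_setD_ev2[OF ind])
  fix a b assume a: "a \<in> sets (F s)" and b: "b \<in> sigma_sets (space M) (increment_algebra s t)"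
  obtain a' where a': "a' \<in> sigma_sets (space M) (sets F0 \<union> generated_by M B {0..s})"
    "AE w in M. w \<in> a \<longleftrightarrow> w \<in> a'" using F_approx_modulo_null[OF st(1) a] by auto
  have ev: "a \<in> events" "a' \<in> events" "b \<in> events"
    using a a'(1) b indep_setD_ev1[OF ind] indep_setD_ev2[OF ind] subalgebra_F[of s]
    unfolding subalgebra_def by blast+
  have "prob (a \<inter> b) = prob (a' \<inter> b)" using a'(2) ev by (intro measure_eq_AE) auto
  also have "\<dots> = prob a' * prob b" by (rule indep_setD[OF ind a'(1) b])
  also have "prob a' = prob a" using a'(2) ev by (intro measure_eq_AE) auto
  finally show "prob (a \<inter> b) = prob a * prob b" .
qed

lemma indep_var_increment:
  fixes \<theta> :: "'w \<Rightarrow> real" and h :: "real^'d \<Rightarrow> real"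
  assumes st: "0 \<le> s" "s < t" and \<theta>: "\<theta> \<in> borel_measurable (F s)" and h: "h \<in> borel_measurable borel"
  shows "indep_var borel \<theta> borel (\<lambda>w. h (B t w - B s w))"
  unfolding indep_var_eq
proof (intro conjI)
  show "random_variable borel \<theta>" by (rule F_measurable_M[OF \<theta>])
  show "random_variable borel (\<lambda>w. h (B t w - B s w))"
    using st by (intro measurable_compose[OF borel_measurable_diff h] B_measurable) auto
  have "sigma_sets (space (F s)) {\<theta> -` A \<inter> space M | A. A \<in> sets borel} \<subseteq> sets (F s)"
    using measurable_sets[OF \<theta>] by (intro sets.sigma_sets_subset) auto
  moreover have "{(\<lambda>w. h (B t w - B s w)) -` A \<inter> space M | A. A \<in> sets borel} \<subseteq> increment_algebra s t"
  proof
    fix x assume "x \<in> {(\<lambda>w. h (B t w - B s w)) -` A \<inter> space M | A. A \<in> sets borel}"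
    then obtain A where A: "A \<in> sets borel" "x = (\<lambda>w. h (B t w - B s w)) -` A \<inter> space M" by auto
    then have "h -` A \<in> sets borel" using measurable_sets[OF h A(1)] by simp
    then show "x \<in> increment_algebra s t"
      unfolding increment_algebra_def A(2) by (intro CollectI exI[of _ "h -` A"]) auto
  qed
  then have "sigma_sets (space M) {(\<lambda>w. h (B t w - B s w)) -` A \<inter> space M | A. A \<in> sets borel}
     \<subseteq> sigma_sets (space M) (increment_algebra s t)" by (rule sigma_sets_mono')
  ultimately show "indep_set (sigma_sets (space M) {\<theta> -` A \<inter> space M | A. A \<in> sets borel})
      (sigma_sets (space M) {(\<lambda>w. h (B t w - B s w)) -` A \<inter> space M | A. A \<in> sets borel})"
    using indep_F_increment[OF st] unfolding indep_sets2_eq space_F by blast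
qed

text \<open>A monomial in the coordinates is written as a product over all coordinates with exponent
  \<open>0\<close> where a coordinate is absent. The integral against the product density then
  factorises into normal moments of order \<open>0\<close>, \<open>1\<close> and
  \<open>2\<close>.\<close>

lemma increment_moments:
  assumes st: "0 \<le> s" "s < t"
  shows "has_bochner_integral M (\<lambda>w. (B t w - B s w) $ c) 0"
    and "has_bochner_integral M (\<lambda>w. (B t w - B s w) $ c * (B t w - B s w) $ c') (if c = c' then t - s else 0)"
proof -
  let ?\<phi> = "normal_density 0 (sqrt (t - s))"
  have \<sigma>: "0 < sqrt (t - s)" using st by simp
  have D: "distributed M lborel (\<lambda>w. B t w - B s w) (\<lambda>x. ennreal (\<Prod>i\<in>UNIV. ?\<phi> (x $ i)))"
    using brownian st unfolding brownian_motion_def by blast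
  have m0: "has_bochner_integral lborel (\<lambda>x. ?\<phi> x * x ^ 0) 1"
    using \<sigma> by (simp add: has_bochner_integral_iff)
  have m1: "has_bochner_integral lborel (\<lambda>x. ?\<phi> x * x ^ 1) 0"
    using normal_moment_odd[OF \<sigma>, of 0 0] by simp
  have m2: "has_bochner_integral lborel (\<lambda>x. ?\<phi> x * x ^ 2) (t - s)"
    using normal_moment_even[OF \<sigma>, of 0 1] st by (simp add: fact_numeral diff_divide_distrib)
  have transfer: "\<And>(h :: real^'d \<Rightarrow> real) I. has_bochner_integral lborel (\<lambda>x. (\<Prod>i\<in>UNIV. ?\<phi> (x $ i)) * h x) I \<Longrightarrow>
      h \<in> borel_measurable borel \<Longrightarrow> has_bochner_integral M (\<lambda>w. h (B t w - B s w)) I"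
    using distributed_integrable[OF D] distributed_integral[OF D]
    by (auto simp: has_bochner_integral_iff prod_nonneg)
  show "has_bochner_integral M (\<lambda>w. (B t w - B s w) $ c) 0"
  proof (rule transfer[of "\<lambda>x. x $ c"])
    have "has_bochner_integral lborel (\<lambda>x::real^'d. \<Prod>i\<in>UNIV. ?\<phi> (x $ i) * (x $ i) ^ (if i = c then 1 else 0)) (\<Prod>i\<in>UNIV. if i = c then 0 else 1)"
      using m0 m1 by (intro has_bochner_integral_prod_vec) auto
    moreover have "(\<Prod>i\<in>UNIV. ?\<phi> (x $ i) * (x $ i) ^ (if i = c then 1 else 0)) = (\<Prod>i\<in>UNIV. ?\<phi> (x $ i)) * x $ c" for x :: "real^'d"
    proof -
      have "(\<Prod>i\<in>UNIV. (x $ i) ^ (if i = c then 1 else 0)) = (\<Prod>i\<in>{c}. x $ i)"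
        by (rule prod.mono_neutral_cong_right) auto
      then show ?thesis by (simp only: prod.distrib) simp
    qed
    ultimately show "has_bochner_integral lborel (\<lambda>x. (\<Prod>i\<in>UNIV. ?\<phi> (x $ i)) * x $ c) 0"
      by (simp add: prod_zero_iff)
  qed measurable
  show "has_bochner_integral M (\<lambda>w. (B t w - B s w) $ c * (B t w - B s w) $ c') (if c = c' then t - s else 0)"
  proof (rule transfer[of "\<lambda>x. x $ c * x $ c'"])
    show "has_bochner_integral lborel (\<lambda>x. (\<Prod>i\<in>UNIV. ?\<phi> (x $ i)) * (x $ c * x $ c')) (if c = c' then t - s else 0)"
    proof (cases "c = c'")
      case True
      have "has_bochner_integral lborel (\<lambda>x::real^'d. \<Prod>i\<in>UNIV. ?\<phi> (x $ i) * (x $ i) ^ (if i = c then 2 else 0)) (\<Prod>i\<in>UNIV. if i = c then t - s else 1)"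
        using m0 m2 by (intro has_bochner_integral_prod_vec) auto
      moreover have "(\<Prod>i\<in>UNIV. ?\<phi> (x $ i) * (x $ i) ^ (if i = c then 2 else 0)) = (\<Prod>i\<in>UNIV. ?\<phi> (x $ i)) * (x $ c * x $ c)" for x :: "real^'d"
      proof -
        have "(\<Prod>i\<in>UNIV. (x $ i) ^ (if i = c then 2 else 0)) = (\<Prod>i\<in>{c}. (x $ i)^2)"
          by (rule prod.mono_neutral_cong_right) auto
        then show ?thesis by (simp only: prod.distrib) (simp add: power2_eq_square)
      qed
      ultimately show ?thesis using True by (simp add: prod.delta)
    next
      case False
      have "has_bochner_integral lborel (\<lambda>x::real^'d. \<Prod>i\<in>UNIV. ?\<phi> (x $ i) * (x $ i) ^ (if i = c \<or> i = c' then 1 else 0)) (\<Prod>i\<in>UNIV. if i = c \<or> i = c' then 0 else 1)"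
        using m0 m1 by (intro has_bochner_integral_prod_vec) auto
      moreover have "(\<Prod>i\<in>UNIV. ?\<phi> (x $ i) * (x $ i) ^ (if i = c \<or> i = c' then 1 else 0)) = (\<Prod>i\<in>UNIV. ?\<phi> (x $ i)) * (x $ c * x $ c')" for x :: "real^'d"
      proof -
        have "(\<Prod>i\<in>UNIV. (x $ i) ^ (if i = c \<or> i = c' then 1 else 0)) = (\<Prod>i\<in>{c, c'}. x $ i)"
          by (rule prod.mono_neutral_cong_right) auto
        then show ?thesis using False by (simp only: prod.distrib) simp
      qed
      moreover have "(\<Prod>i\<in>UNIV. if i = c \<or> i = c' then 0 else (1::real)) = 0"
        by (rule prod_zero) auto
      ultimately show ?thesis using False by simp
    qed
  qed measurable
qed

lemma increment_expect:
  assumes st: "0 \<le> s" "s \<le> t" and \<theta>: "\<theta> \<in> borel_measurable (F s)" "integrable M \<theta>"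
  shows "has_bochner_integral M (\<lambda>w. \<theta> w * (B t w - B s w) $ c) 0"
    and "has_bochner_integral M (\<lambda>w. \<theta> w * ((B t w - B s w) $ c * (B t w - B s w) $ c'))
      (if c = c' then (t - s) * (\<integral>w. \<theta> w \<partial>M) else 0)"
proof -
  consider "s = t" | "s < t" using st by linarith
  then show "has_bochner_integral M (\<lambda>w. \<theta> w * (B t w - B s w) $ c) 0"
  proof cases
    case 2
    note m = increment_moments(1)[OF st(1) 2, of c]
    have iv: "indep_var borel \<theta> borel (\<lambda>w. (B t w - B s w) $ c)"
      by (intro indep_var_increment[OF st(1) 2 \<theta>(1), of "\<lambda>x. x $ c"]) measurable
    show ?thesis
      using indep_var_integrable[OF iv] indep_var_lebesgue_integral[OF iv] m \<theta>(2)
      by (auto simp: has_bochner_integral_iff)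
  qed (simp add: has_bochner_integral_zero)
  consider "s = t" | "s < t" using st by linarith
  then show "has_bochner_integral M (\<lambda>w. \<theta> w * ((B t w - B s w) $ c * (B t w - B s w) $ c'))
      (if c = c' then (t - s) * (\<integral>w. \<theta> w \<partial>M) else 0)"
  proof cases
    case 2
    note m = increment_moments(2)[OF st(1) 2, of c c']
    have iv: "indep_var borel \<theta> borel (\<lambda>w. (B t w - B s w) $ c * (B t w - B s w) $ c')"
      by (intro indep_var_increment[OF st(1) 2 \<theta>(1), of "\<lambda>x. x $ c * x $ c'"]) measurable
    show ?thesis
      using indep_var_integrable[OF iv] indep_var_lebesgue_integral[OF iv] m \<theta>(2)
      by (auto simp: has_bochner_integral_iff)
  qed (simp add: has_bochner_integral_zero)
qed

end

section \<open>Integrals of elementary processes\<close>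

context brownian_basis
begin

text \<open>Compared with \<open>simple_ito\<close>, the intervals are indexed by any finite set and
  may overlap. The difference of two such integrals is then again one, over the disjoint union of
  the index sets, and no common refinement of partitions is needed.\<close>

definition elem_int :: "'i set \<Rightarrow> ('i \<Rightarrow> real) \<Rightarrow> ('i \<Rightarrow> real) \<Rightarrow> ('i \<Rightarrow> 'w \<Rightarrow> real^'d^'m) \<Rightarrow> 'w \<Rightarrow> real^'m" where
  "elem_int I a b \<zeta> w = (\<Sum>i\<in>I. \<zeta> i w *v (B (b i) w - B (a i) w))"

definition elem_proc :: "'i set \<Rightarrow> ('i \<Rightarrow> real) \<Rightarrow> ('i \<Rightarrow> real) \<Rightarrow> ('i \<Rightarrow> 'w \<Rightarrow> real^'d^'m) \<Rightarrow> real \<Rightarrow> 'w \<Rightarrow> real^'d^'m" where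
  "elem_proc I a b \<zeta> s w = (\<Sum>i\<in>I. indicator {a i<..b i} s *\<^sub>R \<zeta> i w)"

text \<open>Adaptedness is demanded on nondegenerate intervals only, so that the notion is stable under
  truncating all intervals at a common time.\<close>

definition elementary :: "'i set \<Rightarrow> ('i \<Rightarrow> real) \<Rightarrow> ('i \<Rightarrow> real) \<Rightarrow> ('i \<Rightarrow> 'w \<Rightarrow> real^'d^'m) \<Rightarrow> bool" where
  "elementary I a b \<zeta> \<longleftrightarrow> finite I \<and>
     (\<forall>i\<in>I. 0 \<le> a i \<and> a i \<le> b i \<and> \<zeta> i \<in> borel_measurable M \<and> (a i < b i \<longrightarrow> \<zeta> i \<in> borel_measurable (F (a i)))) \<and>
     (\<exists>K. \<forall>i\<in>I. \<forall>w\<in>space M. norm (\<zeta> i w) \<le> K)"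

lemma elementaryD:
  assumes "elementary I a b \<zeta>"
  shows "finite I" and "i \<in> I \<Longrightarrow> 0 \<le> a i" and "i \<in> I \<Longrightarrow> a i \<le> b i"
    and "i \<in> I \<Longrightarrow> \<zeta> i \<in> borel_measurable M"
    and "i \<in> I \<Longrightarrow> a i < b i \<Longrightarrow> \<zeta> i \<in> borel_measurable (F (a i))"
    and "\<exists>K. \<forall>i\<in>I. \<forall>w\<in>space M. norm (\<zeta> i w) \<le> K"
  using assms unfolding elementary_def by blast+

lemma measurable_matrix_vector_mult [measurable (raw)]:
  fixes f :: "'a \<Rightarrow> real^'d^'m" and g :: "'a \<Rightarrow> real^'d"
  assumes "f \<in> borel_measurable N" "g \<in> borel_measurable N"
  shows "(\<lambda>x. f x *v g x) \<in> borel_measurable N"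
proof -
  have "continuous_on UNIV (\<lambda>p. fst p *v (snd p :: real^'d) :: real^'m)"
    unfolding matrix_vector_mult_def by (intro continuous_intros)
  then show ?thesis
    using borel_measurable_continuous_on[of "\<lambda>p. fst p *v (snd p :: real^'d) :: real^'m" "\<lambda>x. (f x, g x)" N] assms
    by simp
qed

lemma measurable_vec_component [measurable (raw)]:
  fixes f :: "'a \<Rightarrow> 'b::euclidean_space^'n"
  assumes "f \<in> borel_measurable N"
  shows "(\<lambda>x. f x $ i) \<in> borel_measurable N"
  by (rule measurable_compose[OF assms])
    (intro borel_measurable_continuous_onI continuous_intros)

section \<open>Covariances of increments weighted by coefficients from the past\<close>

lemma inner_sum_sum: "(\<Sum>i\<in>I. f i) \<bullet> (\<Sum>j\<in>J. g j) = (\<Sum>i\<in>I. \<Sum>j\<in>J. f i \<bullet> g j)"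
  for f :: "'i \<Rightarrow> 'b::real_inner"
  by (subst inner_sum_left) (simp only: inner_sum_right)

text \<open>Entry by entry, \<open>Y\<close> times \<open>\<zeta>\<close> is measurable for
  \<open>F a\<close>, and integrable since \<open>\<zeta>\<close> is bounded; the increment is
  centred and independent of it.\<close>

lemma orthogonal_increment:
  fixes \<zeta> :: "'w \<Rightarrow> real^'d^'m" and Y :: "'w \<Rightarrow> real^'m"
  assumes ab: "0 \<le> a" "a \<le> b" and \<zeta>: "\<zeta> \<in> borel_measurable (F a)" and K: "\<And>w. w \<in> space M \<Longrightarrow> norm (\<zeta> w) \<le> K"
    and Y: "Y \<in> borel_measurable (F a)" "msq M Y < \<infinity>"
  shows "has_bochner_integral M (\<lambda>w. Y w \<bullet> (\<zeta> w *v (B b w - B a w))) 0"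
proof -
  have [measurable]: "\<zeta> \<in> borel_measurable M" "Y \<in> borel_measurable M"
    by (rule F_measurable_M[OF \<zeta>], rule F_measurable_M[OF Y(1)])
  have YI: "integrable M Y" by (intro msq_integrable Y) measurable
  have comp: "has_bochner_integral M (\<lambda>w. Y w $ r * \<zeta> w $ r $ c * (B b w - B a w) $ c) 0" for r c
  proof (rule increment_expect(1)[OF ab])
    show "(\<lambda>w. Y w $ r * \<zeta> w $ r $ c) \<in> borel_measurable (F a)"
      by (intro borel_measurable_times measurable_vec_component \<zeta> Y(1))
    show "integrable M (\<lambda>w. Y w $ r * \<zeta> w $ r $ c)"
    proof (rule Bochner_Integration.integrable_bound[of _ "\<lambda>w. K * norm (Y w)"])
      show "AE w in M. norm (Y w $ r * \<zeta> w $ r $ c) \<le> norm (K * norm (Y w))"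
      proof (intro AE_I2)
        fix w assume w: "w \<in> space M"
        have "\<bar>\<zeta> w $ r $ c\<bar> \<le> K"
          using component_le_norm_cart[of "\<zeta> w $ r" c] Finite_Cartesian_Product.norm_nth_le[of "\<zeta> w" r] K[OF w] by linarith
        moreover have "\<bar>Y w $ r\<bar> \<le> norm (Y w)" by (rule component_le_norm_cart)
        ultimately have "\<bar>Y w $ r\<bar> * \<bar>\<zeta> w $ r $ c\<bar> \<le> norm (Y w) * K" by (intro mult_mono) auto
        moreover have "0 \<le> K" using K[OF w] norm_ge_zero by (rule order_trans[rotated])
        ultimately show "norm (Y w $ r * \<zeta> w $ r $ c) \<le> norm (K * norm (Y w))"
          by (simp add: abs_mult mult.commute)
      qed
    qed (use YI in auto)
  qed
  have "has_bochner_integral M (\<lambda>w. \<Sum>r\<in>UNIV. \<Sum>c\<in>UNIV. Y w $ r * \<zeta> w $ r $ c * (B b w - B a w) $ c) (\<Sum>r\<in>(UNIV::'m set). \<Sum>c\<in>(UNIV::'d set). 0)"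
    by (intro has_bochner_integral_sum comp)
  then show ?thesis
    by (simp add: inner_vec_def matrix_vector_mult_def sum_distrib_left mult.assoc)
qed

text \<open>Distinct coordinates of the increment are uncorrelated, so only the diagonal terms
  \<open>c = c'\<close> survive. They add up to the Frobenius inner product of the matrices.\<close>

lemma same_increment:
  fixes \<zeta> \<eta> :: "'w \<Rightarrow> real^'d^'m"
  assumes ab: "0 \<le> a" "a \<le> b" and \<zeta>: "\<zeta> \<in> borel_measurable (F a)" and \<eta>: "\<eta> \<in> borel_measurable (F a)"
    and K: "\<And>w. w \<in> space M \<Longrightarrow> norm (\<zeta> w) \<le> K" and L: "\<And>w. w \<in> space M \<Longrightarrow> norm (\<eta> w) \<le> L"
  shows "has_bochner_integral M (\<lambda>w. (\<zeta> w *v (B b w - B a w)) \<bullet> (\<eta> w *v (B b w - B a w))) ((b - a) * (\<integral>w. \<zeta> w \<bullet> \<eta> w \<partial>M))"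
proof -
  have [measurable]: "\<zeta> \<in> borel_measurable M" "\<eta> \<in> borel_measurable M"
    by (rule F_measurable_M[OF \<zeta>], rule F_measurable_M[OF \<eta>])
  have I: "integrable M (\<lambda>w. \<zeta> w $ r $ c * \<eta> w $ r $ c')" for r c c'
  proof (rule integrable_const_bound[of _ "K * L"])
    show "AE w in M. norm (\<zeta> w $ r $ c * \<eta> w $ r $ c') \<le> K * L"
    proof (intro AE_I2)
      fix w assume w: "w \<in> space M"
      have "\<bar>\<zeta> w $ r $ c\<bar> \<le> K" "\<bar>\<eta> w $ r $ c'\<bar> \<le> L"
        using component_le_norm_cart[of "\<zeta> w $ r" c] Finite_Cartesian_Product.norm_nth_le[of "\<zeta> w" r] K[OF w]
          component_le_norm_cart[of "\<eta> w $ r" c'] Finite_Cartesian_Product.norm_nth_le[of "\<eta> w" r] L[OF w] by linarith+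
      then show "norm (\<zeta> w $ r $ c * \<eta> w $ r $ c') \<le> K * L"
        by (auto simp: abs_mult intro!: mult_mono)
    qed
  qed measurable
  have comp: "has_bochner_integral M (\<lambda>w. (\<zeta> w $ r $ c * \<eta> w $ r $ c') * ((B b w - B a w) $ c * (B b w - B a w) $ c'))
      (if c = c' then (b - a) * (\<integral>w. \<zeta> w $ r $ c * \<eta> w $ r $ c' \<partial>M) else 0)" for r c c'
    by (intro increment_expect(2)[OF ab] I borel_measurable_times measurable_vec_component \<zeta> \<eta>)
  have "has_bochner_integral M (\<lambda>w. \<Sum>r\<in>UNIV. \<Sum>c\<in>UNIV. \<Sum>c'\<in>UNIV.
       (\<zeta> w $ r $ c * \<eta> w $ r $ c') * ((B b w - B a w) $ c * (B b w - B a w) $ c'))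
      (\<Sum>r\<in>UNIV. \<Sum>c\<in>UNIV. \<Sum>c'\<in>UNIV. if c = c' then (b - a) * (\<integral>w. \<zeta> w $ r $ c * \<eta> w $ r $ c' \<partial>M) else 0)"
    by (intro has_bochner_integral_sum comp)
  moreover have "(\<Sum>r\<in>UNIV. \<Sum>c\<in>UNIV. \<Sum>c'\<in>UNIV. (\<zeta> w $ r $ c * \<eta> w $ r $ c') * ((B b w - B a w) $ c * (B b w - B a w) $ c'))
     = (\<zeta> w *v (B b w - B a w)) \<bullet> (\<eta> w *v (B b w - B a w))" for w
    unfolding inner_vec_def matrix_vector_mult_def vec_lambda_beta inner_real_def sum_product
    by (intro sum.cong refl) (simp add: mult_ac)
  moreover have "(\<Sum>r\<in>UNIV. \<Sum>c\<in>UNIV. \<Sum>c'\<in>UNIV. if c = c' then (b - a) * (\<integral>w. \<zeta> w $ r $ c * \<eta> w $ r $ c' \<partial>M) else 0)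
     = (b - a) * (\<integral>w. \<zeta> w \<bullet> \<eta> w \<partial>M)"
  proof -
    have "(\<integral>w. \<zeta> w \<bullet> \<eta> w \<partial>M) = (\<Sum>r\<in>UNIV. \<Sum>c\<in>UNIV. \<integral>w. \<zeta> w $ r $ c * \<eta> w $ r $ c \<partial>M)"
      by (simp add: inner_vec_def Bochner_Integration.integral_sum I)
    then show ?thesis by (simp add: sum_distrib_left)
  qed
  ultimately show ?thesis by simp
qed

lemma increment_msq_finite:
  fixes \<zeta> :: "'w \<Rightarrow> real^'d^'m"
  assumes ab: "0 \<le> a" "a \<le> b" and \<zeta>: "\<zeta> \<in> borel_measurable (F a)" and K: "\<And>w. w \<in> space M \<Longrightarrow> norm (\<zeta> w) \<le> K"
  shows "msq M (\<lambda>w. \<zeta> w *v (B b w - B a w)) < \<infinity>"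
proof -
  have "integrable M (\<lambda>w. (norm (\<zeta> w *v (B b w - B a w)))\<^sup>2)"
    using same_increment[OF ab \<zeta> \<zeta> K K] by (simp add: has_bochner_integral_iff power2_norm_eq_inner)
  then show ?thesis by (simp add: msq_eq_integral)
qed

lemma increment_F_measurable:
  fixes \<zeta> :: "'w \<Rightarrow> real^'d^'m"
  assumes "0 \<le> a" "a \<le> b" "b \<le> t" "\<zeta> \<in> borel_measurable (F a)"
  shows "(\<lambda>w. \<zeta> w *v (B b w - B a w)) \<in> borel_measurable (F t)"
proof -
  have "\<zeta> \<in> borel_measurable (F t)"
    by (rule F_measurable_mono[OF assms(4)]) (use assms in linarith)
  moreover have "B b \<in> borel_measurable (F t)" "B a \<in> borel_measurable (F t)"
    by (rule B_F_measurable; use assms in linarith)+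
  ultimately show ?thesis by (intro measurable_matrix_vector_mult borel_measurable_diff)
qed

text \<open>The earlier weighted increment is itself a square integrable variable of the past at
  \<open>c\<close>.\<close>

lemma disjoint_increments:
  fixes \<zeta> \<eta> :: "'w \<Rightarrow> real^'d^'m"
  assumes "0 \<le> a" "a \<le> b" "b \<le> c" "c \<le> d" and "\<zeta> \<in> borel_measurable (F a)" and \<eta>: "\<eta> \<in> borel_measurable (F c)"
    and K: "\<And>w. w \<in> space M \<Longrightarrow> norm (\<zeta> w) \<le> K" and L: "\<And>w. w \<in> space M \<Longrightarrow> norm (\<eta> w) \<le> L"
  shows "has_bochner_integral M (\<lambda>w. (\<zeta> w *v (B b w - B a w)) \<bullet> (\<eta> w *v (B d w - B c w))) 0"
  by (rule orthogonal_increment[OF _ _ \<eta> L increment_F_measurable increment_msq_finite[OF _ _ _ K]])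
    (use assms in \<open>assumption | linarith\<close>)+

text \<open>Both intervals are cut at each other's end points, so that any two pieces are equal or
  disjoint. Only the common piece contributes. The three cases are disjoint, overlapping and nested
  intervals.\<close>

lemma increment_covariance_le:
  fixes \<zeta> \<eta> :: "'w \<Rightarrow> real^'d^'m"
  assumes le: "0 \<le> a" "a < b" "a \<le> c" "c < d" and \<zeta>: "\<zeta> \<in> borel_measurable (F a)" and \<eta>: "\<eta> \<in> borel_measurable (F c)"
    and K: "\<And>w. w \<in> space M \<Longrightarrow> norm (\<zeta> w) \<le> K" and L: "\<And>w. w \<in> space M \<Longrightarrow> norm (\<eta> w) \<le> L"
  shows "has_bochner_integral M (\<lambda>w. (\<zeta> w *v (B b w - B a w)) \<bullet> (\<eta> w *v (B d w - B c w)))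
     (measure lborel ({a<..b} \<inter> {c<..d}) * (\<integral>w. \<zeta> w \<bullet> \<eta> w \<partial>M))"
proof -
  have m: "\<And>s. a \<le> s \<Longrightarrow> \<zeta> \<in> borel_measurable (F s)" "\<And>s. c \<le> s \<Longrightarrow> \<eta> \<in> borel_measurable (F s)"
    by (rule F_measurable_mono[OF \<zeta>], assumption) (rule F_measurable_mono[OF \<eta>], assumption)
  let ?J = "\<lambda>\<zeta> x y w. \<zeta> w *v (B y w - B x w)"
  have split: "\<And>(\<xi> :: 'w \<Rightarrow> real^'d^'m) x z w y. ?J \<xi> x z w = ?J \<xi> x y w + ?J \<xi> y z w"
    by (simp add: matrix_vector_mult_add_rdistrib[symmetric] matrix_vector_right_distrib[symmetric])
  consider "b \<le> c" | "c < b" "b \<le> d" | "c < b" "d < b" by linarith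
  then show ?thesis
  proof cases
    case 1
    then have "{a<..b} \<inter> {c<..d} = {}" by auto
    then show ?thesis using 1 le disjoint_increments[OF _ _ _ _ \<zeta> \<eta> K L, of b d] by simp
  next
    case 2
    then have int: "{a<..b} \<inter> {c<..d} = {c<..b}" using le by auto
    have "has_bochner_integral M (\<lambda>w. (?J \<zeta> a c w \<bullet> ?J \<eta> c b w + ?J \<zeta> a c w \<bullet> ?J \<eta> b d w) + (?J \<zeta> c b w \<bullet> ?J \<eta> c b w + ?J \<zeta> c b w \<bullet> ?J \<eta> b d w))
       ((0 + 0) + ((b - c) * (\<integral>w. \<zeta> w \<bullet> \<eta> w \<partial>M) + 0))"
      using 2 le by (intro has_bochner_integral_add disjoint_increments[where K=K and L=L] same_increment[where K=K and L=L] m K L) auto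
    moreover have "(?J \<zeta> a c w \<bullet> ?J \<eta> c b w + ?J \<zeta> a c w \<bullet> ?J \<eta> b d w) + (?J \<zeta> c b w \<bullet> ?J \<eta> c b w + ?J \<zeta> c b w \<bullet> ?J \<eta> b d w)
       = ?J \<zeta> a b w \<bullet> ?J \<eta> c d w" for w
      unfolding split[of \<zeta> w b a c] split[of \<eta> w d c b] by (simp add: inner_add_left inner_add_right)
    ultimately show ?thesis using 2 unfolding int by simp
  next
    case 3
    then have int: "{a<..b} \<inter> {c<..d} = {c<..d}" using le by auto
    have "has_bochner_integral M (\<lambda>w. ?J \<zeta> a c w \<bullet> ?J \<eta> c d w + (?J \<zeta> c d w \<bullet> ?J \<eta> c d w + ?J \<eta> c d w \<bullet> ?J \<zeta> d b w))
       (0 + ((d - c) * (\<integral>w. \<zeta> w \<bullet> \<eta> w \<partial>M) + 0))"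
      using 3 le by (intro has_bochner_integral_add disjoint_increments[where K=K and L=L] disjoint_increments[where K=L and L=K]
          same_increment[where K=K and L=L] m K L) auto
    moreover have "?J \<zeta> a c w \<bullet> ?J \<eta> c d w + (?J \<zeta> c d w \<bullet> ?J \<eta> c d w + ?J \<eta> c d w \<bullet> ?J \<zeta> d b w)
       = ?J \<zeta> a b w \<bullet> ?J \<eta> c d w" for w
      unfolding split[of \<zeta> w b a c] split[of \<zeta> w b c d] by (simp add: inner_add_left inner_add_right inner_commute)
    ultimately show ?thesis using le unfolding int by simp
  qed
qed

lemma increment_covariance:
  fixes \<zeta> \<eta> :: "'w \<Rightarrow> real^'d^'m"
  assumes le: "0 \<le> a" "a \<le> b" "0 \<le> c" "c \<le> d" and \<zeta>: "a < b \<Longrightarrow> \<zeta> \<in> borel_measurable (F a)" and \<eta>: "c < d \<Longrightarrow> \<eta> \<in> borel_measurable (F c)"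
    and K: "\<And>w. w \<in> space M \<Longrightarrow> norm (\<zeta> w) \<le> K" and L: "\<And>w. w \<in> space M \<Longrightarrow> norm (\<eta> w) \<le> L"
  shows "has_bochner_integral M (\<lambda>w. (\<zeta> w *v (B b w - B a w)) \<bullet> (\<eta> w *v (B d w - B c w)))
     (measure lborel ({a<..b} \<inter> {c<..d}) * (\<integral>w. \<zeta> w \<bullet> \<eta> w \<partial>M))"
proof -
  consider "a = b \<or> c = d" | "a < b" "c < d" "a \<le> c" | "a < b" "c < d" "c \<le> a" using le by linarith
  then show ?thesis
  proof cases
    case 1
    then show ?thesis by (auto simp: has_bochner_integral_zero)
  next
    case 2
    then show ?thesis using le by (intro increment_covariance_le[where K=K and L=L] \<zeta> \<eta> K L) auto
  next
    case 3
    then have "has_bochner_integral M (\<lambda>w. (\<eta> w *v (B d w - B c w)) \<bullet> (\<zeta> w *v (B b w - B a w)))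
     (measure lborel ({c<..d} \<inter> {a<..b}) * (\<integral>w. \<eta> w \<bullet> \<zeta> w \<partial>M))"
      using le by (intro increment_covariance_le[where K=L and L=K] \<zeta> \<eta> K L) auto
    then show ?thesis by (simp add: inner_commute Int_commute)
  qed
qed

lemma elementary_bounded_inner:
  assumes "elementary I a b \<zeta>" "i \<in> I" "j \<in> I"
  shows "integrable M (\<lambda>w. \<zeta> i w \<bullet> \<zeta> j w)"
proof -
  obtain K where K: "\<And>i w. i \<in> I \<Longrightarrow> w \<in> space M \<Longrightarrow> norm (\<zeta> i w) \<le> K"
    using elementaryD(6)[OF assms(1)] by blast
  note m [measurable] = elementaryD(4)[OF assms(1) assms(2)] elementaryD(4)[OF assms(1) assms(3)]
  have "AE w in M. norm (\<zeta> i w \<bullet> \<zeta> j w) \<le> K * K"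
  proof (intro AE_I2)
    fix w assume w: "w \<in> space M"
    have "\<bar>\<zeta> i w \<bullet> \<zeta> j w\<bar> \<le> norm (\<zeta> i w) * norm (\<zeta> j w)" by (rule Cauchy_Schwarz_ineq2)
    also have "\<dots> \<le> K * K" using K[OF assms(2) w] K[OF assms(3) w]
      by (intro mult_mono) (auto intro: order_trans[OF norm_ge_zero])
    finally show "norm (\<zeta> i w \<bullet> \<zeta> j w) \<le> K * K" by simp
  qed
  then show ?thesis by (intro integrable_const_bound[of _ "K * K"]) auto
qed

text \<open>Expanding the square gives one covariance for each pair of intervals.
  \<open>elementary_proc_msq\<close> arrives at the same double sum for the process, and the
  isometry is the equality of the two.\<close>

lemma elementary_int_msq:
  assumes el: "elementary I a b \<zeta>"
  shows "msq M (elem_int I a b \<zeta>)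
    = ennreal (\<Sum>i\<in>I. \<Sum>j\<in>I. measure lborel ({a i<..b i} \<inter> {a j<..b j}) * (\<integral>w. \<zeta> i w \<bullet> \<zeta> j w \<partial>M))"
proof -
  obtain K where K: "\<And>i w. i \<in> I \<Longrightarrow> w \<in> space M \<Longrightarrow> norm (\<zeta> i w) \<le> K"
    using elementaryD(6)[OF el] by blast
  have "has_bochner_integral M (\<lambda>w. \<Sum>i\<in>I. \<Sum>j\<in>I. (\<zeta> i w *v (B (b i) w - B (a i) w)) \<bullet> (\<zeta> j w *v (B (b j) w - B (a j) w)))
     (\<Sum>i\<in>I. \<Sum>j\<in>I. measure lborel ({a i<..b i} \<inter> {a j<..b j}) * (\<integral>w. \<zeta> i w \<bullet> \<zeta> j w \<partial>M))"
    by (intro has_bochner_integral_sum increment_covariance[where K=K and L=K] K elementaryD[OF el])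
  moreover have "(\<Sum>i\<in>I. \<Sum>j\<in>I. (\<zeta> i w *v (B (b i) w - B (a i) w)) \<bullet> (\<zeta> j w *v (B (b j) w - B (a j) w)))
     = (norm (elem_int I a b \<zeta> w))\<^sup>2" for w
    unfolding elem_int_def power2_norm_eq_inner inner_sum_sum ..
  ultimately have "has_bochner_integral M (\<lambda>w. (norm (elem_int I a b \<zeta> w))\<^sup>2)
     (\<Sum>i\<in>I. \<Sum>j\<in>I. measure lborel ({a i<..b i} \<inter> {a j<..b j}) * (\<integral>w. \<zeta> i w \<bullet> \<zeta> j w \<partial>M))" by simp
  then show ?thesis by (simp add: msq_eq_integral has_bochner_integral_iff)
qed

lemma elem_proc_measurable:
  assumes el: "elementary I a b \<zeta>"
  shows "(\<lambda>p. elem_proc I a b \<zeta> (fst p) (snd p)) \<in> borel_measurable (strip c d M)"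
proof -
  have "(\<lambda>p. indicator {a i<..b i} (fst p) *\<^sub>R \<zeta> i (snd p)) \<in> borel_measurable (strip c d M)" if "i \<in> I" for i
  proof -
    note [measurable] = elementaryD(4)[OF el that]
    have "(\<lambda>p. indicator {a i<..b i} (fst p) :: real) \<in> borel_measurable (strip c d M)"
      by (rule measurable_compose[OF measurable_fst]) (simp add: measurable_restrict_space1)
    then show ?thesis
      by (intro borel_measurable_scaleR measurable_compose[OF measurable_snd]) auto
  qed
  then show ?thesis unfolding elem_proc_def by (intro borel_measurable_sum)
qed

text \<open>At time \<open>t\<close> the second moment is the finite sum \<open>g t\<close> of
  weighted indicators, and integration in time turns these into lengths of intersections. The bound
  on \<open>b i\<close> keeps the intervals inside the strip, so that their full lengths
  appear.\<close>

lemma elementary_proc_msq: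
  assumes el: "elementary I a b \<zeta>" and bT: "\<And>i. i \<in> I \<Longrightarrow> b i \<le> T"
  shows "msq (strip 0 T M) (\<lambda>p. elem_proc I a b \<zeta> (fst p) (snd p))
    = ennreal (\<Sum>i\<in>I. \<Sum>j\<in>I. measure lborel ({a i<..b i} \<inter> {a j<..b j}) * (\<integral>w. \<zeta> i w \<bullet> \<zeta> j w \<partial>M))"
proof -
  let ?L = "restrict_space lborel {0..T}"
  define c where "c i j = (\<integral>w. \<zeta> i w \<bullet> \<zeta> j w \<partial>M)" for i j
  define A where "A i j = {a i<..b i} \<inter> {a j<..b j}" for i j
  define g where "g t = (\<Sum>i\<in>I. \<Sum>j\<in>I. indicator (A i j) t * c i j)" for t :: real
  have sub: "A i j \<subseteq> {0..T}" if "i \<in> I" "j \<in> I" for i j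
    using elementaryD(2)[OF el that(1)] bT[OF that(1)] by (auto simp: A_def)
  have Ab: "A i j \<in> sets borel" for i j unfolding A_def by simp
  have S: "A i j \<in> sets ?L" if "i \<in> I" "j \<in> I" for i j
    using sub[OF that] Ab by (simp add: sets_restrict_space_iff)
  have sq: "has_bochner_integral M (\<lambda>w. (norm (elem_proc I a b \<zeta> t w))\<^sup>2) (g t)" for t
  proof -
    have "has_bochner_integral M (\<lambda>w. \<Sum>i\<in>I. \<Sum>j\<in>I. indicator (A i j) t * (\<zeta> i w \<bullet> \<zeta> j w)) (g t)"
      unfolding g_def c_def
      by (intro has_bochner_integral_sum has_bochner_integral_mult_right has_bochner_integral_integrable
        elementary_bounded_inner[OF el])
    moreover have "(\<Sum>i\<in>I. \<Sum>j\<in>I. indicator (A i j) t * (\<zeta> i w \<bullet> \<zeta> j w)) = (norm (elem_proc I a b \<zeta> t w))\<^sup>2" for w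
      unfolding elem_proc_def power2_norm_eq_inner inner_sum_sum A_def
      by (intro sum.cong refl) (simp only: indicator_inter_arith inner_scaleR_left inner_scaleR_right mult_ac)
    ultimately show ?thesis by simp
  qed
  have g0: "0 \<le> g t" for t
  proof -
    have "0 \<le> (\<integral>w. (norm (elem_proc I a b \<zeta> t w))\<^sup>2 \<partial>M)" by simp
    then show ?thesis using sq[of t] unfolding has_bochner_integral_iff by simp
  qed
  have fin: "emeasure ?L X < \<infinity>" for X
    using finite_measure.emeasure_finite[OF finite_measure_time[of 0 T], of X] by (simp add: top.not_eq_extremum)
  have gI: "has_bochner_integral ?L g (\<Sum>i\<in>I. \<Sum>j\<in>I. measure ?L (A i j) * c i j)"
    unfolding g_def
    by (intro has_bochner_integral_sum has_bochner_integral_mult_left has_bochner_integral_real_indicator S fin)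
  have "msq (strip 0 T M) (\<lambda>p. elem_proc I a b \<zeta> (fst p) (snd p)) = (\<integral>\<^sup>+t. ennreal (g t) \<partial>?L)"
  proof (subst msq_strip_time(1)[OF elem_proc_measurable[OF el]], intro nn_integral_cong)
    fix t
    have "msq M (elem_proc I a b \<zeta> t) = ennreal (g t)"
      using sq[of t] unfolding has_bochner_integral_iff by (simp add: msq_eq_integral)
    then show "msq M (\<lambda>w. elem_proc I a b \<zeta> (fst (t, w)) (snd (t, w))) = ennreal (g t)" by simp
  qed
  also have "\<dots> = ennreal (\<Sum>i\<in>I. \<Sum>j\<in>I. measure ?L (A i j) * c i j)"
    using gI g0 unfolding has_bochner_integral_iff by (subst nn_integral_eq_integral) auto
  also have "(\<Sum>i\<in>I. \<Sum>j\<in>I. measure ?L (A i j) * c i j)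
     = (\<Sum>i\<in>I. \<Sum>j\<in>I. measure lborel (A i j) * c i j)"
    using sub by (intro sum.cong refl) (simp add: measure_restrict_space)
  finally show ?thesis unfolding A_def c_def .
qed

section \<open>The elementary integral as a process in its upper limit\<close>

definition elem_ito :: "'i set \<Rightarrow> ('i \<Rightarrow> real) \<Rightarrow> ('i \<Rightarrow> real) \<Rightarrow> ('i \<Rightarrow> 'w \<Rightarrow> real^'d^'m) \<Rightarrow> real \<Rightarrow> 'w \<Rightarrow> real^'m" where
  "elem_ito I a b \<zeta> u = elem_int I (\<lambda>i. min (a i) u) (\<lambda>i. min (b i) u) \<zeta>"

lemma elementary_truncate:
  assumes el: "elementary I a b \<zeta>" and u: "0 \<le> u"
  shows "elementary I (\<lambda>i. min (a i) u) (\<lambda>i. min (b i) u) \<zeta>"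
  unfolding elementary_def
proof (intro conjI ballI impI)
  fix i assume i: "i \<in> I" "min (a i) u < min (b i) u"
  then have "min (a i) u = a i" "a i < b i" by auto
  then show "\<zeta> i \<in> borel_measurable (F (min (a i) u))" using elementaryD(5)[OF el i(1)] by simp
next
  show "finite I" by (rule elementaryD(1)[OF el])
  show "\<exists>K. \<forall>i\<in>I. \<forall>w\<in>space M. norm (\<zeta> i w) \<le> K" by (rule elementaryD(6)[OF el])
  fix i assume i: "i \<in> I"
  show "\<zeta> i \<in> borel_measurable M" by (rule elementaryD(4)[OF el i])
  show "0 \<le> min (a i) u" "min (a i) u \<le> min (b i) u"
    using elementaryD(2,3)[OF el i] u by auto
qed

text \<open>Truncating the intervals at \<open>u\<close> changes the integrand only at times beyond
  \<open>u\<close>, which the strip does not see.\<close>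

theorem elementary_ito_isometry:
  assumes el: "elementary I a b \<zeta>" and u: "0 \<le> u"
  shows "msq M (elem_ito I a b \<zeta> u) = msq (strip 0 u M) (\<lambda>p. elem_proc I a b \<zeta> (fst p) (snd p))"
proof -
  note el' = elementary_truncate[OF el u]
  have "msq M (elem_ito I a b \<zeta> u) = msq (strip 0 u M) (\<lambda>p. elem_proc I (\<lambda>i. min (a i) u) (\<lambda>i. min (b i) u) \<zeta> (fst p) (snd p))"
    unfolding elem_ito_def using elementary_int_msq[OF el'] elementary_proc_msq[OF el', of u] by simp
  also have "\<dots> = msq (strip 0 u M) (\<lambda>p. elem_proc I a b \<zeta> (fst p) (snd p))"
  proof (intro msq_cong AE_I2)
    fix p assume "p \<in> space (strip 0 u M)"
    then have "fst p \<le> u" by (auto simp: space_strip)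
    then show "elem_proc I (\<lambda>i. min (a i) u) (\<lambda>i. min (b i) u) \<zeta> (fst p) (snd p) = elem_proc I a b \<zeta> (fst p) (snd p)"
      unfolding elem_proc_def by (intro sum.cong) (auto simp: indicator_def)
  qed
  finally show ?thesis .
qed

lemma elem_ito_F_measurable:
  assumes el: "elementary I a b \<zeta>" and u: "0 \<le> u"
  shows "elem_ito I a b \<zeta> u \<in> borel_measurable (F u)"
  unfolding elem_ito_def elem_int_def
proof (rule borel_measurable_sum)
  fix i assume i: "i \<in> I"
  show "(\<lambda>w. \<zeta> i w *v (B (min (b i) u) w - B (min (a i) u) w)) \<in> borel_measurable (F u)"
  proof (cases "min (a i) u < min (b i) u")
    case True
    note el' = elementary_truncate[OF el u]
    show ?thesis
      by (intro increment_F_measurable elementaryD(2)[OF el' i] elementaryD(3)[OF el' i] elementaryD(5)[OF el' i] True) simp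
  next
    case False
    then have "min (b i) u = min (a i) u" using elementaryD(3)[OF el i] by (auto simp: min_def split: if_splits)
    then show ?thesis by simp
  qed
qed

lemma elem_ito_msq_finite:
  assumes el: "elementary I a b \<zeta>" and u: "0 \<le> u"
  shows "msq M (elem_ito I a b \<zeta> u) < \<infinity>"
  unfolding elem_ito_def using elementary_int_msq[OF elementary_truncate[OF assms]] by simp

text \<open>Clamping all end points to \<open>[s, u]\<close> by \<open>?c\<close> turns the
  difference into a sum of increments that start at \<open>s\<close> or later, each orthogonal to
  \<open>Y\<close>. This form of the martingale property is all that the maximal inequality uses, so
  no conditional expectation of the integral is needed.\<close>

lemma elem_ito_orthogonal:
  fixes Y :: "'w \<Rightarrow> real^'m"
  assumes el: "elementary I a b \<zeta>" and su: "0 \<le> s" "s \<le> u"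
    and Y: "Y \<in> borel_measurable (F s)" "msq M Y < \<infinity>"
  shows "has_bochner_integral M (\<lambda>w. Y w \<bullet> (elem_ito I a b \<zeta> u w - elem_ito I a b \<zeta> s w)) 0"
proof -
  obtain K where K: "\<And>i w. i \<in> I \<Longrightarrow> w \<in> space M \<Longrightarrow> norm (\<zeta> i w) \<le> K"
    using elementaryD(6)[OF el] by blast
  let ?c = "\<lambda>x. max s (min u x)"
  have eq: "elem_ito I a b \<zeta> u w - elem_ito I a b \<zeta> s w = (\<Sum>i\<in>I. \<zeta> i w *v (B (?c (b i)) w - B (?c (a i)) w))" for w
  proof -
    have *: "B (min x u) w - B (min x s) w = B (?c x) w - B s w" for x
    proof (cases "s = u")
      case False
      then show ?thesis using su by (cases "x \<le> s") (auto simp: min_def max_def)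
    qed simp
    have "elem_ito I a b \<zeta> u w - elem_ito I a b \<zeta> s w = (\<Sum>i\<in>I. \<zeta> i w *v (B (min (b i) u) w - B (min (a i) u) w)
       - \<zeta> i w *v (B (min (b i) s) w - B (min (a i) s) w))"
      by (simp add: elem_ito_def elem_int_def sum_subtractf)
    also have "\<dots> = (\<Sum>i\<in>I. \<zeta> i w *v ((B (min (b i) u) w - B (min (b i) s) w) - (B (min (a i) u) w - B (min (a i) s) w)))"
      by (intro sum.cong) (auto simp: matrix_vector_mult_diff_distrib algebra_simps)
    also have "\<dots> = (\<Sum>i\<in>I. \<zeta> i w *v (B (?c (b i)) w - B (?c (a i)) w))"
      unfolding * by simp
    finally show ?thesis .
  qed
  have "has_bochner_integral M (\<lambda>w. \<Sum>i\<in>I. Y w \<bullet> (\<zeta> i w *v (B (?c (b i)) w - B (?c (a i)) w))) (\<Sum>i\<in>I. 0)"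
  proof (intro has_bochner_integral_sum)
    fix i assume i: "i \<in> I"
    show "has_bochner_integral M (\<lambda>w. Y w \<bullet> (\<zeta> i w *v (B (?c (b i)) w - B (?c (a i)) w))) 0"
    proof (cases "?c (a i) < ?c (b i)")
      case True
      then have *: "a i \<le> ?c (a i)" "a i < b i" by (auto simp: max_def min_def split: if_splits)
      then have "\<zeta> i \<in> borel_measurable (F (?c (a i)))"
        by (intro F_measurable_mono[OF elementaryD(5)[OF el i]])
      moreover have "Y \<in> borel_measurable (F (?c (a i)))" using Y(1) by (rule F_measurable_mono) simp
      moreover have "0 \<le> ?c (a i)" "?c (a i) \<le> ?c (b i)" using True su by linarith+
      ultimately show ?thesis
        by (intro orthogonal_increment[where K=K] K i Y(2))
    next
      case False
      have "?c (a i) \<le> ?c (b i)" using elementaryD(3)[OF el i] by (auto simp: max_def min_def)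
      with False have "?c (b i) = ?c (a i)" unfolding not_less by (rule antisym)
      then show ?thesis by (simp add: has_bochner_integral_zero)
    qed
  qed
  then show ?thesis by (simp add: eq inner_sum_right)
qed

lemma elem_ito_continuous: "elementary I a b \<zeta> \<Longrightarrow> AE w in M. continuous_on {0..} (\<lambda>u. elem_ito I a b \<zeta> u w)"
proof -
  assume el: "elementary I a b \<zeta>"
  have "AE w in M. continuous_on {0..} (\<lambda>t. B t w)" using brownian by (simp add: brownian_motion_def)
  then show ?thesis
  proof eventually_elim
    case (elim w)
    have c: "continuous_on {0..} (\<lambda>u. B (min x u) w)" if "0 \<le> x" for x
      using that by (intro continuous_on_compose2[OF elim]) (auto intro!: continuous_intros)
    show ?case
      unfolding elem_ito_def elem_int_def
      using elementaryD(2,3)[OF el]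
      by (intro continuous_on_sum bounded_linear.continuous_on[OF matrix_vector_mul_bounded_linear] continuous_on_diff c)
        (auto intro: order_trans)
  qed
qed

end

section \<open>A maximal inequality\<close>

context prob_space
begin

text \<open>The events that the level \<open>l\<close> is exceeded for the first time at \<open>\<tau> k\<close> are disjoint, and on each of
  them \<open>|N (\<tau> m)|\<^sup>2\<close> dominates \<open>l\<^sup>2\<close> plus a multiple of an increment that is orthogonal to the past.\<close>

lemma discrete_maximal_inequality:
  fixes N :: "real \<Rightarrow> 'a \<Rightarrow> 'b::euclidean_space" and G :: "real \<Rightarrow> 'a measure" and \<tau> :: "nat \<Rightarrow> real"
  assumes sub: "\<And>t. 0 \<le> t \<Longrightarrow> subalgebra M (G t)"
    and mono: "\<And>s t. 0 \<le> s \<Longrightarrow> s \<le> t \<Longrightarrow> sets (G s) \<subseteq> sets (G t)"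
    and meas: "\<And>t. 0 \<le> t \<Longrightarrow> N t \<in> borel_measurable (G t)"
    and fin: "\<And>t. 0 \<le> t \<Longrightarrow> msq M (N t) < \<infinity>"
    and orth: "\<And>s u Y. 0 \<le> s \<Longrightarrow> s \<le> u \<Longrightarrow> Y \<in> borel_measurable (G s) \<Longrightarrow> msq M Y < \<infinity> \<Longrightarrow>
      has_bochner_integral M (\<lambda>w. Y w \<bullet> (N u w - N s w)) 0"
    and \<tau>: "mono \<tau>" "0 \<le> \<tau> 0" and l: "0 < l"
  shows "{w \<in> space M. \<exists>k\<le>m. l < norm (N (\<tau> k) w)} \<in> events"
    and "ennreal (l\<^sup>2) * emeasure M {w \<in> space M. \<exists>k\<le>m. l < norm (N (\<tau> k) w)} \<le> msq M (N (\<tau> m))"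
proof -
  have \<tau>0: "0 \<le> \<tau> k" for k by (rule order_trans[OF \<tau>(2) monoD[OF \<tau>(1) le0]])
  have Nm [measurable]: "N (\<tau> k) \<in> borel_measurable M" for k
    by (rule measurable_from_subalg[OF sub[OF \<tau>0] meas[OF \<tau>0]])
  have spG: "space (G (\<tau> k)) = space M" for k using sub[OF \<tau>0] by (simp add: subalgebra_def)
  define A where "A k = {w \<in> space M. l < norm (N (\<tau> k) w) \<and> (\<forall>j\<in>{..<k}. norm (N (\<tau> j) w) \<le> l)}" for k
  define E where "E = {w \<in> space M. \<exists>k\<le>m. l < norm (N (\<tau> k) w)}"
  have AG: "A k \<in> sets (G (\<tau> k))" for k
  proof -
    have NG: "N (\<tau> j) \<in> borel_measurable (G (\<tau> k))" if "j \<le> k" for j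
      using sub[OF \<tau>0] mono[OF \<tau>0 monoD[OF \<tau>(1) that]]
      by (intro measurable_from_subalg[OF _ meas[OF \<tau>0]]) (simp add: subalgebra_def)
    have "{w \<in> space (G (\<tau> k)). l < norm (N (\<tau> k) w)} \<in> sets (G (\<tau> k))"
      using sets_Collect_in[OF NG, of k "{x. l < norm x}"] by simp
    moreover have "{w \<in> space (G (\<tau> k)). \<forall>j\<in>{..<k}. norm (N (\<tau> j) w) \<le> l} \<in> sets (G (\<tau> k))"
      using sets_Collect_in[OF NG, of _ "{x. norm x \<le> l}"] by (intro sets.sets_Collect_finite_All) simp_all
    ultimately have "{w \<in> space (G (\<tau> k)). l < norm (N (\<tau> k) w)} \<inter> {w \<in> space (G (\<tau> k)). \<forall>j\<in>{..<k}. norm (N (\<tau> j) w) \<le> l} \<in> sets (G (\<tau> k))"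
      by (rule sets.Int)
    moreover have "{w \<in> space (G (\<tau> k)). l < norm (N (\<tau> k) w)} \<inter> {w \<in> space (G (\<tau> k)). \<forall>j\<in>{..<k}. norm (N (\<tau> j) w) \<le> l} = A k"
      by (auto simp: A_def spG)
    ultimately show ?thesis by simp
  qed
  have E: "E \<in> events" unfolding E_def by measurable
  show "{w \<in> space M. \<exists>k\<le>m. l < norm (N (\<tau> k) w)} \<in> events" using E by (simp add: E_def)
  define Y where "Y k w = indicator (A k) w *\<^sub>R N (\<tau> k) w" for k w
  have Y: "Y k \<in> borel_measurable (G (\<tau> k))" for k
    unfolding Y_def using AG meas[OF \<tau>0] by (intro borel_measurable_scaleR borel_measurable_indicator)
  have Yfin: "msq M (Y k) < \<infinity>" for k
  proof -
    have "msq M (Y k) \<le> msq M (N (\<tau> k))" by (intro msq_mono AE_I2) (auto simp: Y_def indicator_def)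
    then show ?thesis using fin[OF \<tau>0, of k] by (rule le_less_trans)
  qed
  define S where "S w = (\<Sum>k\<le>m. Y k w \<bullet> (N (\<tau> m) w - N (\<tau> k) w))" for w
  have S: "has_bochner_integral M S 0"
  proof -
    have "has_bochner_integral M S (\<Sum>k\<le>m. 0)"
      unfolding S_def using monoD[OF \<tau>(1)] by (intro has_bochner_integral_sum orth Y Yfin \<tau>0) auto
    then show ?thesis by simp
  qed
  have pt: "l\<^sup>2 * indicator E w + 2 * S w \<le> (norm (N (\<tau> m) w))\<^sup>2" if w: "w \<in> space M" for w
  proof (cases "w \<in> E")
    case False
    then have "S w = 0" using w by (auto simp: S_def Y_def A_def E_def intro!: sum.neutral)
    then show ?thesis using False by simp
  next
    case True
    \<comment> \<open>At the first crossing \<open>k\<close> the sum \<open>S w\<close> reduces to a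
      single term. It is half of the cross term in the expansion of the squared norm of
      \<open>N (\<tau> m) w\<close> around \<open>N (\<tau> k) w\<close>.\<close>
    define k where "k = (LEAST k. l < norm (N (\<tau> k) w))"
    obtain k' where k': "k' \<le> m" "l < norm (N (\<tau> k') w)" using True by (auto simp: E_def)
    have k: "l < norm (N (\<tau> k) w)" "k \<le> m"
      unfolding k_def using k' by (auto intro: LeastI order_trans[OF Least_le])
    have first: "norm (N (\<tau> j) w) \<le> l" if "j < k" for j
      using not_less_Least[of j "\<lambda>k. l < norm (N (\<tau> k) w)"] that by (simp add: k_def)
    have ind: "indicator (A j) w = (if j = k then 1 else 0 :: real)" if "j \<le> m" for j
    proof -
      have "w \<in> A j \<longleftrightarrow> j = k"
        using k first w unfolding A_def by (cases j k rule: linorder_cases) (auto simp: not_less[symmetric])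
      then show ?thesis by (simp add: indicator_def)
    qed
    have "S w = (\<Sum>j\<le>m. if j = k then N (\<tau> k) w \<bullet> (N (\<tau> m) w - N (\<tau> k) w) else 0)"
      unfolding S_def by (intro sum.cong) (auto simp: Y_def ind)
    also have "\<dots> = N (\<tau> k) w \<bullet> (N (\<tau> m) w - N (\<tau> k) w)" using k by (simp add: sum.delta)
    finally have Sw: "S w = N (\<tau> k) w \<bullet> (N (\<tau> m) w - N (\<tau> k) w)" .
    have "(norm (N (\<tau> m) w))\<^sup>2 = (norm (N (\<tau> k) w))\<^sup>2 + 2 * S w + (norm (N (\<tau> m) w - N (\<tau> k) w))\<^sup>2"
      unfolding Sw power2_norm_eq_inner by (simp add: inner_diff_left inner_diff_right inner_commute)
    moreover have "l\<^sup>2 \<le> (norm (N (\<tau> k) w))\<^sup>2" using k l by (intro power_mono) auto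
    moreover have "l\<^sup>2 * indicator E w = l\<^sup>2" using True by simp
    ultimately show ?thesis using zero_le_power2[of "norm (N (\<tau> m) w - N (\<tau> k) w)"] by linarith
  qed
  have I: "integrable M (\<lambda>w. (norm (N (\<tau> m) w))\<^sup>2)" using fin[OF \<tau>0, of m] by (intro msq_integrable(2)) auto
  have hb: "has_bochner_integral M (\<lambda>w. l\<^sup>2 * indicator E w + 2 * S w) (l\<^sup>2 * prob E + 2 * 0)"
    by (intro has_bochner_integral_add has_bochner_integral_mult_right has_bochner_integral_real_indicator E S)
      (simp add: emeasure_eq_measure)
  then have "l\<^sup>2 * prob E = (\<integral>w. l\<^sup>2 * indicator E w + 2 * S w \<partial>M)"
    unfolding has_bochner_integral_iff by simp
  also have "\<dots> \<le> (\<integral>w. (norm (N (\<tau> m) w))\<^sup>2 \<partial>M)"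
    using hb I pt unfolding has_bochner_integral_iff by (intro integral_mono) auto
  finally have "ennreal (l\<^sup>2 * prob E) \<le> msq M (N (\<tau> m))"
    unfolding msq_eq_integral[OF I] by (rule ennreal_leI)
  then show "ennreal (l\<^sup>2) * emeasure M {w \<in> space M. \<exists>k\<le>m. l < norm (N (\<tau> k) w)} \<le> msq M (N (\<tau> m))"
    unfolding E_def[symmetric] by (simp add: emeasure_eq_measure ennreal_mult)
qed

text \<open>Dyadic grids are nested, so the exceedance events increase and the discrete bound passes
  to their union. Off that union the norm is at most \<open>l\<close> at all dyadic times, and this
  closed condition extends to all times by continuity.\<close>

theorem maximal_inequality:
  fixes N :: "real \<Rightarrow> 'a \<Rightarrow> 'b::euclidean_space" and G :: "real \<Rightarrow> 'a measure"
  assumes sub: "\<And>t. 0 \<le> t \<Longrightarrow> subalgebra M (G t)"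
    and mono: "\<And>s t. 0 \<le> s \<Longrightarrow> s \<le> t \<Longrightarrow> sets (G s) \<subseteq> sets (G t)"
    and meas: "\<And>t. 0 \<le> t \<Longrightarrow> N t \<in> borel_measurable (G t)"
    and fin: "\<And>t. 0 \<le> t \<Longrightarrow> msq M (N t) < \<infinity>"
    and orth: "\<And>s u Y. 0 \<le> s \<Longrightarrow> s \<le> u \<Longrightarrow> Y \<in> borel_measurable (G s) \<Longrightarrow> msq M Y < \<infinity> \<Longrightarrow>
      has_bochner_integral M (\<lambda>w. Y w \<bullet> (N u w - N s w)) 0"
    and cont: "AE w in M. continuous_on {0..T} (\<lambda>t. N t w)"
    and T: "0 < T" and l: "0 < l"
  shows "\<exists>A\<in>events. ennreal (l\<^sup>2) * emeasure M A \<le> msq M (N T) \<and>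
    (AE w in M. w \<notin> A \<longrightarrow> (\<forall>t\<in>{0..T}. norm (N t w) \<le> l))"
proof -
  define E where "E n = {w \<in> space M. \<exists>k\<le>2^n. l < norm (N (node 0 T (2^n) k) w)}" for n :: nat
  have nodes: "mono (node 0 T (2^n))" "0 \<le> node 0 T (2^n) 0" for n :: nat
    using T by (auto intro!: monoI node_mono)
  note dm = discrete_maximal_inequality[of G N, OF sub mono meas fin orth nodes l]
  have E: "E n \<in> events" for n
    unfolding E_def by (rule dm(1)) auto
  have Ele: "ennreal (l\<^sup>2) * emeasure M (E n) \<le> msq M (N T)" for n
  proof -
    have "ennreal (l\<^sup>2) * emeasure M (E n) \<le> msq M (N (node 0 T (2^n) (2^n)))"
      unfolding E_def by (rule dm(2)) auto
    then show ?thesis using node_last[of "2^n" 0 T] by simp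
  qed
  have inc: "incseq E"
  proof (rule incseq_SucI)
    fix n
    have "node 0 T (2 ^ n) k = node 0 T (2 ^ Suc n) (2 * k)" for k
      by (simp add: node_def field_simps)
    then have "w \<in> space M \<and> (\<exists>k\<le>2^Suc n. l < norm (N (node 0 T (2^Suc n) k) w))"
      if "w \<in> space M" "k \<le> 2^n" "l < norm (N (node 0 T (2^n) k) w)" for w k
      using that by (intro conjI exI[of _ "2 * k"]) auto
    then show "E n \<subseteq> E (Suc n)"
      unfolding E_def by blast
  qed
  show ?thesis
  proof (intro bexI[of _ "\<Union>n. E n"] conjI)
    show "(\<Union>n. E n) \<in> events" using E by auto
    have "(\<lambda>n. ennreal (l\<^sup>2) * emeasure M (E n)) \<longlonglongrightarrow> ennreal (l\<^sup>2) * emeasure M (\<Union>n. E n)"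
      using E inc by (intro ennreal_tendsto_cmult Lim_emeasure_incseq) auto
    then show "ennreal (l\<^sup>2) * emeasure M (\<Union>n. E n) \<le> msq M (N T)"
      by (rule LIMSEQ_le_const2) (use Ele in auto)
    show "AE w in M. w \<notin> (\<Union>n. E n) \<longrightarrow> (\<forall>t\<in>{0..T}. norm (N t w) \<le> l)"
      using cont AE_space
    proof eventually_elim
      case (elim w)
      show ?case
      proof (intro impI ballI)
        fix t assume w: "w \<notin> (\<Union>n. E n)" and t: "t \<in> {0..T}"
        define s where "s n = node 0 T (2^n) (cell 0 T (2^n) t)" for n :: nat
        have s: "s n \<le> t" "0 \<le> s n" for n
          using node_cell_le[of 0 T "2^n" t] T t by (auto simp: s_def intro!: node_ge)
        have "s \<longlonglongrightarrow> t" unfolding s_def by (rule node_cell_tendsto[OF T t])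
        moreover have "\<forall>n. s n \<in> {0..T}" using s t by (auto intro: order_trans)
        ultimately have "(\<lambda>n. N (s n) w) \<longlonglongrightarrow> N t w"
          using elim(1) t unfolding continuous_on_sequentially by (auto simp: comp_def)
        then have "(\<lambda>n. norm (N (s n) w)) \<longlonglongrightarrow> norm (N t w)" by (rule tendsto_norm)
        moreover have "norm (N (s n) w) \<le> l" for n
        proof -
          have "cell 0 T (2^n) t \<le> 2^n" using cell_less[of 0 T "2^n" t] T t by simp
          then show ?thesis using w elim(2) unfolding E_def s_def by (auto simp: not_less)
        qed
        ultimately show "norm (N t w) \<le> l" by (intro LIMSEQ_le_const2) auto
      qed
    qed
  qed
qed

end

section \<open>The Ito integral\<close>

lemma (in complete_measure) borel_measurable_cong_AE:
  fixes f g :: "'a \<Rightarrow> 'b::topological_space"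
  assumes f: "f \<in> borel_measurable M" and AE: "AE w in M. f w = g w"
  shows "g \<in> borel_measurable M"
proof (rule measurableI)
  fix A :: "'b set" assume A: "A \<in> sets borel"
  obtain N where N: "N \<in> null_sets M" "{w \<in> space M. f w \<noteq> g w} \<subseteq> N"
    using AE by (auto simp: eventually_ae_filter)
  have "g -` A \<inter> N \<inter> space M \<in> null_sets M"
    using complete2[of "g -` A \<inter> N \<inter> space M" N] N(1) by auto
  then have "g -` A \<inter> N \<inter> space M \<in> sets M" by auto
  moreover have "f -` A \<inter> space M - N \<in> sets M"
    using measurable_sets[OF f A] N(1) by auto
  moreover have "g -` A \<inter> space M = (f -` A \<inter> space M - N) \<union> (g -` A \<inter> N \<inter> space M)"
    using N(2) by auto
  ultimately show "g -` A \<inter> space M \<in> sets M" by auto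
qed simp

lemma complete_measure_completion: "complete_measure (completion M)"
  by standard

lemma msq_completion: "msq (completion M) f = msq M f"
  by (simp add: msq_def nn_integral_completion)

lemma (in prob_space) msq_strip_restrict:
  fixes f :: "real \<times> 'a \<Rightarrow> 'b::euclidean_space"
  assumes [measurable]: "f \<in> borel_measurable (strip 0 u M)" "f \<in> borel_measurable (strip 0 T M)" and u: "u \<le> T"
  shows "msq (strip 0 u M) f = msq (strip 0 T M) (\<lambda>p. indicator {0..u} (fst p) *\<^sub>R f p)"
proof -
  have m: "(\<lambda>p. indicator {0..u} (fst p) :: real) \<in> borel_measurable (strip 0 T M)"
    by (rule measurable_compose[OF measurable_fst]) (simp add: measurable_restrict_space1)
  have "msq (strip 0 u M) f = (\<integral>\<^sup>+t. msq M (\<lambda>w. f (t, w)) * indicator {0..u} t \<partial>lborel)"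
    by (rule msq_strip) measurable
  also have "\<dots> = (\<integral>\<^sup>+t. msq M (\<lambda>w. indicator {0..u} t *\<^sub>R f (t, w)) * indicator {0..T} t \<partial>lborel)"
    using u by (intro nn_integral_cong) (auto simp: indicator_def)
  also have "\<dots> = msq (strip 0 T M) (\<lambda>p. indicator {0..u} (fst p) *\<^sub>R f p)"
    using m by (subst msq_strip) auto
  finally show ?thesis .
qed

context brownian_basis
begin

section \<open>Rules for the Ito integral, and its construction\<close>

lemma simple_elementary:
  assumes "simple_integrand M F n \<tau> \<zeta>"
  shows "elementary {..<n} \<tau> (\<lambda>i. \<tau> (Suc i)) \<zeta>"
  unfolding elementary_def
proof (intro conjI ballI impI)
  have s: "0 \<le> \<tau> 0" "\<And>i. i < n \<Longrightarrow> \<tau> i \<le> \<tau> (Suc i)" "\<And>i. i < n \<Longrightarrow> \<zeta> i \<in> borel_measurable (F (\<tau> i))"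
    "\<exists>K. \<forall>i<n. \<forall>\<omega>\<in>space M. norm (\<zeta> i \<omega>) \<le> K"
    using assms unfolding simple_integrand_def by blast+
  show "finite {..<n}" by simp
  show "\<exists>K. \<forall>i\<in>{..<n}. \<forall>w\<in>space M. norm (\<zeta> i w) \<le> K" using s(4) by (simp add: Ball_def)
  fix i assume "i \<in> {..<n}"
  then have i: "i < n" by simp
  then show "0 \<le> \<tau> i"
  proof (induction i)
    case (Suc i)
    then show ?case using s(2)[of i] by simp
  qed (rule s(1))
  show "\<tau> i \<le> \<tau> (Suc i)" by (rule s(2)[OF i])
  show "\<zeta> i \<in> borel_measurable (F (\<tau> i))" by (rule s(3)[OF i])
  show "\<zeta> i \<in> borel_measurable M" by (rule F_measurable_M[OF s(3)[OF i]])
qed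

lemma simple_ito_eq: "simple_ito B n \<tau> \<zeta> u = elem_ito {..<n} \<tau> (\<lambda>i. \<tau> (Suc i)) \<zeta> u"
  by (simp add: fun_eq_iff simple_ito_def elem_ito_def elem_int_def)

lemma simple_process_eq: "simple_process n \<tau> \<zeta> = elem_proc {..<n} \<tau> (\<lambda>i. \<tau> (Suc i)) \<zeta>"
  by (simp add: fun_eq_iff simple_process_def elem_proc_def)

lemma elementary_diff:
  assumes I: "elementary I a b \<zeta>" and J: "elementary J c d \<eta>"
  shows "elementary (I <+> J) (case_sum a c) (case_sum b d) (case_sum \<zeta> (\<lambda>j w. - \<eta> j w))"
  unfolding elementary_def
proof (intro conjI ballI impI)
  show "finite (I <+> J)" using elementaryD(1)[OF I] elementaryD(1)[OF J] by simp
  obtain K L where K: "\<And>i w. i \<in> I \<Longrightarrow> w \<in> space M \<Longrightarrow> norm (\<zeta> i w) \<le> K"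
    and L: "\<And>i w. i \<in> J \<Longrightarrow> w \<in> space M \<Longrightarrow> norm (\<eta> i w) \<le> L"
    using elementaryD(6)[OF I] elementaryD(6)[OF J] by blast
  show "\<exists>K. \<forall>i\<in>I <+> J. \<forall>w\<in>space M. norm (case_sum \<zeta> (\<lambda>j w. - \<eta> j w) i w) \<le> K"
    using K L by (intro exI[of _ "max K L"]) (auto simp: le_max_iff_disj)
  fix k assume "k \<in> I <+> J"
  then consider i where "k = Inl i" "i \<in> I" | j where "k = Inr j" "j \<in> J" by auto
  note k = this
  show "0 \<le> case_sum a c k" by (cases rule: k) (auto intro: elementaryD(2)[OF I] elementaryD(2)[OF J])
  show "case_sum a c k \<le> case_sum b d k" by (cases rule: k) (auto intro: elementaryD(3)[OF I] elementaryD(3)[OF J])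
  show "case_sum \<zeta> (\<lambda>j w. - \<eta> j w) k \<in> borel_measurable M"
    by (cases rule: k) (simp_all add: elementaryD(4)[OF I] elementaryD(4)[OF J])
  show "case_sum \<zeta> (\<lambda>j w. - \<eta> j w) k \<in> borel_measurable (F (case_sum a c k))" if "case_sum a c k < case_sum b d k"
  proof (cases rule: k)
    case (1 i)
    then show ?thesis using elementaryD(5)[OF I, of i] that by simp
  next
    case (2 j)
    then have "\<eta> j \<in> borel_measurable (F (c j))" using elementaryD(5)[OF J, of j] that by simp
    then show ?thesis unfolding 2 by (simp add: borel_measurable_uminus)
  qed
qed

lemma elem_ito_diff:
  assumes "finite I" "finite J"
  shows "elem_ito (I <+> J) (case_sum a c) (case_sum b d) (case_sum \<zeta> (\<lambda>j w. - \<eta> j w)) u w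
     = elem_ito I a b \<zeta> u w - elem_ito J c d \<eta> u w"
proof -
  have neg: "(- A) *v x = - (A *v x)" for A :: "real^'d^'m" and x
    using matrix_vector_mult_diff_rdistrib[of 0 A x] by simp
  show ?thesis using assms
    unfolding elem_ito_def elem_int_def by (subst sum.Plus) (simp_all add: neg sum_negf)
qed

lemma elem_proc_diff:
  assumes "finite I" "finite J"
  shows "elem_proc (I <+> J) (case_sum a c) (case_sum b d) (case_sum \<zeta> (\<lambda>j w. - \<eta> j w)) s w
     = elem_proc I a b \<zeta> s w - elem_proc J c d \<eta> s w"
  using assms unfolding elem_proc_def by (subst sum.Plus) (simp_all add: sum_negf)

lemma simple_process_measurable:
  fixes \<zeta> :: "nat \<Rightarrow> 'w \<Rightarrow> real^'d^'m"
  assumes "simple_integrand M F n \<tau> \<zeta>"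
  shows "(\<lambda>p. simple_process n \<tau> \<zeta> (fst p) (snd p)) \<in> borel_measurable (strip c d M)"
  unfolding simple_process_eq by (rule elem_proc_measurable[OF simple_elementary[OF assms]])

lemma simple_ito_isometry:
  assumes \<zeta>: "simple_integrand M F n \<tau> \<zeta>" and \<eta>: "simple_integrand M F m \<rho> \<eta>" and u: "0 \<le> u" "u \<le> T"
  shows "msq M (\<lambda>w. simple_ito B n \<tau> \<zeta> u w - simple_ito B m \<rho> \<eta> u w)
    = msq (strip 0 T M) (\<lambda>p. indicator {0..u} (fst p) *\<^sub>R (simple_process n \<tau> \<zeta> (fst p) (snd p) - simple_process m \<rho> \<eta> (fst p) (snd p)))"
proof -
  note el = elementary_diff[OF simple_elementary[OF \<zeta>] simple_elementary[OF \<eta>]]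
  have "msq M (\<lambda>w. simple_ito B n \<tau> \<zeta> u w - simple_ito B m \<rho> \<eta> u w)
    = msq (strip 0 u M) (\<lambda>p. simple_process n \<tau> \<zeta> (fst p) (snd p) - simple_process m \<rho> \<eta> (fst p) (snd p))"
    using elementary_ito_isometry[OF el u(1)]
    unfolding elem_ito_diff[OF finite_lessThan finite_lessThan, abs_def] elem_proc_diff[OF finite_lessThan finite_lessThan, abs_def]
      simple_ito_eq simple_process_eq .
  also have "\<dots> = msq (strip 0 T M) (\<lambda>p. indicator {0..u} (fst p) *\<^sub>R (simple_process n \<tau> \<zeta> (fst p) (snd p) - simple_process m \<rho> \<eta> (fst p) (snd p)))"
    using u simple_process_measurable[OF \<zeta>] simple_process_measurable[OF \<eta>]
    by (intro msq_strip_restrict borel_measurable_diff) auto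
  finally show ?thesis .
qed

lemma simple_ito_F_measurable:
  "simple_integrand M F n \<tau> \<zeta> \<Longrightarrow> 0 \<le> u \<Longrightarrow> simple_ito B n \<tau> \<zeta> u \<in> borel_measurable (F u)"
  unfolding simple_ito_eq by (rule elem_ito_F_measurable[OF simple_elementary])

text \<open>The nonnegative integral is unchanged by completion, so here the errors are measured on
  the uncompleted strip; only the measurability of \<open>\<phi>\<close> still refers to the
  completion.\<close>

lemma has_ito_integralD:
  assumes "has_ito_integral M B F T \<phi> I"
  obtains n \<tau> \<zeta> where
    "(\<lambda>p. \<phi> (fst p) (snd p)) \<in> borel_measurable (completion (strip 0 T M))"
    "\<And>t. t \<in> {0..T} \<Longrightarrow> I t \<in> borel_measurable (F t)"
    "AE \<omega> in M. continuous_on {0..T} (\<lambda>t. I t \<omega>)"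
    "\<And>k. simple_integrand M F (n k) (\<tau> k) (\<zeta> k)"
    "(\<lambda>k. msq (strip 0 T M) (\<lambda>p. \<phi> (fst p) (snd p) - simple_process (n k) (\<tau> k) (\<zeta> k) (fst p) (snd p))) \<longlonglongrightarrow> 0"
    "\<And>t. t \<in> {0..T} \<Longrightarrow> (\<lambda>k. msq M (\<lambda>w. I t w - simple_ito B (n k) (\<tau> k) (\<zeta> k) t w)) \<longlonglongrightarrow> 0"
  using assms unfolding has_ito_integral_def Let_def case_prod_beta' msq_def[symmetric] msq_completion
  by (elim conjE exE) (rule that, assumption, blast, assumption, blast, assumption, blast)

lemma has_ito_integralI:
  assumes "(\<lambda>p. \<phi> (fst p) (snd p)) \<in> borel_measurable (completion (strip 0 T M))"
    "\<And>t. t \<in> {0..T} \<Longrightarrow> I t \<in> borel_measurable (F t)"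
    "AE \<omega> in M. continuous_on {0..T} (\<lambda>t. I t \<omega>)"
    "\<And>k. simple_integrand M F (n k) (\<tau> k) (\<zeta> k)"
    "(\<lambda>k. msq (strip 0 T M) (\<lambda>p. \<phi> (fst p) (snd p) - simple_process (n k) (\<tau> k) (\<zeta> k) (fst p) (snd p))) \<longlonglongrightarrow> 0"
    "\<And>t. t \<in> {0..T} \<Longrightarrow> (\<lambda>k. msq M (\<lambda>w. I t w - simple_ito B (n k) (\<tau> k) (\<zeta> k) t w)) \<longlonglongrightarrow> 0"
  shows "has_ito_integral M B F T \<phi> I"
  using assms unfolding has_ito_integral_def Let_def case_prod_beta' msq_def[symmetric] msq_completion
  by (intro conjI ballI exI[of _ n] exI[of _ \<tau>] exI[of _ \<zeta>]) blast+

lemma has_ito_integral_cong: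
  assumes I: "has_ito_integral M B F T \<phi> I"
    and AE: "AE p in strip 0 T M. \<phi> (fst p) (snd p) = \<psi> (fst p) (snd p)"
  shows "has_ito_integral M B F T \<psi> I"
proof -
  from I obtain n \<tau> \<zeta> where *:
    "(\<lambda>p. \<phi> (fst p) (snd p)) \<in> borel_measurable (completion (strip 0 T M))"
    "\<And>t. t \<in> {0..T} \<Longrightarrow> I t \<in> borel_measurable (F t)"
    "AE \<omega> in M. continuous_on {0..T} (\<lambda>t. I t \<omega>)"
    "\<And>k. simple_integrand M F (n k) (\<tau> k) (\<zeta> k)"
    "(\<lambda>k. msq (strip 0 T M) (\<lambda>p. \<phi> (fst p) (snd p) - simple_process (n k) (\<tau> k) (\<zeta> k) (fst p) (snd p))) \<longlonglongrightarrow> 0"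
    "\<And>t. t \<in> {0..T} \<Longrightarrow> (\<lambda>k. msq M (\<lambda>w. I t w - simple_ito B (n k) (\<tau> k) (\<zeta> k) t w)) \<longlonglongrightarrow> 0"
    by (rule has_ito_integralD) (rule that)
  show ?thesis
  proof (rule has_ito_integralI[OF _ *(2-4) _ *(6)])
    show "(\<lambda>p. \<psi> (fst p) (snd p)) \<in> borel_measurable (completion (strip 0 T M))"
      by (rule complete_measure.borel_measurable_cong_AE[OF complete_measure_completion *(1) AE_completion[OF AE]])
    have "msq (strip 0 T M) (\<lambda>p. \<psi> (fst p) (snd p) - simple_process (n k) (\<tau> k) (\<zeta> k) (fst p) (snd p))
       = msq (strip 0 T M) (\<lambda>p. \<phi> (fst p) (snd p) - simple_process (n k) (\<tau> k) (\<zeta> k) (fst p) (snd p))" for k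
      using AE by (intro msq_cong) (auto elim: eventually_mono)
    then show "(\<lambda>k. msq (strip 0 T M) (\<lambda>p. \<psi> (fst p) (snd p) - simple_process (n k) (\<tau> k) (\<zeta> k) (fst p) (snd p))) \<longlonglongrightarrow> 0"
      using *(5) by simp
  qed
qed

text \<open>The isometry is applied to the simple approximants of both integrals. Two triangle
  inequalities replace \<open>I\<close> and \<open>J\<close> by simple integrals and two more
  replace the simple processes by \<open>\<phi>\<close> and \<open>\<psi>\<close>; the four
  doublings leave the factor \<open>16\<close> in place of \<open>1\<close>.\<close>

lemma has_ito_integral_msq_diff:
  assumes I: "has_ito_integral M B F T \<phi> I" and J: "has_ito_integral M B F T \<psi> J" and u: "0 \<le> u" "u \<le> T"
  shows "msq M (\<lambda>w. I u w - J u w)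
    \<le> 16 * msq (strip 0 T M) (\<lambda>p. indicator {0..u} (fst p) *\<^sub>R (\<phi> (fst p) (snd p) - \<psi> (fst p) (snd p)))"
proof -
  let ?Q = "completion (strip 0 T M)"
  from I obtain n \<tau> \<zeta> where 1:
    "(\<lambda>p. \<phi> (fst p) (snd p)) \<in> borel_measurable ?Q"
    "\<And>t. t \<in> {0..T} \<Longrightarrow> I t \<in> borel_measurable (F t)"
    "AE \<omega> in M. continuous_on {0..T} (\<lambda>t. I t \<omega>)"
    "\<And>k. simple_integrand M F (n k) (\<tau> k) (\<zeta> k)"
    "(\<lambda>k. msq (strip 0 T M) (\<lambda>p. \<phi> (fst p) (snd p) - simple_process (n k) (\<tau> k) (\<zeta> k) (fst p) (snd p))) \<longlonglongrightarrow> 0"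
    "\<And>t. t \<in> {0..T} \<Longrightarrow> (\<lambda>k. msq M (\<lambda>w. I t w - simple_ito B (n k) (\<tau> k) (\<zeta> k) t w)) \<longlonglongrightarrow> 0"
    by (rule has_ito_integralD) (rule that)
  from J obtain m \<rho> \<eta> where 2:
    "(\<lambda>p. \<psi> (fst p) (snd p)) \<in> borel_measurable ?Q"
    "\<And>t. t \<in> {0..T} \<Longrightarrow> J t \<in> borel_measurable (F t)"
    "AE \<omega> in M. continuous_on {0..T} (\<lambda>t. J t \<omega>)"
    "\<And>k. simple_integrand M F (m k) (\<rho> k) (\<eta> k)"
    "(\<lambda>k. msq (strip 0 T M) (\<lambda>p. \<psi> (fst p) (snd p) - simple_process (m k) (\<rho> k) (\<eta> k) (fst p) (snd p))) \<longlonglongrightarrow> 0"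
    "\<And>t. t \<in> {0..T} \<Longrightarrow> (\<lambda>k. msq M (\<lambda>w. J t w - simple_ito B (m k) (\<rho> k) (\<eta> k) t w)) \<longlonglongrightarrow> 0"
    by (rule has_ito_integralD) (rule that)
  have uT: "u \<in> {0..T}" using u by simp
  let ?S = "\<lambda>k. simple_ito B (n k) (\<tau> k) (\<zeta> k) u" and ?R = "\<lambda>k. simple_ito B (m k) (\<rho> k) (\<eta> k) u"
  let ?s = "\<lambda>k p. simple_process (n k) (\<tau> k) (\<zeta> k) (fst p) (snd p)" and ?r = "\<lambda>k p. simple_process (m k) (\<rho> k) (\<eta> k) (fst p) (snd p)"
  let ?\<phi> = "\<lambda>p. \<phi> (fst p) (snd p)" and ?\<psi> = "\<lambda>p. \<psi> (fst p) (snd p)"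
  let ?i = "\<lambda>p::real \<times> 'w. indicator {0..u} (fst p) :: real"
  have Sm: "?S k \<in> borel_measurable M" "?R k \<in> borel_measurable M" for k
    by (rule F_measurable_M[OF simple_ito_F_measurable[OF 1(4) u(1)]], rule F_measurable_M[OF simple_ito_F_measurable[OF 2(4) u(1)]])
  have IJm: "I u \<in> borel_measurable M" "J u \<in> borel_measurable M"
    by (rule F_measurable_M[OF 1(2)[OF uT]], rule F_measurable_M[OF 2(2)[OF uT]])
  have sm: "?s k \<in> borel_measurable ?Q" "?r k \<in> borel_measurable ?Q" for k
    by (rule measurable_completion[OF simple_process_measurable[OF 1(4)]],
        rule measurable_completion[OF simple_process_measurable[OF 2(4)]])
  have im: "?i \<in> borel_measurable ?Q"
    by (rule measurable_completion, rule measurable_compose[OF measurable_fst]) (simp add: measurable_restrict_space1)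
  define a where "a k = msq M (\<lambda>w. I u w - ?S k w)" for k
  define b where "b k = msq M (\<lambda>w. J u w - ?R k w)" for k
  define c where "c k = msq (strip 0 T M) (\<lambda>p. ?\<phi> p - ?s k p)" for k
  define d where "d k = msq (strip 0 T M) (\<lambda>p. ?\<psi> p - ?r k p)" for k
  define D where "D = msq (strip 0 T M) (\<lambda>p. ?i p *\<^sub>R (?\<phi> p - ?\<psi> p))"
  have lim: "a \<longlonglongrightarrow> 0" "b \<longlonglongrightarrow> 0" "c \<longlonglongrightarrow> 0" "d \<longlonglongrightarrow> 0"
    unfolding a_def b_def c_def d_def using 1(5) 1(6)[OF uT] 2(5) 2(6)[OF uT] by simp_all
  have main: "msq M (\<lambda>w. I u w - J u w) \<le> 2 * a k + 2 * (2 * (2 * c k + 2 * (2 * D + 2 * d k)) + 2 * b k)" for k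
  proof -
    have less: "msq ?Q (\<lambda>p. ?i p *\<^sub>R f p) \<le> msq ?Q f" for f :: "real \<times> 'w \<Rightarrow> real^'d^'e"
      by (intro msq_mono AE_I2) (auto simp: indicator_def)
    have "msq M (\<lambda>w. ?S k w - ?R k w) = msq ?Q (\<lambda>p. ?i p *\<^sub>R (?s k p - ?r k p))"
      unfolding msq_completion by (rule simple_ito_isometry[OF 1(4) 2(4) u])
    also have "\<dots> = msq ?Q (\<lambda>p. ?i p *\<^sub>R ?s k p - ?i p *\<^sub>R ?r k p)"
      by (simp add: scaleR_diff_right)
    also have "\<dots> \<le> 2 * msq ?Q (\<lambda>p. ?i p *\<^sub>R ?s k p - ?i p *\<^sub>R ?\<phi> p) + 2 * msq ?Q (\<lambda>p. ?i p *\<^sub>R ?\<phi> p - ?i p *\<^sub>R ?r k p)"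
      by (intro msq_triangle borel_measurable_scaleR im sm 1(1))
    also have "msq ?Q (\<lambda>p. ?i p *\<^sub>R ?\<phi> p - ?i p *\<^sub>R ?r k p)
        \<le> 2 * msq ?Q (\<lambda>p. ?i p *\<^sub>R ?\<phi> p - ?i p *\<^sub>R ?\<psi> p) + 2 * msq ?Q (\<lambda>p. ?i p *\<^sub>R ?\<psi> p - ?i p *\<^sub>R ?r k p)"
      by (intro msq_triangle borel_measurable_scaleR im sm 1(1) 2(1))
    also have "msq ?Q (\<lambda>p. ?i p *\<^sub>R ?\<psi> p - ?i p *\<^sub>R ?r k p) \<le> d k"
      unfolding scaleR_diff_right[symmetric] d_def using less[of "\<lambda>p. ?\<psi> p - ?r k p"] by (simp only: msq_completion)
    also have "msq ?Q (\<lambda>p. ?i p *\<^sub>R ?s k p - ?i p *\<^sub>R ?\<phi> p) \<le> c k"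
      unfolding scaleR_diff_right[symmetric] c_def using less[of "\<lambda>p. ?s k p - ?\<phi> p"]
      by (simp only: msq_completion msq_minus_commute[of _ "?s k"])
    also have "msq ?Q (\<lambda>p. ?i p *\<^sub>R ?\<phi> p - ?i p *\<^sub>R ?\<psi> p) = D"
      unfolding scaleR_diff_right[symmetric] D_def by (simp only: msq_completion)
    finally have *: "msq M (\<lambda>w. ?S k w - ?R k w) \<le> 2 * c k + 2 * (2 * D + 2 * d k)"
      by (simp add: add_mono mult_left_mono)
    have "msq M (\<lambda>w. I u w - J u w) \<le> 2 * a k + 2 * msq M (\<lambda>w. ?S k w - J u w)"
      unfolding a_def by (intro msq_triangle IJm Sm)
    also have "msq M (\<lambda>w. ?S k w - J u w) \<le> 2 * msq M (\<lambda>w. ?S k w - ?R k w) + 2 * msq M (\<lambda>w. ?R k w - J u w)"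
      by (intro msq_triangle IJm Sm)
    also have "msq M (\<lambda>w. ?R k w - J u w) = b k" unfolding b_def by (rule msq_minus_commute)
    also note *
    finally show ?thesis by (simp add: add_mono mult_left_mono)
  qed
  have "(\<lambda>k. 2 * a k + 2 * (2 * (2 * c k + 2 * (2 * D + 2 * d k)) + 2 * b k)) \<longlonglongrightarrow>
      2 * 0 + 2 * (2 * (2 * 0 + 2 * (2 * D + 2 * 0)) + 2 * 0)"
    by (intro tendsto_intros ennreal_tendsto_cmult lim) auto
  then have "msq M (\<lambda>w. I u w - J u w) \<le> 2 * 0 + 2 * (2 * (2 * 0 + 2 * (2 * D + 2 * 0)) + 2 * 0)"
    by (rule LIMSEQ_le_const) (use main in auto)
  also have "\<dots> = 16 * D" by (simp add: mult.assoc[symmetric])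
  finally show ?thesis unfolding D_def .
qed

lemma has_ito_integral_zero: "has_ito_integral M B F T (\<lambda>s w. 0 :: real^'d^'m) (\<lambda>t w. 0)"
proof (rule has_ito_integralI[where n="\<lambda>_. 0" and \<tau>="\<lambda>_ _. 0" and \<zeta>="\<lambda>_ _ _. 0"])
qed (auto simp: simple_integrand_def simple_process_def simple_ito_def)

text \<open>The effort goes into a continuous version. By the maximal inequality and Borel-Cantelli,
  consecutive simple integrals eventually differ by at most \<open>(1/2)^k\<close> uniformly in
  time, so almost every path is a uniform limit of continuous ones.\<close>

theorem has_ito_integral_exists:
  fixes \<psi> :: "real \<times> 'w \<Rightarrow> real^'d^'m"
  assumes T: "0 < T" and \<psi>: "\<psi> \<in> borel_measurable (strip 0 T M)" and fin: "msq (strip 0 T M) \<psi> < \<infinity>"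
    and adapted: "AE t in restrict_space lborel {0..T}. (\<lambda>w. \<psi> (t, w)) \<in> borel_measurable (F t)"
  shows "\<exists>I. has_ito_integral M B F T (\<lambda>s w. \<psi> (s, w)) I"
proof -
  \<comment> \<open>The maximal inequality at level \<open>(1/2)^k\<close> divides by
    \<open>(1/4)^k\<close>. Errors of order \<open>(1/16)^k\<close> leave probabilities of order
    \<open>(1/4)^k\<close>, which are summable.\<close>
  define e where "e k = (1/16::real)^k" for k :: nat
  have e: "0 < e k" for k by (simp add: e_def)
  define Q where "Q k n \<eta> \<longleftrightarrow> 0 < n \<and> (\<forall>i. \<eta> i \<in> borel_measurable (F (node 0 T n i))) \<and> (\<exists>K. \<forall>i w. norm (\<eta> i w) \<le> K) \<and>
    msq (strip 0 T M) (\<lambda>p. \<psi> p - \<eta> (cell 0 T n (fst p)) (snd p)) \<le> ennreal (e k)" for k n \<eta>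
  have "\<forall>k. \<exists>p. Q k (fst p) (snd p)"
    using adapted_step_approx[OF T subalgebra_F sets_F_mono \<psi> fin adapted e] unfolding Q_def by simp
  from choice[OF this] obtain p where p: "\<And>k. Q k (fst (p k)) (snd (p k))" by blast
  define n \<eta> where "n k = fst (p k)" and "\<eta> k = snd (p k)" for k
  have Q: "Q k (n k) (\<eta> k)" for k using p by (simp add: n_def \<eta>_def)
  have n: "0 < n k" and \<eta>F: "\<eta> k i \<in> borel_measurable (F (node 0 T (n k) i))"
    and \<eta>b: "\<exists>K. \<forall>i w. norm (\<eta> k i w) \<le> K"
    and \<eta>: "msq (strip 0 T M) (\<lambda>p. \<psi> p - \<eta> k (cell 0 T (n k) (fst p)) (snd p)) \<le> ennreal (e k)" for k i
    using Q[of k] unfolding Q_def by blast+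
  define \<tau> where "\<tau> k = node 0 T (n k)" for k
  have simple: "simple_integrand M F (n k) (\<tau> k) (\<eta> k)" for k
    unfolding simple_integrand_def \<tau>_def
  proof (intro conjI allI impI)
    show "\<exists>K. \<forall>i<n k. \<forall>\<omega>\<in>space M. norm (\<eta> k i \<omega>) \<le> K" using \<eta>b[of k] by blast
    show "\<eta> k i \<in> borel_measurable (F (node 0 T (n k) i))" for i by (rule \<eta>F)
    show "node 0 T (n k) i \<le> node 0 T (n k) (Suc i)" for i using T by (intro node_mono) auto
  qed simp
  let ?s = "\<lambda>k p. simple_process (n k) (\<tau> k) (\<eta> k) (fst p) (snd p)"
  \<comment> \<open>At time \<open>0\<close> a simple process vanishes, since its intervals are open
    on the left, whereas the step function has the value of cell \<open>0\<close>.\<close>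
  have "AE p in strip 0 T M. fst p \<noteq> 0"
  proof -
    interpret P: pair_sigma_finite "restrict_space lborel {0..T}" M by (rule pair_sigma_finite_strip)
    have "{p \<in> space (strip 0 T M). fst p \<noteq> 0} = ({0..T} - {0}) \<times> space M" by (auto simp: space_strip)
    moreover have "\<dots> \<in> sets (strip 0 T M)" by (intro pair_measureI) (auto simp: sets_restrict_space_iff)
    moreover have "AE t in restrict_space lborel {0..T}. t \<noteq> 0"
      by (subst AE_restrict_space_iff) (auto intro: AE_mp[OF AE_lborel_singleton[of 0]])
    ultimately show ?thesis by (intro P.AE_pair_measure) auto
  qed
  then have eq: "AE p in strip 0 T M. ?s k p = \<eta> k (cell 0 T (n k) (fst p)) (snd p)" for k
    using AE_space
  proof eventually_elim
    case (elim p)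
    then have t: "0 < fst p" "fst p \<le> T" by (auto simp: space_strip)
    have "?s k p = (\<Sum>i<n k. if cell 0 T (n k) (fst p) = i then \<eta> k i (snd p) else 0)"
      unfolding simple_process_def \<tau>_def
      by (intro sum.cong) (auto simp: indicator_def cell_eq_iff[OF T n t(1)])
    then show ?case using cell_less[OF T n t(2)] by (simp add: sum.delta')
  qed
  have err: "msq (strip 0 T M) (\<lambda>p. \<psi> p - ?s k p) \<le> ennreal (e k)" for k
  proof -
    have "msq (strip 0 T M) (\<lambda>p. \<psi> p - ?s k p) = msq (strip 0 T M) (\<lambda>p. \<psi> p - \<eta> k (cell 0 T (n k) (fst p)) (snd p))"
      using eq[of k] by (intro msq_cong) (auto elim: eventually_mono)
    then show ?thesis using \<eta>[of k] by simp
  qed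
  note sm = simple_process_measurable[OF simple]
  have inc: "msq (strip 0 T M) (\<lambda>p. ?s (Suc k) p - ?s k p) \<le> ennreal (4 * e k)" for k
  proof -
    have "msq (strip 0 T M) (\<lambda>p. ?s (Suc k) p - ?s k p)
       \<le> 2 * msq (strip 0 T M) (\<lambda>p. ?s (Suc k) p - \<psi> p) + 2 * msq (strip 0 T M) (\<lambda>p. \<psi> p - ?s k p)"
      by (intro msq_triangle sm \<psi>)
    also have "msq (strip 0 T M) (\<lambda>p. ?s (Suc k) p - \<psi> p) = msq (strip 0 T M) (\<lambda>p. \<psi> p - ?s (Suc k) p)"
      by (rule msq_minus_commute)
    also have "2 * \<dots> + 2 * msq (strip 0 T M) (\<lambda>p. \<psi> p - ?s k p) \<le> 2 * ennreal (e k) + 2 * ennreal (e k)"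
    proof (intro add_mono mult_left_mono err order_trans[OF err] ennreal_leI)
      show "e (Suc k) \<le> e k" by (simp add: e_def)
    qed auto
    also have "\<dots> = ennreal (4 * e k)"
      using e[of k] by (simp add: numeral_mult_ennreal ennreal_plus[symmetric] del: ennreal_plus)
    finally show ?thesis .
  qed
  let ?S = "\<lambda>k. simple_ito B (n k) (\<tau> k) (\<eta> k)"
  define N where "N k t w = ?S (Suc k) t w - ?S k t w" for k t w
  note SF = simple_ito_F_measurable[OF simple]
  have Nmsq: "msq M (N k t) \<le> ennreal (4 * e k)" if t: "0 \<le> t" "t \<le> T" for k t
  proof -
    have "msq M (N k t) = msq (strip 0 T M) (\<lambda>p. indicator {0..t} (fst p) *\<^sub>R (?s (Suc k) p - ?s k p))"
      unfolding N_def by (rule simple_ito_isometry[OF simple simple t])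
    also have "\<dots> \<le> msq (strip 0 T M) (\<lambda>p. ?s (Suc k) p - ?s k p)"
      by (intro msq_mono AE_I2) (auto simp: indicator_def)
    also note inc
    finally show ?thesis .
  qed
  let ?I = "\<lambda>k. {..<n (Suc k)} <+> {..<n k}"
  let ?a = "\<lambda>k. case_sum (\<tau> (Suc k)) (\<tau> k)" and ?b = "\<lambda>k. case_sum (\<lambda>i. \<tau> (Suc k) (Suc i)) (\<lambda>i. \<tau> k (Suc i))"
  let ?z = "\<lambda>k. case_sum (\<eta> (Suc k)) (\<lambda>j w. - \<eta> k j w)"
  have el: "elementary (?I k) (?a k) (?b k) (?z k)" for k
    by (rule elementary_diff[OF simple_elementary[OF simple] simple_elementary[OF simple]])
  have Nel: "N k = elem_ito (?I k) (?a k) (?b k) (?z k)" for k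
    unfolding N_def simple_ito_eq by (intro ext) (simp add: elem_ito_diff)
  have Ncont: "AE w in M. continuous_on {0..T} (\<lambda>t. N k t w)" for k
    using elem_ito_continuous[OF el[of k]] unfolding Nel
    by eventually_elim (erule continuous_on_subset, simp)
  have Scont: "AE w in M. continuous_on {0..T} (\<lambda>t. ?S k t w)" for k
    using elem_ito_continuous[OF simple_elementary[OF simple[of k]]] unfolding simple_ito_eq
    by eventually_elim (erule continuous_on_subset, simp)
  have max: "\<exists>A\<in>events. ennreal (((1/2)^k)\<^sup>2) * emeasure M A \<le> msq M (N k T) \<and>
      (AE w in M. w \<notin> A \<longrightarrow> (\<forall>t\<in>{0..T}. norm (N k t w) \<le> (1/2)^k))" for k
  proof (rule maximal_inequality[OF subalgebra_F sets_F_mono _ _ _ Ncont T])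
    show "N k t \<in> borel_measurable (F t)" if "0 \<le> t" for t
      unfolding Nel by (rule elem_ito_F_measurable[OF el that])
    show "msq M (N k t) < \<infinity>" if "0 \<le> t" for t
      unfolding Nel by (rule elem_ito_msq_finite[OF el that])
    show "has_bochner_integral M (\<lambda>w. Y w \<bullet> (N k u w - N k s w)) 0"
      if "0 \<le> s" "s \<le> u" "Y \<in> borel_measurable (F s)" "msq M Y < \<infinity>" for s u and Y :: "'w \<Rightarrow> real^'m"
      unfolding Nel by (rule elem_ito_orthogonal[OF el that])
  qed simp_all
  have "\<forall>k. \<exists>A. A \<in> events \<and> ennreal (((1/2)^k)\<^sup>2) * emeasure M A \<le> msq M (N k T) \<and>
      (AE w in M. w \<notin> A \<longrightarrow> (\<forall>t\<in>{0..T}. norm (N k t w) \<le> (1/2)^k))"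
    using max by (simp only: Bex_def simp_thms)
  from choice[OF this] obtain A where "\<forall>k. A k \<in> events \<and> ennreal (((1/2)^k)\<^sup>2) * emeasure M (A k) \<le> msq M (N k T) \<and>
      (AE w in M. w \<notin> A k \<longrightarrow> (\<forall>t\<in>{0..T}. norm (N k t w) \<le> (1/2)^k))" by (rule exE)
  then have A: "\<And>k. A k \<in> events" "\<And>k. ennreal (((1/2)^k)\<^sup>2) * emeasure M (A k) \<le> msq M (N k T)"
    "\<And>k. AE w in M. w \<notin> A k \<longrightarrow> (\<forall>t\<in>{0..T}. norm (N k t w) \<le> (1/2)^k)" by simp_all
  have Aprob: "prob (A k) \<le> 4 * (1/4)^k" for k
  proof -
    have "ennreal (((1/2)^k)\<^sup>2 * prob (A k)) \<le> ennreal (4 * e k)"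
      using order_trans[OF A(2)[of k] Nmsq[of T k]] T by (simp add: emeasure_eq_measure ennreal_mult)
    then have "((1/2)^k)\<^sup>2 * prob (A k) \<le> 4 * e k"
      using e[of k] by (subst (asm) ennreal_le_iff) auto
    moreover have "((1/2)^k)\<^sup>2 = (1/4::real)^k" by (simp add: power2_eq_square power_mult_distrib[symmetric])
    moreover have "e k = (1/4)^k * (1/4)^k" by (simp add: e_def power_mult_distrib[symmetric])
    ultimately have "(1/4)^k * prob (A k) \<le> (1/4)^k * (4 * (1/4)^k)" by (simp add: mult_ac)
    then show ?thesis by (subst (asm) mult_le_cancel_left_pos) auto
  qed
  have "summable (\<lambda>k. prob (A k))"
    by (rule summable_comparison_test'[of "\<lambda>k. 4 * (1/4)^k" 0]) (auto intro!: summable_mult summable_geometric Aprob)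
  then have BC: "AE w in M. eventually (\<lambda>k. w \<in> space M - A k) sequentially"
    using A(1) by (intro borel_cantelli_AE1) (auto simp: emeasure_eq_measure)
  \<comment> \<open>The limit is taken at every sample point, so that \<open>I t\<close> inherits
    the measurability for \<open>F t\<close>. Almost surely it is the sum of the uniformly
    convergent series of the \<open>N k\<close>.\<close>
  define I where "I t w = lim (\<lambda>k. ?S k t w)" for t w
  have IF: "I t \<in> borel_measurable (F t)" if "0 \<le> t" for t
    unfolding I_def by (rule borel_measurable_lim_metric) (rule SF[OF that])
  have "AE w in M. \<forall>k. w \<notin> A k \<longrightarrow> (\<forall>t\<in>{0..T}. norm (N k t w) \<le> (1/2)^k)"
    using A(3) by (simp add: AE_all_countable)
  moreover have "AE w in M. \<forall>k. continuous_on {0..T} (\<lambda>t. ?S k t w)"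
    using Scont by (simp add: AE_all_countable)
  ultimately have Icont: "AE w in M. continuous_on {0..T} (\<lambda>t. I t w)"
    using BC
  proof eventually_elim
    case (elim w)
    have "uniform_limit {0..T} (\<lambda>n t. \<Sum>i<n. N i t w) (\<lambda>t. \<Sum>i. N i t w) sequentially"
    proof (rule Weierstrass_m_test_ev)
      show "\<forall>\<^sub>F k in sequentially. \<forall>t\<in>{0..T}. norm (N k t w) \<le> (1/2)^k"
        using elim(3) by eventually_elim (use elim(1) in auto)
      show "summable (\<lambda>k. (1/2::real)^k)" by (rule summable_geometric) simp
    qed
    moreover have "(\<Sum>i<n. N i t w) = ?S n t w - ?S 0 t w" for n t
      unfolding N_def using sum_lessThan_telescope[of "\<lambda>k. ?S k t w" n] by simp
    ultimately have ul: "uniform_limit {0..T} (\<lambda>n t. ?S n t w - ?S 0 t w) (\<lambda>t. \<Sum>i. N i t w) sequentially"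
      by simp
    have c1: "continuous_on {0..T} (\<lambda>t. \<Sum>i. N i t w)"
      by (rule uniform_limit_theorem[OF _ ul]) (use elim(2) in \<open>auto intro!: always_eventually continuous_on_diff\<close>)
    have c2: "continuous_on {0..T} (\<lambda>t. (\<Sum>i. N i t w) + ?S 0 t w)"
      using elim(2) by (intro continuous_on_add c1) auto
    have Ieq: "I t w = (\<Sum>i. N i t w) + ?S 0 t w" if "t \<in> {0..T}" for t
    proof -
      have "(\<lambda>n. (?S n t w - ?S 0 t w) + ?S 0 t w) \<longlonglongrightarrow> (\<Sum>i. N i t w) + ?S 0 t w"
        by (intro tendsto_add tendsto_const tendsto_uniform_limitI[OF ul that])
      then show ?thesis unfolding I_def by (intro limI) simp
    qed
    show ?case by (rule continuous_on_eq[OF c2 Ieq[symmetric]])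
  qed
  have "has_ito_integral M B F T (\<lambda>s w. \<psi> (s, w)) I"
  proof (rule has_ito_integralI[where n=n and \<tau>=\<tau> and \<zeta>=\<eta>])
    show "(\<lambda>p. \<psi> (fst p, snd p)) \<in> borel_measurable (completion (strip 0 T M))"
      using measurable_completion[OF \<psi>] by simp
    show "I t \<in> borel_measurable (F t)" if "t \<in> {0..T}" for t using that by (intro IF) auto
    have e0: "(\<lambda>k. ennreal (C * (1/16)^k)) \<longlonglongrightarrow> 0" "(\<lambda>k. ennreal (C * (1/4)^k)) \<longlonglongrightarrow> 0" for C
      by (rule tendsto_eq_rhs[OF tendsto_ennrealI[OF tendsto_mult[OF tendsto_const LIMSEQ_power_zero]]], simp, simp)+
    show "(\<lambda>k. msq (strip 0 T M) (\<lambda>p. \<psi> (fst p, snd p) - ?s k p)) \<longlonglongrightarrow> 0"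
      by (rule tendsto_sandwich[OF _ _ tendsto_const e0(1)[of 1]])
        (use err in \<open>auto simp: e_def intro!: always_eventually\<close>)
    fix t assume t: "t \<in> {0..T}"
    have "msq M (\<lambda>w. ?S (Suc k) t w - ?S k t w) \<le> ennreal (4 * (1/4)^k)" for k
    proof -
      have "(1/16::real)^k \<le> (1/4)^k" by (intro power_mono) auto
      then have "ennreal (4 * e k) \<le> ennreal (4 * (1/4)^k)" unfolding e_def by (intro ennreal_leI) simp
      then have "msq M (N k t) \<le> ennreal (4 * (1/4)^k)"
        using t by (intro order_trans[OF Nmsq]) simp_all
      then show ?thesis unfolding N_def .
    qed
    then have *: "msq M (\<lambda>w. I t w - ?S k t w) \<le> ennreal (4 * 4 * (1/4)^k)" for k
      unfolding I_def using t by (intro msq_fast_lim F_measurable_M[OF SF]) simp_all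
    show "(\<lambda>k. msq M (\<lambda>w. I t w - ?S k t w)) \<longlonglongrightarrow> 0"
      by (rule tendsto_sandwich[OF _ _ tendsto_const e0(2)[of "4 * 4"]])
        (use * in \<open>auto intro!: always_eventually\<close>)
  qed (use simple Icont in auto)
  then show ?thesis by blast
qed

end

section \<open>Time integrals\<close>

text \<open>The Borel counterpart, for a jointly measurable integrand, of the integral over
  \<open>lebesgue\<close> in \<open>strong_solution\<close>. Tonelli and Fubini apply to it
  directly.\<close>

definition drift :: "(real \<times> 'a \<Rightarrow> 'b::euclidean_space) \<Rightarrow> real \<Rightarrow> 'a \<Rightarrow> 'b" where
  "drift f u w = (\<integral>s. f (s, w) \<partial>restrict_space lborel {0..u})"

lemma drift_measurable:
  assumes "f \<in> borel_measurable (restrict_space lborel {0..u} \<Otimes>\<^sub>M N)"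
  shows "drift f u \<in> borel_measurable N"
proof -
  interpret L: finite_measure "restrict_space lborel {0..u}" by (rule finite_measure_time)
  have "(\<lambda>(w, s). f (s, w)) \<in> borel_measurable (N \<Otimes>\<^sub>M restrict_space lborel {0..u})"
    by (rule measurable_pair_swap[OF assms])
  then have "(\<lambda>w. \<integral>s. f (s, w) \<partial>restrict_space lborel {0..u}) \<in> borel_measurable N"
    by (rule L.borel_measurable_lebesgue_integral)
  then show ?thesis unfolding drift_def[abs_def] .
qed

lemma drift_zero_time: "drift f 0 w = 0"
proof -
  have "AE s in lborel. s \<in> {0..0::real} \<longrightarrow> f (s, w) = 0"
    using AE_lborel_singleton[of "0::real"] by eventually_elim simp
  then have "AE s in restrict_space lborel {0..0::real}. f (s, w) = 0"
    by (rule AE_restrict_space_iff[THEN iffD2, rotated]) simp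
  then show ?thesis unfolding drift_def by (rule integral_eq_zero_AE)
qed

lemma strip_measurable_subset:
  assumes f: "f \<in> borel_measurable (restrict_space lborel {a..c::real} \<Otimes>\<^sub>M N)" and sub: "{a'..c'} \<subseteq> {a..c}"
  shows "f \<in> borel_measurable (restrict_space lborel {a'..c'} \<Otimes>\<^sub>M N)"
proof -
  have "(\<lambda>t. t) \<in> restrict_space lborel {a'..c'} \<rightarrow>\<^sub>M restrict_space lborel {a..c}"
    using sub by (intro measurable_restrict_space2) (auto simp: space_restrict_space measurable_restrict_space1)
  then have "(\<lambda>p. (fst p, snd p)) \<in> restrict_space lborel {a'..c'} \<Otimes>\<^sub>M N \<rightarrow>\<^sub>M restrict_space lborel {a..c} \<Otimes>\<^sub>M N"
    by (intro measurable_Pair measurable_compose[OF measurable_fst] measurable_snd)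
  from measurable_compose[OF this f] show ?thesis by simp
qed

lemma strip_measurable_mono:
  "f \<in> borel_measurable (restrict_space lborel {0..T::real} \<Otimes>\<^sub>M N) \<Longrightarrow> u \<le> T \<Longrightarrow>
    f \<in> borel_measurable (restrict_space lborel {0..u} \<Otimes>\<^sub>M N)"
  by (rule strip_measurable_subset) auto

lemma measurable_strip_time_section:
  assumes "f \<in> borel_measurable (restrict_space lborel {a..c::real} \<Otimes>\<^sub>M N)" "w \<in> space N"
  shows "(\<lambda>s. f (s, w)) \<in> borel_measurable (restrict_space lborel {a..c})"
  using assms by (intro measurable_compose[OF measurable_Pair2'])

lemma (in prob_space) msq_strip_snd:
  fixes f :: "real \<times> 'a \<Rightarrow> 'b::euclidean_space"
  assumes [measurable]: "f \<in> borel_measurable (strip a c M)"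
  shows "msq (strip a c M) f = (\<integral>\<^sup>+w. msq (restrict_space lborel {a..c}) (\<lambda>s. f (s, w)) \<partial>M)"
proof -
  interpret P: pair_sigma_finite "restrict_space lborel {a..c}" M by (rule pair_sigma_finite_strip)
  have "(\<lambda>p. ennreal ((norm (f p))\<^sup>2)) \<in> borel_measurable (strip a c M)" by measurable
  from P.nn_integral_snd[OF this] show ?thesis by (simp add: msq_def)
qed

lemma (in prob_space) time_msq_finite_AE:
  fixes f :: "real \<times> 'a \<Rightarrow> 'b::euclidean_space"
  assumes f: "f \<in> borel_measurable (strip a c M)" and fin: "msq (strip a c M) f < \<infinity>"
  shows "AE w in M. msq (restrict_space lborel {a..c}) (\<lambda>s. f (s, w)) < \<infinity>"
proof -
  interpret L: finite_measure "restrict_space lborel {a..c}" by (rule finite_measure_time)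
  have "(\<lambda>p. ennreal ((norm (f p))\<^sup>2)) \<in> borel_measurable (strip a c M)" using f by measurable
  from measurable_pair_swap[OF this]
  have "(\<lambda>w. msq (restrict_space lborel {a..c}) (\<lambda>s. f (s, w))) \<in> borel_measurable M"
    unfolding msq_def by (intro L.borel_measurable_nn_integral) (simp add: case_prod_beta')
  then have "AE w in M. msq (restrict_space lborel {a..c}) (\<lambda>s. f (s, w)) \<noteq> \<infinity>"
    using fin unfolding msq_strip_snd[OF f] by (intro nn_integral_PInf_AE) auto
  then show ?thesis by eventually_elim (simp add: less_top)
qed

text \<open>Cauchy-Schwarz in time at each sample point, then Tonelli.\<close>

lemma (in prob_space) drift_msq:
  fixes f :: "real \<times> 'a \<Rightarrow> 'b::euclidean_space"
  assumes f: "f \<in> borel_measurable (strip 0 u M)" and u: "0 \<le> u"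
  shows "msq M (drift f u) \<le> ennreal u * msq (strip 0 u M) f"
proof -
  let ?L = "restrict_space lborel {0..u}"
  interpret L: finite_measure ?L by (rule finite_measure_time)
  interpret P: pair_sigma_finite ?L M by (rule pair_sigma_finite_strip)
  have eL: "emeasure ?L (space ?L) = ennreal u"
    using u by (simp add: emeasure_restrict_space space_restrict_space)
  have m: "(\<lambda>p. ennreal ((norm (f p))\<^sup>2)) \<in> borel_measurable (strip 0 u M)" using f by measurable
  have m2: "(\<lambda>w. msq ?L (\<lambda>s. f (s, w))) \<in> borel_measurable M"
    unfolding msq_def using measurable_pair_swap[OF m]
    by (intro L.borel_measurable_nn_integral) (simp add: case_prod_beta')
  have "msq M (drift f u) \<le> (\<integral>\<^sup>+w. ennreal u * msq ?L (\<lambda>s. f (s, w)) \<partial>M)"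
    unfolding msq_def[of M] drift_def
  proof (intro nn_integral_mono)
    fix w assume w: "w \<in> space M"
    show "ennreal ((norm (\<integral>s. f (s, w) \<partial>?L))\<^sup>2) \<le> ennreal u * msq ?L (\<lambda>s. f (s, w))"
      using L.integral_sq_le[OF measurable_strip_time_section[OF f w]] unfolding eL .
  qed
  also have "\<dots> = ennreal u * msq (strip 0 u M) f"
    unfolding msq_strip_snd[OF f] by (rule nn_integral_cmult[OF m2])
  finally show ?thesis .
qed

lemma integrable_time_mono:
  fixes g :: "real \<Rightarrow> 'b::euclidean_space"
  assumes "integrable (restrict_space lborel {0..T}) g" "u \<le> T"
  shows "integrable (restrict_space lborel {0..u}) g"
proof -
  have "set_integrable lborel {0..T} g" using assms(1) by (simp add: integrable_restrict_space set_integrable_def)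
  then have "set_integrable lborel {0..u} g" by (rule set_integrable_subset) (use assms(2) in auto)
  then show ?thesis by (simp add: integrable_restrict_space set_integrable_def)
qed

text \<open>Dominated convergence: the indicators of \<open>{0..x n}\<close> converge to that of
  \<open>{0..u}\<close> at every time except possibly \<open>u\<close>.\<close>

lemma continuous_on_time_integral:
  fixes g :: "real \<Rightarrow> 'b::euclidean_space"
  assumes g: "integrable (restrict_space lborel {0..T}) g"
  shows "continuous_on {0..T} (\<lambda>u. \<integral>s. g s \<partial>restrict_space lborel {0..u})"
proof (rule continuous_on_sequentiallyI)
  fix x :: "nat \<Rightarrow> real" and u assume x: "\<forall>n. x n \<in> {0..T}" "u \<in> {0..T}" "x \<longlonglongrightarrow> u"
  define h where "h s = indicator {0..T} s *\<^sub>R g s" for s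
  have h: "integrable lborel h" using g by (simp add: integrable_restrict_space h_def[abs_def])
  have [measurable]: "h \<in> borel_measurable lborel" using h by (rule borel_measurable_integrable)
  have eq: "(\<integral>s. g s \<partial>restrict_space lborel {0..v}) = (\<integral>s. indicator {0..v} s *\<^sub>R h s \<partial>lborel)" if "v \<le> T" for v
    unfolding integral_restrict_space[of "{0..v}" lborel, simplified] h_def
    using that by (intro Bochner_Integration.integral_cong) (auto simp: indicator_def)
  have "(\<lambda>n. \<integral>s. indicator {0..x n} s *\<^sub>R h s \<partial>lborel) \<longlonglongrightarrow> (\<integral>s. indicator {0..u} s *\<^sub>R h s \<partial>lborel)"
  proof (rule integral_dominated_convergence[where w="\<lambda>s. norm (h s)"])
    show "integrable lborel (\<lambda>s. norm (h s))" using h by simp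
    show "AE s in lborel. norm (indicator {0..x n} s *\<^sub>R h s) \<le> norm (h s)" for n
      by (intro AE_I2) (auto simp: indicator_def)
    show "AE s in lborel. (\<lambda>n. indicator {0..x n} s *\<^sub>R h s) \<longlonglongrightarrow> indicator {0..u} s *\<^sub>R h s"
      using AE_lborel_singleton[of u]
    proof eventually_elim
      case (elim s)
      have "\<forall>\<^sub>F n in sequentially. indicator {0..x n} s *\<^sub>R h s = indicator {0..u} s *\<^sub>R h s"
      proof (cases "s < u")
        case True
        from order_tendstoD(1)[OF x(3) this] show ?thesis
          by eventually_elim (use True in \<open>auto simp: indicator_def\<close>)
      next
        case False
        then have "u < s" using elim by simp
        from order_tendstoD(2)[OF x(3) this] show ?thesis
          by eventually_elim (use \<open>u < s\<close> in \<open>auto simp: indicator_def\<close>)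
      qed
      then show ?case by (rule tendsto_eventually)
    qed
  qed measurable
  then show "(\<lambda>n. \<integral>s. g s \<partial>restrict_space lborel {0..x n}) \<longlonglongrightarrow> (\<integral>s. g s \<partial>restrict_space lborel {0..u})"
    using x eq by simp
qed

text \<open>\<open>h\<close> agrees with an integrable Borel function almost everywhere but need not
  be Borel itself. Completeness of \<open>lebesgue\<close> makes it measurable.\<close>

lemma lebesgue_set_integral_cong_AE:
  fixes g h :: "real \<Rightarrow> 'b::euclidean_space"
  assumes g: "integrable (restrict_space lborel {0..T}) g"
    and AE: "AE s in restrict_space lborel {0..T}. h s = g s"
  shows "set_integrable lebesgue {0..T} h"
    and "t \<le> T \<Longrightarrow> (LINT s:{0..t}|lebesgue. h s) = (\<integral>s. g s \<partial>restrict_space lborel {0..t})"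
proof -
  have AE': "AE s in lborel. s \<in> {0..T} \<longrightarrow> h s = g s" using AE by (simp add: AE_restrict_space_iff)
  have *: "integrable lebesgue (\<lambda>s. indicator {0..t} s *\<^sub>R h s) \<and>
      (\<integral>s. indicator {0..t} s *\<^sub>R h s \<partial>lebesgue) = (\<integral>s. g s \<partial>restrict_space lborel {0..t})" if t: "t \<le> T" for t
  proof -
    have gI: "integrable lborel (\<lambda>s. indicator {0..t} s *\<^sub>R g s)"
      using integrable_time_mono[OF g t] by (simp add: integrable_restrict_space)
    then have gm: "(\<lambda>s. indicator {0..t} s *\<^sub>R g s) \<in> borel_measurable lborel" by (rule borel_measurable_integrable)
    have gL: "integrable lebesgue (\<lambda>s. indicator {0..t} s *\<^sub>R g s)"
      using gI integrable_completion[OF gm] by simp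
    have eq: "AE s in lebesgue. indicator {0..t} s *\<^sub>R g s = indicator {0..t} s *\<^sub>R h s"
      using AE_completion[OF AE'] by eventually_elim (use t in \<open>auto simp: indicator_def\<close>)
    have hm: "(\<lambda>s. indicator {0..t} s *\<^sub>R h s) \<in> borel_measurable lebesgue"
      by (rule complete_measure.borel_measurable_cong_AE[OF complete_measure_completion borel_measurable_integrable[OF gL] eq])
    have "integrable lebesgue (\<lambda>s. indicator {0..t} s *\<^sub>R h s)"
      by (rule integrable_cong_AE_imp[OF gL hm]) (use eq in eventually_elim, auto)
    moreover have "(\<integral>s. indicator {0..t} s *\<^sub>R h s \<partial>lebesgue) = (\<integral>s. indicator {0..t} s *\<^sub>R g s \<partial>lebesgue)"
      by (rule integral_cong_AE[OF hm borel_measurable_integrable[OF gL]]) (use eq in eventually_elim, auto)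
    moreover have "\<dots> = (\<integral>s. g s \<partial>restrict_space lborel {0..t})"
      using integral_completion[OF gm] by (simp add: integral_restrict_space)
    ultimately show ?thesis by simp
  qed
  show "set_integrable lebesgue {0..T} h" using *[of T] by (simp add: set_integrable_def)
  show "(LINT s:{0..t}|lebesgue. h s) = (\<integral>s. g s \<partial>restrict_space lborel {0..t})" if "t \<le> T"
    using *[OF that] by (simp add: set_lebesgue_integral_def)
qed

section \<open>Adaptedness of the time integral\<close>

context brownian_basis
begin

text \<open>Fubini alone does not give this, as \<open>\<psi>\<close> restricted to times up to
  \<open>u\<close> need not be jointly measurable with respect to \<open>F u\<close>. Adapted step
  functions agree there with such functions, and their time integrals converge in mean
  square.\<close>

lemma drift_F_measurable:
  fixes \<psi> :: "real \<times> 'w \<Rightarrow> 'b::euclidean_space"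
  assumes T: "0 < T" and \<psi>: "\<psi> \<in> borel_measurable (strip 0 T M)" and fin: "msq (strip 0 T M) \<psi> < \<infinity>"
    and adapted: "AE t in restrict_space lborel {0..T}. (\<lambda>w. \<psi> (t, w)) \<in> borel_measurable (F t)"
    and u: "0 \<le> u" "u \<le> T"
  shows "drift \<psi> u \<in> borel_measurable (F u)"
proof -
  let ?L = "restrict_space lborel {0..u}"
  interpret L: finite_measure ?L by (rule finite_measure_time)
  define e where "e k = (1/2::real)^k" for k :: nat
  have e: "0 < e k" for k by (simp add: e_def)
  define Q where "Q k n \<eta> \<longleftrightarrow> 0 < n \<and> (\<forall>i. \<eta> i \<in> borel_measurable (F (node 0 T n i))) \<and> (\<exists>K. \<forall>i w. norm (\<eta> i w) \<le> K) \<and>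
    msq (strip 0 T M) (\<lambda>p. \<psi> p - \<eta> (cell 0 T n (fst p)) (snd p)) \<le> ennreal (e k)" for k n \<eta>
  have "\<forall>k. \<exists>p. Q k (fst p) (snd p)"
    using adapted_step_approx[OF T subalgebra_F sets_F_mono \<psi> fin adapted e] unfolding Q_def by simp
  from choice[OF this] obtain p where p: "\<And>k. Q k (fst (p k)) (snd (p k))" by blast
  define n \<eta> where "n k = fst (p k)" and "\<eta> k = snd (p k)" for k
  have Q: "Q k (n k) (\<eta> k)" for k using p by (simp add: n_def \<eta>_def)
  have n: "0 < n k" and \<eta>F: "\<eta> k i \<in> borel_measurable (F (node 0 T (n k) i))"
    and \<eta>b: "\<exists>K. \<forall>i w. norm (\<eta> k i w) \<le> K"
    and \<eta>: "msq (strip 0 T M) (\<lambda>p. \<psi> p - \<eta> k (cell 0 T (n k) (fst p)) (snd p)) \<le> ennreal (e k)" for k i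
    using Q[of k] unfolding Q_def by blast+
  define s where "s k p = \<eta> k (cell 0 T (n k) (fst p)) (snd p)" for k p
  have \<eta>m: "\<eta> k i \<in> borel_measurable M" for k i by (rule F_measurable_M[OF \<eta>F])
  have sm: "s k \<in> borel_measurable (strip 0 v M)" for k v
    unfolding s_def[abs_def] by (rule step_measurable[OF \<eta>m])
  have \<psi>u: "\<psi> \<in> borel_measurable (strip 0 u M)" by (rule strip_measurable_mono[OF \<psi> u(2)])
  have mono_u: "msq (strip 0 u M) f \<le> msq (strip 0 T M) f"
    if "f \<in> borel_measurable (strip 0 u M)" "f \<in> borel_measurable (strip 0 T M)" for f :: "real \<times> 'w \<Rightarrow> 'b"
    unfolding msq_strip_restrict[OF that u(2)] by (intro msq_mono AE_I2) (auto simp: indicator_def)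
  show ?thesis
  proof (rule F_measurable_limit)
    fix k
    \<comment> \<open>Cells beginning after \<open>u\<close> carry coefficients that need not be
      measurable for \<open>F u\<close>. They do not meet \<open>[0, u]\<close>, so these
      coefficients are replaced by \<open>0\<close>.\<close>
    define z where "z i w = (if node 0 T (n k) i \<le> u then \<eta> k i w else 0)" for i w
    have zF: "z i \<in> borel_measurable (F u)" for i
    proof (cases "node 0 T (n k) i \<le> u")
      case True
      have "z i = \<eta> k i" using True by (simp add: z_def fun_eq_iff)
      then show ?thesis using F_measurable_mono[OF \<eta>F True] by simp
    next
      case False
      then have "z i = (\<lambda>w. 0)" by (simp add: z_def fun_eq_iff)
      then show ?thesis by simp
    qed
    have "(\<lambda>p. z (cell 0 T (n k) (fst p)) (snd p)) \<in> borel_measurable (?L \<Otimes>\<^sub>M F u)"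
    proof (rule measurable_compose_countable[where f="\<lambda>i p. z i (snd p)"])
      show "(\<lambda>p. z i (snd p)) \<in> borel_measurable (?L \<Otimes>\<^sub>M F u)" for i
        by (rule measurable_compose[OF measurable_snd zF])
      show "(\<lambda>p. cell 0 T (n k) (fst p)) \<in> ?L \<Otimes>\<^sub>M F u \<rightarrow>\<^sub>M count_space UNIV"
        by (rule measurable_compose[OF measurable_fst]) (simp add: measurable_restrict_space1)
    qed
    then have "drift (\<lambda>p. z (cell 0 T (n k) (fst p)) (snd p)) u \<in> borel_measurable (F u)"
      by (rule drift_measurable)
    moreover have "drift (\<lambda>p. z (cell 0 T (n k) (fst p)) (snd p)) u = drift (s k) u"
    proof
      fix w
      show "drift (\<lambda>p. z (cell 0 T (n k) (fst p)) (snd p)) u w = drift (s k) u w"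
        unfolding drift_def
      proof (intro Bochner_Integration.integral_cong refl)
        fix t assume "t \<in> space ?L"
        then have t: "0 \<le> t" "t \<le> u" by (auto simp: space_restrict_space)
        have "node 0 T (n k) (cell 0 T (n k) t) \<le> u"
          using node_cell_le[OF T n t(1), of k] t by linarith
        then show "z (cell 0 T (n k) (fst (t, w))) (snd (t, w)) = s k (t, w)"
          by (simp add: z_def s_def)
      qed
    qed
    ultimately show "drift (s k) u \<in> borel_measurable (F u)" by simp
  next
    show "drift \<psi> u \<in> borel_measurable M" by (rule drift_measurable[OF \<psi>u])
    have fin_u: "msq (strip 0 u M) \<psi> < \<infinity>" using mono_u[OF \<psi>u \<psi>] fin by (rule le_less_trans)
    have bound: "msq M (\<lambda>w. drift (s k) u w - drift \<psi> u w) \<le> ennreal (T * e k)" for k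
    proof -
      obtain K where K: "\<And>i w. norm (\<eta> k i w) \<le> K" using \<eta>b[of k] by blast
      have "AE w in M. drift (s k) u w - drift \<psi> u w = drift (\<lambda>p. s k p - \<psi> p) u w"
        using time_msq_finite_AE[OF \<psi>u fin_u] AE_space
      proof eventually_elim
        case (elim w)
        have "integrable ?L (\<lambda>t. \<psi> (t, w))"
          by (rule L.msq_integrable(1)[OF measurable_strip_time_section[OF \<psi>u elim(2)] elim(1)])
        moreover have "integrable ?L (\<lambda>t. s k (t, w))"
          using K by (intro L.integrable_const_bound[of _ K] measurable_strip_time_section[OF sm elim(2)]) (auto simp: s_def)
        ultimately show ?case unfolding drift_def by simp
      qed
      then have "msq M (\<lambda>w. drift (s k) u w - drift \<psi> u w) = msq M (drift (\<lambda>p. s k p - \<psi> p) u)"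
        by (rule msq_cong)
      also have "\<dots> \<le> ennreal u * msq (strip 0 u M) (\<lambda>p. s k p - \<psi> p)"
        by (intro drift_msq borel_measurable_diff sm \<psi>u u)
      also have "\<dots> \<le> ennreal u * msq (strip 0 T M) (\<lambda>p. s k p - \<psi> p)"
        by (intro mult_left_mono mono_u borel_measurable_diff sm \<psi>u \<psi>) simp
      also have "msq (strip 0 T M) (\<lambda>p. s k p - \<psi> p) = msq (strip 0 T M) (\<lambda>p. \<psi> p - s k p)"
        by (rule msq_minus_commute)
      also have "ennreal u * \<dots> \<le> ennreal T * ennreal (e k)"
        using \<eta>[of k] u unfolding s_def by (intro mult_mono ennreal_leI) auto
      also have "\<dots> = ennreal (T * e k)" using T e[of k] by (simp add: ennreal_mult)
      finally show ?thesis .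
    qed
    have "(\<lambda>k. ennreal (T * e k)) \<longlonglongrightarrow> ennreal (T * 0)"
      unfolding e_def by (intro tendsto_ennrealI tendsto_mult tendsto_const LIMSEQ_power_zero) simp
    then have e0: "(\<lambda>k. ennreal (T * e k)) \<longlonglongrightarrow> 0" by simp
    show "(\<lambda>k. msq M (\<lambda>w. drift (s k) u w - drift \<psi> u w)) \<longlonglongrightarrow> 0"
      by (rule tendsto_sandwich[OF _ _ tendsto_const e0]) (use bound in \<open>auto intro!: always_eventually\<close>)
  qed
qed

end

section \<open>Laws and the Wasserstein distance\<close>

context prob_space
begin

text \<open>The joint law of \<open>X\<close> and \<open>Y\<close> is a coupling, and its cost is
  the mean square distance.\<close>

lemma W2_distr_le:
  fixes X Y :: "'a \<Rightarrow> 'b::euclidean_space"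
  assumes X [measurable]: "X \<in> borel_measurable M" and Y [measurable]: "Y \<in> borel_measurable M"
    and fin: "msq M (\<lambda>w. X w - Y w) < \<infinity>"
  shows "ennreal ((W2 (distr M borel X) (distr M borel Y))\<^sup>2) \<le> msq M (\<lambda>w. X w - Y w)"
proof -
  let ?c = "distr M (borel \<Otimes>\<^sub>M borel) (\<lambda>w. (X w, Y w))"
  have "?c \<in> couplings (distr M borel X) (distr M borel Y)"
    unfolding couplings_def by (auto simp: distr_distr comp_def intro!: prob_space_distr)
  then have "(INF \<pi>\<in>couplings (distr M borel X) (distr M borel Y). \<integral>\<^sup>+p. ennreal ((dist (fst p) (snd p))\<^sup>2) \<partial>\<pi>)
     \<le> (\<integral>\<^sup>+p. ennreal ((dist (fst p) (snd p))\<^sup>2) \<partial>?c)"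
    by (rule INF_lower)
  also have "\<dots> = msq M (\<lambda>w. X w - Y w)"
    by (subst nn_integral_distr) (auto simp: msq_def dist_norm)
  finally have le: "(INF \<pi>\<in>couplings (distr M borel X) (distr M borel Y). \<integral>\<^sup>+p. ennreal ((dist (fst p) (snd p))\<^sup>2) \<partial>\<pi>)
     \<le> msq M (\<lambda>w. X w - Y w)" .
  then have "enn2real (INF \<pi>\<in>couplings (distr M borel X) (distr M borel Y). \<integral>\<^sup>+p. ennreal ((dist (fst p) (snd p))\<^sup>2) \<partial>\<pi>)
     \<le> enn2real (msq M (\<lambda>w. X w - Y w))"
    using fin by (intro enn2real_mono) auto
  then have "(W2 (distr M borel X) (distr M borel Y))\<^sup>2 \<le> enn2real (msq M (\<lambda>w. X w - Y w))"
    unfolding W2_def by simp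
  then have "ennreal ((W2 (distr M borel X) (distr M borel Y))\<^sup>2) \<le> ennreal (enn2real (msq M (\<lambda>w. X w - Y w)))"
    by (rule ennreal_leI)
  then show ?thesis unfolding ennreal_enn2real[OF fin[unfolded infinity_ennreal_def]] .
qed

lemma distr_in_P2:
  fixes X :: "'a \<Rightarrow> 'b::euclidean_space"
  assumes [measurable]: "X \<in> borel_measurable M" and fin: "msq M X < \<infinity>"
  shows "distr M borel X \<in> P2"
  using fin unfolding P2_def by (auto simp: nn_integral_distr msq_def intro!: prob_space_distr)

lemma distr_zero: "distr M borel (\<lambda>w. 0 :: 'b::euclidean_space) = return borel 0"
  by (intro measure_eqI) (auto simp: emeasure_distr emeasure_space_1 indicator_def)

text \<open>Almost every law of a square integrable process is a limit in the Wasserstein distance of laws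
  that are constant in time on the cells of a partition. This replaces the measurability of
  \<open>t \<mapsto> P_{X t}\<close>.\<close>

lemma law_approximation:
  fixes X :: "real \<Rightarrow> 'a \<Rightarrow> 'b::euclidean_space"
  assumes ac: "a < c" and X: "(\<lambda>p. X (fst p) (snd p)) \<in> borel_measurable (strip a c M)"
    and fin: "msq (strip a c M) (\<lambda>p. X (fst p) (snd p)) < \<infinity>"
  shows "\<exists>(n :: nat \<Rightarrow> nat) L. (\<forall>k i. L k i \<in> P2) \<and>
    (AE t in restrict_space lborel {a..c}. (\<lambda>k. W2 (L k (cell a c (n k) t)) (distr M borel (X t))) \<longlonglongrightarrow> 0)"
proof -
  let ?L = "restrict_space lborel {a..c}"
  \<comment> \<open>The errors are summable, so for almost every \<open>t\<close> the series of mean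
    square distances is finite and its terms tend to \<open>0\<close>, without passing to a
    subsequence.\<close>
  define e where "e k = (1/4::real)^k" for k :: nat
  have e: "0 < e k" for k by (simp add: e_def)
  define Q where "Q k n \<eta> \<longleftrightarrow> (\<forall>i. \<eta> i \<in> borel_measurable M) \<and> (\<exists>K. \<forall>i. \<forall>w\<in>space M. norm (\<eta> i w) \<le> K) \<and>
     msq (strip a c M) (\<lambda>p. X (fst p) (snd p) - \<eta> (cell a c n (fst p)) (snd p)) \<le> ennreal (e k)"
    for k n and \<eta> :: "nat \<Rightarrow> 'a \<Rightarrow> 'b"
  have "\<forall>k. \<exists>p. Q k (fst p) (snd p)"
  proof
    fix k
    have "\<forall>\<^sub>F n in sequentially. \<exists>\<eta>. Q k n \<eta>"
      using step_approx_L2[OF ac X fin] e[of k] unfolding step_approx_def Q_def by blast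
    from eventually_happens'[OF sequentially_bot this] show "\<exists>p. Q k (fst p) (snd p)" by simp
  qed
  from choice[OF this] obtain p where p: "\<And>k. Q k (fst (p k)) (snd (p k))" by blast
  define n \<eta> where "n k = fst (p k)" and "\<eta> k = snd (p k)" for k
  have Q: "Q k (n k) (\<eta> k)" for k using p by (simp add: n_def \<eta>_def)
  have \<eta>m: "\<eta> k i \<in> borel_measurable M" and \<eta>b: "\<exists>K. \<forall>i. \<forall>w\<in>space M. norm (\<eta> k i w) \<le> K"
    and \<eta>: "msq (strip a c M) (\<lambda>p. X (fst p) (snd p) - \<eta> k (cell a c (n k) (fst p)) (snd p)) \<le> ennreal (e k)" for k i
    using Q[of k] unfolding Q_def by blast+
  define L where "L k i = distr M borel (\<eta> k i)" for k i
  have \<eta>fin: "msq M (\<eta> k i) < \<infinity>" for k i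
  proof -
    obtain K where K: "\<And>w. w \<in> space M \<Longrightarrow> norm (\<eta> k i w) \<le> K" using \<eta>b[of k] by blast
    have "msq M (\<eta> k i) \<le> (\<integral>\<^sup>+w. ennreal (K\<^sup>2) \<partial>M)"
      unfolding msq_def using K by (intro nn_integral_mono ennreal_leI power_mono) auto
    also have "\<dots> < \<infinity>" by (simp add: emeasure_space_1)
    finally show ?thesis .
  qed
  let ?d = "\<lambda>k t. msq M (\<lambda>w. X t w - \<eta> k (cell a c (n k) t) w)"
  have dm: "(\<lambda>p. X (fst p) (snd p) - \<eta> k (cell a c (n k) (fst p)) (snd p)) \<in> borel_measurable (strip a c M)" for k
    by (intro borel_measurable_diff X step_measurable \<eta>m)
  have dt: "(\<lambda>t. ?d k t) \<in> borel_measurable ?L" for k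
    using msq_strip_time(2)[OF dm[of k]] by simp
  have di: "(\<integral>\<^sup>+t. ?d k t \<partial>?L) \<le> ennreal (e k)" for k
    using \<eta>[of k] unfolding msq_strip_time(1)[OF dm[of k]] by simp
  have "(\<integral>\<^sup>+t. (\<Sum>k. ?d k t) \<partial>?L) = (\<Sum>k. \<integral>\<^sup>+t. ?d k t \<partial>?L)"
    by (rule nn_integral_suminf[OF dt])
  also have "\<dots> \<le> (\<Sum>k. ennreal (e k))" by (intro suminf_le di) auto
  also have "\<dots> = ennreal (\<Sum>k. e k)"
    unfolding e_def by (intro suminf_ennreal2 summable_geometric) auto
  also have "\<dots> < \<infinity>" by simp
  finally have "AE t in ?L. (\<Sum>k. ?d k t) \<noteq> \<infinity>"
    by (intro nn_integral_PInf_AE borel_measurable_suminf_order dt) auto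
  moreover have "AE t in ?L. msq M (\<lambda>w. X t w) \<noteq> \<infinity>"
    using fin msq_strip_time[OF X] by (intro nn_integral_PInf_AE) auto
  ultimately have "AE t in ?L. (\<lambda>k. W2 (L k (cell a c (n k) t)) (distr M borel (X t))) \<longlonglongrightarrow> 0"
    using AE_space
  proof eventually_elim
    case (elim t)
    have Xm: "X t \<in> borel_measurable M"
      using measurable_strip_section[OF X, of t] elim(3) by (simp add: space_restrict_space)
    have dfin: "?d k t < \<infinity>" for k
    proof -
      have "?d k t \<le> (\<Sum>k. ?d k t)" using sum_le_suminf[of "\<lambda>k. ?d k t" "{k}"] by (auto simp: summableI)
      then show ?thesis using elim(1) by (simp add: less_top[symmetric] neq_top_trans)
    qed
    define r where "r k = enn2real (?d k t)" for k
    have r: "?d k t = ennreal (r k)" for k unfolding r_def using dfin[of k] by simp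
    have r0: "0 \<le> r k" for k by (simp add: r_def)
    have "summable r"
      using elim(1) unfolding r by (intro summable_suminf_not_top r0) auto
    then have "r \<longlonglongrightarrow> 0" by (rule summable_LIMSEQ_zero)
    then have sq: "(\<lambda>k. sqrt (r k)) \<longlonglongrightarrow> 0" using tendsto_real_sqrt by fastforce
    have W0: "0 \<le> W2 \<mu> \<nu>" for \<mu> \<nu> :: "'b measure" by (simp add: W2_def)
    have "W2 (L k (cell a c (n k) t)) (distr M borel (X t)) \<le> sqrt (r k)" for k
    proof -
      have "msq M (\<lambda>w. \<eta> k (cell a c (n k) t) w - X t w) = ennreal (r k)"
        unfolding r[symmetric] by (rule msq_minus_commute)
      then have "ennreal ((W2 (L k (cell a c (n k) t)) (distr M borel (X t)))\<^sup>2) \<le> ennreal (r k)"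
        using W2_distr_le[OF \<eta>m Xm, of k "cell a c (n k) t"] unfolding L_def by simp
      then have "(W2 (L k (cell a c (n k) t)) (distr M borel (X t)))\<^sup>2 \<le> r k"
        using r0 by simp
      then show ?thesis by (rule real_le_rsqrt)
    qed
    then show ?case using W0 by (intro tendsto_sandwich[OF _ _ tendsto_const sq]) auto
  qed
  moreover have "L k i \<in> P2" for k i unfolding L_def by (rule distr_in_P2[OF \<eta>m \<eta>fin])
  ultimately show ?thesis by blast
qed

end

text \<open>If \<open>h\<close> takes finitely many values, the composition is glued from finitely
  many measurable functions; continuity in the second argument passes to the limit.\<close>

lemma caratheodory_measurable:
  fixes g :: "'a \<Rightarrow> 'x::euclidean_space \<Rightarrow> 'y::euclidean_space"
  assumes g: "\<And>x. (\<lambda>a. g a x) \<in> borel_measurable N"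
    and cont: "\<And>a. a \<in> space N \<Longrightarrow> continuous_on UNIV (g a)"
    and h: "h \<in> borel_measurable N"
  shows "(\<lambda>a. g a (h a)) \<in> borel_measurable N"
proof -
  obtain s where s: "\<And>i. simple_function N (s i)" "\<And>a. a \<in> space N \<Longrightarrow> (\<lambda>i. s i a) \<longlonglongrightarrow> h a"
    using borel_measurable_implies_sequence_metric[OF h, of 0] by metis
  show ?thesis
  proof (rule borel_measurable_LIMSEQ_metric)
    fix i
    have "s i \<in> N \<rightarrow>\<^sub>M count_space (s i ` space N)"
      using simple_functionD[OF s(1)] by (subst measurable_count_space_eq2) auto
    then show "(\<lambda>a. g a (s i a)) \<in> borel_measurable N"
      by (rule measurable_compose_countable'[OF g]) (use simple_functionD(1)[OF s(1)] in \<open>auto intro: countable_finite\<close>)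
  next
    fix a assume a: "a \<in> space N"
    then show "(\<lambda>i. g a (s i a)) \<longlonglongrightarrow> g a (h a)"
      using cont[OF a] s(2)[OF a] unfolding continuous_on_sequentially by (auto simp: comp_def)
  qed
qed

text \<open>Here the inserted variable of \<open>caratheodory_measurable\<close> is time. Clamping
  it to \<open>[0, T]\<close> extends each path to a continuous function on the whole line.\<close>

lemma continuous_process_measurable:
  fixes V :: "real \<Rightarrow> 'a \<Rightarrow> 'b::euclidean_space"
  assumes T: "0 \<le> T" and V: "\<And>t. t \<in> {0..T} \<Longrightarrow> V t \<in> borel_measurable N"
    and cont: "\<And>w. w \<in> space N \<Longrightarrow> continuous_on {0..T} (\<lambda>t. V t w)"
  shows "(\<lambda>p. V (max 0 (min T (fst p))) (snd p)) \<in> borel_measurable (restrict_space lborel {a..c::real} \<Otimes>\<^sub>M N)"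
proof (rule caratheodory_measurable[where g="\<lambda>p x. V (max 0 (min T x)) (snd p)" and h=fst])
  show "(\<lambda>p. V (max 0 (min T x)) (snd p)) \<in> borel_measurable (restrict_space lborel {a..c} \<Otimes>\<^sub>M N)" for x
    using T by (intro measurable_compose[OF measurable_snd] V) auto
  show "continuous_on UNIV (\<lambda>x. V (max 0 (min T x)) (snd p))" if "p \<in> space (restrict_space lborel {a..c} \<Otimes>\<^sub>M N)" for p
    using that T by (intro continuous_on_compose2[OF cont] continuous_intros) (auto simp: space_pair_measure)
  show "fst \<in> borel_measurable (restrict_space lborel {a..c} \<Otimes>\<^sub>M N)"
    by (rule measurable_compose[OF measurable_fst]) (simp add: measurable_restrict_space1)
qed

section \<open>Coefficients along a process\<close>

lemma strip_measurable_shift: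
  assumes f: "f \<in> borel_measurable (restrict_space lborel {-\<delta>..T::real} \<Otimes>\<^sub>M N)" and d: "0 \<le> \<delta>"
  shows "(\<lambda>p. f (fst p - \<delta>, snd p)) \<in> borel_measurable (restrict_space lborel {0..T} \<Otimes>\<^sub>M N)"
proof -
  have "(\<lambda>t. t - \<delta>) \<in> restrict_space lborel {0..T} \<rightarrow>\<^sub>M restrict_space lborel {-\<delta>..T}"
    using d by (intro measurable_restrict_space2) (auto simp: space_restrict_space measurable_restrict_space1)
  then have "(\<lambda>p. (fst p - \<delta>, snd p)) \<in> restrict_space lborel {0..T} \<Otimes>\<^sub>M N \<rightarrow>\<^sub>M restrict_space lborel {-\<delta>..T} \<Otimes>\<^sub>M N"
    by (intro measurable_Pair measurable_compose[OF measurable_fst] measurable_snd)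
  from measurable_compose[OF this f] show ?thesis by simp
qed

lemma AE_time_subset:
  assumes "AE t in restrict_space lborel {a..c::real}. P t" "{a'..c'} \<subseteq> {a..c}"
  shows "AE t in restrict_space lborel {a'..c'}. P t"
  using assms by (auto simp: AE_restrict_space_iff elim!: eventually_mono)

lemma AE_time_shift:
  assumes "AE t in restrict_space lborel {-\<delta>..T::real}. P t" and d: "0 \<le> \<delta>"
  shows "AE t in restrict_space lborel {0..T}. P (t - \<delta>)"
proof -
  have "AE t in distr lborel borel ((+) (- \<delta>)). t \<in> {-\<delta>..T} \<longrightarrow> P t"
    using assms(1) unfolding lborel_distr_plus by (simp add: AE_restrict_space_iff)
  then have "AE t in lborel. - \<delta> + t \<in> {-\<delta>..T} \<longrightarrow> P (- \<delta> + t)"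
    by (rule AE_distrD[rotated]) simp
  then show ?thesis
    using d by (auto simp: AE_restrict_space_iff elim!: eventually_mono)
qed

lemma nn_integral_time_shift:
  fixes v :: "real \<Rightarrow> ennreal"
  assumes v: "v \<in> borel_measurable (restrict_space lborel {-\<delta>..T::real})" and d: "0 \<le> \<delta>"
  shows "(\<integral>\<^sup>+t. v (t - \<delta>) \<partial>restrict_space lborel {0..T}) \<le> (\<integral>\<^sup>+t. v t \<partial>restrict_space lborel {-\<delta>..T})"
proof -
  have m: "(\<lambda>t. v t * indicator {-\<delta>..T} t) \<in> borel_measurable borel"
    using v by (simp add: borel_measurable_restrict_space_iff_ennreal)
  have "(\<integral>\<^sup>+t. v (t - \<delta>) \<partial>restrict_space lborel {0..T}) = (\<integral>\<^sup>+t. v (t - \<delta>) * indicator {0..T} t \<partial>lborel)"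
    by (simp add: nn_integral_restrict_space)
  also have "\<dots> \<le> (\<integral>\<^sup>+t. v (- \<delta> + 1 * t) * indicator {-\<delta>..T} (- \<delta> + 1 * t) \<partial>lborel)"
    using d by (intro nn_integral_mono) (auto simp: indicator_def)
  also have "\<dots> = (\<integral>\<^sup>+t. v t * indicator {-\<delta>..T} t \<partial>lborel)"
    by (subst nn_integral_real_affine[OF m, of 1 "- \<delta>"]) auto
  also have "\<dots> = (\<integral>\<^sup>+t. v t \<partial>restrict_space lborel {-\<delta>..T})"
    by (simp add: nn_integral_restrict_space)
  finally show ?thesis .
qed

lemma nn_integral_time_mono:
  fixes v :: "real \<Rightarrow> ennreal"
  assumes "{a'..c'} \<subseteq> {a..c::real}"
  shows "(\<integral>\<^sup>+t. v t \<partial>restrict_space lborel {a'..c'}) \<le> (\<integral>\<^sup>+t. v t \<partial>restrict_space lborel {a..c})"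
  using assms by (auto simp: nn_integral_restrict_space indicator_def intro!: nn_integral_mono)

lemma nn_integral_time_split_le:
  fixes v :: "real \<Rightarrow> ennreal"
  assumes "v \<in> borel_measurable (restrict_space lborel {a..c})" and "a \<le> m" "m \<le> c"
  shows "(\<integral>\<^sup>+t. v t \<partial>restrict_space lborel {a..c})
    \<le> (\<integral>\<^sup>+t. v t \<partial>restrict_space lborel {a..m}) + (\<integral>\<^sup>+t. v t \<partial>restrict_space lborel {m..c})"
proof -
  define u where "u t = v t * indicator {a..c} t" for t
  have u [measurable]: "u \<in> borel_measurable lborel"
    using assms(1) unfolding u_def[abs_def] by (subst (asm) borel_measurable_restrict_space_iff_ennreal) auto
  have "(\<integral>\<^sup>+t. v t \<partial>restrict_space lborel {a..c}) \<le> (\<integral>\<^sup>+t. u t * indicator {a..m} t + u t * indicator {m..c} t \<partial>lborel)"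
    unfolding nn_integral_restrict_space[of "{a..c}" lborel, simplified] u_def
    by (intro nn_integral_mono) (auto split: split_indicator)
  also have "\<dots> = (\<integral>\<^sup>+t. u t * indicator {a..m} t \<partial>lborel) + (\<integral>\<^sup>+t. u t * indicator {m..c} t \<partial>lborel)"
    by (intro nn_integral_add) auto
  also have "(\<integral>\<^sup>+t. u t * indicator {a..m} t \<partial>lborel) = (\<integral>\<^sup>+t. v t \<partial>restrict_space lborel {a..m})"
    unfolding nn_integral_restrict_space[of "{a..m}" lborel, simplified] u_def
    using assms(2,3) by (intro nn_integral_cong) (auto split: split_indicator)
  also have "(\<integral>\<^sup>+t. u t * indicator {m..c} t \<partial>lborel) = (\<integral>\<^sup>+t. v t \<partial>restrict_space lborel {m..c})"
    unfolding nn_integral_restrict_space[of "{m..c}" lborel, simplified] u_def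
    using assms(2,3) by (intro nn_integral_cong) (auto split: split_indicator)
  finally show ?thesis .
qed

text \<open>The gain \<open>1 / k\<close> is what makes the weighted solution map a
  contraction.\<close>

lemma nn_integral_exp_le:
  assumes k: "0 < k" and t: "0 \<le> t" and a: "0 \<le> a"
  shows "(\<integral>\<^sup>+s. ennreal (a * exp (k * s)) \<partial>restrict_space lborel {0..t}) \<le> ennreal (a * exp (k * t) / k)"
proof -
  have "(\<integral>\<^sup>+s. ennreal (a * exp (k * s)) \<partial>restrict_space lborel {0..t})
      = (\<integral>\<^sup>+s. ennreal (a * exp (k * s)) * indicator {0..t} s \<partial>lborel)"
    by (simp add: nn_integral_restrict_space)
  also have "\<dots> = ennreal (a * exp (k * t) / k - a * exp (k * 0) / k)"
    using k t a by (intro nn_integral_FTC_Icc) (auto intro!: derivative_eq_intros)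
  also have "\<dots> \<le> ennreal (a * exp (k * t) / k)" using a k by (intro ennreal_leI) simp
  finally show ?thesis .
qed

lemma W2_nonneg: "0 \<le> W2 \<mu> \<nu>"
  by (simp add: W2_def)

text \<open>The identity on the space of \<open>\<mu>\<close> serves as both random
  variables.\<close>

lemma W2_refl:
  assumes "\<mu> \<in> P2"
  shows "W2 \<mu> \<mu> = 0"
proof -
  interpret \<mu>: prob_space \<mu> using assms by (simp add: P2_def)
  have s: "sets \<mu> = sets borel" using assms by (simp add: P2_def)
  have m: "(\<lambda>x. x) \<in> borel_measurable \<mu>" unfolding measurable_cong_sets[OF s refl] by simp
  have d: "distr \<mu> borel (\<lambda>x. x) = \<mu>" by (rule distr_id2[OF s[symmetric]])
  have "ennreal ((W2 \<mu> \<mu>)\<^sup>2) \<le> 0" using \<mu>.W2_distr_le[OF m m] unfolding d by simp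
  then show ?thesis by simp
qed

context prob_space
begin

text \<open>The exceptional set may vary with \<open>t\<close>. The set of equality is product
  measurable, so Tonelli combines the sections.\<close>

lemma AE_strip_eqI:
  fixes f g :: "real \<times> 'a \<Rightarrow> 'b::euclidean_space"
  assumes [measurable]: "f \<in> borel_measurable (strip a c M)" "g \<in> borel_measurable (strip a c M)"
    and eq: "\<And>t. t \<in> {a..c} \<Longrightarrow> AE w in M. f (t, w) = g (t, w)"
  shows "AE p in strip a c M. f p = g p"
proof -
  interpret P: pair_sigma_finite "restrict_space lborel {a..c}" M by (rule pair_sigma_finite_strip)
  show ?thesis
  proof (rule P.AE_pair_measure)
    show "{p \<in> space (strip a c M). f p = g p} \<in> sets (strip a c M)" by measurable
    show "AE t in restrict_space lborel {a..c}. AE w in M. f (t, w) = g (t, w)"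
      by (rule AE_I2) (simp add: eq space_restrict_space)
  qed
qed

lemma AE_strip_fst:
  assumes "AE t in restrict_space lborel {a..c::real}. P t"
  shows "AE p in strip a c M. P (fst p)"
proof -
  obtain N where N: "{t \<in> space (restrict_space lborel {a..c}). \<not> P t} \<subseteq> N" "N \<in> null_sets (restrict_space lborel {a..c})"
    using assms by (auto simp: eventually_ae_filter)
  show ?thesis
  proof (rule AE_I[of _ _ "N \<times> space M"])
    show "{p \<in> space (strip a c M). \<not> P (fst p)} \<subseteq> N \<times> space M"
      using N(1) by (auto simp: space_pair_measure)
    show "emeasure (strip a c M) (N \<times> space M) = 0"
      using N(2) by (subst emeasure_pair_measure_Times) auto
    show "N \<times> space M \<in> sets (strip a c M)"
      using N(2) by (intro pair_measureI) auto
  qed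
qed

lemma AE_strip_snd:
  assumes "AE w in M. P w"
  shows "AE p in strip a c M. P (snd p)"
proof -
  obtain N where N: "{w \<in> space M. \<not> P w} \<subseteq> N" "N \<in> null_sets M"
    using assms by (auto simp: eventually_ae_filter)
  show ?thesis
  proof (rule AE_I[of _ _ "space (restrict_space lborel {a..c}) \<times> N"])
    show "{p \<in> space (strip a c M). \<not> P (snd p)} \<subseteq> space (restrict_space lborel {a..c}) \<times> N"
      using N(1) by (auto simp: space_pair_measure)
    show "emeasure (strip a c M) (space (restrict_space lborel {a..c}) \<times> N) = 0"
      using N(2) by (subst emeasure_pair_measure_Times[OF sets.top]) auto
    show "space (restrict_space lborel {a..c}) \<times> N \<in> sets (strip a c M)"
      using N(2) by (intro pair_measureI sets.top) auto
  qed
qed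

lemma AE_strip_sections:
  assumes "AE p in strip a c M. P p"
  shows "AE t in restrict_space lborel {a..c}. AE w in M. P (t, w)"
    and "AE w in M. AE t in restrict_space lborel {a..c}. P (t, w)"
proof -
  interpret P: pair_sigma_finite "restrict_space lborel {a..c}" M by (rule pair_sigma_finite_strip)
  show "AE t in restrict_space lborel {a..c}. AE w in M. P (t, w)" by (rule P.AE_pair[OF assms])
  interpret Q: pair_sigma_finite M "restrict_space lborel {a..c}" ..
  have "AE q in M \<Otimes>\<^sub>M restrict_space lborel {a..c}. P (case q of (x, y) \<Rightarrow> (y, x))"
    using assms by (subst (asm) P.distr_pair_swap) (rule AE_distrD[OF measurable_pair_swap'])
  from Q.AE_pair[OF this] show "AE w in M. AE t in restrict_space lborel {a..c}. P (t, w)" by simp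
qed

end

section \<open>Coefficients frozen along a square integrable process\<close>

context brownian_basis
begin

text \<open>By Tonelli the iterated integral in \<open>H2\<close> is a mean square on the
  strip.\<close>

lemma H2_iff:
  fixes X :: "real \<Rightarrow> 'w \<Rightarrow> 'b::euclidean_space"
  shows "X \<in> H2 M F s r \<longleftrightarrow> (\<forall>t\<in>{s..r}. X t \<in> borel_measurable (F t)) \<and>
    (\<lambda>p. X (fst p) (snd p)) \<in> borel_measurable (strip s r M) \<and> msq (strip s r M) (\<lambda>p. X (fst p) (snd p)) < \<infinity>"
proof -
  have "(\<integral>\<^sup>+\<omega>. (\<integral>\<^sup>+t\<in>{s..r}. ennreal ((norm (X t \<omega>))\<^sup>2) \<partial>lborel) \<partial>M) = msq (strip s r M) (\<lambda>p. X (fst p) (snd p))"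
    if "(\<lambda>p. X (fst p) (snd p)) \<in> borel_measurable (strip s r M)"
    unfolding msq_strip_snd[OF that] by (simp add: msq_def nn_integral_restrict_space)
  then show ?thesis unfolding H2_def mem_Collect_eq case_prod_beta' by (simp cong: conj_cong)
qed

lemma H2_msq_finite_AE:
  fixes X :: "real \<Rightarrow> 'w \<Rightarrow> 'b::euclidean_space"
  assumes "X \<in> H2 M F s r"
  shows "AE t in restrict_space lborel {s..r}. X t \<in> borel_measurable M \<and> msq M (X t) < \<infinity>"
proof -
  have X: "(\<lambda>p. X (fst p) (snd p)) \<in> borel_measurable (strip s r M)" "msq (strip s r M) (\<lambda>p. X (fst p) (snd p)) < \<infinity>"
    using assms by (simp_all only: H2_iff)
  have "AE t in restrict_space lborel {s..r}. msq M (\<lambda>w. X t w) \<noteq> \<infinity>"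
    using X(2) msq_strip_time[OF X(1)] by (intro nn_integral_PInf_AE) simp_all
  then show ?thesis
    using AE_space
  proof eventually_elim
    case (elim t)
    then show ?case using measurable_strip_section[OF X(1), of t] by (simp add: space_restrict_space less_top)
  qed
qed

text \<open>A single null set serves all times, states and laws, so that a coefficient can be
  redefined on it.\<close>

lemma coefficient_lipschitzD:
  assumes "coefficient_lipschitz M s r f"
  obtains C N where "0 \<le> C" "N \<in> null_sets M" "\<And>w t x x' y y' \<mu> \<mu>' \<nu> \<nu>'. w \<in> space M \<Longrightarrow> w \<notin> N \<Longrightarrow> t \<in> {s..r} \<Longrightarrow>
     \<mu> \<in> P2 \<Longrightarrow> \<mu>' \<in> P2 \<Longrightarrow> \<nu> \<in> P2 \<Longrightarrow> \<nu>' \<in> P2 \<Longrightarrow>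
     norm (f t w x y \<mu> \<nu> - f t w x' y' \<mu>' \<nu>') \<le> C * (norm (x - x') + norm (y - y') + W2 \<mu> \<mu>' + W2 \<nu> \<nu>')"
proof -
  obtain C where C: "0 \<le> C" "AE \<omega> in M. \<forall>t\<in>{s..r}. \<forall>x x' x\<^sub>\<delta> x\<^sub>\<delta>'.
        \<forall>\<mu>\<in>P2. \<forall>\<mu>'\<in>P2. \<forall>\<mu>\<^sub>\<delta>\<in>P2. \<forall>\<mu>\<^sub>\<delta>'\<in>P2.
          norm (f t \<omega> x x\<^sub>\<delta> \<mu> \<mu>\<^sub>\<delta> - f t \<omega> x' x\<^sub>\<delta>' \<mu>' \<mu>\<^sub>\<delta>')
            \<le> C * (norm (x - x') + norm (x\<^sub>\<delta> - x\<^sub>\<delta>') + W2 \<mu> \<mu>' + W2 \<mu>\<^sub>\<delta> \<mu>\<^sub>\<delta>')"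
    using assms unfolding coefficient_lipschitz_def by blast
  define P where "P \<omega> \<longleftrightarrow> (\<forall>t\<in>{s..r}. \<forall>x x' x\<^sub>\<delta> x\<^sub>\<delta>'.
        \<forall>\<mu>\<in>P2. \<forall>\<mu>'\<in>P2. \<forall>\<mu>\<^sub>\<delta>\<in>P2. \<forall>\<mu>\<^sub>\<delta>'\<in>P2.
          norm (f t \<omega> x x\<^sub>\<delta> \<mu> \<mu>\<^sub>\<delta> - f t \<omega> x' x\<^sub>\<delta>' \<mu>' \<mu>\<^sub>\<delta>')
            \<le> C * (norm (x - x') + norm (x\<^sub>\<delta> - x\<^sub>\<delta>') + W2 \<mu> \<mu>' + W2 \<mu>\<^sub>\<delta> \<mu>\<^sub>\<delta>'))" for \<omega>
  have "AE \<omega> in M. P \<omega>" using C(2) by (simp only: P_def)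
  then obtain N where N: "N \<in> null_sets M" "{\<omega> \<in> space M. \<not> P \<omega>} \<subseteq> N"
    unfolding eventually_ae_filter by blast
  have P: "P w" if "w \<in> space M" "w \<notin> N" for w using N(2) that by blast
  show ?thesis by (rule that[OF C(1) N(1)], drule(1) P, simp only: P_def)
qed

text \<open>The square of a sum of four terms costs a factor \<open>4\<close>. The two Wasserstein
  terms are bounded by the same mean squares as the two state terms, which doubles it to
  \<open>8 * C\<^sup>2\<close>. The laws lie in \<open>P2\<close> for almost every time only, hence
  the form of the conclusion.\<close>

lemma along_msq_lipschitz:
  fixes f :: "('w, 'x::euclidean_space, 'y::euclidean_space) coefficient"
  assumes lip: "coefficient_lipschitz M (- \<delta>) T f" and d: "0 \<le> \<delta>"
  obtains K where "0 \<le> K" "\<And>X Y. X \<in> H2 M F (- \<delta>) T \<Longrightarrow> Y \<in> H2 M F (- \<delta>) T \<Longrightarrow>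
    AE t in restrict_space lborel {0..T}. msq M (\<lambda>w. along M \<delta> f X t w - along M \<delta> f Y t w)
      \<le> ennreal K * (msq M (\<lambda>w. X t w - Y t w) + msq M (\<lambda>w. X (t - \<delta>) w - Y (t - \<delta>) w))"
proof -
  obtain C N where C: "0 \<le> C" and N: "N \<in> null_sets M"
    and L: "\<And>w t x x' y y' \<mu> \<mu>' \<nu> \<nu>'. w \<in> space M \<Longrightarrow> w \<notin> N \<Longrightarrow> t \<in> {- \<delta>..T} \<Longrightarrow>
     \<mu> \<in> P2 \<Longrightarrow> \<mu>' \<in> P2 \<Longrightarrow> \<nu> \<in> P2 \<Longrightarrow> \<nu>' \<in> P2 \<Longrightarrow>
     norm (f t w x y \<mu> \<nu> - f t w x' y' \<mu>' \<nu>') \<le> C * (norm (x - x') + norm (y - y') + W2 \<mu> \<mu>' + W2 \<nu> \<nu>')"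
    by (rule coefficient_lipschitzD[OF lip]) (rule that, assumption+)
  show ?thesis
  proof (rule that[of "8 * C\<^sup>2"])
    show "0 \<le> 8 * C\<^sup>2" by simp
    fix X Y :: "real \<Rightarrow> 'w \<Rightarrow> 'x" assume X: "X \<in> H2 M F (- \<delta>) T" and Y: "Y \<in> H2 M F (- \<delta>) T"
    have sub: "{0..T} \<subseteq> {- \<delta>..T}" using d by auto
    note XA = H2_msq_finite_AE[OF X] and YA = H2_msq_finite_AE[OF Y]
    show "AE t in restrict_space lborel {0..T}. msq M (\<lambda>w. along M \<delta> f X t w - along M \<delta> f Y t w)
      \<le> ennreal (8 * C\<^sup>2) * (msq M (\<lambda>w. X t w - Y t w) + msq M (\<lambda>w. X (t - \<delta>) w - Y (t - \<delta>) w))"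
      using AE_time_subset[OF XA sub] AE_time_subset[OF YA sub] AE_time_shift[OF XA d] AE_time_shift[OF YA d] AE_space
    proof eventually_elim
      case (elim t)
      let ?a = "\<lambda>w. X t w - Y t w" and ?b = "\<lambda>w. X (t - \<delta>) w - Y (t - \<delta>) w"
      have t: "t \<in> {- \<delta>..T}" using elim(5) d by (auto simp: space_restrict_space)
      have m: "X t \<in> borel_measurable M" "Y t \<in> borel_measurable M" "X (t - \<delta>) \<in> borel_measurable M" "Y (t - \<delta>) \<in> borel_measurable M"
        using elim(1-4) by blast+
      have am [measurable]: "?a \<in> borel_measurable M" "?b \<in> borel_measurable M" by (intro borel_measurable_diff m)+
      have fin: "msq M (\<lambda>w. U w - V w) < \<infinity>" if "U \<in> borel_measurable M" "V \<in> borel_measurable M" "msq M U < \<infinity>" "msq M V < \<infinity>"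
        for U V :: "'w \<Rightarrow> 'x"
      proof -
        have "msq M (\<lambda>w. U w - V w) \<le> 2 * msq M (\<lambda>w. U w - 0) + 2 * msq M (\<lambda>w. 0 - V w)"
          by (intro msq_triangle that) simp
        also have "msq M (\<lambda>w. 0 - V w) = msq M V" by (simp add: msq_def)
        also have "2 * msq M (\<lambda>w. U w - 0) + 2 * msq M V < \<infinity>" using that(3,4) by (simp add: ennreal_mult_less_top)
        finally show ?thesis .
      qed
      have fa: "msq M ?a < \<infinity>" "msq M ?b < \<infinity>" by (rule fin; use elim(1-4) in blast)+
      let ?W = "W2 (distr M borel (X t)) (distr M borel (Y t))" and ?V = "W2 (distr M borel (X (t - \<delta>))) (distr M borel (Y (t - \<delta>)))"
      have W: "ennreal (?W\<^sup>2) \<le> msq M ?a" "ennreal (?V\<^sup>2) \<le> msq M ?b"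
        by (rule W2_distr_le[OF m(1,2) fa(1)], rule W2_distr_le[OF m(3,4) fa(2)])
      have P: "distr M borel (X t) \<in> P2" "distr M borel (Y t) \<in> P2" "distr M borel (X (t - \<delta>)) \<in> P2" "distr M borel (Y (t - \<delta>)) \<in> P2"
        by (rule distr_in_P2; use elim(1-4) in blast)+
      have "msq M (\<lambda>w. along M \<delta> f X t w - along M \<delta> f Y t w)
         \<le> (\<integral>\<^sup>+w. ennreal (4 * C\<^sup>2) * (ennreal ((norm (?a w))\<^sup>2) + ennreal ((norm (?b w))\<^sup>2) + (msq M ?a + msq M ?b)) \<partial>M)"
        unfolding msq_def[of M "\<lambda>w. along M \<delta> f X t w - along M \<delta> f Y t w"]
      proof (intro nn_integral_mono_AE, use AE_not_in[OF N] AE_space in eventually_elim)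
        case (elim w)
        let ?A = "norm (?a w)" and ?B = "norm (?b w)"
        have "norm (along M \<delta> f X t w - along M \<delta> f Y t w) \<le> C * (?A + ?B + ?W + ?V)"
          unfolding along_def by (rule L[OF elim(2) elim(1) t P])
        then have "(norm (along M \<delta> f X t w - along M \<delta> f Y t w))\<^sup>2 \<le> (C * (?A + ?B + ?W + ?V))\<^sup>2"
          by (intro power_mono) auto
        also have "\<dots> \<le> 4 * C\<^sup>2 * (?A\<^sup>2 + ?B\<^sup>2 + (?W\<^sup>2 + ?V\<^sup>2))"
        proof -
          \<comment> \<open>The difference of the two sides is the sum of the six squared pairwise
            differences.\<close>
          have "(?A + ?B + ?W + ?V)\<^sup>2 \<le> 4 * (?A\<^sup>2 + ?B\<^sup>2 + (?W\<^sup>2 + ?V\<^sup>2))"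
            using zero_le_power2[of "?A - ?B"] zero_le_power2[of "?A - ?W"] zero_le_power2[of "?A - ?V"]
              zero_le_power2[of "?B - ?W"] zero_le_power2[of "?B - ?V"] zero_le_power2[of "?W - ?V"]
            unfolding power2_eq_square by (simp only: algebra_simps)
          then have "C\<^sup>2 * (?A + ?B + ?W + ?V)\<^sup>2 \<le> C\<^sup>2 * (4 * (?A\<^sup>2 + ?B\<^sup>2 + (?W\<^sup>2 + ?V\<^sup>2)))"
            by (intro mult_left_mono) auto
          then show ?thesis unfolding power_mult_distrib by (simp only: mult_ac)
        qed
        finally have "ennreal ((norm (along M \<delta> f X t w - along M \<delta> f Y t w))\<^sup>2)
            \<le> ennreal (4 * C\<^sup>2 * (?A\<^sup>2 + ?B\<^sup>2 + (?W\<^sup>2 + ?V\<^sup>2)))" by (rule ennreal_leI)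
        also have "\<dots> = ennreal (4 * C\<^sup>2) * (ennreal (?A\<^sup>2) + ennreal (?B\<^sup>2) + (ennreal (?W\<^sup>2) + ennreal (?V\<^sup>2)))"
          by (simp only: ennreal_mult ennreal_plus add_nonneg_nonneg zero_le_power2 mult_nonneg_nonneg zero_le_numeral)
        also have "\<dots> \<le> ennreal (4 * C\<^sup>2) * (ennreal (?A\<^sup>2) + ennreal (?B\<^sup>2) + (msq M ?a + msq M ?b))"
          by (intro mult_left_mono add_mono W) auto
        finally show ?case .
      qed
      also have "\<dots> = ennreal (4 * C\<^sup>2) * ((msq M ?a + msq M ?b) + (msq M ?a + msq M ?b))"
      proof -
        have "(\<integral>\<^sup>+w. ennreal (4 * C\<^sup>2) * (ennreal ((norm (?a w))\<^sup>2) + ennreal ((norm (?b w))\<^sup>2) + (msq M ?a + msq M ?b)) \<partial>M)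
          = ennreal (4 * C\<^sup>2) * (\<integral>\<^sup>+w. ennreal ((norm (?a w))\<^sup>2) + ennreal ((norm (?b w))\<^sup>2) + (msq M ?a + msq M ?b) \<partial>M)"
          by (intro nn_integral_cmult) measurable
        also have "(\<integral>\<^sup>+w. ennreal ((norm (?a w))\<^sup>2) + ennreal ((norm (?b w))\<^sup>2) + (msq M ?a + msq M ?b) \<partial>M)
          = (\<integral>\<^sup>+w. ennreal ((norm (?a w))\<^sup>2) + ennreal ((norm (?b w))\<^sup>2) \<partial>M) + (\<integral>\<^sup>+w. msq M ?a + msq M ?b \<partial>M)"
          by (intro nn_integral_add) measurable
        also have "(\<integral>\<^sup>+w. ennreal ((norm (?a w))\<^sup>2) + ennreal ((norm (?b w))\<^sup>2) \<partial>M) = msq M ?a + msq M ?b"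
          unfolding msq_def by (intro nn_integral_add) measurable
        also have "(\<integral>\<^sup>+w. msq M ?a + msq M ?b \<partial>M) = msq M ?a + msq M ?b"
          by (simp add: emeasure_space_1)
        finally show ?thesis .
      qed
      also have "\<dots> = ennreal (4 * C\<^sup>2) * (2 * (msq M ?a + msq M ?b))" by (simp only: mult_2)
      also have "\<dots> = ennreal (8 * C\<^sup>2) * (msq M ?a + msq M ?b)"
      proof -
        have "ennreal (4 * C\<^sup>2) * 2 = ennreal (8 * C\<^sup>2)"
          using numeral_mult_ennreal[of "4 * C\<^sup>2" "num.Bit0 num.One"] by (simp add: mult.commute)
        then show ?thesis by (simp only: mult.assoc[symmetric])
      qed
      finally show ?case .
    qed
  qed
qed

lemma zero_in_H2: "(\<lambda>t w. 0 :: 'b::euclidean_space) \<in> H2 M F s r"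
  by (simp add: H2_iff)

text \<open>Along a process in \<open>H2\<close> a coefficient agrees almost everywhere with a jointly measurable, adapted
  and square integrable integrand: the limit of the integrands in which the laws are replaced by
  their piecewise constant approximations.\<close>

lemma along_version:
  fixes f :: "('w, 'x::euclidean_space, 'y::euclidean_space) coefficient"
  assumes T: "0 < T" and d: "0 \<le> \<delta>" and fH: "coefficient_in_H2 M F (- \<delta>) T f"
    and lip: "coefficient_lipschitz M (- \<delta>) T f" and X: "X \<in> H2 M F (- \<delta>) T"
  shows "\<exists>\<psi>. \<psi> \<in> borel_measurable (strip 0 T M) \<and> msq (strip 0 T M) \<psi> < \<infinity> \<and>
    (AE p in strip 0 T M. along M \<delta> f X (fst p) (snd p) = \<psi> p) \<and>
    (AE t in restrict_space lborel {0..T}. (\<lambda>w. \<psi> (t, w)) \<in> borel_measurable (F t))"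
proof -
  let ?L = "restrict_space lborel {0..T}"
  let ?P = "\<lambda>t. distr M borel (X t)"
  have sub: "{0..T} \<subseteq> {- \<delta>..T}" using d by auto
  obtain C N where C: "0 \<le> C" and N: "N \<in> null_sets M"
    and L: "\<And>w t x x' y y' \<mu> \<mu>' \<nu> \<nu>'. w \<in> space M \<Longrightarrow> w \<notin> N \<Longrightarrow> t \<in> {- \<delta>..T} \<Longrightarrow>
     \<mu> \<in> P2 \<Longrightarrow> \<mu>' \<in> P2 \<Longrightarrow> \<nu> \<in> P2 \<Longrightarrow> \<nu>' \<in> P2 \<Longrightarrow>
     norm (f t w x y \<mu> \<nu> - f t w x' y' \<mu>' \<nu>') \<le> C * (norm (x - x') + norm (y - y') + W2 \<mu> \<mu>' + W2 \<nu> \<nu>')"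
    by (rule coefficient_lipschitzD[OF lip]) (rule that, assumption+)
  \<comment> \<open>With value \<open>0\<close> on the exceptional set the Lipschitz bound holds at
    every sample point, and so does the continuity that \<open>caratheodory_measurable\<close>
    demands.\<close>
  define g where "g t w x y \<mu> \<nu> = (if w \<in> N then 0 else f t w x y \<mu> \<nu>)" for t w x y \<mu> \<nu>
  have Ns: "N \<in> sets M" using N by auto
  have gm: "(\<lambda>p. g (fst p) (snd p) x y \<mu> \<nu>) \<in> borel_measurable (strip 0 T M)" if "\<mu> \<in> P2" "\<nu> \<in> P2" for x y \<mu> \<nu>
  proof -
    have "(\<lambda>t \<omega>. f t \<omega> x y \<mu> \<nu>) \<in> H2 M F (- \<delta>) T" using fH that unfolding coefficient_in_H2_def by blast
    then have "(\<lambda>p. f (fst p) (snd p) x y \<mu> \<nu>) \<in> borel_measurable (strip (- \<delta>) T M)" by (simp only: H2_iff)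
    from strip_measurable_subset[OF this sub]
    have 1: "(\<lambda>p. f (fst p) (snd p) x y \<mu> \<nu>) \<in> borel_measurable (strip 0 T M)" .
    have 2: "{p \<in> space (strip 0 T M). snd p \<in> N} \<in> sets (strip 0 T M)"
      by (rule sets_Collect_in[OF measurable_snd Ns])
    show ?thesis unfolding g_def by (rule measurable_If[OF _ 1 2]) simp
  qed
  have gF: "(\<lambda>w. g t w x y \<mu> \<nu>) \<in> borel_measurable (F t)"
    if "\<mu> \<in> P2" "\<nu> \<in> P2" "t \<in> {0..T}" for t x y \<mu> \<nu>
  proof -
    have "(\<lambda>t \<omega>. f t \<omega> x y \<mu> \<nu>) \<in> H2 M F (- \<delta>) T" using fH that(1,2) unfolding coefficient_in_H2_def by blast
    moreover have "t \<in> {- \<delta>..T}" using that(3) sub by blast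
    ultimately have 1: "(\<lambda>w. f t w x y \<mu> \<nu>) \<in> borel_measurable (F t)" unfolding H2_iff by blast
    have "AE w in M. f t w x y \<mu> \<nu> = g t w x y \<mu> \<nu>"
      using AE_not_in[OF N] by eventually_elim (simp add: g_def)
    from F_measurable_cong_AE[OF 1 this] show ?thesis by simp
  qed
  have glip: "norm (g t w x y \<mu> \<nu> - g t w x' y' \<mu>' \<nu>') \<le> C * (norm (x - x') + norm (y - y') + W2 \<mu> \<mu>' + W2 \<nu> \<nu>')"
    if "w \<in> space M" "t \<in> {0..T}" "\<mu> \<in> P2" "\<mu>' \<in> P2" "\<nu> \<in> P2" "\<nu>' \<in> P2" for t w x x' y y' \<mu> \<mu>' \<nu> \<nu>'
  proof (cases "w \<in> N")
    case True
    then show ?thesis using C by (simp add: g_def W2_nonneg)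
  next
    case False
    have "t \<in> {- \<delta>..T}" using that(2) sub by blast
    from L[OF that(1) False this that(3-6)] show ?thesis using False by (simp add: g_def)
  qed
  have gcont: "continuous_on UNIV (\<lambda>z. g t w (fst z) (snd z) \<mu> \<nu>)"
    if "w \<in> space M" "t \<in> {0..T}" "\<mu> \<in> P2" "\<nu> \<in> P2" for t w \<mu> \<nu>
    unfolding continuous_on_def
  proof
    fix z :: "'x \<times> 'x" assume "z \<in> UNIV"
    have lim: "((\<lambda>z'. C * (norm (fst z' - fst z) + norm (snd z' - snd z))) \<longlongrightarrow> C * (norm (fst z - fst z) + norm (snd z - snd z))) (at z within UNIV)"
      by (intro tendsto_intros)
    have "((\<lambda>z'. norm (g t w (fst z') (snd z') \<mu> \<nu> - g t w (fst z) (snd z) \<mu> \<nu>)) \<longlongrightarrow> 0) (at z within UNIV)"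
    proof (rule tendsto_sandwich[OF _ _ tendsto_const])
      show "((\<lambda>z'. C * (norm (fst z' - fst z) + norm (snd z' - snd z))) \<longlongrightarrow> 0) (at z within UNIV)"
        using lim by simp
      show "\<forall>\<^sub>F z' in at z within UNIV. norm (g t w (fst z') (snd z') \<mu> \<nu> - g t w (fst z) (snd z) \<mu> \<nu>)
         \<le> C * (norm (fst z' - fst z) + norm (snd z' - snd z))"
      proof (intro always_eventually allI)
        fix z' :: "'x \<times> 'x"
        show "norm (g t w (fst z') (snd z') \<mu> \<nu> - g t w (fst z) (snd z) \<mu> \<nu>)
         \<le> C * (norm (fst z' - fst z) + norm (snd z' - snd z))"
          using glip[OF that(1,2) that(3,3) that(4,4)] W2_refl[OF that(3)] W2_refl[OF that(4)] by simp
      qed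
    qed (simp add: always_eventually)
    then show "((\<lambda>z. g t w (fst z) (snd z) \<mu> \<nu>) \<longlongrightarrow> g t w (fst z) (snd z) \<mu> \<nu>) (at z within UNIV)"
      by (rule LIM_zero_cancel[OF tendsto_norm_zero_cancel])
  qed
  have Xm: "(\<lambda>p. X (fst p) (snd p)) \<in> borel_measurable (strip (- \<delta>) T M)"
    and Xfin: "msq (strip (- \<delta>) T M) (\<lambda>p. X (fst p) (snd p)) < \<infinity>"
    and XF: "\<And>t. t \<in> {- \<delta>..T} \<Longrightarrow> X t \<in> borel_measurable (F t)"
    using X unfolding H2_iff by blast+
  define h where "h p = (X (fst p) (snd p), X (fst p - \<delta>) (snd p))" for p
  have hm: "h \<in> borel_measurable (strip 0 T M)"
  proof -
    have "(\<lambda>p. X (fst p) (snd p)) \<in> borel_measurable (strip 0 T M)" by (rule strip_measurable_subset[OF Xm sub])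
    moreover have "(\<lambda>p. X (fst p - \<delta>) (snd p)) \<in> borel_measurable (strip 0 T M)"
      using strip_measurable_shift[OF Xm d] by simp
    ultimately show ?thesis unfolding h_def[abs_def] by (rule borel_measurable_Pair)
  qed
  have dT: "- \<delta> < T" using T d by simp
  \<comment> \<open>The laws are approximated on all of \<open>[-\<delta>, T]\<close>, so one family
    serves both the present and the delayed time.\<close>
  obtain n :: "nat \<Rightarrow> nat" and A where AP: "\<And>k i. A k i \<in> P2"
    and Alim: "AE t in restrict_space lborel {- \<delta>..T}. (\<lambda>k. W2 (A k (cell (- \<delta>) T (n k) t)) (?P t)) \<longlonglongrightarrow> 0"
    using law_approximation[OF dT Xm Xfin] by blast
  let ?c = "\<lambda>k. cell (- \<delta>) T (n k)"
  define G where "G k p = g (fst p) (snd p) (fst (h p)) (snd (h p)) (A k (?c k (fst p))) (A k (?c k (fst p - \<delta>)))" for k p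
  have Gm: "G k \<in> borel_measurable (strip 0 T M)" for k
    unfolding G_def[abs_def]
  \<comment> \<open>Gluing first over the cell of \<open>t\<close> and then over the cell of
    \<open>t - \<delta>\<close> leaves a fixed pair of laws, for which only the states vary.\<close>
  proof (rule measurable_compose_countable[where g="\<lambda>p. ?c k (fst p)"
        and f="\<lambda>i p. g (fst p) (snd p) (fst (h p)) (snd (h p)) (A k i) (A k (?c k (fst p - \<delta>)))"])
    show "(\<lambda>p. ?c k (fst p)) \<in> strip 0 T M \<rightarrow>\<^sub>M count_space UNIV"
      by (rule measurable_compose[OF measurable_fst]) (simp add: measurable_restrict_space1)
    fix i
    show "(\<lambda>p. g (fst p) (snd p) (fst (h p)) (snd (h p)) (A k i) (A k (?c k (fst p - \<delta>)))) \<in> borel_measurable (strip 0 T M)"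
    proof (rule measurable_compose_countable[where g="\<lambda>p. ?c k (fst p - \<delta>)"
        and f="\<lambda>j p. g (fst p) (snd p) (fst (h p)) (snd (h p)) (A k i) (A k j)"])
      have "(\<lambda>t. ?c k (t - \<delta>)) \<in> borel \<rightarrow>\<^sub>M count_space UNIV"
        by (rule measurable_compose[OF _ measurable_cell]) simp
      then show "(\<lambda>p. ?c k (fst p - \<delta>)) \<in> strip 0 T M \<rightarrow>\<^sub>M count_space UNIV"
        by (intro measurable_compose[OF measurable_fst]) (simp add: measurable_restrict_space1)
      fix j
      show "(\<lambda>p. g (fst p) (snd p) (fst (h p)) (snd (h p)) (A k i) (A k j)) \<in> borel_measurable (strip 0 T M)"
      proof (rule caratheodory_measurable[OF _ _ hm])
        show "(\<lambda>p. g (fst p) (snd p) (fst z) (snd z) (A k i) (A k j)) \<in> borel_measurable (strip 0 T M)" for z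
          by (rule gm[OF AP AP])
        show "continuous_on UNIV (\<lambda>z. g (fst p) (snd p) (fst z) (snd z) (A k i) (A k j))" if "p \<in> space (strip 0 T M)" for p
          using that by (intro gcont AP) (auto simp: space_strip)
      qed
    qed
  qed
  define \<psi> where "\<psi> p = lim (\<lambda>k. G k p)" for p
  have \<psi>m: "\<psi> \<in> borel_measurable (strip 0 T M)"
    unfolding \<psi>_def[abs_def] by (rule borel_measurable_lim_metric[OF Gm])
  note XA = H2_msq_finite_AE[OF X]
  define good where "good t \<longleftrightarrow> t \<in> {0..T} \<and> ?P t \<in> P2 \<and> ?P (t - \<delta>) \<in> P2 \<and>
     (\<lambda>k. W2 (A k (?c k t)) (?P t)) \<longlonglongrightarrow> 0 \<and> (\<lambda>k. W2 (A k (?c k (t - \<delta>))) (?P (t - \<delta>))) \<longlonglongrightarrow> 0" for t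
  have good: "AE t in ?L. good t"
    using AE_time_subset[OF XA sub] AE_time_shift[OF XA d] AE_time_subset[OF Alim sub] AE_time_shift[OF Alim d] AE_space
  proof eventually_elim
    case (elim t)
    have "?P t \<in> P2" by (rule distr_in_P2; use elim(1) in blast)
    moreover have "?P (t - \<delta>) \<in> P2" by (rule distr_in_P2; use elim(2) in blast)
    moreover have "t \<in> {0..T}" using elim(5) by (simp add: space_restrict_space)
    ultimately show ?case unfolding good_def using elim(3,4) by blast
  qed
  have eq: "AE p in strip 0 T M. along M \<delta> f X (fst p) (snd p) = \<psi> p"
    using AE_strip_fst[OF good] AE_strip_snd[OF AE_not_in[OF N]] AE_space
  proof eventually_elim
    case (elim p)
    let ?t = "fst p" and ?w = "snd p"
    have t: "?t \<in> {0..T}" and P: "?P ?t \<in> P2" "?P (?t - \<delta>) \<in> P2"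
      and lim: "(\<lambda>k. W2 (A k (?c k ?t)) (?P ?t)) \<longlonglongrightarrow> 0" "(\<lambda>k. W2 (A k (?c k (?t - \<delta>))) (?P (?t - \<delta>))) \<longlonglongrightarrow> 0"
      using elim(1) unfolding good_def by blast+
    have w: "?w \<in> space M" using elim(3) by (auto simp: space_strip)
    have al: "along M \<delta> f X ?t ?w = g ?t ?w (fst (h p)) (snd (h p)) (?P ?t) (?P (?t - \<delta>))"
      using elim(2) by (simp add: along_def g_def h_def)
    have lim0: "(\<lambda>k. C * (0 + 0 + W2 (A k (?c k ?t)) (?P ?t) + W2 (A k (?c k (?t - \<delta>))) (?P (?t - \<delta>)))) \<longlonglongrightarrow> C * (0 + 0 + 0 + 0)"
      by (intro tendsto_intros lim)
    have "(\<lambda>k. norm (G k p - along M \<delta> f X ?t ?w)) \<longlonglongrightarrow> 0"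
    proof (rule tendsto_sandwich[OF _ _ tendsto_const])
      show "(\<lambda>k. C * (0 + 0 + W2 (A k (?c k ?t)) (?P ?t) + W2 (A k (?c k (?t - \<delta>))) (?P (?t - \<delta>)))) \<longlonglongrightarrow> 0"
        using lim0 by simp
      show "\<forall>\<^sub>F k in sequentially. norm (G k p - along M \<delta> f X ?t ?w)
         \<le> C * (0 + 0 + W2 (A k (?c k ?t)) (?P ?t) + W2 (A k (?c k (?t - \<delta>))) (?P (?t - \<delta>)))"
      proof (intro always_eventually allI)
        fix k
        have "norm (G k p - along M \<delta> f X ?t ?w) \<le> C * (norm (fst (h p) - fst (h p)) + norm (snd (h p) - snd (h p))
            + W2 (A k (?c k ?t)) (?P ?t) + W2 (A k (?c k (?t - \<delta>))) (?P (?t - \<delta>)))"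
          unfolding al G_def by (rule glip[OF w t AP P(1) AP P(2)])
        then show "norm (G k p - along M \<delta> f X ?t ?w)
         \<le> C * (0 + 0 + W2 (A k (?c k ?t)) (?P ?t) + W2 (A k (?c k (?t - \<delta>))) (?P (?t - \<delta>)))" by simp
      qed
    qed (simp add: always_eventually)
    then have "(\<lambda>k. G k p) \<longlonglongrightarrow> along M \<delta> f X ?t ?w"
      by (rule LIM_zero_cancel[OF tendsto_norm_zero_cancel])
    then show ?case unfolding \<psi>_def by (rule limI[symmetric])
  qed
  have adapted: "AE t in ?L. (\<lambda>w. \<psi> (t, w)) \<in> borel_measurable (F t)"
    using good AE_strip_sections(1)[OF eq]
  proof eventually_elim
    case (elim t)
    have t: "t \<in> {0..T}" and P: "?P t \<in> P2" "?P (t - \<delta>) \<in> P2" using elim(1) unfolding good_def by blast+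
    have "(\<lambda>w. X t w) \<in> borel_measurable (F t)" using XF[of t] t sub by blast
    moreover have "(\<lambda>w. X (t - \<delta>) w) \<in> borel_measurable (F t)"
      by (rule F_measurable_mono[OF XF]) (use t d in auto)
    ultimately have hF: "(\<lambda>w. h (t, w)) \<in> borel_measurable (F t)"
      unfolding h_def fst_conv snd_conv by (rule borel_measurable_Pair)
    \<comment> \<open>With the time fixed, the true laws are constants and can be inserted directly;
      only joint measurability needed the approximation.\<close>
    have "(\<lambda>w. g t w (fst (h (t, w))) (snd (h (t, w))) (?P t) (?P (t - \<delta>))) \<in> borel_measurable (F t)"
    proof (rule caratheodory_measurable[OF _ _ hF])
      show "(\<lambda>w. g t w (fst z) (snd z) (?P t) (?P (t - \<delta>))) \<in> borel_measurable (F t)" for z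
        by (rule gF[OF P t])
      show "continuous_on UNIV (\<lambda>z. g t w (fst z) (snd z) (?P t) (?P (t - \<delta>)))" if "w \<in> space (F t)" for w
        using that by (intro gcont t P) simp
    qed
    then show ?case
    proof (rule F_measurable_cong_AE)
      show "AE w in M. g t w (fst (h (t, w))) (snd (h (t, w))) (?P t) (?P (t - \<delta>)) = \<psi> (t, w)"
        using elim(2) AE_not_in[OF N]
      proof eventually_elim
        case (elim w)
        then show ?case by (simp add: along_def g_def h_def)
      qed
    qed
  qed
  \<comment> \<open>The comparison is with the zero process. Its law is the Dirac mass at
    \<open>0\<close>, so the coefficient along it is square integrable by
    \<open>coefficient_in_H2\<close>.\<close>
  have fin: "msq (strip 0 T M) \<psi> < \<infinity>"
  proof -
    have "return borel 0 \<in> (P2 :: 'x measure set)"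
      using distr_in_P2[of "\<lambda>w. 0 :: 'x"] unfolding distr_zero by simp
    then have "(\<lambda>t \<omega>. f t \<omega> 0 0 (return borel 0) (return borel 0)) \<in> H2 M F (- \<delta>) T"
      using fH unfolding coefficient_in_H2_def by blast
    then have f0: "(\<lambda>p. f (fst p) (snd p) 0 0 (return borel 0) (return borel 0)) \<in> borel_measurable (strip (- \<delta>) T M)"
      "msq (strip (- \<delta>) T M) (\<lambda>p. f (fst p) (snd p) 0 0 (return borel 0) (return borel 0)) < \<infinity>" unfolding H2_iff by blast+
    define \<phi> where "\<phi> p = along M \<delta> f (\<lambda>t w. 0) (fst p) (snd p)" for p
    have \<phi>: "\<phi> = (\<lambda>p. f (fst p) (snd p) 0 0 (return borel 0) (return borel 0))"
      unfolding \<phi>_def[abs_def] along_def distr_zero ..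
    have \<phi>m: "\<phi> \<in> borel_measurable (strip 0 T M)" unfolding \<phi> by (rule strip_measurable_subset[OF f0(1) sub])
    have \<phi>fin: "msq (strip 0 T M) \<phi> < \<infinity>"
    proof -
      have "msq (strip 0 T M) \<phi> \<le> msq (strip (- \<delta>) T M) \<phi>"
        unfolding msq_strip_time(1)[OF \<phi>m] msq_strip_time(1)[OF f0(1)[folded \<phi>]] by (rule nn_integral_time_mono[OF sub])
      then show ?thesis using f0(2) unfolding \<phi> by (rule le_less_trans)
    qed
    obtain K where K: "0 \<le> K" "\<And>X Y. X \<in> H2 M F (- \<delta>) T \<Longrightarrow> Y \<in> H2 M F (- \<delta>) T \<Longrightarrow>
    AE t in ?L. msq M (\<lambda>w. along M \<delta> f X t w - along M \<delta> f Y t w)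
      \<le> ennreal K * (msq M (\<lambda>w. X t w - Y t w) + msq M (\<lambda>w. X (t - \<delta>) w - Y (t - \<delta>) w))"
      by (rule along_msq_lipschitz[OF lip d]) (rule that, assumption+)
    let ?v = "\<lambda>t. msq M (X t)"
    have vm: "?v \<in> borel_measurable (restrict_space lborel {- \<delta>..T})" using msq_strip_time(2)[OF Xm] by simp
    have vI: "(\<integral>\<^sup>+t. ?v t \<partial>restrict_space lborel {- \<delta>..T}) < \<infinity>" using Xfin unfolding msq_strip_time(1)[OF Xm] by simp
    have v1: "?v \<in> borel_measurable ?L" using msq_strip_time(2)[OF strip_measurable_subset[OF Xm sub]] by simp
    have v2: "(\<lambda>t. ?v (t - \<delta>)) \<in> borel_measurable ?L" using msq_strip_time(2)[OF strip_measurable_shift[OF Xm d]] by simp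
    have "msq (strip 0 T M) (\<lambda>p. \<psi> p - \<phi> p) = (\<integral>\<^sup>+t. msq M (\<lambda>w. \<psi> (t, w) - \<phi> (t, w)) \<partial>?L)"
      by (rule msq_strip_time(1)[OF borel_measurable_diff[OF \<psi>m \<phi>m]])
    also have "\<dots> \<le> (\<integral>\<^sup>+t. ennreal K * (?v t + ?v (t - \<delta>)) \<partial>?L)"
    proof (intro nn_integral_mono_AE, use K(2)[OF X zero_in_H2] AE_strip_sections(1)[OF eq] in eventually_elim)
      case (elim t)
      have "msq M (\<lambda>w. \<psi> (t, w) - \<phi> (t, w)) = msq M (\<lambda>w. along M \<delta> f X t w - along M \<delta> f (\<lambda>t w. 0) t w)"
        using elim(2) by (intro msq_cong) (auto simp: \<phi>_def elim: eventually_mono)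
      then show ?case using elim(1) by simp
    qed
    also have "\<dots> = ennreal K * ((\<integral>\<^sup>+t. ?v t \<partial>?L) + (\<integral>\<^sup>+t. ?v (t - \<delta>) \<partial>?L))"
      using v1 v2 by (simp add: nn_integral_cmult nn_integral_add)
    also have "\<dots> \<le> ennreal K * ((\<integral>\<^sup>+t. ?v t \<partial>restrict_space lborel {- \<delta>..T}) + (\<integral>\<^sup>+t. ?v t \<partial>restrict_space lborel {- \<delta>..T}))"
      by (intro mult_left_mono add_mono nn_integral_time_mono[OF sub] nn_integral_time_shift[OF vm d]) simp
    also have "\<dots> < \<infinity>" using vI by (simp add: ennreal_mult_less_top)
    finally have "msq (strip 0 T M) (\<lambda>p. \<psi> p - \<phi> p) < \<infinity>" .
    moreover have "msq (strip 0 T M) \<psi> \<le> 2 * msq (strip 0 T M) (\<lambda>p. \<psi> p - \<phi> p) + 2 * msq (strip 0 T M) \<phi>"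
      using msq_add[OF borel_measurable_diff[OF \<psi>m \<phi>m] \<phi>m] by simp
    ultimately show ?thesis using \<phi>fin by (auto intro: le_less_trans simp: ennreal_mult_less_top)
  qed
  show ?thesis using \<psi>m fin eq adapted by blast
qed

end

section \<open>The Picard iteration\<close>

text \<open>\<open>\<xi>0\<close> is stated separately because \<open>H2\<close> bounds an integral
  over time, which says nothing about the size of the value at a single time.\<close>

locale mean_field_delay_sde = brownian_basis M B F0
  for M :: "'w measure" and B :: "real \<Rightarrow> 'w \<Rightarrow> real^'d" and F0 :: "'w measure" +
  fixes T \<delta> :: real
    and b :: "('w, real^'m, real^'m) coefficient"
    and \<sigma> :: "('w, real^'m, real^'d^'m) coefficient"
    and \<xi> :: "real \<Rightarrow> 'w \<Rightarrow> real^'m"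
  assumes T: "0 < T" and d: "0 \<le> \<delta>"
    and bH: "coefficient_in_H2 M F (- \<delta>) T b" and \<sigma>H: "coefficient_in_H2 M F (- \<delta>) T \<sigma>"
    and bL: "coefficient_lipschitz M (- \<delta>) T b" and \<sigma>L: "coefficient_lipschitz M (- \<delta>) T \<sigma>"
    and \<xi>H: "\<xi> \<in> H2 M F (- \<delta>) 0" and \<xi>0: "msq M (\<xi> 0) < \<infinity>"
begin

text \<open>The coefficients are frozen along \<open>X\<close>, so that the strong solutions are the fixed points of
  this relation.\<close>

definition solves :: "(real \<Rightarrow> 'w \<Rightarrow> real^'m) \<Rightarrow> (real \<Rightarrow> 'w \<Rightarrow> real^'m) \<Rightarrow> bool" where
  "solves X Z \<longleftrightarrow> Z \<in> H2 M F (- \<delta>) T \<and>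
     (AE \<omega> in M. \<forall>t\<in>{-\<delta>..0}. Z t \<omega> = \<xi> t \<omega>) \<and>
     (AE \<omega> in M. set_integrable lebesgue {0..T} (\<lambda>s. along M \<delta> b X s \<omega>)) \<and>
     (\<exists>I. has_ito_integral M B F T (along M \<delta> \<sigma> X) I \<and>
        (AE \<omega> in M. \<forall>t\<in>{0..T}.
           Z t \<omega> = \<xi> 0 \<omega> + (LINT s:{0..t}|lebesgue. along M \<delta> b X s \<omega>) + I t \<omega>))"

lemma strong_solution_iff: "strong_solution M B F T \<delta> b \<sigma> \<xi> X \<longleftrightarrow> solves X X"
  unfolding strong_solution_def solves_def ..

text \<open>A coefficient along a process is measurable for the completed product measure only. All
  estimates are carried out on a version that is measurable for the product measure itself.\<close>

definition version :: "(real \<Rightarrow> 'w \<Rightarrow> 'y::euclidean_space) \<Rightarrow> (real \<times> 'w \<Rightarrow> 'y) \<Rightarrow> bool" where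
  "version \<phi> \<psi> \<longleftrightarrow> \<psi> \<in> borel_measurable (strip 0 T M) \<and> msq (strip 0 T M) \<psi> < \<infinity> \<and>
    (AE p in strip 0 T M. \<phi> (fst p) (snd p) = \<psi> p) \<and>
    (AE t in restrict_space lborel {0..T}. (\<lambda>w. \<psi> (t, w)) \<in> borel_measurable (F t))"

section \<open>A mean square Lipschitz estimate for the solution map\<close>

lemma versionD:
  assumes "version \<phi> \<psi>"
  shows "\<psi> \<in> borel_measurable (strip 0 T M)" and "msq (strip 0 T M) \<psi> < \<infinity>"
    and "AE p in strip 0 T M. \<phi> (fst p) (snd p) = \<psi> p"
    and "AE t in restrict_space lborel {0..T}. (\<lambda>w. \<psi> (t, w)) \<in> borel_measurable (F t)"
  using assms unfolding version_def by blast+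

lemma version_b: "X \<in> H2 M F (- \<delta>) T \<Longrightarrow> \<exists>\<psi>. version (along M \<delta> b X) \<psi>"
  unfolding version_def by (rule along_version[OF T d bH bL])

lemma version_\<sigma>: "X \<in> H2 M F (- \<delta>) T \<Longrightarrow> \<exists>\<psi>. version (along M \<delta> \<sigma> X) \<psi>"
  unfolding version_def by (rule along_version[OF T d \<sigma>H \<sigma>L])

text \<open>Fubini turns equality almost everywhere on the strip into equality at almost every time
  along almost every path. There the integral over \<open>lebesgue\<close> becomes
  \<open>drift\<close>.\<close>

lemma version_time_integral:
  assumes "version \<phi> \<psi>"
  shows "AE w in M. integrable (restrict_space lborel {0..T}) (\<lambda>s. \<psi> (s, w)) \<and>
    set_integrable lebesgue {0..T} (\<lambda>s. \<phi> s w) \<and>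
    (\<forall>t\<in>{0..T}. (LINT s:{0..t}|lebesgue. \<phi> s w) = drift \<psi> t w)"
  using time_msq_finite_AE[OF versionD(1,2)[OF assms]] AE_strip_sections(2)[OF versionD(3)[OF assms]] AE_space
proof eventually_elim
  case (elim w)
  interpret L: finite_measure "restrict_space lborel {0..T}" by (rule finite_measure_time)
  have I: "integrable (restrict_space lborel {0..T}) (\<lambda>s. \<psi> (s, w))"
    by (rule L.msq_integrable(1)[OF measurable_strip_time_section[OF versionD(1)[OF assms] elim(3)] elim(1)])
  have AE: "AE s in restrict_space lborel {0..T}. \<phi> s w = \<psi> (s, w)" using elim(2) by simp
  show ?case
    using I lebesgue_set_integral_cong_AE[OF I AE] unfolding drift_def by simp
qed

lemma version_msq_diff:
  assumes v: "version (along M \<delta> f X) \<psi>" "version (along M \<delta> f X') \<psi>'"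
    and K: "0 \<le> K" "AE t in restrict_space lborel {0..T}. msq M (\<lambda>w. along M \<delta> f X t w - along M \<delta> f X' t w)
      \<le> ennreal K * (msq M (\<lambda>w. X t w - X' t w) + msq M (\<lambda>w. X (t - \<delta>) w - X' (t - \<delta>) w))"
    and t: "t \<le> T"
    and m: "(\<lambda>s. msq M (\<lambda>w. X s w - X' s w) + msq M (\<lambda>w. X (s - \<delta>) w - X' (s - \<delta>) w)) \<in> borel_measurable (restrict_space lborel {0..t})"
  shows "msq (strip 0 t M) (\<lambda>p. \<psi> p - \<psi>' p) \<le> ennreal K *
    (\<integral>\<^sup>+s. msq M (\<lambda>w. X s w - X' s w) + msq M (\<lambda>w. X (s - \<delta>) w - X' (s - \<delta>) w) \<partial>restrict_space lborel {0..t})"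
proof -
  have sub: "{0..t} \<subseteq> {0..T}" using t by auto
  have dm: "(\<lambda>p. \<psi> p - \<psi>' p) \<in> borel_measurable (strip 0 t M)"
    by (intro borel_measurable_diff strip_measurable_mono[OF versionD(1)[OF v(1)] t] strip_measurable_mono[OF versionD(1)[OF v(2)] t])
  have "msq (strip 0 t M) (\<lambda>p. \<psi> p - \<psi>' p) = (\<integral>\<^sup>+s. msq M (\<lambda>w. \<psi> (s, w) - \<psi>' (s, w)) \<partial>restrict_space lborel {0..t})"
    by (rule msq_strip_time(1)[OF dm])
  also have "\<dots> \<le> (\<integral>\<^sup>+s. ennreal K * (msq M (\<lambda>w. X s w - X' s w) + msq M (\<lambda>w. X (s - \<delta>) w - X' (s - \<delta>) w)) \<partial>restrict_space lborel {0..t})"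
  proof (intro nn_integral_mono_AE, use AE_time_subset[OF K(2) sub] AE_time_subset[OF AE_strip_sections(1)[OF versionD(3)[OF v(1)]] sub]
        AE_time_subset[OF AE_strip_sections(1)[OF versionD(3)[OF v(2)]] sub] in eventually_elim)
    case (elim s)
    have "AE w in M. \<psi> (s, w) - \<psi>' (s, w) = along M \<delta> f X s w - along M \<delta> f X' s w"
      using elim(2,3) by eventually_elim simp
    from msq_cong[OF this] elim(1) show ?case by simp
  qed
  also have "\<dots> = ennreal K * (\<integral>\<^sup>+s. msq M (\<lambda>w. X s w - X' s w) + msq M (\<lambda>w. X (s - \<delta>) w - X' (s - \<delta>) w) \<partial>restrict_space lborel {0..t})"
    by (rule nn_integral_cmult[OF m])
  finally show ?thesis .
qed

lemma sub_T: "{0..T} \<subseteq> {- \<delta>..T}" using d by auto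

lemma H2D:
  fixes X :: "real \<Rightarrow> 'w \<Rightarrow> 'b::euclidean_space"
  assumes "X \<in> H2 M F s r"
  shows "t \<in> {s..r} \<Longrightarrow> X t \<in> borel_measurable (F t)" and "t \<in> {s..r} \<Longrightarrow> X t \<in> borel_measurable M"
    and "(\<lambda>p. X (fst p) (snd p)) \<in> borel_measurable (strip s r M)"
    and "msq (strip s r M) (\<lambda>p. X (fst p) (snd p)) < \<infinity>"
  using assms unfolding H2_iff by (blast intro: F_measurable_M)+

lemma H2_diff_measurable:
  fixes X X' :: "real \<Rightarrow> 'w \<Rightarrow> 'b::euclidean_space"
  assumes X: "X \<in> H2 M F (- \<delta>) T" and X': "X' \<in> H2 M F (- \<delta>) T" and t: "t \<le> T"
  shows "(\<lambda>s. msq M (\<lambda>w. X s w - X' s w)) \<in> borel_measurable (restrict_space lborel {-\<delta>..T})"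
    and "(\<lambda>s. msq M (\<lambda>w. X s w - X' s w)) \<in> borel_measurable (restrict_space lborel {0..t})"
    and "(\<lambda>s. msq M (\<lambda>w. X (s - \<delta>) w - X' (s - \<delta>) w)) \<in> borel_measurable (restrict_space lborel {0..t})"
proof -
  have m: "(\<lambda>p. X (fst p) (snd p) - X' (fst p) (snd p)) \<in> borel_measurable (strip (- \<delta>) T M)"
    by (intro borel_measurable_diff H2D(3) X X')
  show "(\<lambda>s. msq M (\<lambda>w. X s w - X' s w)) \<in> borel_measurable (restrict_space lborel {-\<delta>..T})"
    using msq_strip_time(2)[OF m] by simp
  have "{0..t} \<subseteq> {- \<delta>..T}" using d t by auto
  from msq_strip_time(2)[OF strip_measurable_subset[OF m this]]
  show "(\<lambda>s. msq M (\<lambda>w. X s w - X' s w)) \<in> borel_measurable (restrict_space lborel {0..t})" by simp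
  from msq_strip_time(2)[OF strip_measurable_mono[OF strip_measurable_shift[OF m d] t]]
  show "(\<lambda>s. msq M (\<lambda>w. X (s - \<delta>) w - X' (s - \<delta>) w)) \<in> borel_measurable (restrict_space lborel {0..t})" by simp
qed

text \<open>The initial value cancels. One doubled triangle inequality separates drift and Ito
  integral; Cauchy-Schwarz in time contributes \<open>T * Kb\<close> and
  \<open>has_ito_integral_msq_diff\<close> contributes \<open>16 * Ks\<close>.\<close>

lemma solves_lipschitz:
  obtains K where "0 \<le> K" "\<And>X X' Z Z' t. X \<in> H2 M F (- \<delta>) T \<Longrightarrow> X' \<in> H2 M F (- \<delta>) T \<Longrightarrow> solves X Z \<Longrightarrow> solves X' Z' \<Longrightarrow>
    t \<in> {0..T} \<Longrightarrow> msq M (\<lambda>w. Z t w - Z' t w) \<le> ennreal K *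
    (\<integral>\<^sup>+s. msq M (\<lambda>w. X s w - X' s w) + msq M (\<lambda>w. X (s - \<delta>) w - X' (s - \<delta>) w) \<partial>restrict_space lborel {0..t})"
proof -
  obtain Kb where Kb: "0 \<le> Kb" "\<And>X Y. X \<in> H2 M F (- \<delta>) T \<Longrightarrow> Y \<in> H2 M F (- \<delta>) T \<Longrightarrow>
    AE t in restrict_space lborel {0..T}. msq M (\<lambda>w. along M \<delta> b X t w - along M \<delta> b Y t w)
      \<le> ennreal Kb * (msq M (\<lambda>w. X t w - Y t w) + msq M (\<lambda>w. X (t - \<delta>) w - Y (t - \<delta>) w))"
    by (rule along_msq_lipschitz[OF bL d]) (rule that, assumption+)
  obtain Ks where Ks: "0 \<le> Ks" "\<And>X Y. X \<in> H2 M F (- \<delta>) T \<Longrightarrow> Y \<in> H2 M F (- \<delta>) T \<Longrightarrow>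
    AE t in restrict_space lborel {0..T}. msq M (\<lambda>w. along M \<delta> \<sigma> X t w - along M \<delta> \<sigma> Y t w)
      \<le> ennreal Ks * (msq M (\<lambda>w. X t w - Y t w) + msq M (\<lambda>w. X (t - \<delta>) w - Y (t - \<delta>) w))"
    by (rule along_msq_lipschitz[OF \<sigma>L d]) (rule that, assumption+)
  show ?thesis
  proof (rule that[of "2 * T * Kb + 32 * Ks"])
    show "0 \<le> 2 * T * Kb + 32 * Ks" using T Kb(1) Ks(1) by simp
    fix X X' Z Z' t
    assume X: "X \<in> H2 M F (- \<delta>) T" and X': "X' \<in> H2 M F (- \<delta>) T" and Z: "solves X Z" and Z': "solves X' Z'" and t: "t \<in> {0..T}"
    define J where "J = (\<integral>\<^sup>+s. msq M (\<lambda>w. X s w - X' s w) + msq M (\<lambda>w. X (s - \<delta>) w - X' (s - \<delta>) w) \<partial>restrict_space lborel {0..t})"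
    have t0: "0 \<le> t" and tT: "t \<le> T" using t by auto
    have m: "(\<lambda>s. msq M (\<lambda>w. X s w - X' s w) + msq M (\<lambda>w. X (s - \<delta>) w - X' (s - \<delta>) w)) \<in> borel_measurable (restrict_space lborel {0..t})"
      by (intro borel_measurable_add H2_diff_measurable[OF X X' tT])
    obtain \<beta> \<beta>' where \<beta>: "version (along M \<delta> b X) \<beta>" and \<beta>': "version (along M \<delta> b X') \<beta>'"
      using version_b[OF X] version_b[OF X'] by blast
    obtain \<psi> \<psi>' where \<psi>: "version (along M \<delta> \<sigma> X) \<psi>" and \<psi>': "version (along M \<delta> \<sigma> X') \<psi>'"
      using version_\<sigma>[OF X] version_\<sigma>[OF X'] by blast
    obtain I where I: "has_ito_integral M B F T (along M \<delta> \<sigma> X) I"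
      "AE \<omega> in M. \<forall>t\<in>{0..T}. Z t \<omega> = \<xi> 0 \<omega> + (LINT s:{0..t}|lebesgue. along M \<delta> b X s \<omega>) + I t \<omega>"
      using Z unfolding solves_def by blast
    obtain I' where I': "has_ito_integral M B F T (along M \<delta> \<sigma> X') I'"
      "AE \<omega> in M. \<forall>t\<in>{0..T}. Z' t \<omega> = \<xi> 0 \<omega> + (LINT s:{0..t}|lebesgue. along M \<delta> b X' s \<omega>) + I' t \<omega>"
      using Z' unfolding solves_def by blast
    have \<beta>m: "\<beta> \<in> borel_measurable (strip 0 t M)" "\<beta>' \<in> borel_measurable (strip 0 t M)"
      by (rule strip_measurable_mono[OF versionD(1)[OF \<beta>] tT], rule strip_measurable_mono[OF versionD(1)[OF \<beta>'] tT])
    have dm: "(\<lambda>p. \<beta> p - \<beta>' p) \<in> borel_measurable (strip 0 t M)" by (rule borel_measurable_diff[OF \<beta>m])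
    have Im: "I t \<in> borel_measurable M" "I' t \<in> borel_measurable M"
      using I(1) I'(1) t by (blast elim!: has_ito_integralD intro: F_measurable_M)+
    have eq: "AE w in M. Z t w - Z' t w = drift (\<lambda>p. \<beta> p - \<beta>' p) t w + (I t w - I' t w)"
      using I(2) I'(2) version_time_integral[OF \<beta>] version_time_integral[OF \<beta>']
    proof eventually_elim
      case (elim w)
      have "integrable (restrict_space lborel {0..t}) (\<lambda>s. \<beta> (s, w))" "integrable (restrict_space lborel {0..t}) (\<lambda>s. \<beta>' (s, w))"
        using elim(3,4) tT by (blast intro: integrable_time_mono)+
      then have "drift (\<lambda>p. \<beta> p - \<beta>' p) t w = drift \<beta> t w - drift \<beta>' t w" unfolding drift_def by simp
      moreover have "Z t w = \<xi> 0 w + drift \<beta> t w + I t w" "Z' t w = \<xi> 0 w + drift \<beta>' t w + I' t w"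
        using elim t by auto
      ultimately show ?case by simp
    qed
    have "msq M (\<lambda>w. Z t w - Z' t w) = msq M (\<lambda>w. drift (\<lambda>p. \<beta> p - \<beta>' p) t w + (I t w - I' t w))"
      by (rule msq_cong[OF eq])
    also have "\<dots> \<le> 2 * msq M (drift (\<lambda>p. \<beta> p - \<beta>' p) t) + 2 * msq M (\<lambda>w. I t w - I' t w)"
      by (intro msq_add drift_measurable[OF dm] borel_measurable_diff Im)
    also have "\<dots> \<le> 2 * (ennreal T * (ennreal Kb * J)) + 2 * (16 * (ennreal Ks * J))"
    proof (intro add_mono mult_left_mono)
      have "msq M (drift (\<lambda>p. \<beta> p - \<beta>' p) t) \<le> ennreal t * msq (strip 0 t M) (\<lambda>p. \<beta> p - \<beta>' p)"
        by (rule drift_msq[OF dm t0])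
      also have "\<dots> \<le> ennreal T * (ennreal Kb * J)"
        unfolding J_def using tT by (intro mult_mono ennreal_leI version_msq_diff[OF \<beta> \<beta>' Kb(1) Kb(2)[OF X X'] tT m]) auto
      finally show "msq M (drift (\<lambda>p. \<beta> p - \<beta>' p) t) \<le> ennreal T * (ennreal Kb * J)" .
      have "msq M (\<lambda>w. I t w - I' t w)
        \<le> 16 * msq (strip 0 T M) (\<lambda>p. indicator {0..t} (fst p) *\<^sub>R (along M \<delta> \<sigma> X (fst p) (snd p) - along M \<delta> \<sigma> X' (fst p) (snd p)))"
        by (rule has_ito_integral_msq_diff[OF I(1) I'(1) t0 tT])
      also have "msq (strip 0 T M) (\<lambda>p. indicator {0..t} (fst p) *\<^sub>R (along M \<delta> \<sigma> X (fst p) (snd p) - along M \<delta> \<sigma> X' (fst p) (snd p)))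
         = msq (strip 0 T M) (\<lambda>p. indicator {0..t} (fst p) *\<^sub>R (\<psi> p - \<psi>' p))"
      proof (rule msq_cong)
        show "AE p in strip 0 T M. indicator {0..t} (fst p) *\<^sub>R (along M \<delta> \<sigma> X (fst p) (snd p) - along M \<delta> \<sigma> X' (fst p) (snd p))
            = indicator {0..t} (fst p) *\<^sub>R (\<psi> p - \<psi>' p)"
          using versionD(3)[OF \<psi>] versionD(3)[OF \<psi>'] by eventually_elim simp
      qed
      also have "\<dots> = msq (strip 0 t M) (\<lambda>p. \<psi> p - \<psi>' p)"
        using versionD(1)[OF \<psi>] versionD(1)[OF \<psi>'] tT
        by (intro msq_strip_restrict[symmetric] borel_measurable_diff strip_measurable_mono[OF _ tT])
      also have "\<dots> \<le> ennreal Ks * J"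
        unfolding J_def by (rule version_msq_diff[OF \<psi> \<psi>' Ks(1) Ks(2)[OF X X'] tT m])
      finally show "msq M (\<lambda>w. I t w - I' t w) \<le> 16 * (ennreal Ks * J)" by (simp add: mult_left_mono)
    qed auto
    also have "\<dots> = ennreal (2 * T * Kb + 32 * Ks) * J"
    proof -
      have "ennreal (2 * T * Kb + 32 * Ks) = 2 * (ennreal T * ennreal Kb) + 2 * (16 * ennreal Ks)"
        using T Kb(1) Ks(1) by (simp add: ennreal_plus ennreal_mult' mult.assoc[symmetric])
      then show ?thesis by (simp add: distrib_right mult.assoc)
    qed
    finally show "msq M (\<lambda>w. Z t w - Z' t w) \<le> ennreal (2 * T * Kb + 32 * Ks) *
      (\<integral>\<^sup>+s. msq M (\<lambda>w. X s w - X' s w) + msq M (\<lambda>w. X (s - \<delta>) w - X' (s - \<delta>) w) \<partial>restrict_space lborel {0..t})"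
      unfolding J_def .
  qed
qed

section \<open>Solving the equation with frozen coefficients\<close>

lemma \<xi>_extended_measurable:
  "(\<lambda>p. \<xi> (min 0 (fst p)) (snd p)) \<in> borel_measurable (strip (- \<delta>) T M)"
proof -
  have "(\<lambda>t. min 0 t) \<in> restrict_space lborel {-\<delta>..T} \<rightarrow>\<^sub>M restrict_space lborel {-\<delta>..0}"
    using d by (intro measurable_restrict_space2 measurable_restrict_space1) (auto simp: space_restrict_space)
  then have "(\<lambda>p. (min 0 (fst p), snd p)) \<in> strip (- \<delta>) T M \<rightarrow>\<^sub>M strip (- \<delta>) 0 M"
    by (intro measurable_Pair measurable_compose[OF measurable_fst] measurable_snd)
  from measurable_compose[OF this H2D(3)[OF \<xi>H]] show ?thesis by simp
qed

text \<open>The two kinds of control are joined at time \<open>0\<close>: \<open>\<xi>\<close> is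
  bounded in the integrated sense, and \<open>Z\<close> at each later time.\<close>

lemma H2_extend_\<xi>:
  fixes Z :: "real \<Rightarrow> 'w \<Rightarrow> real^'m"
  assumes F: "\<And>t. t \<in> {0..T} \<Longrightarrow> Z t \<in> borel_measurable (F t)"
    and m: "(\<lambda>p. Z (fst p) (snd p)) \<in> borel_measurable (strip (- \<delta>) T M)"
    and init: "\<And>t. t \<in> {-\<delta>..0} \<Longrightarrow> Z t = \<xi> t"
    and bound: "\<And>t. t \<in> {0..T} \<Longrightarrow> msq M (Z t) \<le> c" and c: "c < \<infinity>"
  shows "Z \<in> H2 M F (- \<delta>) T"
  unfolding H2_iff
proof (intro conjI ballI m)
  fix t assume t: "t \<in> {-\<delta>..T}"
  show "Z t \<in> borel_measurable (F t)"
  proof (cases "t \<le> 0")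
    case True
    then have "t \<in> {-\<delta>..0}" using t by auto
    from H2D(1)[OF \<xi>H this] init[OF this] show ?thesis by simp
  next
    case False
    with t show ?thesis by (intro F) auto
  qed
next
  have "msq (strip (- \<delta>) T M) (\<lambda>p. Z (fst p) (snd p)) = (\<integral>\<^sup>+t. msq M (Z t) \<partial>restrict_space lborel {-\<delta>..T})"
    using msq_strip_time(1)[OF m] by simp
  also have "\<dots> \<le> (\<integral>\<^sup>+t. msq M (Z t) \<partial>restrict_space lborel {-\<delta>..0}) + (\<integral>\<^sup>+t. msq M (Z t) \<partial>restrict_space lborel {0..T})"
    using msq_strip_time(2)[OF m] d T by (intro nn_integral_time_split_le) auto
  also have "(\<integral>\<^sup>+t. msq M (Z t) \<partial>restrict_space lborel {-\<delta>..0}) = (\<integral>\<^sup>+t. msq M (\<xi> t) \<partial>restrict_space lborel {-\<delta>..0})"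
    using init by (intro nn_integral_cong) (simp add: space_restrict_space)
  also have "\<dots> = msq (strip (- \<delta>) 0 M) (\<lambda>p. \<xi> (fst p) (snd p))"
    using msq_strip_time(1)[OF H2D(3)[OF \<xi>H]] by simp
  also have "(\<integral>\<^sup>+t. msq M (Z t) \<partial>restrict_space lborel {0..T}) \<le> (\<integral>\<^sup>+t. c \<partial>restrict_space lborel {0..T})"
    using bound by (intro nn_integral_mono) (simp add: space_restrict_space)
  also have "\<dots> = c * ennreal T"
    using T by (simp add: emeasure_restrict_space space_restrict_space)
  finally show "msq (strip (- \<delta>) T M) (\<lambda>p. Z (fst p) (snd p)) < \<infinity>"
    using H2D(4)[OF \<xi>H] c by (simp add: add_left_mono ennreal_mult_less_top less_top order_le_less_trans)
qed

text \<open>\<open>V\<close> is the right-hand side of the equation. The remaining work is to choose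
  its values on null sets so that the process, glued to \<open>\<xi>\<close> at time
  \<open>0\<close>, is adapted and jointly measurable.\<close>

lemma solves_exists:
  assumes X: "X \<in> H2 M F (- \<delta>) T"
  shows "\<exists>Z. solves X Z"
proof -
  obtain \<beta> where \<beta>: "version (along M \<delta> b X) \<beta>" using version_b[OF X] by blast
  obtain \<psi> where \<psi>: "version (along M \<delta> \<sigma> X) \<psi>" using version_\<sigma>[OF X] by blast
  obtain I where I: "has_ito_integral M B F T (\<lambda>s w. \<psi> (s, w)) I"
    using has_ito_integral_exists[OF T versionD(1,2,4)[OF \<psi>]] by blast
  have I\<sigma>: "has_ito_integral M B F T (along M \<delta> \<sigma> X) I"
  proof (rule has_ito_integral_cong[OF I])
    show "AE p in strip 0 T M. \<psi> (fst p, snd p) = along M \<delta> \<sigma> X (fst p) (snd p)"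
      using versionD(3)[OF \<psi>] by eventually_elim simp
  qed
  have IF: "I t \<in> borel_measurable (F t)" if "t \<in> {0..T}" for t
    using I that unfolding has_ito_integral_def Let_def by blast
  have Icont: "AE w in M. continuous_on {0..T} (\<lambda>t. I t w)"
    using I unfolding has_ito_integral_def Let_def by blast
  have Imsq: "msq M (I t) \<le> 16 * msq (strip 0 T M) (\<lambda>p. indicator {0..t} (fst p) *\<^sub>R \<psi> p)" if "t \<in> {0..T}" for t
    using has_ito_integral_msq_diff[OF I has_ito_integral_zero, of t] that by simp
  \<comment> \<open>\<open>has_ito_integral\<close> does not state an initial value. Comparison with
    the zero integral bounds the mean square at time \<open>0\<close> by an integral over a null set
    of times.\<close>
  have I0: "AE w in M. I 0 w = 0"
  proof (rule msq_eq_0_AE)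
    show "I 0 \<in> borel_measurable M" using T by (intro F_measurable_M[OF IF]) simp
    have "AE t in restrict_space lborel {0..T}. t \<noteq> 0"
      using AE_lborel_singleton[of "0::real"] by (simp add: AE_restrict_space_iff) (auto elim: eventually_mono)
    from AE_strip_fst[OF this]
    have "AE p in strip 0 T M. indicator {0..0} (fst p) *\<^sub>R \<psi> p = 0" by eventually_elim simp
    from msq_cong[OF this] Imsq[of 0] T show "msq M (I 0) = 0" by simp
  qed
  define V where "V t w = \<xi> 0 w + drift \<beta> t w + I t w" for t w
  have \<xi>0F: "\<xi> 0 \<in> borel_measurable (F 0)" using d by (intro H2D(1)[OF \<xi>H]) simp
  have \<beta>F: "drift \<beta> t \<in> borel_measurable (F t)" if "t \<in> {0..T}" for t
    using that by (intro drift_F_measurable[OF T versionD(1,2,4)[OF \<beta>]]) auto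
  have VF: "V t \<in> borel_measurable (F t)" if t: "t \<in> {0..T}" for t
    unfolding V_def[abs_def] using t
    by (intro borel_measurable_add F_measurable_mono[OF \<xi>0F] \<beta>F IF) auto
  have "AE w in M. continuous_on {0..T} (\<lambda>t. V t w) \<and> I 0 w = 0"
    using version_time_integral[OF \<beta>] Icont I0
  proof eventually_elim
    case (elim w)
    have "continuous_on {0..T} (\<lambda>t. drift \<beta> t w)"
      unfolding drift_def by (intro continuous_on_time_integral) (use elim in blast)
    with elim show ?case unfolding V_def by (intro conjI continuous_intros) auto
  qed
  then obtain N where N: "N \<in> null_sets M" "{w \<in> space M. \<not> (continuous_on {0..T} (\<lambda>t. V t w) \<and> I 0 w = 0)} \<subseteq> N"
    by (auto simp: eventually_ae_filter)
  have NAE: "AE w in M. w \<notin> N" by (rule AE_not_in[OF N(1)])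
  \<comment> \<open>Every path of \<open>U\<close> is continuous on \<open>[0, T]\<close>, not just
    almost every one, as \<open>continuous_process_measurable\<close> requires. Adaptedness survives
    because the filtration is completed.\<close>
  define U where "U t w = (if w \<in> N then 0 else V t w)" for t w
  define Z where "Z t w = (if t \<le> 0 then \<xi> t w else U t w)" for t w
  have UF: "U t \<in> borel_measurable (F t)" if "t \<in> {0..T}" for t
    by (rule F_measurable_cong_AE[OF VF[OF that]]) (use NAE in \<open>auto simp: U_def elim!: eventually_mono\<close>)
  have Ucont: "continuous_on {0..T} (\<lambda>t. U t w)" if "w \<in> space M" for w
    using N(2) that by (cases "w \<in> N") (auto simp: U_def)
  have ZV: "AE w in M. \<forall>t\<in>{0..T}. Z t w = V t w"
    using NAE I0 by eventually_elim (auto simp: Z_def U_def V_def drift_zero_time)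
  have ZF: "Z t \<in> borel_measurable (F t)" if t: "t \<in> {0..T}" for t
    by (rule F_measurable_cong_AE[OF VF[OF t]]) (use ZV t in \<open>auto elim!: eventually_mono\<close>)
  \<comment> \<open>Two doubled triangle inequalities for three summands, with Cauchy-Schwarz in
    time for the drift and the comparison with the zero integral for \<open>I\<close>.\<close>
  define c where "c = 2 * (2 * msq M (\<xi> 0) + 2 * (ennreal T * msq (strip 0 T M) \<beta>)) + 2 * (16 * msq (strip 0 T M) \<psi>)"
  have "Z \<in> H2 M F (- \<delta>) T"
  proof (rule H2_extend_\<xi>[OF ZF])
    have "(\<lambda>p. if fst p \<le> 0 then \<xi> (min 0 (fst p)) (snd p) else U (max 0 (min T (fst p))) (snd p))
        \<in> borel_measurable (strip (- \<delta>) T M)"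
    proof (rule measurable_If[OF \<xi>_extended_measurable])
      show "(\<lambda>p. U (max 0 (min T (fst p))) (snd p)) \<in> borel_measurable (strip (- \<delta>) T M)"
        using T by (intro continuous_process_measurable F_measurable_M[OF UF] Ucont) auto
      have [measurable]: "fst \<in> borel_measurable (strip (- \<delta>) T M)"
        by (rule measurable_compose[OF measurable_fst]) (simp add: measurable_restrict_space1)
      show "{p \<in> space (strip (- \<delta>) T M). fst p \<le> 0} \<in> sets (strip (- \<delta>) T M)" by measurable
    qed
    then show "(\<lambda>p. Z (fst p) (snd p)) \<in> borel_measurable (strip (- \<delta>) T M)"
      by (rule measurable_cong[THEN iffD1, rotated]) (auto simp: Z_def space_pair_measure space_restrict_space)
    show "Z t = \<xi> t" if "t \<in> {- \<delta>..0}" for t using that by (auto simp: Z_def)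
    show "msq M (Z t) \<le> c" if t: "t \<in> {0..T}" for t
    proof -
      have tT: "0 \<le> t" "t \<le> T" using t by auto
      have "msq M (Z t) = msq M (\<lambda>w. \<xi> 0 w + drift \<beta> t w + I t w)"
        using ZV t unfolding V_def by (intro msq_cong) (auto elim!: eventually_mono)
      also have "\<dots> \<le> 2 * msq M (\<lambda>w. \<xi> 0 w + drift \<beta> t w) + 2 * msq M (I t)"
        by (intro msq_add borel_measurable_add F_measurable_M[OF \<xi>0F] F_measurable_M[OF \<beta>F[OF t]] F_measurable_M[OF IF[OF t]])
      also have "\<dots> \<le> c" unfolding c_def
      proof (intro add_mono mult_left_mono)
        have "msq M (\<lambda>w. \<xi> 0 w + drift \<beta> t w) \<le> 2 * msq M (\<xi> 0) + 2 * msq M (drift \<beta> t)"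
          by (intro msq_add F_measurable_M[OF \<xi>0F] F_measurable_M[OF \<beta>F[OF t]])
        also have "\<dots> \<le> 2 * msq M (\<xi> 0) + 2 * (ennreal T * msq (strip 0 T M) \<beta>)"
        proof (intro add_mono mult_left_mono order_refl)
          have \<beta>t: "\<beta> \<in> borel_measurable (strip 0 t M)" by (rule strip_measurable_mono[OF versionD(1)[OF \<beta>] tT(2)])
          have "msq M (drift \<beta> t) \<le> ennreal t * msq (strip 0 t M) \<beta>" by (rule drift_msq[OF \<beta>t tT(1)])
          also have "msq (strip 0 t M) \<beta> = msq (strip 0 T M) (\<lambda>p. indicator {0..t} (fst p) *\<^sub>R \<beta> p)"
            by (rule msq_strip_restrict[OF \<beta>t versionD(1)[OF \<beta>] tT(2)])
          also have "ennreal t * \<dots> \<le> ennreal T * msq (strip 0 T M) \<beta>"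
            using tT(2) by (intro mult_mono ennreal_leI msq_mono AE_I2) (auto simp: indicator_def)
          finally show "msq M (drift \<beta> t) \<le> ennreal T * msq (strip 0 T M) \<beta>" .
        qed auto
        finally show "msq M (\<lambda>w. \<xi> 0 w + drift \<beta> t w) \<le> 2 * msq M (\<xi> 0) + 2 * (ennreal T * msq (strip 0 T M) \<beta>)" .
        have "msq (strip 0 T M) (\<lambda>p. indicator {0..t} (fst p) *\<^sub>R \<psi> p) \<le> msq (strip 0 T M) \<psi>"
          by (intro msq_mono AE_I2) (auto simp: indicator_def)
        with Imsq[OF t] show "msq M (I t) \<le> 16 * msq (strip 0 T M) \<psi>"
          by (meson mult_left_mono order_trans zero_le)
      qed auto
      finally show ?thesis .
    qed
    show "c < \<infinity>"
      using \<xi>0 versionD(2)[OF \<beta>] versionD(2)[OF \<psi>] by (simp add: c_def ennreal_mult_less_top)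
  qed auto
  moreover have "AE w in M. \<forall>t\<in>{-\<delta>..0}. Z t w = \<xi> t w" by (simp add: Z_def)
  moreover have "AE w in M. set_integrable lebesgue {0..T} (\<lambda>s. along M \<delta> b X s w)"
    using version_time_integral[OF \<beta>] by eventually_elim blast
  moreover have "AE w in M. \<forall>t\<in>{0..T}. Z t w = \<xi> 0 w + (LINT s:{0..t}|lebesgue. along M \<delta> b X s w) + I t w"
    using version_time_integral[OF \<beta>] ZV by eventually_elim (simp add: V_def)
  ultimately show ?thesis unfolding solves_def using I\<sigma> by blast
qed

lemma solvesD:
  assumes "solves X Z"
  shows "Z \<in> H2 M F (- \<delta>) T" and "AE w in M. \<forall>t\<in>{-\<delta>..0}. Z t w = \<xi> t w"
  using assms unfolding solves_def by blast+

text \<open>Continuity is not part of the definition of a solution. It comes from the equation,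
  which holds at all times simultaneously for almost every sample point.\<close>

lemma solves_continuous:
  assumes X: "X \<in> H2 M F (- \<delta>) T" and Z: "solves X Z"
  shows "AE w in M. continuous_on {0..T} (\<lambda>t. Z t w)"
proof -
  obtain \<beta> where \<beta>: "version (along M \<delta> b X) \<beta>" using version_b[OF X] by blast
  obtain I where I: "has_ito_integral M B F T (along M \<delta> \<sigma> X) I"
    "AE w in M. \<forall>t\<in>{0..T}. Z t w = \<xi> 0 w + (LINT s:{0..t}|lebesgue. along M \<delta> b X s w) + I t w"
    using Z unfolding solves_def by blast
  have "AE w in M. continuous_on {0..T} (\<lambda>t. I t w)"
    using I(1) unfolding has_ito_integral_def Let_def by blast
  with I(2) version_time_integral[OF \<beta>] show ?thesis
  proof eventually_elim
    case (elim w)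
    have "continuous_on {0..T} (\<lambda>t. drift \<beta> t w)"
      unfolding drift_def by (intro continuous_on_time_integral) (use elim in blast)
    then have "continuous_on {0..T} (\<lambda>t. \<xi> 0 w + drift \<beta> t w + I t w)"
      using elim(3) by (intro continuous_intros)
    then show ?case
      by (rule continuous_on_cong[THEN iffD1, rotated 2]) (use elim in auto)
  qed
qed

section \<open>Contraction, uniqueness and the fixed point\<close>

lemma solves_initial_diff:
  assumes "solves X Z" "solves X' Z'" "t \<in> {-\<delta>..0}"
  shows "msq M (\<lambda>w. Z t w - Z' t w) = 0"
proof -
  have "AE w in M. Z t w - Z' t w = 0"
    using solvesD(2)[OF assms(1)] solvesD(2)[OF assms(2)] by eventually_elim (use assms(3) in simp)
  from msq_cong[OF this] show ?thesis by simp
qed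

text \<open>Membership in \<open>H2\<close> bounds the distance of \<open>X\<close> and
  \<open>X'\<close> only after integration in time; one application of the solution map makes the
  bound uniform in time. It supplies the starting constant of the geometric iterations.\<close>

lemma solves_bounded_diff:
  assumes X: "X \<in> H2 M F (- \<delta>) T" and X': "X' \<in> H2 M F (- \<delta>) T" and Z: "solves X Z" "solves X' Z'"
  obtains A where "0 \<le> A" "\<And>t. t \<in> {0..T} \<Longrightarrow> msq M (\<lambda>w. Z t w - Z' t w) \<le> ennreal A"
proof -
  obtain K where K: "0 \<le> K" "\<And>X X' Z Z' t. X \<in> H2 M F (- \<delta>) T \<Longrightarrow> X' \<in> H2 M F (- \<delta>) T \<Longrightarrow> solves X Z \<Longrightarrow> solves X' Z' \<Longrightarrow>
    t \<in> {0..T} \<Longrightarrow> msq M (\<lambda>w. Z t w - Z' t w) \<le> ennreal K *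
    (\<integral>\<^sup>+s. msq M (\<lambda>w. X s w - X' s w) + msq M (\<lambda>w. X (s - \<delta>) w - X' (s - \<delta>) w) \<partial>restrict_space lborel {0..t})"
    by (rule solves_lipschitz) (rule that, assumption+)
  let ?D = "\<lambda>s. msq M (\<lambda>w. X s w - X' s w)"
  let ?m = "msq (strip (- \<delta>) T M) (\<lambda>p. X (fst p) (snd p) - X' (fst p) (snd p))"
  have meas: "(\<lambda>p. X (fst p) (snd p) - X' (fst p) (snd p)) \<in> borel_measurable (strip (- \<delta>) T M)"
    by (intro borel_measurable_diff H2D(3) X X')
  have m: "?m = (\<integral>\<^sup>+s. ?D s \<partial>restrict_space lborel {-\<delta>..T})" using msq_strip_time(1)[OF meas] by simp
  have "?m \<le> 2 * msq (strip (- \<delta>) T M) (\<lambda>p. X (fst p) (snd p)) + 2 * msq (strip (- \<delta>) T M) (\<lambda>p. X' (fst p) (snd p))"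
    using msq_triangle[OF H2D(3)[OF X] _ H2D(3)[OF X'], of "\<lambda>p. 0"] msq_minus_commute[of _ "\<lambda>p. 0" "\<lambda>p. X' (fst p) (snd p)"]
    by simp
  also have "\<dots> < \<infinity>" using H2D(4)[OF X] H2D(4)[OF X'] by (simp add: ennreal_mult_less_top)
  finally have fin: "ennreal K * (?m + ?m) < \<infinity>" by (simp add: ennreal_mult_less_top)
  show thesis
  proof (rule that[of "enn2real (ennreal K * (?m + ?m))"])
    fix t assume t: "t \<in> {0..T}"
    then have tT: "t \<le> T" by simp
    have "msq M (\<lambda>w. Z t w - Z' t w) \<le> ennreal K * (\<integral>\<^sup>+s. ?D s + ?D (s - \<delta>) \<partial>restrict_space lborel {0..t})"
      by (rule K(2)[OF X X' Z t])
    also have "\<dots> \<le> ennreal K * (?m + ?m)"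
    proof (rule mult_left_mono)
      have "(\<integral>\<^sup>+s. ?D s + ?D (s - \<delta>) \<partial>restrict_space lborel {0..t}) =
         (\<integral>\<^sup>+s. ?D s \<partial>restrict_space lborel {0..t}) + (\<integral>\<^sup>+s. ?D (s - \<delta>) \<partial>restrict_space lborel {0..t})"
        by (intro nn_integral_add H2_diff_measurable[OF X X' tT])
      also have "\<dots> \<le> ?m + ?m"
      proof (rule add_mono)
        show "(\<integral>\<^sup>+s. ?D s \<partial>restrict_space lborel {0..t}) \<le> ?m"
          unfolding m using tT d by (intro nn_integral_time_mono) auto
        have "(\<integral>\<^sup>+s. ?D (s - \<delta>) \<partial>restrict_space lborel {0..t}) \<le> (\<integral>\<^sup>+s. ?D (s - \<delta>) \<partial>restrict_space lborel {0..T})"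
          using tT by (intro nn_integral_time_mono) auto
        also have "\<dots> \<le> ?m"
          unfolding m by (rule nn_integral_time_shift[OF H2_diff_measurable(1)[OF X X' order_refl] d])
        finally show "(\<integral>\<^sup>+s. ?D (s - \<delta>) \<partial>restrict_space lborel {0..t}) \<le> ?m" .
      qed
      finally show "(\<integral>\<^sup>+s. ?D s + ?D (s - \<delta>) \<partial>restrict_space lborel {0..t}) \<le> ?m + ?m" .
    qed simp
    finally show "msq M (\<lambda>w. Z t w - Z' t w) \<le> ennreal (enn2real (ennreal K * (?m + ?m)))" using fin by simp
  qed simp
qed

text \<open>Weighting the mean square distance at time \<open>t\<close> by \<open>exp (- \<kappa> * t)\<close> turns the solution map into
  a contraction on all of \<open>[0, T]\<close> at once.\<close>

definition contraction_rate :: "real \<Rightarrow> bool" where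
  "contraction_rate \<kappa> \<longleftrightarrow> 0 \<le> \<kappa> \<and> (\<forall>X X' Z Z' a. X \<in> H2 M F (- \<delta>) T \<longrightarrow> X' \<in> H2 M F (- \<delta>) T \<longrightarrow>
    solves X Z \<longrightarrow> solves X' Z' \<longrightarrow> 0 \<le> a \<longrightarrow> (\<forall>s\<in>{-\<delta>..0}. msq M (\<lambda>w. X s w - X' s w) = 0) \<longrightarrow>
    (\<forall>s\<in>{0..T}. msq M (\<lambda>w. X s w - X' s w) \<le> ennreal (a * exp (\<kappa> * s))) \<longrightarrow>
    (\<forall>t\<in>{0..T}. msq M (\<lambda>w. Z t w - Z' t w) \<le> ennreal (a * (1/4) * exp (\<kappa> * t))))"

lemma contraction_rateD:
  assumes "contraction_rate \<kappa>" "X \<in> H2 M F (- \<delta>) T" "X' \<in> H2 M F (- \<delta>) T" "solves X Z" "solves X' Z'" "0 \<le> a"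
    and "\<And>s. s \<in> {-\<delta>..0} \<Longrightarrow> msq M (\<lambda>w. X s w - X' s w) = 0"
    and "\<And>s. s \<in> {0..T} \<Longrightarrow> msq M (\<lambda>w. X s w - X' s w) \<le> ennreal (a * exp (\<kappa> * s))"
    and "t \<in> {0..T}"
  shows "msq M (\<lambda>w. Z t w - Z' t w) \<le> ennreal (a * (1/4) * exp (\<kappa> * t))"
  using assms unfolding contraction_rate_def by blast

text \<open>The delayed term is bounded like the present one, so the integrand in
  \<open>solves_lipschitz\<close> is at most \<open>2 * a * exp (\<kappa> * s)\<close>. Integration
  gains the factor \<open>1 / \<kappa>\<close>.\<close>

lemma contraction_rate_exists: "\<exists>\<kappa>. contraction_rate \<kappa>"
proof -
  obtain K where K: "0 \<le> K" "\<And>X X' Z Z' t. X \<in> H2 M F (- \<delta>) T \<Longrightarrow> X' \<in> H2 M F (- \<delta>) T \<Longrightarrow> solves X Z \<Longrightarrow> solves X' Z' \<Longrightarrow>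
    t \<in> {0..T} \<Longrightarrow> msq M (\<lambda>w. Z t w - Z' t w) \<le> ennreal K *
    (\<integral>\<^sup>+s. msq M (\<lambda>w. X s w - X' s w) + msq M (\<lambda>w. X (s - \<delta>) w - X' (s - \<delta>) w) \<partial>restrict_space lborel {0..t})"
    by (rule solves_lipschitz) (rule that, assumption+)
  \<comment> \<open>The ratio \<open>2 * K / \<kappa>\<close> is at most \<open>1/4\<close> once
    \<open>8 * K \<le> \<kappa>\<close>; the summand \<open>1\<close> keeps \<open>\<kappa>\<close>
    positive when \<open>K = 0\<close>.\<close>
  define \<kappa> where "\<kappa> = 8 * K + 1"
  have \<kappa>: "0 < \<kappa>" using K(1) by (simp add: \<kappa>_def)
  show ?thesis
    unfolding contraction_rate_def
  proof (intro exI[of _ \<kappa>] conjI allI impI ballI)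
    show "0 \<le> \<kappa>" using \<kappa> by simp
    fix X X' :: "real \<Rightarrow> 'w \<Rightarrow> real^'m" and Z Z' a t
    assume X: "X \<in> H2 M F (- \<delta>) T" and X': "X' \<in> H2 M F (- \<delta>) T" and Z: "solves X Z" "solves X' Z'" and a: "0 \<le> a"
      and 0: "\<forall>s\<in>{-\<delta>..0}. msq M (\<lambda>w. X s w - X' s w) = 0"
      and 1: "\<forall>s\<in>{0..T}. msq M (\<lambda>w. X s w - X' s w) \<le> ennreal (a * exp (\<kappa> * s))"
      and t: "t \<in> {0..T}"
    let ?D = "\<lambda>s. msq M (\<lambda>w. X s w - X' s w)"
    have le: "?D s + ?D (s - \<delta>) \<le> ennreal (2 * a * exp (\<kappa> * s))" if s: "s \<in> {0..t}" for s
    proof -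
      have "?D s \<le> ennreal (a * exp (\<kappa> * s))" using 1 s t by simp
      \<comment> \<open>The delayed time lies either in the initial segment, where the difference
        vanishes, or before \<open>s\<close>, where the weight is no larger.\<close>
      moreover have "?D (s - \<delta>) \<le> ennreal (a * exp (\<kappa> * s))"
      proof (cases "s - \<delta> \<le> 0")
        case True
        then have "s - \<delta> \<in> {-\<delta>..0}" using s by auto
        with 0 show ?thesis by simp
      next
        case False
        then have "s - \<delta> \<in> {0..T}" using s t d by auto
        with 1 have "?D (s - \<delta>) \<le> ennreal (a * exp (\<kappa> * (s - \<delta>)))" by blast
        also have "\<dots> \<le> ennreal (a * exp (\<kappa> * s))"
          using a \<kappa> d by (intro ennreal_leI mult_left_mono) auto
        finally show ?thesis .
      qed
      ultimately have "?D s + ?D (s - \<delta>) \<le> ennreal (a * exp (\<kappa> * s)) + ennreal (a * exp (\<kappa> * s))" by (rule add_mono)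
      also have "\<dots> = ennreal (2 * a * exp (\<kappa> * s))" using a by (subst ennreal_plus[symmetric]) auto
      finally show ?thesis .
    qed
    have "msq M (\<lambda>w. Z t w - Z' t w) \<le> ennreal K * (\<integral>\<^sup>+s. ?D s + ?D (s - \<delta>) \<partial>restrict_space lborel {0..t})"
      by (rule K(2)[OF X X' Z t])
    also have "\<dots> \<le> ennreal K * (\<integral>\<^sup>+s. ennreal (2 * a * exp (\<kappa> * s)) \<partial>restrict_space lborel {0..t})"
      using le by (intro mult_left_mono nn_integral_mono) (auto simp: space_restrict_space)
    also have "\<dots> \<le> ennreal K * ennreal (2 * a * exp (\<kappa> * t) / \<kappa>)"
      using t a \<kappa> by (intro mult_left_mono nn_integral_exp_le) auto
    also have "\<dots> = ennreal (K * (2 * a * exp (\<kappa> * t) / \<kappa>))"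
      by (rule ennreal_mult'[symmetric]) (rule K(1))
    also have "\<dots> \<le> ennreal (a * (1/4) * exp (\<kappa> * t))"
    proof (rule ennreal_leI)
      have "K * 8 \<le> \<kappa>" by (simp add: \<kappa>_def)
      then have "K * 8 * (a * exp (\<kappa> * t)) \<le> \<kappa> * (a * exp (\<kappa> * t))" using a by (intro mult_right_mono) auto
      then show "K * (2 * a * exp (\<kappa> * t) / \<kappa>) \<le> a * (1/4) * exp (\<kappa> * t)"
        using \<kappa> by (simp add: field_simps)
    qed
    finally show "msq M (\<lambda>w. Z t w - Z' t w) \<le> ennreal (a * (1/4) * exp (\<kappa> * t))" .
  qed
qed

text \<open>Two fixed points are their own images, so the contraction improves any uniform bound on
  their distance by \<open>1/4\<close> again and again.\<close>

lemma solution_unique: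
  assumes X: "solves X X" and Y: "solves Y Y"
  shows "AE w in M. \<forall>t\<in>{-\<delta>..T}. Y t w = X t w"
proof -
  have XH: "X \<in> H2 M F (- \<delta>) T" and YH: "Y \<in> H2 M F (- \<delta>) T" by (rule solvesD(1)[OF X], rule solvesD(1)[OF Y])
  obtain \<kappa> where \<kappa>: "contraction_rate \<kappa>" using contraction_rate_exists by blast
  have \<kappa>0: "0 \<le> \<kappa>" using \<kappa> unfolding contraction_rate_def by blast
  obtain A where A: "0 \<le> A" "\<And>t. t \<in> {0..T} \<Longrightarrow> msq M (\<lambda>w. Y t w - X t w) \<le> ennreal A"
    by (rule solves_bounded_diff[OF YH XH Y X]) (rule that, assumption+)
  have le: "t \<in> {0..T} \<Longrightarrow> msq M (\<lambda>w. Y t w - X t w) \<le> ennreal (A * (1/4)^n * exp (\<kappa> * t))" for n t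
  proof (induction n arbitrary: t)
    case 0
    have "A * 1 \<le> A * exp (\<kappa> * t)" using A(1) \<kappa>0 0 by (intro mult_left_mono) auto
    with A(2)[OF 0] show ?case by (auto intro: order_trans ennreal_leI)
  next
    case (Suc n)
    have "msq M (\<lambda>w. Y t w - X t w) \<le> ennreal (A * (1/4)^n * (1/4) * exp (\<kappa> * t))"
      by (rule contraction_rateD[OF \<kappa> YH XH Y X _ solves_initial_diff[OF Y X] Suc.IH Suc.prems]) (use A(1) in simp_all)
    then show ?case by (simp add: mult.assoc mult.commute)
  qed
  have eq: "AE w in M. Y t w = X t w" if t: "t \<in> {0..T}" for t
  proof -
    have "(\<lambda>n. ennreal (A * (1/4)^n * exp (\<kappa> * t))) \<longlonglongrightarrow> ennreal (A * 0 * exp (\<kappa> * t))"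
      by (intro tendsto_intros LIMSEQ_power_zero) auto
    then have "msq M (\<lambda>w. Y t w - X t w) \<le> ennreal (A * 0 * exp (\<kappa> * t))"
      by (rule LIMSEQ_le_const) (use le[OF t] in blast)
    then have "msq M (\<lambda>w. Y t w - X t w) = 0" by simp
    moreover have "(\<lambda>w. Y t w - X t w) \<in> borel_measurable M"
      using t d by (intro borel_measurable_diff H2D(2)[OF XH] H2D(2)[OF YH]) auto
    ultimately have "AE w in M. Y t w - X t w = 0" by (intro msq_eq_0_AE)
    then show ?thesis by eventually_elim simp
  qed
  have node: "node 0 T (2^n) i \<in> {0..T} \<Longrightarrow> AE w in M. Y (node 0 T (2^n) i) w = X (node 0 T (2^n) i) w" for n i :: nat
    by (rule eq)
  \<comment> \<open>The null set in \<open>eq\<close> depends on the time. Countably many dyadic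
    times share one null set, and continuity reaches the remaining times.\<close>
  have "AE w in M. \<forall>n i. node 0 T (2^n) i \<in> {0..T} \<longrightarrow> Y (node 0 T (2^n) i) w = X (node 0 T (2^n) i) w"
    unfolding AE_all_countable using node by (auto intro: AE_impI)
  with solves_continuous[OF XH X] solves_continuous[OF YH Y] solvesD(2)[OF X] solvesD(2)[OF Y] show ?thesis
  proof eventually_elim
    case (elim w)
    show ?case
    proof
      fix t assume t: "t \<in> {-\<delta>..T}"
      show "Y t w = X t w"
      proof (cases "t \<le> 0")
        case True
        with elim(3,4) t show ?thesis by simp
      next
        case False
        with t have t0: "t \<in> {0..T}" by simp
        let ?\<tau> = "\<lambda>n. node 0 T (2^n) (cell 0 T (2^n) t)"
        have n: "?\<tau> n \<in> {0..T}" for n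
          using node_ge[of 0 T] node_cell_le[of 0 T "2^n" t] T t0 by (simp add: order_trans[of _ t])
        have lim: "?\<tau> \<longlonglongrightarrow> t" by (rule node_cell_tendsto[OF T t0])
        have "(\<lambda>n. X (?\<tau> n) w) \<longlonglongrightarrow> X t w"
          using n by (intro continuous_on_tendsto_compose[OF elim(1) lim t0] always_eventually) blast
        moreover have "(\<lambda>n. Y (?\<tau> n) w) \<longlonglongrightarrow> Y t w"
          using n by (intro continuous_on_tendsto_compose[OF elim(2) lim t0] always_eventually) blast
        moreover have "Y (?\<tau> n) w = X (?\<tau> n) w" for n using elim(5) n by blast
        ultimately show ?thesis by (simp add: LIMSEQ_unique)
      qed
    qed
  qed
qed

text \<open>Modifications have the same law at each time, and by Tonelli they agree almost
  everywhere on the strip.\<close>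

lemma along_modification:
  assumes X: "X \<in> H2 M F (- \<delta>) T" and X': "X' \<in> H2 M F (- \<delta>) T"
    and eq: "\<And>t. t \<in> {-\<delta>..T} \<Longrightarrow> AE w in M. X t w = X' t w"
  shows "AE p in strip 0 T M. along M \<delta> f X (fst p) (snd p) = along M \<delta> f X' (fst p) (snd p)"
proof -
  have law: "distr M borel (X t) = distr M borel (X' t)" if "t \<in> {-\<delta>..T}" for t
    using H2D(2)[OF X that] H2D(2)[OF X' that] eq[OF that] by (intro distr_cong_AE) auto
  have 1: "AE p in strip 0 T M. X (fst p) (snd p) = X' (fst p) (snd p)"
    using d by (intro AE_strip_eqI strip_measurable_subset[OF H2D(3)[OF X] sub_T] strip_measurable_subset[OF H2D(3)[OF X'] sub_T])
      (auto intro: eq)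
  have 2: "AE p in strip 0 T M. X (fst p - \<delta>) (snd p) = X' (fst p - \<delta>) (snd p)"
    using strip_measurable_shift[OF H2D(3)[OF X] d] strip_measurable_shift[OF H2D(3)[OF X'] d] d
    by (intro AE_strip_eqI) (auto intro: eq)
  show ?thesis
    using 1 2 AE_space
  proof eventually_elim
    case (elim p)
    then have "fst p \<in> {-\<delta>..T}" "fst p - \<delta> \<in> {-\<delta>..T}" using d by (auto simp: space_pair_measure space_restrict_space)
    from law[OF this(1)] law[OF this(2)] elim(1,2) show ?case by (simp add: along_def)
  qed
qed

lemma solves_modification:
  assumes X: "X \<in> H2 M F (- \<delta>) T" and X': "X' \<in> H2 M F (- \<delta>) T"
    and eq: "\<And>t. t \<in> {-\<delta>..T} \<Longrightarrow> AE w in M. X t w = X' t w" and Z: "solves X' Z"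
  shows "solves X Z"
proof -
  have along_eq: "AE p in strip 0 T M. along M \<delta> f X (fst p) (snd p) = along M \<delta> f X' (fst p) (snd p)"
    for f :: "('w, real^'m, 'y) coefficient"
    by (rule along_modification[OF X X' eq])
  obtain \<beta> where \<beta>: "version (along M \<delta> b X) \<beta>" using version_b[OF X] by blast
  have \<beta>': "version (along M \<delta> b X') \<beta>"
    unfolding version_def
  proof (intro conjI versionD[OF \<beta>])
    show "AE p in strip 0 T M. along M \<delta> b X' (fst p) (snd p) = \<beta> p"
      using along_eq[of b] versionD(3)[OF \<beta>] by eventually_elim simp
  qed
  obtain I where I: "has_ito_integral M B F T (along M \<delta> \<sigma> X') I"
    "AE w in M. \<forall>t\<in>{0..T}. Z t w = \<xi> 0 w + (LINT s:{0..t}|lebesgue. along M \<delta> b X' s w) + I t w"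
    using Z unfolding solves_def by blast
  have "has_ito_integral M B F T (along M \<delta> \<sigma> X) I"
  proof (rule has_ito_integral_cong[OF I(1)])
    show "AE p in strip 0 T M. along M \<delta> \<sigma> X' (fst p) (snd p) = along M \<delta> \<sigma> X (fst p) (snd p)"
      using along_eq[of \<sigma>] by eventually_elim simp
  qed
  moreover have "AE w in M. \<forall>t\<in>{0..T}. Z t w = \<xi> 0 w + (LINT s:{0..t}|lebesgue. along M \<delta> b X s w) + I t w"
    using version_time_integral[OF \<beta>] version_time_integral[OF \<beta>'] I(2) by eventually_elim simp
  moreover have "AE w in M. set_integrable lebesgue {0..T} (\<lambda>s. along M \<delta> b X s w)"
    using version_time_integral[OF \<beta>] by eventually_elim blast
  ultimately show ?thesis
    using solvesD[OF Z] unfolding solves_def by blast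
qed

text \<open>The distance from the image \<open>X\<close> of the limit \<open>X'\<close> to the next
  iterate is controlled by the contraction, the distance from that iterate to \<open>X'\<close> by
  convergence. Both tend to \<open>0\<close>, so \<open>X\<close> is a modification of
  \<open>X'\<close> and may replace it in the equation.\<close>

lemma solution_exists: "\<exists>X. solves X X"
proof -
  have \<xi>0F: "\<xi> 0 \<in> borel_measurable (F 0)" using d by (intro H2D(1)[OF \<xi>H]) simp
  have X0: "(\<lambda>t. \<xi> (min 0 t)) \<in> H2 M F (- \<delta>) T"
  proof (rule H2_extend_\<xi>[OF _ \<xi>_extended_measurable _ _ \<xi>0])
    show "\<xi> (min 0 t) \<in> borel_measurable (F t)" if "t \<in> {0..T}" for t
      using that F_measurable_mono[OF \<xi>0F, of t] by simp
  qed auto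
  define W where "W n = ((\<lambda>X. SOME Z. solves X Z) ^^ n) (\<lambda>t. \<xi> (min 0 t))" for n :: nat
  have W_Suc: "W (Suc n) = (SOME Z. solves (W n) Z)" for n by (simp add: W_def)
  have W: "W n \<in> H2 M F (- \<delta>) T" "solves (W n) (W (Suc n))" for n
  proof -
    have step: "solves (W n) (W (Suc n))" if "W n \<in> H2 M F (- \<delta>) T" for n
      using solves_exists[OF that] unfolding W_Suc by (rule someI_ex)
    show "W n \<in> H2 M F (- \<delta>) T"
    proof (induction n)
      case 0 show ?case using X0 by (simp add: W_def)
    next
      case (Suc n) show ?case by (rule solvesD(1)[OF step[OF Suc]])
    qed
    from step[OF this] show "solves (W n) (W (Suc n))" .
  qed
  \<comment> \<open>The sequence starts with the image of the first guess. Each \<open>Y n\<close>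
    is then a value of the solution map, which \<open>solves_bounded_diff\<close> needs for the
    first difference.\<close>
  define Y where "Y n = W (Suc n)" for n
  have YH: "Y n \<in> H2 M F (- \<delta>) T" and Ys: "solves (Y n) (Y (Suc n))" for n unfolding Y_def by (rule W)+
  have Y\<xi>: "AE w in M. \<forall>t\<in>{-\<delta>..0}. Y n t w = \<xi> t w" for n unfolding Y_def by (rule solvesD(2)[OF W(2)])
  have YM: "Y n t \<in> borel_measurable M" if "t \<in> {-\<delta>..T}" for n t by (rule H2D(2)[OF YH that])
  obtain \<kappa> where \<kappa>: "contraction_rate \<kappa>" using contraction_rate_exists by blast
  have \<kappa>0: "0 \<le> \<kappa>" using \<kappa> unfolding contraction_rate_def by blast
  obtain A where A: "0 \<le> A" "\<And>t. t \<in> {0..T} \<Longrightarrow> msq M (\<lambda>w. Y (Suc 0) t w - Y 0 t w) \<le> ennreal A"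
    by (rule solves_bounded_diff[OF W(1) W(1) W(2) W(2), of "Suc 0" 0, folded Y_def]) (rule that, assumption+)
  have init: "msq M (\<lambda>w. Y (Suc n) t w - Y n t w) = 0" if "t \<in> {-\<delta>..0}" for n t
    unfolding Y_def by (rule solves_initial_diff[OF W(2) W(2) that])
  have le: "t \<in> {0..T} \<Longrightarrow> msq M (\<lambda>w. Y (Suc n) t w - Y n t w) \<le> ennreal (A * (1/4)^n * exp (\<kappa> * t))" for n t
  proof (induction n arbitrary: t)
    case 0
    have "A * 1 \<le> A * exp (\<kappa> * t)" using A(1) \<kappa>0 0 by (intro mult_left_mono) auto
    with A(2)[OF 0] show ?case by (auto intro: order_trans ennreal_leI)
  next
    case (Suc n)
    have "msq M (\<lambda>w. Y (Suc (Suc n)) t w - Y (Suc n) t w) \<le> ennreal (A * (1/4)^n * (1/4) * exp (\<kappa> * t))"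
      by (rule contraction_rateD[OF \<kappa> YH YH Ys Ys _ init Suc.IH Suc.prems]) (use A(1) in simp_all)
    then show ?case by (simp add: mult.assoc mult.commute)
  qed
  \<comment> \<open>The weight is at most its value at \<open>T\<close>. This gives a plain bound
    uniform in time, of the form that \<open>msq_fast_lim\<close> expects.\<close>
  define C where "C = A * exp (\<kappa> * T)"
  have C: "0 \<le> C" using A(1) by (simp add: C_def)
  have fast: "msq M (\<lambda>w. Y (Suc n) t w - Y n t w) \<le> ennreal (C * (1/4)^n)" if t: "t \<in> {-\<delta>..T}" for n t
  proof (cases "t \<le> 0")
    case True
    then have "t \<in> {-\<delta>..0}" using t by simp
    from init[OF this] show ?thesis by simp
  next
    case False
    then have t0: "t \<in> {0..T}" using t by simp
    have "A * (1/4)^n * exp (\<kappa> * t) \<le> A * (1/4)^n * exp (\<kappa> * T)"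
      using A(1) \<kappa>0 t by (intro mult_left_mono) (auto intro: mult_left_mono)
    also have "\<dots> = C * (1/4)^n" by (simp add: C_def)
    finally show ?thesis by (rule order_trans[OF le[OF t0] ennreal_leI])
  qed
  define X' where "X' t w = lim (\<lambda>n. Y n t w)" for t w
  have X'Y: "msq M (\<lambda>w. X' t w - Y n t w) \<le> ennreal (4 * C * (1/4)^n)" if t: "t \<in> {-\<delta>..T}" for n t
    unfolding X'_def by (rule msq_fast_lim[OF YM[OF t] fast[OF t] C])
  have X'\<xi>: "AE w in M. \<forall>t\<in>{-\<delta>..0}. X' t w = \<xi> t w"
  proof -
    have "AE w in M. \<forall>n. \<forall>t\<in>{-\<delta>..0}. Y n t w = \<xi> t w" unfolding AE_all_countable using Y\<xi> by blast
    then show ?thesis by eventually_elim (simp add: X'_def)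
  qed
  have X'H: "X' \<in> H2 M F (- \<delta>) T"
    unfolding H2_iff
  proof (intro conjI ballI)
    show "X' t \<in> borel_measurable (F t)" if "t \<in> {-\<delta>..T}" for t
      unfolding X'_def[abs_def] by (rule borel_measurable_lim_metric) (rule H2D(1)[OF YH that])
    show m: "(\<lambda>p. X' (fst p) (snd p)) \<in> borel_measurable (strip (- \<delta>) T M)"
      unfolding X'_def by (rule borel_measurable_lim_metric) (rule H2D(3)[OF YH])
    have md: "(\<lambda>p. X' (fst p) (snd p) - Y 0 (fst p) (snd p)) \<in> borel_measurable (strip (- \<delta>) T M)"
      by (intro borel_measurable_diff m H2D(3) YH)
    have "msq (strip (- \<delta>) T M) (\<lambda>p. X' (fst p) (snd p) - Y 0 (fst p) (snd p))
        = (\<integral>\<^sup>+t. msq M (\<lambda>w. X' t w - Y 0 t w) \<partial>restrict_space lborel {-\<delta>..T})"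
      using msq_strip_time(1)[OF md] by simp
    also have "\<dots> \<le> (\<integral>\<^sup>+t. ennreal (4 * C) \<partial>restrict_space lborel {-\<delta>..T})"
      using X'Y[of _ 0] by (intro nn_integral_mono) (simp add: space_restrict_space)
    also have "\<dots> < \<infinity>"
      using T d by (simp add: emeasure_restrict_space space_restrict_space ennreal_mult_less_top)
    finally have fin: "msq (strip (- \<delta>) T M) (\<lambda>p. X' (fst p) (snd p) - Y 0 (fst p) (snd p)) < \<infinity>" .
    have "msq (strip (- \<delta>) T M) (\<lambda>p. X' (fst p) (snd p)) \<le>
        2 * msq (strip (- \<delta>) T M) (\<lambda>p. X' (fst p) (snd p) - Y 0 (fst p) (snd p)) + 2 * msq (strip (- \<delta>) T M) (\<lambda>p. Y 0 (fst p) (snd p))"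
      using msq_add[OF md H2D(3)[OF YH[of 0]]] by simp
    also have "\<dots> < \<infinity>" using fin H2D(4)[OF YH[of 0]] by (simp add: ennreal_mult_less_top)
    finally show "msq (strip (- \<delta>) T M) (\<lambda>p. X' (fst p) (snd p)) < \<infinity>" .
  qed
  obtain X where X: "solves X' X" using solves_exists[OF X'H] by blast
  have XH: "X \<in> H2 M F (- \<delta>) T" by (rule solvesD(1)[OF X])
  have X'0: "msq M (\<lambda>w. X' s w - Y n s w) = 0" if "s \<in> {-\<delta>..0}" for n s
  proof -
    have "AE w in M. X' s w - Y n s w = 0"
      using X'\<xi> Y\<xi>[of n] by eventually_elim (use that in simp)
    from msq_cong[OF this] show ?thesis by simp
  qed
  have eq: "AE w in M. X t w = X' t w" if t: "t \<in> {-\<delta>..T}" for t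
  proof (cases "t \<le> 0")
    case True
    show ?thesis using solvesD(2)[OF X] X'\<xi> by eventually_elim (use t True in simp)
  next
    case False
    then have t0: "t \<in> {0..T}" using t by simp
    \<comment> \<open>The constant \<open>4 * C\<close> is that of \<open>msq_fast_lim\<close>; the
      weight is at least \<open>1\<close> on \<open>[0, T]\<close>, so it can be inserted into that
      bound.\<close>
    have XY: "msq M (\<lambda>w. X t w - Y (Suc n) t w) \<le> ennreal (4 * C * (1/4)^n * (1/4) * exp (\<kappa> * t))" for n
    proof (rule contraction_rateD[OF \<kappa> X'H YH X Ys _ X'0 _ t0])
      fix s assume s: "s \<in> {0..T}"
      have "msq M (\<lambda>w. X' s w - Y n s w) \<le> ennreal (4 * C * (1/4)^n * 1)" using X'Y[of s n] s d by simp
      also have "\<dots> \<le> ennreal (4 * C * (1/4)^n * exp (\<kappa> * s))"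
        using C \<kappa>0 s by (intro ennreal_leI mult_left_mono) auto
      finally show "msq M (\<lambda>w. X' s w - Y n s w) \<le> ennreal (4 * C * (1/4)^n * exp (\<kappa> * s))" .
    qed (use C in simp_all)
    have bound: "msq M (\<lambda>w. X t w - X' t w) \<le> 2 * ennreal (4 * C * (1/4)^n * (1/4) * exp (\<kappa> * t)) + 2 * ennreal (4 * C * (1/4)^Suc n)" for n
    proof -
      have "msq M (\<lambda>w. X t w - X' t w) \<le> 2 * msq M (\<lambda>w. X t w - Y (Suc n) t w) + 2 * msq M (\<lambda>w. Y (Suc n) t w - X' t w)"
        by (intro msq_triangle H2D(2)[OF XH t] H2D(2)[OF X'H t] YM[OF t])
      also have "\<dots> \<le> 2 * ennreal (4 * C * (1/4)^n * (1/4) * exp (\<kappa> * t)) + 2 * ennreal (4 * C * (1/4)^Suc n)"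
        using X'Y[OF t, of "Suc n"] unfolding msq_minus_commute[of M "Y (Suc n) t" "X' t"]
        by (intro add_mono mult_left_mono XY) auto
      finally show ?thesis .
    qed
    have lim: "(\<lambda>n. 2 * ennreal (4 * C * (1/4)^n * (1/4) * exp (\<kappa> * t)) + 2 * ennreal (4 * C * (1/4)^Suc n))
        \<longlonglongrightarrow> 2 * ennreal (4 * C * 0 * (1/4) * exp (\<kappa> * t)) + 2 * ennreal (4 * C * 0)"
      by (intro tendsto_intros LIMSEQ_power_zero LIMSEQ_Suc[OF LIMSEQ_power_zero]) auto
    have "msq M (\<lambda>w. X t w - X' t w) \<le> 2 * ennreal (4 * C * 0 * (1/4) * exp (\<kappa> * t)) + 2 * ennreal (4 * C * 0)"
      by (rule LIMSEQ_le_const[OF lim]) (intro exI allI impI bound)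
    then have "msq M (\<lambda>w. X t w - X' t w) = 0" by simp
    then have "AE w in M. X t w - X' t w = 0"
      by (rule msq_eq_0_AE[rotated]) (intro borel_measurable_diff H2D(2)[OF XH t] H2D(2)[OF X'H t])
    then show ?thesis by eventually_elim simp
  qed
  have "solves X X" by (rule solves_modification[OF XH X'H eq X])
  then show ?thesis by blast
qed

end

theorem theorem3p2:
  fixes M :: "'w measure"
    and B :: "real \<Rightarrow> 'w \<Rightarrow> real^'d"
    and F0 :: "'w measure"
    and T \<delta> :: real
    and b :: "('w, real^'m, real^'m) coefficient"
    and \<sigma> :: "('w, real^'m, real^'d^'m) coefficient"
    and \<xi> :: "real \<Rightarrow> 'w \<Rightarrow> real^'m"
  assumes "brownian_basis M B F0"
    and "0 < T" and "0 \<le> \<delta>" and "\<delta> \<le> T"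
    and "coefficient_in_H2 M (brownian_filtration M B F0) (- \<delta>) T b"
    and "coefficient_in_H2 M (brownian_filtration M B F0) (- \<delta>) T \<sigma>"
    and C5_b: "coefficient_lipschitz M (- \<delta>) T b"
    and C5_\<sigma>: "coefficient_lipschitz M (- \<delta>) T \<sigma>"
    and C6: "AE \<omega> in M. bdd_above ((\<lambda>t.
               norm (b t \<omega> 0 0 (return borel 0) (return borel 0)) +
               norm (\<sigma> t \<omega> 0 0 (return borel 0) (return borel 0))) ` {-\<delta>..T})"
    and "\<xi> \<in> H2 M (brownian_filtration M B F0) (- \<delta>) 0"
    and "(\<integral>\<^sup>+\<omega>. ennreal ((norm (\<xi> 0 \<omega>))\<^sup>2) \<partial>M) < \<infinity>"
  shows "\<exists>X. strong_solution M B (brownian_filtration M B F0) T \<delta> b \<sigma> \<xi> X \<and>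
           (\<forall>Y. strong_solution M B (brownian_filtration M B F0) T \<delta> b \<sigma> \<xi> Y \<longrightarrow>
              (AE \<omega> in M. \<forall>t\<in>{-\<delta>..T}. Y t \<omega> = X t \<omega>))"
proof -
  interpret brownian_basis M B F0 by fact
  interpret mean_field_delay_sde M B F0 T \<delta> b \<sigma> \<xi>
    using assms(2,3,5-8,10,11) by unfold_locales (simp_all add: msq_def)
  show ?thesis
    unfolding strong_solution_iff using solution_exists solution_unique by blast
qed

end
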